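(* Let $T\in\mathcal X^3_d$ be an irrational GIET whose rotation number $\gamma=\gamma(T)$ satisfies the Regular Diophantine Condition (RDC). Assume that $T$ is in the affine shadowing case and let $v$ be its affine shadow. If an affine interval exchange transformation with rotation number $\gamma$ and log-slope vector $v$ has exponentially distorted towers, then $T$ also has exponentially distorted towers and has a wandering interval.
   Context: GIETs. A $\mathcal C^r$ generalized interval exchange transformation (GIET) on $d\ge 2$ intervals is a map $T$ of $[0,1]$ (defined up to finitely many points) together with two partitions, up to finitely many points, of $[0,1]$ into open intervals $I^t_1,\dots,I^t_d$ (top) and $I^b_1,\dots,I^b_d$ (bottom), such that for each $i$ the map $T$ restricts to an orientation-preserving $\mathcal C^r$-diffeomorphism $I^t_i\to I^b_i$ extending to a $\mathcal C^r$-diffeomorphism of the closures. Its combinatorial datum is the pair $\pi=(\pi_t,\pi_b)$ of permutations of $\{1,\dots,d\}$ such that, from left to right, the top intervals are $I^t_{\pi_t(1)},\dots,I^t_{\pi_t(d)}$ and the bottom ones $I^b_{\pi_b(1)},\dots,I^b_{\pi_b(d)}$; $\pi$ is irreducible if $\pi_t\{1,\dots,k\}\neq\pi_b\{1,\dots,k\}$ for $1\le k<d$. $\mathcal X^r_d$ is the set of $\mathcal C^r$ GIETs on $d$ intervals with irreducible datum. A standard (resp. affine) IET is a GIET whose branches are translations (resp. affine). The shape log-slope vector of $T$ is $\omega(T)=\big(\log(|I^b_j|/|I^t_j|)\big)_{1\le j\le d}$; for an affine IET it is the vector of logarithms of the slopes, called its log-slope vector. Renormalization. Let $I^t_\alpha,I^b_\beta$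 ($\alpha=\pi_t(d)$, $\beta=\pi_b(d)$) be the rightmost top and bottom intervals. If their lengths differ, the label of the longer one is the winner and the other the loser; the elementary Rauzy–Veech step $\mathcal V(T)$ is the first return map of $T$ to $[0,1]$ minus the shorter of the two, rescaled affinely to $[0,1]$. It is a GIET on $d$ intervals, where points with first return time $2$ get the loser's label and other points keep their label. $T$ is infinitely renormalizable if all $\mathcal V^n(T)$ are defined; its rotation number $\gamma(T)$ is the infinite sequence of combinatorial data and types (top or bottom winner) of the steps; $T$ (or $\gamma(T)$) is irrational if every label wins infinitely often. The Zorich acceleration $\mathcal Z$ performs together a maximal block of consecutive steps of the same type. $\mathcal Z^n(T)$ is the affine rescaling of the first return map $T_n$ of $T$ to some interval $I^{(n)}=[0,\lambda_n]$, with continuity intervals $I^{(n)}_j$ and first return times $q^{(n)}_j$. For $m\le n$, $Q(m,n)\in SL(d,\mathbb Z)$ is the matrix whose $(i,j)$ entry is the number of visits to $I^{(m)}_j$ of the $T_m$-orbit of a point of $I^{(n)}_i$ (starting point included) before its first return to $I^{(n)}$; thus $q^{(n)}=Q(m,n)q^{(m)}$ and $Q(m,p)=Q(n,p)Q(m,n)$. These matrices depend only on $\gamma(T)$. Put $\omega_n=\omega(\mathcal Z^n(T))$. RDC. Let $g$ be the genus of the surface obtained by suspending $T$ (determined by $\pi$). An Oseledets generic extension is a sequence of splittings $\mathbb R^d=\Gamma^{(n)}_s\oplus\Gamma^{(n)}_c\oplus\Gamma^{(n)}_u$, $n\ge0$, with $Q(m,n)\Gamma_x^{(m)}=\Gamma_x^{(n)}$,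 $\dim\Gamma_s^{(n)}=\dim\Gamma_u^{(n)}=g$, such that for some $\theta,C>0$ and all $n$: $\|Q(0,n)w\|\le Ce^{-\theta n}\|w\|$ for $w\in\Gamma_s^{(0)}$; $\|Q(0,n)^{-1}w\|\le Ce^{-\theta n}\|w\|$ for $w\in\Gamma_u^{(n)}$; $\lim_n\frac1n\log\|Q(0,n)w\|=0$ for $0\ne w\in\Gamma_c^{(0)}$; and for every $\epsilon>0$ there is $c(\epsilon)>0$ with $|\sin\angle(\Gamma^{(n)}_x,\Gamma^{(n)}_y)|\ge c(\epsilon)e^{-\epsilon n}$ for distinct $x,y\in\{s,c,u\}$ ($\angle$ is the minimal angle between nonzero vectors). $P_x^{(n)}$ denotes the projection onto $\Gamma_x^{(n)}$ along the splitting. A sequence $(n_k)$ is a sequence of good return times if there are $p\ge1$ and a matrix $A$ with strictly positive entries, a product of $p$ successive Zorich cocycle matrices ($A=Q(0,p)$ for some standard IET), with $Q(n_k,n_k+2p)=AA$ and $n_{k+1}-n_k\ge2p$ for all $k$. Write $\widetilde Q(k,k')=Q(n_k,n_{k'})$, $\widetilde Z_k=\widetilde Q(k,k+1)$, $\widetilde\Gamma^{(k)}_x=\Gamma^{(n_k)}_x$, $\widetilde P^{(k)}_x=P^{(n_k)}_x$ (with the convention $n_0=0$). A standard IET, and its rotation number, satisfies the RDC if (i) it has an Oseledets generic extension; (ii) there is a sequence $(n_k)$ of good return times with $\lim n_k/k<\infty$; (iii) there are constants $K^{\pm},\delta>0$ and an increasing sequence $(k_m)$ with $\limsup k_m/m<\infty$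 such that for all $m$: [B] $\sum_{k=1}^{k_m}\|\widetilde Q(k,k_m)|_{\widetilde\Gamma_s^{(k)}}\|\,\|\widetilde P_s^{(k)}\|\,\|\widetilde Z_{k-1}\|\le K^-$; [F] $\sum_{k=k_m+1}^{\infty}\|\widetilde Q(k_m,k)^{-1}|_{\widetilde\Gamma_u^{(k)}}\|\,\|\widetilde P_u^{(k)}\|\,\|\widetilde Z_{k-1}\|\le K^+$; [S] $\lim_{m\to\infty}\frac1m\log\|\widetilde Q(k_m,k_{m+1})\|=0$; [A] $\angle(\widetilde\Gamma^{(k_m)}_{x},\widetilde\Gamma^{(k_m)}_{y})>\delta$ for distinct $x,y\in\{s,c,u\}$. Affine shadow. For $T$ satisfying the RDC the affine shadow is the vector $$v=P_u^{(0)}(\omega_0)+\sum_{k\ge1}Q(0,n_k)^{-1}P_u^{(n_k)}\big(\omega_{n_k}-Q(n_{k-1},n_k)\omega_{n_{k-1}}\big)\in\Gamma_u^{(0)}.$$ The affine shadowing case is when $v\neq0$ and $\lim_{n\to\infty}\|\omega_n-Q(0,n)v\|/\|Q(0,n)v\|=0$. Towers. An infinitely renormalizable GIET $T$ has exponentially distorted towers if there are constants $C,c,\gamma_0>0$ such that for infinitely many $n\in\mathbb N$, for every $1\le j\le d$ there is an integer $0\le k_0=k_0(j)<q^{(n)}_j$ such that $F_0=T^{k_0}(I^{(n)}_j)$ satisfies $|T^iF_0|\le C\exp(-c|i|^{\gamma_0})\,|F_0|$ for all $-k_0\le i<q^{(n)}_j-k_0$. A wandering interval is a (nondegenerate) interval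 $J\subset[0,1]$ whose images $T^i(J)$ are pairwise disjoint intervals. *)

theory Defs
  imports "HOL-Analysis.Analysis"
begin

section \<open>Generalized interval exchange transformations\<close>

text \<open>
  Labels are the elements of a finite type \<open>'d\<close>, so \<open>d = CARD('d)\<close>. A map defined up to finitely
  many points is represented by its right-continuous version: all intervals are of the form
  \<open>[a, b)\<close>, and the map is a bijection of \<open>[0, 1)\<close>. Values outside \<open>[0, 1)\<close> are irrelevant. The
  bottom intervals are the images of the top intervals.
\<close>

record 'd giet =
  topI :: "'d \<Rightarrow> real set"
  gmap :: "real \<Rightarrow> real"

definition botI :: "('d, 'z) giet_scheme \<Rightarrow> 'd \<Rightarrow> real set" where
  "botI T j = gmap T ` topI T j"

definition len :: "real set \<Rightarrow> real" where
  "len J = measure lborel J"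

text \<open>One-sided derivatives are used at the endpoints when \<open>S\<close> is a closed interval.\<close>

definition Cr_on :: "nat \<Rightarrow> real set \<Rightarrow> (real \<Rightarrow> real) \<Rightarrow> bool" where
  "Cr_on r S f \<longleftrightarrow> (\<exists>D :: nat \<Rightarrow> real \<Rightarrow> real.
     (\<forall>x\<in>S. D 0 x = f x) \<and>
     (\<forall>k<r. \<forall>x\<in>S. (D k has_real_derivative D (Suc k) x) (at x within S)) \<and>
     (\<forall>k\<le>r. continuous_on S (D k)))"

definition Cr_diffeo :: "nat \<Rightarrow> real set \<Rightarrow> real set \<Rightarrow> (real \<Rightarrow> real) \<Rightarrow> bool" where
  "Cr_diffeo r S S' f \<longleftrightarrow> bij_betw f S S' \<and> Cr_on r S f \<and> Cr_on r S' (inv_into S f)"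

definition interval_partition :: "('d::finite \<Rightarrow> real set) \<Rightarrow> bool" where
  "interval_partition I \<longleftrightarrow>
     (\<forall>j. \<exists>a b. a < b \<and> I j = {a..<b}) \<and> disjoint_family I \<and> (\<Union>j. I j) = {0..<1}"

definition giet :: "nat \<Rightarrow> 'd::finite giet \<Rightarrow> bool" where
  "giet r T \<longleftrightarrow> 2 \<le> CARD('d) \<and> interval_partition (topI T) \<and> interval_partition (botI T) \<and>
     (\<forall>j. \<exists>f. (\<forall>x\<in>topI T j. f x = gmap T x) \<and> strict_mono_on (closure (topI T j)) f \<and>
        Cr_diffeo r (closure (topI T j)) (closure (botI T j)) f)"

text \<open>A permutation \<open>\<pi>\<close> of the labels is the word \<open>[\<pi>(1), \<dots>, \<pi>(d)]\<close>.\<close>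

type_synonym 'd datum = "'d list \<times> 'd list"

definition word_of :: "('d \<Rightarrow> real set) \<Rightarrow> 'd list" where
  "word_of I = (THE w. distinct w \<and> set w = UNIV \<and>
     sorted_wrt (\<lambda>i j. \<forall>x\<in>I i. \<forall>y\<in>I j. x < y) w)"

definition datum :: "'d giet \<Rightarrow> 'd datum" where
  "datum T = (word_of (topI T), word_of (botI T))"

definition irreducible_datum :: "'d::finite datum \<Rightarrow> bool" where
  "irreducible_datum \<pi> \<longleftrightarrow>
     (\<forall>k. 1 \<le> k \<and> k < CARD('d) \<longrightarrow> set (take k (fst \<pi>)) \<noteq> set (take k (snd \<pi>)))"

definition giet_space :: "nat \<Rightarrow> 'd::finite giet set" where
  "giet_space r = {T. giet r T \<and> irreducible_datum (datum T)}"

definition standard_iet :: "'d::finite giet \<Rightarrow> bool" where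
  "standard_iet T \<longleftrightarrow> giet 1 T \<and> (\<forall>j. \<exists>b. \<forall>x\<in>topI T j. gmap T x = x + b)"

definition affine_iet :: "'d::finite giet \<Rightarrow> bool" where
  "affine_iet T \<longleftrightarrow> giet 1 T \<and> (\<forall>j. \<exists>a b. \<forall>x\<in>topI T j. gmap T x = a * x + b)"

definition log_slope :: "'d::finite giet \<Rightarrow> real ^ 'd" where
  "log_slope T = (\<chi> j. ln (len (botI T j) / len (topI T j)))"

definition iter :: "'d giet \<Rightarrow> int \<Rightarrow> real \<Rightarrow> real" where
  "iter T i = (if 0 \<le> i then gmap T ^^ nat i else inv_into {0..<1} (gmap T) ^^ nat (- i))"


section \<open>Renormalization\<close>

definition ret_time :: "(real \<Rightarrow> real) \<Rightarrow> real set \<Rightarrow> real \<Rightarrow> nat" where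
  "ret_time F A x = (LEAST n. 1 \<le> n \<and> (F ^^ n) x \<in> A)"

definition ret_map :: "(real \<Rightarrow> real) \<Rightarrow> real set \<Rightarrow> real \<Rightarrow> real" where
  "ret_map F A x = (F ^^ ret_time F A x) x"

datatype side = Top | Bottom

definition top_last :: "'d giet \<Rightarrow> 'd" where
  "top_last T = last (fst (datum T))"

definition bot_last :: "'d giet \<Rightarrow> 'd" where
  "bot_last T = last (snd (datum T))"

definition renormalizable :: "'d giet \<Rightarrow> bool" where
  "renormalizable T \<longleftrightarrow> len (topI T (top_last T)) \<noteq> len (botI T (bot_last T))"

definition step_type :: "'d giet \<Rightarrow> side" where
  "step_type T = (if len (topI T (top_last T)) > len (botI T (bot_last T)) then Top else Bottom)"

definition loser :: "'d giet \<Rightarrow> 'd" where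
  "loser T = (case step_type T of Top \<Rightarrow> bot_last T | Bottom \<Rightarrow> top_last T)"

definition step_length :: "'d giet \<Rightarrow> real" where
  "step_length T = 1 - min (len (topI T (top_last T))) (len (botI T (bot_last T)))"

definition rauzy :: "'d giet \<Rightarrow> 'd giet" where
  "rauzy T = (let l = step_length T; A = {0..<l} in
     \<lparr> topI = (\<lambda>j. (\<lambda>x. x / l) `
           {x \<in> A. if ret_time (gmap T) A x = 2 then j = loser T else x \<in> topI T j}),
       gmap = (\<lambda>x. ret_map (gmap T) A (l * x) / l) \<rparr>)"

definition infinitely_renormalizable :: "'d giet \<Rightarrow> bool" where
  "infinitely_renormalizable T \<longleftrightarrow> (\<forall>n. renormalizable ((rauzy ^^ n) T))"

type_synonym 'd rotation_number = "nat \<Rightarrow> 'd datum \<times> side"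

definition has_rotation_number :: "'d giet \<Rightarrow> 'd rotation_number \<Rightarrow> bool" where
  "has_rotation_number T \<gamma> \<longleftrightarrow> infinitely_renormalizable T \<and>
     (\<forall>n. \<gamma> n = (datum ((rauzy ^^ n) T), step_type ((rauzy ^^ n) T)))"

fun winner :: "'d datum \<times> side \<Rightarrow> 'd" where
  "winner ((t, b), Top) = last t"
| "winner ((t, b), Bottom) = last b"

definition irrational :: "'d rotation_number \<Rightarrow> bool" where
  "irrational \<gamma> \<longleftrightarrow> (\<forall>j. infinite {n. winner (\<gamma> n) = j})"

text \<open>\<open>zorich_time T n\<close> is the number of elementary steps performed by \<open>n\<close> accelerated steps.\<close>

primrec zorich_time :: "'d giet \<Rightarrow> nat \<Rightarrow> nat" where
  "zorich_time T 0 = 0"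
| "zorich_time T (Suc n) = (LEAST m. zorich_time T n < m \<and>
     step_type ((rauzy ^^ m) T) \<noteq> step_type ((rauzy ^^ zorich_time T n) T))"

definition zorich :: "'d giet \<Rightarrow> nat \<Rightarrow> 'd giet" where
  "zorich T n = (rauzy ^^ zorich_time T n) T"

text \<open>The base \<open>I\<^sup>(\<^sup>n\<^sup>)\<close> and its pieces, before rescaling.\<close>

definition base_length :: "'d giet \<Rightarrow> nat \<Rightarrow> real" where
  "base_length T n = (\<Prod>k<zorich_time T n. step_length ((rauzy ^^ k) T))"

definition base :: "'d giet \<Rightarrow> nat \<Rightarrow> real set" where
  "base T n = {0..<base_length T n}"

definition piece :: "'d giet \<Rightarrow> nat \<Rightarrow> 'd \<Rightarrow> real set" where
  "piece T n j = (\<lambda>x. base_length T n * x) ` topI (zorich T n) j"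

definition return_map :: "'d giet \<Rightarrow> nat \<Rightarrow> real \<Rightarrow> real" where
  "return_map T n = ret_map (gmap T) (base T n)"

text \<open>Return times and numbers of visits are constant on each piece, so any point of it may be used.\<close>

definition height :: "'d giet \<Rightarrow> nat \<Rightarrow> 'd \<Rightarrow> nat" where
  "height T n j = ret_time (gmap T) (base T n) (SOME x. x \<in> piece T n j)"

definition Q :: "'d::finite giet \<Rightarrow> nat \<Rightarrow> nat \<Rightarrow> real ^ 'd ^ 'd" where
  "Q T m n = (\<chi> i j. let x = (SOME x. x \<in> piece T n i) in
     real (card {k. k < ret_time (return_map T m) (base T n) x \<and>
                    (return_map T m ^^ k) x \<in> piece T m j}))"

definition omega :: "'d::finite giet \<Rightarrow> nat \<Rightarrow> real ^ 'd" where
  "omega T n = log_slope (zorich T n)"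


section \<open>The genus of the suspension\<close>

text \<open>
  The suspension is a polygon with \<open>2 d\<close> sides whose top and bottom sides with the same label are
  glued by a translation. \<open>(Top, p)\<close> and \<open>(Bottom, p)\<close>, \<open>p \<le> d\<close>, are the \<open>p\<close>-th vertices of the
  upper and lower boundary lines, which have their first and last vertices in common. If \<open>V\<close> is the
  number of vertices after gluing, the Euler characteristic gives \<open>2 - 2 g = V - d + 1\<close>.
\<close>

definition glued :: "'d::finite datum \<Rightarrow> ((side \<times> nat) \<times> (side \<times> nat)) set" where
  "glued \<pi> = {((Top, 0), (Bottom, 0)), ((Top, CARD('d)), (Bottom, CARD('d)))} \<union>
     {((Top, p + e), (Bottom, q + e)) | p q e.
        p < CARD('d) \<and> q < CARD('d) \<and> fst \<pi> ! p = snd \<pi> ! q \<and> e \<le> 1}"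

definition vertex_count :: "'d::finite datum \<Rightarrow> nat" where
  "vertex_count \<pi> = card ((UNIV \<times> {0..CARD('d)}) // ((glued \<pi> \<union> (glued \<pi>)\<inverse>)\<^sup>*))"

definition genus :: "'d::finite datum \<Rightarrow> nat" where
  "genus \<pi> = (CARD('d) + 1 - vertex_count \<pi>) div 2"


section \<open>The Regular Diophantine Condition\<close>

datatype direction = Stable | Central | Unstable

type_synonym 'd splitting = "direction \<Rightarrow> nat \<Rightarrow> (real ^ 'd) set"

definition onorm_on :: "(real ^ 'd::finite \<Rightarrow> real ^ 'd) \<Rightarrow> (real ^ 'd) set \<Rightarrow> real" where
  "onorm_on f V = (SUP w\<in>{w \<in> V. norm w \<le> 1}. norm (f w))"

text \<open>
  The minimal angle between nonzero vectors of two subspaces never exceeds \<open>\<pi>/2\<close>. Inserting this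
  value only matters for a trivial subspace (\<open>\<Gamma>\<^sub>c = 0\<close> if \<open>d = 2 g\<close>), whose angle with any
  subspace is thus \<open>\<pi>/2\<close>.
\<close>

definition min_angle :: "(real ^ 'd::finite) set \<Rightarrow> (real ^ 'd) set \<Rightarrow> real" where
  "min_angle V W = Inf (insert (pi / 2)
     {arccos (v \<bullet> w / (norm v * norm w)) | v w. v \<in> V \<and> w \<in> W \<and> v \<noteq> 0 \<and> w \<noteq> 0})"

definition decomposes :: "'d splitting \<Rightarrow> nat \<Rightarrow> real ^ 'd::finite \<Rightarrow> (direction \<Rightarrow> real ^ 'd) \<Rightarrow> bool" where
  "decomposes \<Gamma> n w f \<longleftrightarrow>
     (\<forall>x. f x \<in> \<Gamma> x n) \<and> w = f Stable + f Central + f Unstable"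

definition splitting_proj :: "'d splitting \<Rightarrow> direction \<Rightarrow> nat \<Rightarrow> real ^ 'd::finite \<Rightarrow> real ^ 'd" where
  "splitting_proj \<Gamma> x n w = (THE f. decomposes \<Gamma> n w f) x"

definition oseledets_extension :: "'d::finite giet \<Rightarrow> 'd splitting \<Rightarrow> bool" where
  "oseledets_extension T \<Gamma> \<longleftrightarrow>
     (\<forall>x n. subspace (\<Gamma> x n)) \<and>
     (\<forall>n w. \<exists>!f. decomposes \<Gamma> n w f) \<and>
     (\<forall>x m n. m \<le> n \<longrightarrow> (\<lambda>w. Q T m n *v w) ` \<Gamma> x m = \<Gamma> x n) \<and>
     (\<forall>n. dim (\<Gamma> Stable n) = genus (datum T) \<and> dim (\<Gamma> Unstable n) = genus (datum T)) \<and>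
     (\<exists>\<theta>>0. \<exists>C>0. \<forall>n.
        (\<forall>w\<in>\<Gamma> Stable 0. norm (Q T 0 n *v w) \<le> C * exp (- \<theta> * real n) * norm w) \<and>
        (\<forall>w\<in>\<Gamma> Unstable n. norm (matrix_inv (Q T 0 n) *v w) \<le> C * exp (- \<theta> * real n) * norm w)) \<and>
     (\<forall>w\<in>\<Gamma> Central 0. w \<noteq> 0 \<longrightarrow> (\<lambda>n. 1 / real n * ln (norm (Q T 0 n *v w))) \<longlonglongrightarrow> 0) \<and>
     (\<forall>\<epsilon>>0. \<exists>c>0. \<forall>n x y. x \<noteq> y \<longrightarrow>
        \<bar>sin (min_angle (\<Gamma> x n) (\<Gamma> y n))\<bar> \<ge> c * exp (- \<epsilon> * real n))"

text \<open>
  The good return times are \<open>n 1, n 2, \<dots>\<close>; the value \<open>n 0 = 0\<close> is only a convention. The auxiliary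
  standard IET \<open>S\<close> realizing the positive matrix need not be related to \<open>T\<close>.
\<close>

definition good_return_times :: "'d::finite giet \<Rightarrow> (nat \<Rightarrow> nat) \<Rightarrow> bool" where
  "good_return_times T n \<longleftrightarrow> n 0 = 0 \<and>
     (\<exists>p\<ge>1. \<exists>A :: real ^ 'd ^ 'd. (\<forall>i j. A $ i $ j > 0) \<and>
        (\<exists>S \<sigma>. S \<in> giet_space 1 \<and> standard_iet S \<and> has_rotation_number S \<sigma> \<and> irrational \<sigma> \<and>
           A = Q S 0 p) \<and>
        (\<forall>k\<ge>1. Q T (n k) (n k + 2 * p) = A ** A \<and> n k + 2 * p \<le> n (Suc k)))"

text \<open>
  The condition is stated for a given extension and given good return times, since the affine shadow
  is defined in terms of them.
\<close>

definition RDC_with :: "'d::finite giet \<Rightarrow> 'd splitting \<Rightarrow> (nat \<Rightarrow> nat) \<Rightarrow> bool" where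
  "RDC_with T \<Gamma> n \<longleftrightarrow>
     oseledets_extension T \<Gamma> \<and>
     good_return_times T n \<and> convergent (\<lambda>k. real (n k) / real k) \<and>
     (\<exists>K\<^sub>m>0. \<exists>K\<^sub>p>0. \<exists>\<delta>>0. \<exists>\<kappa> :: nat \<Rightarrow> nat.
        strict_mono \<kappa> \<and> limsup (\<lambda>m. ereal (real (\<kappa> m) / real m)) < \<infinity> \<and>
        (\<forall>m. (\<Sum>k = 1..\<kappa> m.
            onorm_on ((*v) (Q T (n k) (n (\<kappa> m)))) (\<Gamma> Stable (n k)) *
            onorm (splitting_proj \<Gamma> Stable (n k)) * onorm ((*v) (Q T (n (k - 1)) (n k)))) \<le> K\<^sub>m) \<and>
        (\<forall>m. let f = (\<lambda>k.
            onorm_on ((*v) (matrix_inv (Q T (n (\<kappa> m)) (n k)))) (\<Gamma> Unstable (n k)) *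
            onorm (splitting_proj \<Gamma> Unstable (n k)) * onorm ((*v) (Q T (n (k - 1)) (n k))))
          in summable (\<lambda>i. f (\<kappa> m + 1 + i)) \<and> (\<Sum>i. f (\<kappa> m + 1 + i)) \<le> K\<^sub>p) \<and>
        (\<lambda>m. 1 / real m * ln (onorm ((*v) (Q T (n (\<kappa> m)) (n (\<kappa> (Suc m))))))) \<longlonglongrightarrow> 0 \<and>
        (\<forall>m x y. x \<noteq> y \<longrightarrow> min_angle (\<Gamma> x (n (\<kappa> m))) (\<Gamma> y (n (\<kappa> m))) > \<delta>))"

definition rotation_RDC :: "'d::finite rotation_number \<Rightarrow> 'd splitting \<Rightarrow> (nat \<Rightarrow> nat) \<Rightarrow> bool" where
  "rotation_RDC \<gamma> \<Gamma> n \<longleftrightarrow>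
     (\<exists>S. standard_iet S \<and> has_rotation_number S \<gamma> \<and> RDC_with S \<Gamma> n)"


section \<open>Affine shadow, towers and wandering intervals\<close>

definition affine_shadow :: "'d::finite giet \<Rightarrow> 'd splitting \<Rightarrow> (nat \<Rightarrow> nat) \<Rightarrow> real ^ 'd" where
  "affine_shadow T \<Gamma> n = splitting_proj \<Gamma> Unstable 0 (omega T 0) +
     (\<Sum>k. matrix_inv (Q T 0 (n (Suc k))) *v
        splitting_proj \<Gamma> Unstable (n (Suc k))
          (omega T (n (Suc k)) - Q T (n k) (n (Suc k)) *v omega T (n k)))"

definition affine_shadowing_case :: "'d::finite giet \<Rightarrow> 'd splitting \<Rightarrow> (nat \<Rightarrow> nat) \<Rightarrow> bool" where
  "affine_shadowing_case T \<Gamma> n \<longleftrightarrow> (let v = affine_shadow T \<Gamma> n in v \<noteq> 0 \<and>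
     (\<lambda>N. norm (omega T N - Q T 0 N *v v) / norm (Q T 0 N *v v)) \<longlonglongrightarrow> 0)"

definition exp_distorted_towers :: "'d::finite giet \<Rightarrow> bool" where
  "exp_distorted_towers T \<longleftrightarrow> infinitely_renormalizable T \<and>
     (\<exists>C>0. \<exists>c>0. \<exists>\<gamma>\<^sub>0>0. infinite {n. \<forall>j. \<exists>k\<^sub>0 < height T n j.
        let F\<^sub>0 = iter T (int k\<^sub>0) ` piece T n j in
        \<forall>i. - int k\<^sub>0 \<le> i \<and> i < int (height T n j) - int k\<^sub>0 \<longrightarrow>
          len (iter T i ` F\<^sub>0) \<le> C * exp (- c * \<bar>real_of_int i\<bar> powr \<gamma>\<^sub>0) * len F\<^sub>0})"

definition wandering_interval :: "'d giet \<Rightarrow> real set \<Rightarrow> bool" where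
  "wandering_interval T J \<longleftrightarrow> J \<subseteq> {0..<1} \<and> is_interval J \<and> (\<exists>x\<in>J. \<exists>y\<in>J. x < y) \<and>
     (\<forall>i. is_interval (iter T i ` J)) \<and> disjoint_family (\<lambda>i. iter T i ` J)"

end

theory Submission
  imports Defs
begin

text \<open>
  Write \<open>\<delta>\<^sub>N = \<omega>\<^sub>N - Q(0, N) v\<close>. Along the times \<open>N\<^sub>m = n (\<kappa> m)\<close> its stable part is bounded by [B] and its
  unstable part, a tail of the series defining \<open>v\<close>, by [F]. The central part grows subexponentially:
  the cocycle acts isometrically on the quotient by the common kernel of the functionals attached to
  the vertices of the suspension, and only one central direction can lie in this kernel. Hence
  \<open>\<delta>\<close> is subexponential along \<open>N\<^sub>m\<close>. Decomposing a piece of orbit into towers of the levels \<open>N\<^sub>m\<close>, and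
  using bounded distortion and [S], the logarithms of the ratios of the lengths of two floors at
  distance \<open>i\<close> in the towers of \<open>T\<close> and of the affine map differ by at most \<open>C i\<^sup>\<epsilon>\<close> for every \<open>\<epsilon> > 0\<close>, because
  heights grow exponentially in \<open>m\<close>. This error is absorbed by \<open>c i\<^sup>\<gamma>\<^sup>0\<close>.

  For the wandering interval, the floors of a level cover \<open>[0, 1)\<close>, so that some largest floor \<open>F\<^sub>0\<close> has length
  bounded below. If the bases shrink to a point, \<open>F\<^sub>0\<close> lies deep inside its tower; otherwise a piece
  of the bases themselves does not return for a long time. In both cases a limit of these intervals
  wanders.
\<close>

subsection \<open>Tilings by half-open intervals\<close>

text \<open>Why the central part is the delicate one: its exponents vanish vector by vector. Through
  a basis this bounds the cocycle on \<Gamma>_c from above, but by itself it gives no uniform bound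
  for the inverse, and such a bound is required to add up central errors made at different times.
  The vertex functionals supply it, because they are invariant and their coefficients stay in a
  finite set. The exceptional direction comes from the halving in the genus, which may round; on a
  line the exponent alone bounds from both sides. What T, the affine map and the standard map behind
  the RDC have in common is read off \<gamma>: a first return is coded by a word built from
  \<gamma>, the cocycle counts letters in such words, and the affine map multiplies lengths by
  exponentials of sums of v over them. Comparing towers thus means comparing logarithms of lengths
  for T with word sums, and these comparisons are made on blocks of words at different
  levels.\<close>

definition tiles :: "real \<Rightarrow> ('d \<Rightarrow> real) \<Rightarrow> ('d \<Rightarrow> real) \<Rightarrow> bool" where
  "tiles L p q \<longleftrightarrow> (\<forall>j. 0 \<le> p j \<and> p j < q j \<and> q j \<le> L) \<and> (\<forall>i j. i \<noteq> j \<longrightarrow> q i \<le> p j \<or> q j \<le> p i) \<and>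
     (\<forall>x. 0 \<le> x \<and> x < L \<longrightarrow> (\<exists>j. p j \<le> x \<and> x < q j))"

lemma tilesD:
  assumes "tiles L p q"
  shows "0 \<le> p j" "p j < q j" "q j \<le> L" "i \<noteq> j \<Longrightarrow> q i \<le> p j \<or> q j \<le> p i"
    "0 \<le> x \<Longrightarrow> x < L \<Longrightarrow> \<exists>j. p j \<le> x \<and> x < q j"
  using assms unfolding tiles_def by blast+

lemma interval_partition_iff_tiles:
  "interval_partition I \<longleftrightarrow>
     (\<forall>j. I j = {Inf (I j)..<Sup (I j)}) \<and> tiles 1 (\<lambda>j. Inf (I j)) (\<lambda>j. Sup (I j))"
    (is "?L \<longleftrightarrow> ?R")
proof
  assume L: ?L
  have eq: "I j = {Inf (I j)..<Sup (I j)} \<and> Inf (I j) < Sup (I j)" for j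
    using L unfolding interval_partition_def
    by (metis cInf_atLeastLessThan cSup_atLeastLessThan)
  have mem: "x \<in> I j \<longleftrightarrow> Inf (I j) \<le> x \<and> x < Sup (I j)" for x j
    using arg_cong[OF conjunct1[OF eq[of j]], of "\<lambda>A. x \<in> A"] unfolding atLeastLessThan_iff .
  have un: "x \<in> {0..<1} \<longleftrightarrow> (\<exists>j. x \<in> I j)" for x
    using L unfolding interval_partition_def by blast
  have sub: "0 \<le> Inf (I j) \<and> Sup (I j) \<le> 1" for j
  proof -
    have "{Inf (I j)..<Sup (I j)} \<subseteq> {0..<1}"
      by (subst conjunct1[OF eq, symmetric]) (use un in blast)
    then show ?thesis using conjunct2[OF eq, of j] by (metis atLeastLessThan_subset_iff linorder_not_le)
  qed
  have dis: "Sup (I i) \<le> Inf (I j) \<or> Sup (I j) \<le> Inf (I i)" if "i \<noteq> j" for i j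
  proof (rule ccontr)
    assume a: "\<not> ?thesis"
    let ?m = "max (Inf (I i)) (Inf (I j))"
    have "Inf (I i) < Sup (I i)" "Inf (I j) < Sup (I j)" by (rule conjunct2[OF eq])+
    then have "?m \<in> {Inf (I i)..<Sup (I i)}" "?m \<in> {Inf (I j)..<Sup (I j)}"
      using a by (auto)
    then have "?m \<in> I i" "?m \<in> I j" using mem by auto
    moreover have "I i \<inter> I j = {}" using L that unfolding interval_partition_def disjoint_family_on_def by blast
    ultimately show False by blast
  qed
  have cov: "\<exists>j. Inf (I j) \<le> x \<and> x < Sup (I j)" if "0 \<le> x" "x < 1" for x
    using un[of x] that by (auto simp: mem)
  have "tiles 1 (\<lambda>j. Inf (I j)) (\<lambda>j. Sup (I j))"
    unfolding tiles_def
    by (intro conjI allI impI)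
      (rule sub[THEN conjunct1] sub[THEN conjunct2] conjunct2[OF eq] dis cov; simp?)+
  then show ?R by (intro conjI allI conjunct1[OF eq])
next
  assume R: ?R
  have eq: "I j = {Inf (I j)..<Sup (I j)}" for j using R by blast
  note t = tilesD[OF conjunct2[OF R]]
  have "disjoint_family I"
    unfolding disjoint_family_on_def
  proof (intro ballI impI)
    fix i j :: 'a assume "i \<noteq> j"
    then have "{Inf (I i)..<Sup (I i)} \<inter> {Inf (I j)..<Sup (I j)} = {}"
      using t(4)[of i j] by auto
    then show "I i \<inter> I j = {}" unfolding eq[of i, symmetric] eq[of j, symmetric] .
  qed
  moreover have "(\<Union>j. I j) = {0..<1}"
  proof -
    have "(\<Union>j. {Inf (I j)..<Sup (I j)}) = {0..<1}"
    proof (intro equalityI subsetI)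
      fix x assume "x \<in> (\<Union>j. {Inf (I j)..<Sup (I j)})"
      then obtain j where "Inf (I j) \<le> x" "x < Sup (I j)" by auto
      then show "x \<in> {0..<1}" using t(1)[of j] t(3)[of j] by simp
    next
      fix x :: real assume "x \<in> {0..<1}"
      then obtain j where "Inf (I j) \<le> x" "x < Sup (I j)" using t(5)[of x] by auto
      then show "x \<in> (\<Union>j. {Inf (I j)..<Sup (I j)})" by (metis UN_I UNIV_I atLeastLessThan_iff)
    qed
    then show ?thesis unfolding eq[symmetric] .
  qed
  moreover have "\<exists>a b. a < b \<and> I j = {a..<b}" for j
    by (intro exI conjI, rule t(2), rule eq)
  ultimately show ?L unfolding interval_partition_def by (intro conjI allI)
qed

lemma tiles_scale:
  assumes "tiles L p q" "l > 0"
  shows "tiles (L / l) (\<lambda>j. p j / l) (\<lambda>j. q j / l)"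
proof -
  note t = tilesD[OF assms(1)]
  have "\<exists>j. p j / l \<le> x \<and> x < q j / l" if "0 \<le> x" "x < L / l" for x
  proof -
    have "0 \<le> x * l" "x * l < L" using that assms(2) by (auto simp: field_simps)
    then show ?thesis using t(5)[of "x * l"] assms(2) by (auto simp: field_simps)
  qed
  moreover have "q i / l \<le> p j / l \<or> q j / l \<le> p i / l" if "i \<noteq> j" for i j
    using t(4)[OF that] assms(2) by (auto intro: divide_right_mono)
  moreover have "0 \<le> p j / l \<and> p j / l < q j / l \<and> q j / l \<le> L / l" for j
    using t(1,2,3)[of j] assms(2) by (auto intro: divide_right_mono divide_strict_right_mono)
  ultimately show ?thesis unfolding tiles_def by blast
qed

lemma tiles_right:
  assumes "tiles L p q" "q i < L"
  obtains j where "p j = q i"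
proof -
  note t = tilesD[OF assms(1)]
  obtain j where j: "p j \<le> q i" "q i < q j" using t(5)[of "q i"] t(1,2) assms(2)
    by (meson order.strict_implies_order order.trans)
  then have "j \<noteq> i" by auto
  then have "p j = q i" using t(4)[of i j] t(2)[of i] t(2)[of j] j by auto
  then show ?thesis using that by blast
qed

lemma tiles_inj:
  assumes "tiles L p q"
  shows "p i = p j \<Longrightarrow> i = j" "q i = q j \<Longrightarrow> i = j"
  using tilesD(4)[OF assms, of i j] tilesD(2)[OF assms, of i] tilesD(2)[OF assms, of j] by force+

text \<open>The order behind \<open>word_of\<close>, expressed by endpoints. In this form the
  definite description in \<open>word_of\<close> is shown to be determined.\<close>

definition sorted_word :: "('d \<Rightarrow> real) \<Rightarrow> ('d \<Rightarrow> real) \<Rightarrow> 'd list \<Rightarrow> bool" where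
  "sorted_word p q w \<longleftrightarrow> distinct w \<and> set w = UNIV \<and> sorted_wrt (\<lambda>i j. q i \<le> p j) w"

lemma sorted_word_exists:
  fixes p q :: "'d::finite \<Rightarrow> real"
  assumes "tiles L p q"
  shows "\<exists>w. sorted_word p q w"
proof -
  obtain xs :: "'d list" where xs: "set xs = UNIV" "distinct xs"
    using finite_distinct_list[of "UNIV :: 'd set"] by auto
  define w where "w = sort_key p xs"
  have w: "set w = UNIV" "distinct w" "sorted (map p w)"
    unfolding w_def using xs by auto
  have "sorted_wrt (\<lambda>i j. q i \<le> p j) w"
    unfolding sorted_wrt_iff_nth_less
  proof (intro allI impI)
    fix i j assume ij: "i < j" "j < length w"
    then have "p (w ! i) \<le> p (w ! j)" using w(3) by (simp add: sorted_iff_nth_mono)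
    moreover have "w ! i \<noteq> w ! j" using ij w(2) by (simp add: nth_eq_iff_index_eq)
    ultimately show "q (w ! i) \<le> p (w ! j)"
      using tilesD(4)[OF assms, of "w ! i" "w ! j"] tilesD(2)[OF assms, of "w ! j"] by linarith
  qed
  then show ?thesis unfolding sorted_word_def using w by blast
qed

lemma sorted_word_unique:
  fixes p q :: "'d::finite \<Rightarrow> real"
  assumes "tiles L p q" "sorted_word p q w" "sorted_word p q w'"
  shows "w = w'"
proof -
  have s: "sorted_wrt (<) (map p u)" if "sorted_word p q u" for u
    using that unfolding sorted_word_def sorted_wrt_map
    by (auto elim!: sorted_wrt_mono_rel[rotated] intro: less_le_trans[OF tilesD(2)[OF assms(1)]])
  have "inj p" using tiles_inj(1)[OF assms(1)] by (auto intro: injI)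
  moreover have "map p w = map p w'"
    using s[OF assms(2)] s[OF assms(3)] assms(2,3) unfolding sorted_word_def
    by (intro sorted_distinct_set_unique) (auto simp: strict_sorted_iff)
  ultimately show ?thesis by (simp add: inj_map_eq_map)
qed

lemma word_of_sorted:
  fixes I :: "'d::finite \<Rightarrow> real set"
  assumes "interval_partition I"
  shows "sorted_word (\<lambda>j. Inf (I j)) (\<lambda>j. Sup (I j)) (word_of I)"
proof -
  have eq: "I j = {Inf (I j)..<Sup (I j)}" for j
    using assms unfolding interval_partition_iff_tiles by blast
  have t: "tiles 1 (\<lambda>j. Inf (I j)) (\<lambda>j. Sup (I j))"
    using assms unfolding interval_partition_iff_tiles by blast
  have rel: "(\<forall>x\<in>I i. \<forall>y\<in>I j. x < y) \<longleftrightarrow> Sup (I i) \<le> Inf (I j)" for i j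
  proof
    assume a: "\<forall>x\<in>I i. \<forall>y\<in>I j. x < y"
    have "Inf (I j) \<in> I j" "Inf (I i) \<in> I i" using eq[of j] eq[of i] tilesD(2)[OF t] by (metis atLeastLessThan_iff order_refl)+
    then have *: "x < Inf (I j)" if "x \<in> {Inf (I i)..<Sup (I i)}" for x using a that eq[of i] by blast
    show "Sup (I i) \<le> Inf (I j)"
    proof (rule ccontr)
      assume "\<not> ?thesis"
      then show False using *[of "max (Inf (I i)) (Inf (I j))"] tilesD(2)[OF t, of i] by auto
    qed
  next
    assume "Sup (I i) \<le> Inf (I j)"
    then have "\<forall>x\<in>{Inf (I i)..<Sup (I i)}. \<forall>y\<in>{Inf (I j)..<Sup (I j)}. x < y" by auto
    then show "\<forall>x\<in>I i. \<forall>y\<in>I j. x < y" using eq[of i] eq[of j] by simp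
  qed
  have wo: "word_of I = (THE w. sorted_word (\<lambda>j. Inf (I j)) (\<lambda>j. Sup (I j)) w)"
    unfolding word_of_def sorted_word_def rel ..
  show ?thesis unfolding wo
    by (rule theI', rule ex_ex1I)
      (use sorted_word_exists[OF t] sorted_word_unique[OF t] in blast)+
qed

text \<open>There are no gaps: a right end below L is the left end of the interval that covers it,
  and any choice other than the next letter would leave no room for the letters in between.\<close>

lemma sorted_wordD:
  fixes p q :: "'d::finite \<Rightarrow> real"
  assumes "tiles L p q" "sorted_word p q w"
  shows "length w = CARD('d)" "w \<noteq> []" "p (hd w) = 0" "q (last w) = L"
    "Suc i < length w \<Longrightarrow> q (w ! i) = p (w ! Suc i)"
proof -
  note t = tilesD[OF assms(1)]
  have d: "distinct w" and s: "set w = UNIV"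
    and le: "\<And>i j. i < j \<Longrightarrow> j < length w \<Longrightarrow> q (w ! i) \<le> p (w ! j)"
    using assms(2) unfolding sorted_word_def sorted_wrt_iff_nth_less by auto
  show len: "length w = CARD('d)" using d s by (metis distinct_card)
  show ne: "w \<noteq> []" using s by auto
  have L: "L > 0" using t(1,2,3) by (meson le_less_trans less_le_trans)
  have idx: "\<exists>r<length w. w ! r = j" for j using s by (metis UNIV_I in_set_conv_nth)
  show "p (hd w) = 0"
  proof -
    obtain j where j: "p j \<le> 0" using t(5)[of 0] L by auto
    obtain r where r: "r < length w" "w ! r = j" using idx by blast
    have "r = 0"
      using le[of 0 r] r j t(1)[of "w ! 0"] t(2)[of "w ! 0"] by (cases "r = 0") auto
    then show ?thesis using r j t(1)[of j] ne by (simp add: hd_conv_nth)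
  qed
  show "q (last w) = L"
  proof (rule ccontr)
    assume "q (last w) \<noteq> L"
    then have "q (last w) < L" using t(3)[of "last w"] by simp
    then obtain j where j: "p j = q (last w)" using tiles_right[OF assms(1)] by blast
    obtain r where r: "r < length w" "w ! r = j" using idx by blast
    show False
    proof (cases "r = length w - 1")
      case True
      then have "j = last w" using r ne by (simp add: last_conv_nth)
      then show False using j t(2)[of j] by simp
    next
      case False
      then have "q j \<le> p (last w)" using le[of r "length w - 1"] r ne by (simp add: last_conv_nth)
      then show False using j t(2)[of j] t(2)[of "last w"] by simp
    qed
  qed
  assume i: "Suc i < length w"
  have "q (w ! i) < L" using le[of i "Suc i"] i t(2)[of "w ! Suc i"] t(3)[of "w ! Suc i"] by simp
  then obtain j where j: "p j = q (w ! i)" using tiles_right[OF assms(1)] by blast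
  obtain r where r: "r < length w" "w ! r = j" using idx by blast
  consider "r \<le> i" | "r = Suc i" | "r > Suc i" by linarith
  then show "q (w ! i) = p (w ! Suc i)"
  proof cases
    case 1
    then show ?thesis using le[of r i] i r j t(2)[of j] t(2)[of "w ! i"] by (cases "r = i") auto
  next
    case 2
    then show ?thesis using r j by simp
  next
    case 3
    then show ?thesis using le[of "Suc i" r] le[of i "Suc i"] i r j t(2)[of "w ! Suc i"] by auto
  qed
qed

subsection \<open>Piecewise increasing interval exchanges\<close>

text \<open>The part of the structure that is carried through the Rauzy steps: two partitions and
  increasing branches. Regularity enters later, only through a distortion constant of the original
  map.\<close>

definition pgiet :: "'d::finite giet \<Rightarrow> bool" where
  "pgiet T \<longleftrightarrow> interval_partition (topI T) \<and> interval_partition (botI T) \<and>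
     (\<forall>j. strict_mono_on (topI T j) (gmap T))"

abbreviation "tl0 T j \<equiv> Inf (topI T j)"
abbreviation "tr0 T j \<equiv> Sup (topI T j)"
abbreviation "bl0 T j \<equiv> Inf (botI T j)"
abbreviation "br0 T j \<equiv> Sup (botI T j)"

lemma pgiet_intervals:
  assumes "pgiet T"
  shows "topI T j = {tl0 T j..<tr0 T j}" "botI T j = {bl0 T j..<br0 T j}"
    "tiles 1 (tl0 T) (tr0 T)" "tiles 1 (bl0 T) (br0 T)"
  using assms unfolding pgiet_def interval_partition_iff_tiles by auto

lemma giet_imp_pgiet:
  assumes "giet r T"
  shows "pgiet T"
proof -
  have "strict_mono_on (topI T j) (gmap T)" for j
  proof -
    obtain f where f: "\<forall>x\<in>topI T j. f x = gmap T x" "strict_mono_on (closure (topI T j)) f"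
      using assms unfolding giet_def by blast
    show ?thesis
    proof (rule strict_mono_onI)
      fix x y assume "x \<in> topI T j" "y \<in> topI T j" "x < y"
      then show "gmap T x < gmap T y"
        using f strict_mono_onD[OF f(2), of x y] closure_subset[of "topI T j"] by auto
    qed
  qed
  then show ?thesis using assms unfolding giet_def pgiet_def by blast
qed

lemma len_Ico: "len {a..<b} = (if a \<le> b then b - a else 0)"
  unfolding len_def by simp

text \<open>Surjectivity onto an interval replaces continuity: an increasing map with such an image
  cannot jump, so it sends subintervals to intervals.\<close>

lemma strict_mono_image_Ico:
  fixes f :: "real \<Rightarrow> real"
  assumes "strict_mono_on {p..<q} f" "f ` {p..<q} = {p'..<q'}" "p < q"
  shows "f p = p'" "p \<le> x \<Longrightarrow> x < q \<Longrightarrow> f ` {p..<x} = {p'..<f x}"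
    "p \<le> x \<Longrightarrow> x < q \<Longrightarrow> f ` {x..<q} = {f x..<q'}"
proof -
  have lt: "f x < f y" if "p \<le> x" "x < y" "y < q" for x y
    using strict_mono_onD[OF assms(1), of x y] that by auto
  have le: "f x \<le> f y" if "p \<le> x" "x \<le> y" "y < q" for x y
    using lt[of x y] that by (cases "x = y") auto
  have mem: "p' \<le> f x \<and> f x < q'" if "p \<le> x" "x < q" for x
    using that assms(2) by (metis atLeastLessThan_iff imageI)
  have pre: "\<exists>x. p \<le> x \<and> x < q \<and> f x = y" if "p' \<le> y" "y < q'" for y
    using that assms(2) by (metis atLeastLessThan_iff imageE)
  have p'q': "p' < q'" using mem[of p] assms(3) by simp
  show fp: "f p = p'"
    using pre[of p'] p'q' le[of p] mem[of p] assms(3) by force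
  show "f ` {p..<x} = {p'..<f x}" if x: "p \<le> x" "x < q"
  proof (intro equalityI subsetI)
    fix y assume "y \<in> f ` {p..<x}"
    then show "y \<in> {p'..<f x}" using mem lt x by force
  next
    fix y assume y: "y \<in> {p'..<f x}"
    then obtain z where z: "p \<le> z" "z < q" "f z = y" using pre[of y] mem[OF x] by auto
    have "z < x" using le[of x z] x z y by (metis atLeastLessThan_iff linorder_not_le)
    then show "y \<in> f ` {p..<x}" using z by auto
  qed
  show "f ` {x..<q} = {f x..<q'}" if x: "p \<le> x" "x < q"
  proof (intro equalityI subsetI)
    fix y assume "y \<in> f ` {x..<q}"
    then show "y \<in> {f x..<q'}" using mem le x by force
  next
    fix y assume y: "y \<in> {f x..<q'}"
    then obtain z where z: "p \<le> z" "z < q" "f z = y" using pre[of y] mem[OF x] by auto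
    have "x \<le> z" using lt[of z x] x z y by (metis atLeastLessThan_iff linorder_not_le)
    then show "y \<in> f ` {x..<q}" using z by auto
  qed
qed

lemma strict_mono_image_sub:
  fixes f :: "real \<Rightarrow> real"
  assumes "strict_mono_on {p..<q} f" "f ` {p..<q} = {p'..<q'}" "p \<le> x" "x < y" "y \<le> q"
  obtains x' y' where "x' < y'" "f ` {x..<y} = {x'..<y'}"
proof -
  have "f ` {x..<q} = {f x..<q'}" "f x < q'"
    using strict_mono_image_Ico(3)[OF assms(1,2), of x] assms by (auto)
  moreover have "strict_mono_on {x..<q} f"
    using assms(1) by (rule monotone_on_subset) (use assms(3) in auto)
  ultimately show ?thesis
  proof (cases "y < q")
    case True
    then have "f ` {x..<y} = {f x..<f y}"
      using strict_mono_image_Ico(2)[OF \<open>strict_mono_on {x..<q} f\<close> \<open>f ` {x..<q} = {f x..<q'}\<close>, of y] assms by auto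
    moreover have "f x < f y" using assms True by (intro strict_mono_onD[OF assms(1)]) auto
    ultimately show ?thesis using that by blast
  next
    case False
    then show ?thesis using that \<open>f ` {x..<q} = {f x..<q'}\<close> \<open>f x < q'\<close> assms(5) by (metis antisym_conv2)
  qed
qed

lemma pgiet_maps:
  assumes "pgiet T"
  shows "x \<in> topI T j \<Longrightarrow> gmap T x \<in> botI T j"
    "x \<in> {0..<1} \<Longrightarrow> \<exists>j. x \<in> topI T j" "x \<in> topI T j \<Longrightarrow> x \<in> {0..<1}"
    "x \<in> {0..<1} \<Longrightarrow> \<exists>j. x \<in> botI T j" "x \<in> botI T j \<Longrightarrow> x \<in> {0..<1}"
    "x \<in> topI T i \<Longrightarrow> x \<in> topI T j \<Longrightarrow> i = j" "x \<in> botI T i \<Longrightarrow> x \<in> botI T j \<Longrightarrow> i = j"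
    "topI T j \<noteq> {}"
proof -
  have dis: "topI T i \<inter> topI T j = {}" "botI T i \<inter> botI T j = {}" if "i \<noteq> j" for i j
    using assms that unfolding pgiet_def interval_partition_def disjoint_family_on_def by auto
  have t: "(\<Union>j. topI T j) = {0..<1}" "(\<Union>j. botI T j) = {0..<1}"
    using assms unfolding pgiet_def interval_partition_def by auto
  show "x \<in> topI T j \<Longrightarrow> gmap T x \<in> botI T j" unfolding botI_def by blast
  show "x \<in> {0..<1} \<Longrightarrow> \<exists>j. x \<in> topI T j" "x \<in> topI T j \<Longrightarrow> x \<in> {0..<1}"
    "x \<in> {0..<1} \<Longrightarrow> \<exists>j. x \<in> botI T j" "x \<in> botI T j \<Longrightarrow> x \<in> {0..<1}" using t by blast+
  show "x \<in> topI T i \<Longrightarrow> x \<in> topI T j \<Longrightarrow> i = j" "x \<in> botI T i \<Longrightarrow> x \<in> botI T j \<Longrightarrow> i = j"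
    using dis[of i j] by blast+
  have "tl0 T j \<in> topI T j"
    by (subst pgiet_intervals(1)[OF assms]) (use tilesD(2)[OF pgiet_intervals(3)[OF assms]] in auto)
  then show "topI T j \<noteq> {}" by auto
qed

lemma pgiet_bij:
  assumes "pgiet T"
  shows "bij_betw (gmap T) {0..<1} {0..<1}"
proof -
  note m = pgiet_maps[OF assms]
  have "inj_on (gmap T) {0..<1}"
  proof (rule inj_onI)
    fix x y :: real assume xy: "x \<in> {0..<1}" "y \<in> {0..<1}" "gmap T x = gmap T y"
    obtain i j where ij: "x \<in> topI T i" "y \<in> topI T j" using m(2) xy by blast
    then have "i = j" using m(1)[of x i] m(1)[of y j] m(7) xy(3) by metis
    moreover have "inj_on (gmap T) (topI T j)"
      using assms unfolding pgiet_def by (meson strict_mono_on_imp_inj_on)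
    ultimately show "x = y" using ij xy(3) by (metis inj_onD)
  qed
  moreover have "gmap T ` {0..<1} = {0..<1}"
  proof (intro equalityI subsetI)
    fix y assume "y \<in> gmap T ` {0..<1}"
    then show "y \<in> {0..<1}" using m(1,2,5) by blast
  next
    fix y :: real assume "y \<in> {0..<1}"
    then obtain j where "y \<in> botI T j" using m(4) by blast
    then show "y \<in> gmap T ` {0..<1}" unfolding botI_def using m(3) by blast
  qed
  ultimately show ?thesis unfolding bij_betw_def by blast
qed

lemma pgiet_last:
  assumes "pgiet T"
  shows "tr0 T (top_last T) = 1" "br0 T (bot_last T) = 1"
    "tr0 T j = 1 \<Longrightarrow> j = top_last T" "br0 T j = 1 \<Longrightarrow> j = bot_last T"
proof -
  note i = pgiet_intervals[OF assms]
  have wt: "sorted_word (tl0 T) (tr0 T) (word_of (topI T))"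
    and wb: "sorted_word (bl0 T) (br0 T) (word_of (botI T))"
    using assms unfolding pgiet_def by (blast intro: word_of_sorted)+
  show 1: "tr0 T (top_last T) = 1" "br0 T (bot_last T) = 1"
    using sorted_wordD(4)[OF i(3) wt] sorted_wordD(4)[OF i(4) wb]
    unfolding top_last_def bot_last_def datum_def by auto
  show "tr0 T j = 1 \<Longrightarrow> j = top_last T" "br0 T j = 1 \<Longrightarrow> j = bot_last T"
    using tiles_inj(2)[OF i(3), of j "top_last T"] tiles_inj(2)[OF i(4), of j "bot_last T"] 1
    by auto
qed

subsection \<open>The elementary Rauzy--Veech step\<close>

lemma tiles_cut:
  assumes "tiles 1 p q" "q \<alpha> = 1" "p \<alpha> < l" "l < 1"
  shows "tiles l p (q(\<alpha> := l))"
proof -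
  note t = tilesD[OF assms(1)]
  have le: "q j \<le> p \<alpha>" if "j \<noteq> \<alpha>" for j
    using t(4)[OF that] t(2)[of j] t(3)[of j] assms(2) by auto
  have "\<exists>j. p j \<le> x \<and> x < (q(\<alpha> := l)) j" if "0 \<le> x" "x < l" for x
    using t(5)[of x] that assms(4) by (auto split: if_splits)
  moreover have "0 \<le> p j \<and> p j < (q(\<alpha> := l)) j \<and> (q(\<alpha> := l)) j \<le> l" for j
    using t(1,2)[of j] le[of j] assms(3) by auto
  moreover have "(q(\<alpha> := l)) i \<le> p j \<or> (q(\<alpha> := l)) j \<le> p i" if "i \<noteq> j" for i j
    using t(4)[OF that] le that t(2)[of i] t(2)[of j] by (auto simp: assms(2))
  ultimately show ?thesis unfolding tiles_def by blast
qed

lemma tiles_insert: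
  assumes "tiles 1 p q" "q \<beta> = 1" "p \<alpha> < c" "c < q \<alpha>" "\<alpha> \<noteq> \<beta>"
  shows "tiles (p \<beta>) (p(\<beta> := c)) (q(\<alpha> := c, \<beta> := q \<alpha>))"
proof -
  note t = tilesD[OF assms(1)]
  have le: "q j \<le> p \<beta>" if "j \<noteq> \<beta>" for j
    using t(4)[OF that] t(2)[of j] t(3)[of j] assms(2) by auto
  have dis: "q j \<le> p \<alpha> \<or> q \<alpha> \<le> p j" if "j \<noteq> \<alpha>" for j using t(4)[OF that] .
  let ?p = "p(\<beta> := c)" and ?q = "q(\<alpha> := c, \<beta> := q \<alpha>)"
  have "\<exists>j. ?p j \<le> x \<and> x < ?q j" if x: "0 \<le> x" "x < p \<beta>" for x
  proof -
    obtain j where j: "p j \<le> x" "x < q j" using t(5)[of x] x t(2,3)[of \<beta>] by auto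
    then have "j \<noteq> \<beta>" using x by auto
    show ?thesis
    proof (cases "j = \<alpha>")
      case True
      then show ?thesis
        using j assms \<open>j \<noteq> \<beta>\<close> by (cases "x < c") (auto intro: exI[of _ \<alpha>] exI[of _ \<beta>])
    qed (use j \<open>j \<noteq> \<beta>\<close> in \<open>auto intro: exI[of _ j]\<close>)
  qed
  moreover have "0 \<le> ?p j \<and> ?p j < ?q j \<and> ?q j \<le> p \<beta>" for j
    using t(1)[of j] t(2)[of j] t(1)[of \<alpha>] le[of j] le[of \<alpha>] assms(3,4,5) by auto
  moreover have "?q i \<le> ?p j \<or> ?q j \<le> ?p i" if "i \<noteq> j" for i j
    using t(4)[OF that] dis[of i] dis[of j] that assms(3,4,5) by (auto split: if_splits)
  ultimately show ?thesis unfolding tiles_def by blast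
qed

text \<open>
  The two types of a step are exchanged by swapping the two partitions. Here \<open>p, q\<close> bound the
  intervals of the partition of the winner \<open>\<alpha>\<close>, and \<open>r, s\<close> those of the partition of the loser \<open>\<beta>\<close>.
\<close>

definition istep ::
  "real \<Rightarrow> 'd \<Rightarrow> 'd \<Rightarrow> real \<Rightarrow> ('d \<Rightarrow> real) \<Rightarrow> ('d \<Rightarrow> real) \<Rightarrow> ('d \<Rightarrow> real) \<Rightarrow> ('d \<Rightarrow> real) \<Rightarrow>
    ('d \<Rightarrow> real) \<Rightarrow> ('d \<Rightarrow> real) \<Rightarrow> ('d \<Rightarrow> real) \<Rightarrow> ('d \<Rightarrow> real) \<Rightarrow> bool" where
  "istep l \<alpha> \<beta> c p q r s p' q' r' s' \<longleftrightarrow>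
     \<alpha> \<noteq> \<beta> \<and> q \<alpha> = 1 \<and> s \<beta> = 1 \<and> r \<beta> = l \<and> p \<alpha> < l \<and> l < 1 \<and> r \<alpha> < c \<and> c < s \<alpha> \<and>
     p' = (\<lambda>j. p j / l) \<and> q' = (\<lambda>j. (q(\<alpha> := l)) j / l) \<and>
     r' = (\<lambda>j. (r(\<beta> := c)) j / l) \<and> s' = (\<lambda>j. (s(\<alpha> := c, \<beta> := s \<alpha>)) j / l)"

lemma istepD:
  assumes "istep l \<alpha> \<beta> c p q r s p' q' r' s'"
  shows "\<alpha> \<noteq> \<beta>" "q \<alpha> = 1" "s \<beta> = 1" "r \<beta> = l" "p \<alpha> < l" "l < 1" "r \<alpha> < c" "c < s \<alpha>"
    "p' j = p j / l" "q' j = (if j = \<alpha> then l else q j) / l" "r' j = (if j = \<beta> then c else r j) / l"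
    "s' j = (if j = \<beta> then s \<alpha> else if j = \<alpha> then c else s j) / l"
  using assms unfolding istep_def by auto

lemma istep_tiles:
  assumes "istep l \<alpha> \<beta> c p q r s p' q' r' s'" "tiles 1 p q" "tiles 1 r s"
  shows "tiles 1 p' q'" "tiles 1 r' s'"
proof -
  note i = assms(1)[unfolded istep_def]
  have l: "l > 0" using i tilesD(1)[OF assms(2), of \<alpha>] by linarith
  show "tiles 1 p' q'"
    using tiles_scale[OF tiles_cut[OF assms(2), of \<alpha> l] l] i l by simp
  show "tiles 1 r' s'"
    using tiles_scale[OF tiles_insert[OF assms(3), of \<beta> \<alpha> c] l] i l by simp
qed

lemma image_divide_Ico:
  fixes l :: real
  assumes "l > 0"
  shows "(\<lambda>x. x / l) ` {p..<q} = {p / l..<q / l}"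
proof (intro equalityI subsetI)
  fix y assume "y \<in> {p / l..<q / l}"
  then have "y * l \<in> {p..<q}" "y = (y * l) / l" using assms by (auto simp: field_simps)
  then show "y \<in> (\<lambda>x. x / l) ` {p..<q}" by blast
qed (use assms in \<open>auto intro: divide_right_mono divide_strict_right_mono\<close>)

locale rauzy_step =
  fixes T :: "'d::finite giet"
  assumes pg: "pgiet T" and ne: "top_last T \<noteq> bot_last T" and ren: "renormalizable T"
begin

abbreviation "f \<equiv> gmap T"
abbreviation "\<alpha> \<equiv> top_last T"
abbreviation "\<beta> \<equiv> bot_last T"
abbreviation "l \<equiv> step_length T"

lemmas ivs = pgiet_intervals[OF pg]
lemmas maps = pgiet_maps[OF pg]
lemmas lasts = pgiet_last(1,2)[OF pg]

lemma top_last_eq: "topI T \<alpha> = {tl0 T \<alpha>..<1}" and bot_last_eq: "botI T \<beta> = {bl0 T \<beta>..<1}"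
  using ivs(1)[of \<alpha>] ivs(2)[of \<beta>] unfolding lasts .

lemma left_ends: "0 \<le> tl0 T \<alpha>" "tl0 T \<alpha> < 1" "0 \<le> bl0 T \<beta>" "bl0 T \<beta> < 1"
  using tilesD(1,2,3)[OF ivs(3), of \<alpha>] tilesD(1,2,3)[OF ivs(4), of \<beta>] lasts by auto

lemma lens: "len (topI T \<alpha>) = 1 - tl0 T \<alpha>" "len (botI T \<beta>) = 1 - bl0 T \<beta>"
  using left_ends len_Ico[of "tl0 T \<alpha>" 1] len_Ico[of "bl0 T \<beta>" 1]
  unfolding top_last_eq[symmetric] bot_last_eq[symmetric] by simp_all

lemma l_eq: "l = max (tl0 T \<alpha>) (bl0 T \<beta>)" and ends_ne: "tl0 T \<alpha> \<noteq> bl0 T \<beta>"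
  and type_Top: "step_type T = Top \<longleftrightarrow> tl0 T \<alpha> < bl0 T \<beta>"
  using ren unfolding step_length_def renormalizable_def step_type_def lens by auto

lemma l_bounds: "0 < l" "l < 1"
  using left_ends ends_ne unfolding l_eq by auto

lemma type_Bottom: "step_type T = Bottom \<longleftrightarrow> bl0 T \<beta> < tl0 T \<alpha>"
  using type_Top ends_ne by (cases "step_type T") auto

lemma l_type: "l = (if step_type T = Top then bl0 T \<beta> else tl0 T \<alpha>)"
  using type_Top unfolding l_eq by auto

lemma other_top: "j \<noteq> \<alpha> \<Longrightarrow> tr0 T j \<le> tl0 T \<alpha>" and other_bot: "j \<noteq> \<beta> \<Longrightarrow> br0 T j \<le> bl0 T \<beta>"
  using tilesD(4)[OF ivs(3), of j \<alpha>] tilesD(2,3)[OF ivs(3), of j]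
    tilesD(4)[OF ivs(4), of j \<beta>] tilesD(2,3)[OF ivs(4), of j] lasts by auto

lemma top_mem: "x \<in> topI T j \<longleftrightarrow> tl0 T j \<le> x \<and> x < tr0 T j"
  using arg_cong[OF ivs(1)[of j], of "\<lambda>A. x \<in> A"] unfolding atLeastLessThan_iff .

lemma bot_mem: "x \<in> botI T j \<longleftrightarrow> bl0 T j \<le> x \<and> x < br0 T j"
  using arg_cong[OF ivs(2)[of j], of "\<lambda>A. x \<in> A"] unfolding atLeastLessThan_iff .

lemma ge_l: "x \<in> topI T \<alpha>" "x \<in> botI T \<beta>" if "l \<le> x" "x < 1"
  using that unfolding top_mem bot_mem lasts l_eq by auto

text \<open>The removed part [l, 1) lies in the last top interval and in the last bottom interval. A
  point sent into it therefore starts in the top interval of \<beta>, and its second image is in the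
  bottom interval of \<alpha>, to the left of that of \<beta>. So all return times are 1 or
  2.\<close>

lemma long_return:
  assumes "x \<in> {0..<1}" "l \<le> f x"
  shows "x \<in> topI T \<beta>" "f x \<in> topI T \<alpha>" "x < l" "f (f x) < l" "0 \<le> f (f x)"
proof -
  have fx: "f x < 1" using pgiet_bij[OF pg] assms(1) by (auto dest: bij_betwE)
  obtain j where j: "x \<in> topI T j" using maps(2)[OF assms(1)] by blast
  have "j = \<beta>" using maps(7)[OF maps(1)[OF j] ge_l(2)[OF assms(2) fx]] .
  then show x: "x \<in> topI T \<beta>" using j by simp
  show fx\<alpha>: "f x \<in> topI T \<alpha>" using ge_l(1)[OF assms(2) fx] .
  have "x < tl0 T \<alpha>" using x other_top[OF ne[symmetric]] unfolding top_mem by linarith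
  then show "x < l" unfolding l_eq by simp
  have ffx: "f (f x) \<in> botI T \<alpha>" using maps(1)[OF fx\<alpha>] .
  then have "f (f x) < bl0 T \<beta>" using other_bot[OF ne] unfolding bot_mem by linarith
  then show "f (f x) < l" unfolding l_eq by simp
  show "0 \<le> f (f x)" using maps(5)[OF ffx] by simp
qed

lemma f_bounds: "x \<in> {0..<1} \<Longrightarrow> 0 \<le> f x \<and> f x < 1"
  using pgiet_bij[OF pg] by (auto dest: bij_betwE)

lemma ret:
  assumes "x \<in> {0..<l}"
  shows "ret_time f {0..<l} x = (if f x < l then 1 else 2)"
    "ret_map f {0..<l} x = (if f x < l then f x else f (f x))"
proof -
  have x: "x \<in> {0..<1}" using assms l_bounds by auto
  show 1: "ret_time f {0..<l} x = (if f x < l then 1 else 2)"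
  proof (cases "f x < l")
    case True
    then show ?thesis unfolding ret_time_def using f_bounds[OF x] by (auto intro: Least_equality)
  next
    case False
    have "(LEAST n. 1 \<le> n \<and> (f ^^ n) x \<in> {0..<l}) = 2"
    proof (rule Least_equality)
      show "1 \<le> (2::nat) \<and> (f ^^ 2) x \<in> {0..<l}"
        using long_return[OF x] False by (auto simp: numeral_2_eq_2)
    next
      fix n assume n: "1 \<le> n \<and> (f ^^ n) x \<in> {0..<l}"
      then have "n \<noteq> 1" using False by auto
      then show "2 \<le> n" using n by auto
    qed
    then show ?thesis using False unfolding ret_time_def by simp
  qed
  show "ret_map f {0..<l} x = (if f x < l then f x else f (f x))"
    unfolding ret_map_def 1 by (simp add: numeral_2_eq_2)
qed

definition g :: "real \<Rightarrow> real" where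
  "g x = (if f x < l then f x else f (f x))"

definition dom :: "'d \<Rightarrow> real set" where
  "dom j = {x \<in> {0..<l}. if l \<le> f x then j = loser T else x \<in> topI T j}"

lemma topI_rauzy: "topI (rauzy T) j = (\<lambda>x. x / l) ` dom j"
proof -
  have "{x \<in> {0..<l}. if ret_time f {0..<l} x = 2 then j = loser T else x \<in> topI T j} = dom j"
    unfolding dom_def using ret(1) by (intro Collect_cong conj_cong refl) (simp add: not_less)
  then show ?thesis unfolding rauzy_def Let_def by simp
qed

lemma gmap_rauzy: "0 \<le> y \<Longrightarrow> y < 1 \<Longrightarrow> gmap (rauzy T) y = g (l * y) / l"
  using ret(2)[of "l * y"] l_bounds unfolding rauzy_def Let_def g_def by simp

lemma dom_bounds: "x \<in> dom j \<Longrightarrow> 0 \<le> x \<and> x < l"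
  unfolding dom_def by simp

lemma botI_rauzy: "botI (rauzy T) j = (\<lambda>x. x / l) ` g ` dom j"
proof -
  have "gmap (rauzy T) (x / l) = g x / l" if "x \<in> dom j" for x
    using gmap_rauzy[of "x / l"] dom_bounds[OF that] l_bounds by simp
  then show ?thesis unfolding botI_def topI_rauzy image_image by (intro image_cong refl)
qed

lemma rauzy_orbit:
  assumes "y \<in> topI (rauzy T) j"
  shows "0 \<le> l * y" "l * y < l"
    "j \<noteq> loser T \<Longrightarrow> l * y \<in> topI T j \<and> l * gmap (rauzy T) y = f (l * y)"
    "j = loser T \<Longrightarrow> l * y \<in> topI T \<beta> \<and> f (l * y) \<in> topI T \<alpha> \<and> l \<le> f (l * y) \<and>
       l * gmap (rauzy T) y = f (f (l * y))"
proof -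
  obtain x where x: "x \<in> dom j" "y = x / l" using assms unfolding topI_rauzy by blast
  have ly: "l * y = x" using x l_bounds by simp
  show b: "0 \<le> l * y" "l * y < l" using dom_bounds[OF x(1)] ly by auto
  have "0 \<le> y" "y < 1" using dom_bounds[OF x(1)] x(2) l_bounds by auto
  then have gm: "l * gmap (rauzy T) y = g x"
    using gmap_rauzy[of y] l_bounds ly by simp
  show "j \<noteq> loser T \<Longrightarrow> l * y \<in> topI T j \<and> l * gmap (rauzy T) y = f (l * y)"
    using x(1) unfolding gm ly dom_def g_def by (auto split: if_splits)
  assume j: "j = loser T"
  \<comment> \<open>With return time 1, the loser's label would place either the image at or beyond
    \<open>bl0 T \<beta>\<close> or the point at or beyond \<open>tl0 T \<alpha>\<close>; for the
    type in question this bound is l.\<close>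
  have "l \<le> f x"
  proof (rule ccontr)
    assume lt: "\<not> l \<le> f x"
    then have xj: "x \<in> topI T j" using x(1) unfolding dom_def by auto
    show False
    proof (cases "step_type T = Top")
      case True
      then have "f x \<in> botI T \<beta>" using maps(1)[OF xj] j unfolding loser_def by simp
      then have "bl0 T \<beta> \<le> f x" unfolding bot_mem by simp
      then show False using lt True unfolding l_type by simp
    next
      case False
      then have "x \<in> topI T \<alpha>" using xj j unfolding loser_def by (cases "step_type T") auto
      then have "tl0 T \<alpha> \<le> x" unfolding top_mem by simp
      then show False using b ly False unfolding l_type by simp
    qed
  qed
  then show "l * y \<in> topI T \<beta> \<and> f (l * y) \<in> topI T \<alpha> \<and> l \<le> f (l * y) \<and>
       l * gmap (rauzy T) y = f (f (l * y))"
    using long_return[of x] b l_bounds unfolding gm ly g_def by auto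
qed

lemma f_top: "strict_mono_on {tl0 T j..<tr0 T j} f" "f ` {tl0 T j..<tr0 T j} = {bl0 T j..<br0 T j}"
proof -
  show "strict_mono_on {tl0 T j..<tr0 T j} f"
    using pg ivs(1)[of j] unfolding pgiet_def by metis
  show "f ` {tl0 T j..<tr0 T j} = {bl0 T j..<br0 T j}"
    using ivs(1,2)[of j] unfolding botI_def by metis
qed

lemmas tlr = tilesD(2)[OF ivs(3)]

lemma bounds_of_image:
  assumes "topI (rauzy T) j = (\<lambda>x. x / l) ` {p..<q}" "p < q"
  shows "tl0 (rauzy T) j = p / l" "tr0 (rauzy T) j = q / l"
  unfolding assms(1) image_divide_Ico[OF l_bounds(1)] using assms(2) l_bounds(1)
  by (auto simp: divide_strict_right_mono)

lemma bounds_of_image_bot: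
  assumes "botI (rauzy T) j = (\<lambda>x. x / l) ` {p..<q}" "p < q"
  shows "bl0 (rauzy T) j = p / l" "br0 (rauzy T) j = q / l"
  unfolding assms(1) image_divide_Ico[OF l_bounds(1)] using assms(2) l_bounds(1)
  by (auto simp: divide_strict_right_mono)

lemma rauzy_Top:
  assumes "step_type T = Top"
  obtains c where
    "istep l \<alpha> \<beta> c (tl0 T) (tr0 T) (bl0 T) (br0 T)
      (tl0 (rauzy T)) (tr0 (rauzy T)) (bl0 (rauzy T)) (br0 (rauzy T))"
    "\<And>j. topI (rauzy T) j = (\<lambda>x. x / l) ` {tl0 T j..<((tr0 T)(\<alpha> := l)) j}"
    "\<And>j. botI (rauzy T) j = (\<lambda>x. x / l) ` {((bl0 T)(\<beta> := c)) j..<((br0 T)(\<alpha> := c, \<beta> := br0 T \<alpha>)) j}"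
proof -
  have l: "l = bl0 T \<beta>" and ab: "tl0 T \<alpha> < l" and los: "loser T = \<beta>"
    using assms l_type type_Top unfolding loser_def by auto
  have l\<alpha>: "tl0 T \<alpha> \<le> l" "l < tr0 T \<alpha>" using ab l_bounds lasts by auto
  have long: "l \<le> f x \<longleftrightarrow> x \<in> topI T \<beta>" if "x \<in> {0..<1}" for x
    using long_return(1)[OF that] maps(1)[of x \<beta>] unfolding bot_mem l by auto
  have dom: "dom j = {tl0 T j..<((tr0 T)(\<alpha> := l)) j}" for j
  proof (intro equalityI subsetI)
    fix x assume x: "x \<in> dom j"
    then have x01: "x \<in> {0..<1}" using dom_bounds[OF x] l_bounds by auto
    have "x \<in> topI T j" using x long[OF x01] unfolding dom_def los by (auto split: if_splits)
    then show "x \<in> {tl0 T j..<((tr0 T)(\<alpha> := l)) j}" using dom_bounds[OF x] unfolding top_mem by auto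
  next
    fix x assume x: "x \<in> {tl0 T j..<((tr0 T)(\<alpha> := l)) j}"
    then have xj: "x \<in> topI T j" using l\<alpha> unfolding top_mem by (auto split: if_splits)
    then have x01: "x \<in> {0..<1}" using maps(3) by blast
    have "x < l" using x other_top[of j] ab by (auto split: if_splits)
    then show "x \<in> dom j" using xj x01 long[OF x01] maps(6)[OF xj, of \<beta>] unfolding dom_def los by auto
  qed
  have gf: "g x = f x" if "x \<in> topI T j" "j \<noteq> \<beta>" for x j
    using long[OF maps(3)[OF that(1)]] maps(6)[OF that(1), of \<beta>] that(2) unfolding g_def by auto
  \<comment> \<open>The top interval of the winner is cut at l, so its bottom interval is cut at the
    image of l: the witness c is \<open>f l\<close>.\<close>
  have fl: "bl0 T \<alpha> < f l" "f l < br0 T \<alpha>"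
  proof -
    have "f (tl0 T \<alpha>) < f l" using f_top(1)[of \<alpha>] l\<alpha> ab by (intro strict_mono_onD[OF f_top(1)]) auto
    then show "bl0 T \<alpha> < f l" using strict_mono_image_Ico(1)[OF f_top tlr, of \<alpha>] by simp
    show "f l < br0 T \<alpha>" using maps(1)[of l \<alpha>] l\<alpha> unfolding top_mem bot_mem by simp
  qed
  have gdom: "g ` dom j = {((bl0 T)(\<beta> := f l)) j..<((br0 T)(\<alpha> := f l, \<beta> := br0 T \<alpha>)) j}" for j
  proof -
    consider "j = \<alpha>" | "j = \<beta>" | "j \<noteq> \<alpha>" "j \<noteq> \<beta>" by blast
    then show ?thesis
    proof cases
      case 1
      have "g ` dom \<alpha> = f ` {tl0 T \<alpha>..<l}"
        unfolding dom using gf[of _ \<alpha>] ne l\<alpha> by (intro image_cong) (auto simp: top_mem)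
      also have "\<dots> = {bl0 T \<alpha>..<f l}" using strict_mono_image_Ico(2)[OF f_top tlr l\<alpha>] .
      finally show ?thesis using 1 ne by simp
    next
      case 2
      have "g ` dom \<beta> = f ` f ` {tl0 T \<beta>..<tr0 T \<beta>}"
        unfolding dom image_image using ne long maps(3)[of _ \<beta>]
        by (intro image_cong) (auto simp: top_mem g_def not_le[symmetric])
      also have "\<dots> = f ` {l..<tr0 T \<alpha>}" unfolding f_top lasts l ..
      also have "\<dots> = {f l..<br0 T \<alpha>}" using strict_mono_image_Ico(3)[OF f_top tlr l\<alpha>] .
      finally show ?thesis using 2 by simp
    next
      case 3
      have "g ` dom j = f ` {tl0 T j..<tr0 T j}"
        unfolding dom using gf[of _ j] 3 by (intro image_cong) (auto simp: top_mem)
      then show ?thesis using 3 f_top(2)[of j] by simp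
    qed
  qed
  have t: "topI (rauzy T) j = (\<lambda>x. x / l) ` {tl0 T j..<((tr0 T)(\<alpha> := l)) j}" for j
    unfolding topI_rauzy dom ..
  have b: "botI (rauzy T) j = (\<lambda>x. x / l) ` {((bl0 T)(\<beta> := f l)) j..<((br0 T)(\<alpha> := f l, \<beta> := br0 T \<alpha>)) j}" for j
    unfolding botI_rauzy gdom ..
  have tb: "tl0 T j < ((tr0 T)(\<alpha> := l)) j" for j using tlr[of j] ab by simp
  have bb: "((bl0 T)(\<beta> := f l)) j < ((br0 T)(\<alpha> := f l, \<beta> := br0 T \<alpha>)) j" for j
    using tilesD(2)[OF ivs(4), of j] fl ne by auto
  have "istep l \<alpha> \<beta> (f l) (tl0 T) (tr0 T) (bl0 T) (br0 T)
      (tl0 (rauzy T)) (tr0 (rauzy T)) (bl0 (rauzy T)) (br0 (rauzy T))"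
    unfolding istep_def
    using bounds_of_image[OF t tb] bounds_of_image_bot[OF b bb] fl ne lasts l ab l_bounds by auto
  then show ?thesis using that t b by blast
qed

lemma rauzy_Bottom:
  assumes "step_type T = Bottom"
  obtains c where
    "istep l \<beta> \<alpha> c (bl0 T) (br0 T) (tl0 T) (tr0 T)
      (bl0 (rauzy T)) (br0 (rauzy T)) (tl0 (rauzy T)) (tr0 (rauzy T))"
    "\<And>j. topI (rauzy T) j = (\<lambda>x. x / l) ` {((tl0 T)(\<alpha> := c)) j..<((tr0 T)(\<beta> := c, \<alpha> := tr0 T \<beta>)) j}"
    "\<And>j. botI (rauzy T) j = (\<lambda>x. x / l) ` {bl0 T j..<((br0 T)(\<beta> := l)) j}"
proof -
  have l: "l = tl0 T \<alpha>" and ba: "bl0 T \<beta> < l" and los: "loser T = \<alpha>"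
    using assms l_type type_Bottom unfolding loser_def by auto
  \<comment> \<open>Now the cut at l is made in the bottom interval of the winner, and c is the
    preimage e of l. The points of the top interval of \<beta> beyond e are those that return after
    two steps.\<close>
  have "l \<in> f ` {tl0 T \<beta>..<tr0 T \<beta>}" using f_top(2)[of \<beta>] ba lasts l_bounds by auto
  then obtain e where e: "tl0 T \<beta> \<le> e" "e < tr0 T \<beta>" "f e = l" by auto
  have "e \<noteq> tl0 T \<beta>" using strict_mono_image_Ico(1)[OF f_top tlr, of \<beta>] e ba by auto
  then have e1: "tl0 T \<beta> < e" using e by simp
  have long: "l \<le> f x \<longleftrightarrow> e \<le> x" if "x \<in> topI T \<beta>" for x
  proof -
    have "x < e \<Longrightarrow> f x < l" using strict_mono_onD[OF f_top(1)[of \<beta>], of x e] that e unfolding top_mem by auto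
    moreover have "e < x \<Longrightarrow> l < f x" using strict_mono_onD[OF f_top(1)[of \<beta>], of e x] that e unfolding top_mem by auto
    ultimately show ?thesis using e(3) by (metis less_eq_real_def linorder_not_le)
  qed
  have long': "l \<le> f x \<longleftrightarrow> x \<in> topI T \<beta> \<and> e \<le> x" if "x \<in> {0..<1}" for x
    using long_return(1)[OF that] long by blast
  have \<beta>l: "tr0 T \<beta> \<le> l" using other_top[of \<beta>] ne l by auto
  have dom: "dom j = {((tl0 T)(\<alpha> := e)) j..<((tr0 T)(\<beta> := e, \<alpha> := tr0 T \<beta>)) j}" for j
  proof -
    consider "j = \<alpha>" | "j = \<beta>" | "j \<noteq> \<alpha>" "j \<noteq> \<beta>" by blast
    then show ?thesis
    proof cases
      case 1
      have "x \<in> dom \<alpha> \<longleftrightarrow> e \<le> x \<and> x < tr0 T \<beta>" for x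
      proof
        assume x: "x \<in> dom \<alpha>"
        then have x01: "x \<in> {0..<1}" using dom_bounds[OF x] l_bounds by auto
        have "x \<notin> topI T \<alpha>" using dom_bounds[OF x] l unfolding top_mem by auto
        then have "l \<le> f x" using x unfolding dom_def by (auto split: if_splits)
        then show "e \<le> x \<and> x < tr0 T \<beta>" using long'[OF x01] unfolding top_mem by auto
      next
        assume x: "e \<le> x \<and> x < tr0 T \<beta>"
        then have xb: "x \<in> topI T \<beta>" using e unfolding top_mem by auto
        then show "x \<in> dom \<alpha>" using long[OF xb] x maps(3)[OF xb] \<beta>l unfolding dom_def los by auto
      qed
      then show ?thesis unfolding 1 by (simp add: set_eq_iff)
    next
      case 2
      have "x \<in> dom \<beta> \<longleftrightarrow> tl0 T \<beta> \<le> x \<and> x < e" for x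
      proof
        assume x: "x \<in> dom \<beta>"
        then have x01: "x \<in> {0..<1}" using dom_bounds[OF x] l_bounds by auto
        show "tl0 T \<beta> \<le> x \<and> x < e" using x long'[OF x01] ne unfolding dom_def los
          by (auto simp: top_mem split: if_splits)
      next
        assume x: "tl0 T \<beta> \<le> x \<and> x < e"
        then have xb: "x \<in> topI T \<beta>" using e unfolding top_mem by auto
        then show "x \<in> dom \<beta>" using long[OF xb] x maps(3)[OF xb] \<beta>l e unfolding dom_def los by auto
      qed
      then show ?thesis unfolding 2 using ne by (simp add: set_eq_iff)
    next
      case 3
      have "x \<in> dom j \<longleftrightarrow> x \<in> topI T j" for x
      proof
        assume x: "x \<in> dom j"
        then show "x \<in> topI T j" using 3 unfolding dom_def los by (auto split: if_splits)
      next
        assume x: "x \<in> topI T j"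
        then have "x \<notin> topI T \<beta>" using maps(6)[OF x] 3 by blast
        then show "x \<in> dom j" using x long'[OF maps(3)[OF x]] other_top[of j] 3 maps(3)[OF x] l
          unfolding dom_def los by (auto simp: top_mem)
      qed
      then show ?thesis using 3 by (simp add: set_eq_iff top_mem)
    qed
  qed
  have gdom: "g ` dom j = {bl0 T j..<((br0 T)(\<beta> := l)) j}" for j
  proof -
    consider "j = \<alpha>" | "j = \<beta>" | "j \<noteq> \<alpha>" "j \<noteq> \<beta>" by blast
    then show ?thesis
    proof cases
      case 1
      have "g ` dom \<alpha> = f ` f ` {e..<tr0 T \<beta>}"
        unfolding dom image_image using ne long e
        by (intro image_cong) (auto simp: top_mem g_def not_le[symmetric])
      also have "f ` {e..<tr0 T \<beta>} = {tl0 T \<alpha>..<tr0 T \<alpha>}"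
        using strict_mono_image_Ico(3)[OF f_top tlr e(1,2)] e(3) l lasts by simp
      finally show ?thesis using 1 ne f_top(2)[of \<alpha>] by simp
    next
      case 2
      have "g ` dom \<beta> = f ` {tl0 T \<beta>..<e}"
        unfolding dom using ne long e
        by (intro image_cong) (auto simp: top_mem g_def not_le[symmetric])
      also have "\<dots> = {bl0 T \<beta>..<l}"
        using strict_mono_image_Ico(2)[OF f_top tlr e(1,2)] e(3) by simp
      finally show ?thesis using 2 by simp
    next
      case 3
      have "g ` dom j = f ` {tl0 T j..<tr0 T j}"
      proof (unfold dom, intro image_cong)
        fix x assume x: "x \<in> {tl0 T j..<tr0 T j}"
        then have xj: "x \<in> topI T j" unfolding top_mem by simp
        then have "\<not> l \<le> f x" using long'[OF maps(3)[OF xj]] maps(6)[OF xj, of \<beta>] 3 by blast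
        then show "g x = f x" unfolding g_def by simp
      qed (use 3 in auto)
      then show ?thesis using 3 f_top(2)[of j] by simp
    qed
  qed
  have t: "topI (rauzy T) j = (\<lambda>x. x / l) ` {((tl0 T)(\<alpha> := e)) j..<((tr0 T)(\<beta> := e, \<alpha> := tr0 T \<beta>)) j}" for j
    unfolding topI_rauzy dom ..
  have b: "botI (rauzy T) j = (\<lambda>x. x / l) ` {bl0 T j..<((br0 T)(\<beta> := l)) j}" for j
    unfolding botI_rauzy gdom ..
  have tb: "((tl0 T)(\<alpha> := e)) j < ((tr0 T)(\<beta> := e, \<alpha> := tr0 T \<beta>)) j" for j
    using tlr[of j] e e1 ne by auto
  have bb: "bl0 T j < ((br0 T)(\<beta> := l)) j" for j
    using tilesD(2)[OF ivs(4), of j] ba by auto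
  have "istep l \<beta> \<alpha> e (bl0 T) (br0 T) (tl0 T) (tr0 T)
      (bl0 (rauzy T)) (br0 (rauzy T)) (tl0 (rauzy T)) (tr0 (rauzy T))"
    unfolding istep_def
    using bounds_of_image[OF t tb] bounds_of_image_bot[OF b bb] e e1 ne lasts l ba l_bounds by auto
  then show ?thesis using that t b by blast
qed

lemma g_mono: "strict_mono_on (dom j) g"
proof (rule strict_mono_onI)
  fix x y assume x: "x \<in> dom j" and y: "y \<in> dom j" and xy: "x < y"
  have "x / l \<in> topI (rauzy T) j" "y / l \<in> topI (rauzy T) j" unfolding topI_rauzy using x y by auto
  note o = rauzy_orbit[OF this(1)] rauzy_orbit[OF this(2)]
  have e: "l * (x / l) = x" "l * (y / l) = y" using l_bounds by auto
  have gg: "l * gmap (rauzy T) (x / l) = g x" "l * gmap (rauzy T) (y / l) = g y"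
    using gmap_rauzy[of "x / l"] gmap_rauzy[of "y / l"] dom_bounds[OF x] dom_bounds[OF y] l_bounds by auto
  have m: "f u < f v" if "u \<in> topI T i" "v \<in> topI T i" "u < v" for u v i
    using that by (intro strict_mono_onD[OF f_top(1)]) (auto simp: top_mem)
  show "g x < g y"
    using o(3,4,7,8) m xy unfolding e gg by (cases "j = loser T") auto
qed

lemma pgiet_rauzy: "pgiet (rauzy T)"
proof -
  have eqs: "topI (rauzy T) j = {tl0 (rauzy T) j..<tr0 (rauzy T) j} \<and>
      botI (rauzy T) j = {bl0 (rauzy T) j..<br0 (rauzy T) j}" for j
  proof (cases "step_type T")
    case Top
    then obtain c where c: "istep l \<alpha> \<beta> c (tl0 T) (tr0 T) (bl0 T) (br0 T)
      (tl0 (rauzy T)) (tr0 (rauzy T)) (bl0 (rauzy T)) (br0 (rauzy T))"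
      "\<And>j. topI (rauzy T) j = (\<lambda>x. x / l) ` {tl0 T j..<((tr0 T)(\<alpha> := l)) j}"
      "\<And>j. botI (rauzy T) j = (\<lambda>x. x / l) ` {((bl0 T)(\<beta> := c)) j..<((br0 T)(\<alpha> := c, \<beta> := br0 T \<alpha>)) j}"
      by (rule rauzy_Top) (rule that)
    show ?thesis
      by (intro conjI; rule trans[OF c(2)] trans[OF c(3)], rule trans[OF image_divide_Ico[OF l_bounds(1)]])
        (simp_all only: istepD[OF c(1)] fun_upd_apply)
  next
    case Bottom
    then obtain c where c: "istep l \<beta> \<alpha> c (bl0 T) (br0 T) (tl0 T) (tr0 T)
      (bl0 (rauzy T)) (br0 (rauzy T)) (tl0 (rauzy T)) (tr0 (rauzy T))"
      "\<And>j. topI (rauzy T) j = (\<lambda>x. x / l) ` {((tl0 T)(\<alpha> := c)) j..<((tr0 T)(\<beta> := c, \<alpha> := tr0 T \<beta>)) j}"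
      "\<And>j. botI (rauzy T) j = (\<lambda>x. x / l) ` {bl0 T j..<((br0 T)(\<beta> := l)) j}"
      by (rule rauzy_Bottom) (rule that)
    show ?thesis
      by (intro conjI; rule trans[OF c(2)] trans[OF c(3)], rule trans[OF image_divide_Ico[OF l_bounds(1)]])
        (simp_all only: istepD[OF c(1)] fun_upd_apply)
  qed
  have ti: "tiles 1 (tl0 (rauzy T)) (tr0 (rauzy T)) \<and> tiles 1 (bl0 (rauzy T)) (br0 (rauzy T))"
  proof (cases "step_type T")
    case Top
    then obtain c where "istep l \<alpha> \<beta> c (tl0 T) (tr0 T) (bl0 T) (br0 T)
      (tl0 (rauzy T)) (tr0 (rauzy T)) (bl0 (rauzy T)) (br0 (rauzy T))" by (rule rauzy_Top) (rule that)
    note istep_tiles[OF this ivs(3,4)]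
    then show ?thesis by (rule conjI)
  next
    case Bottom
    then obtain c where "istep l \<beta> \<alpha> c (bl0 T) (br0 T) (tl0 T) (tr0 T)
      (bl0 (rauzy T)) (br0 (rauzy T)) (tl0 (rauzy T)) (tr0 (rauzy T))" by (rule rauzy_Bottom) (rule that)
    note istep_tiles[OF this ivs(4,3)]
    then show ?thesis by (rule conjI[rotated])
  qed
  have "strict_mono_on (topI (rauzy T) j) (gmap (rauzy T))" for j
  proof (rule strict_mono_onI)
    fix y z assume yz: "y \<in> topI (rauzy T) j" "z \<in> topI (rauzy T) j" "y < z"
    then obtain u v where uv: "u \<in> dom j" "y = u / l" "v \<in> dom j" "z = v / l"
      unfolding topI_rauzy by blast
    have "u < v" using uv yz(3) l_bounds by (simp add: divide_less_cancel)
    then have "g u / l < g v / l" using strict_mono_onD[OF g_mono uv(1,3)] l_bounds by (simp add: divide_strict_right_mono)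
    then show "gmap (rauzy T) y < gmap (rauzy T) z"
      using gmap_rauzy[of y] gmap_rauzy[of z] dom_bounds[OF uv(1)] dom_bounds[OF uv(3)] l_bounds uv by simp
  qed
  then show ?thesis unfolding pgiet_def interval_partition_iff_tiles using eqs ti by (intro conjI allI) blast+
qed

text \<open>The winner's interval is shortened but stays at the right end. Hence the winner is the
  same throughout a block of steps of one type.\<close>

lemma last_rauzy:
  "step_type T = Top \<Longrightarrow> top_last (rauzy T) = \<alpha>" "step_type T = Bottom \<Longrightarrow> bot_last (rauzy T) = \<beta>"
proof -
  assume "step_type T = Top"
  then obtain c where "istep l \<alpha> \<beta> c (tl0 T) (tr0 T) (bl0 T) (br0 T)
      (tl0 (rauzy T)) (tr0 (rauzy T)) (bl0 (rauzy T)) (br0 (rauzy T))" by (rule rauzy_Top) (rule that)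
  from istepD(10)[OF this, of \<alpha>] have "tr0 (rauzy T) \<alpha> = 1" using l_bounds by simp
  then show "top_last (rauzy T) = \<alpha>" by (rule pgiet_last(3)[OF pgiet_rauzy, symmetric])
next
  assume "step_type T = Bottom"
  then obtain c where "istep l \<beta> \<alpha> c (bl0 T) (br0 T) (tl0 T) (tr0 T)
      (bl0 (rauzy T)) (br0 (rauzy T)) (tl0 (rauzy T)) (tr0 (rauzy T))" by (rule rauzy_Bottom) (rule that)
  from istepD(10)[OF this, of \<beta>] have "br0 (rauzy T) \<beta> = 1" using l_bounds by simp
  then show "bot_last (rauzy T) = \<beta>" by (rule pgiet_last(4)[OF pgiet_rauzy, symmetric])
qed

end

subsection \<open>Irreducibility\<close>

definition left_of :: "('d \<Rightarrow> real) \<Rightarrow> ('d \<Rightarrow> real) \<Rightarrow> 'd set \<Rightarrow> real \<Rightarrow> bool" where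
  "left_of p q X x \<longleftrightarrow> (\<forall>j\<in>X. q j \<le> x) \<and> (\<forall>j. j \<notin> X \<longrightarrow> x \<le> p j)"

text \<open>Reducibility in terms of endpoints: a proper set of labels fills an initial segment of
  both partitions. Unlike an equality of prefixes of words, this can be followed through a step by
  arithmetic on endpoints.\<close>

definition splits :: "('d \<Rightarrow> real) \<Rightarrow> ('d \<Rightarrow> real) \<Rightarrow> ('d \<Rightarrow> real) \<Rightarrow> ('d \<Rightarrow> real) \<Rightarrow> bool" where
  "splits p q r s \<longleftrightarrow>
     (\<exists>X x y. X \<noteq> {} \<and> X \<noteq> UNIV \<and> left_of p q X x \<and> left_of r s X y)"

lemma splits_commute: "splits p q r s \<longleftrightarrow> splits r s p q"
  unfolding splits_def by blast

text \<open>A splitting set X of the new partitions omits \<alpha>, which is last in the winner's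
  partition, and then \<beta>, which lies to the right of \<alpha> in the other one. The step
  changes the order of no other labels, so X already splits the old partitions.\<close>

lemma istep_splits:
  assumes st: "istep l \<alpha> \<beta> c p q r s p' q' r' s'" and t: "tiles 1 p q" "tiles 1 r s"
    and sp: "splits p' q' r' s'"
  shows "splits p q r s"
proof -
  note i = istepD[OF st]
  have l: "l > 0" using i(5) tilesD(1)[OF t(1), of \<alpha>] by linarith
  note t' = istep_tiles[OF st t]
  obtain X x y where X: "X \<noteq> {}" "X \<noteq> UNIV" and pq: "left_of p' q' X x" and rs: "left_of r' s' X y"
    using sp unfolding splits_def by blast
  have "\<alpha> \<notin> X"
  proof
    assume "\<alpha> \<in> X"
    then have "1 \<le> x" using pq i(10)[of \<alpha>] l unfolding left_of_def by force
    obtain j where "j \<notin> X" using X by blast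
    then have "x \<le> p' j" using pq unfolding left_of_def by blast
    then show False using tilesD(2,3)[OF t'(1), of j] \<open>1 \<le> x\<close> by linarith
  qed
  then have yr: "y \<le> r' \<alpha>" using rs unfolding left_of_def by blast
  have s\<alpha>: "s' \<beta> = s \<alpha> / l" "r' \<alpha> = r \<alpha> / l" "r' \<beta> = c / l" using i(11,12) i(1) by auto
  have "\<beta> \<notin> X"
  proof
    assume "\<beta> \<in> X"
    then have "s \<alpha> / l \<le> y" using rs s\<alpha> unfolding left_of_def by force
    then have "s \<alpha> / l \<le> r \<alpha> / l" using yr s\<alpha> by simp
    then show False using i(7,8) l by (simp add: divide_le_cancel)
  qed
  have "left_of p q X (x * l)"
    unfolding left_of_def
  proof (intro conjI ballI allI impI)
    fix j assume "j \<in> X"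
    then have "q' j \<le> x" "j \<noteq> \<alpha>" using pq \<open>\<alpha> \<notin> X\<close> unfolding left_of_def by auto
    then show "q j \<le> x * l" using i(10)[of j] l by (simp add: divide_le_eq)
  next
    fix j assume "j \<notin> X"
    then have "x \<le> p' j" using pq unfolding left_of_def by auto
    then show "x * l \<le> p j" using i(9)[of j] l by (simp add: le_divide_eq)
  qed
  moreover have "left_of r s X (y * l)"
    unfolding left_of_def
  proof (intro conjI ballI allI impI)
    fix j assume "j \<in> X"
    then have "s' j \<le> y" "j \<noteq> \<alpha>" "j \<noteq> \<beta>" using rs \<open>\<alpha> \<notin> X\<close> \<open>\<beta> \<notin> X\<close> unfolding left_of_def by auto
    then show "s j \<le> y * l" using i(12)[of j] l by (simp add: divide_le_eq)
  next
    fix j assume j: "j \<notin> X"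
    show "y * l \<le> r j"
    proof (cases "j = \<beta>")
      case True
      have "y * l \<le> r \<alpha>" using yr s\<alpha> l by (simp add: le_divide_eq)
      moreover have "r \<alpha> < l" using tilesD(2,3)[OF t'(2), of \<alpha>] s\<alpha>(2) l by (simp add: divide_less_eq less_le_trans)
      ultimately show ?thesis using True i(4) by simp
    next
      case False
      have "y \<le> r' j" using rs j unfolding left_of_def by auto
      then show ?thesis using i(11)[of j] False l by (simp add: le_divide_eq)
    qed
  qed
  ultimately show ?thesis unfolding splits_def using X by blast
qed

lemma prefix_of_word:
  fixes p q :: "'d::finite \<Rightarrow> real"
  assumes "tiles 1 p q" "sorted_word p q w" "left_of p q X x"
  shows "set (take (card X) w) = X"
proof -
  have d: "distinct w" and s: "set w = UNIV"
    and le: "\<And>i j. i < j \<Longrightarrow> j < length w \<Longrightarrow> q (w ! i) \<le> p (w ! j)"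
    using assms(2) unfolding sorted_word_def sorted_wrt_iff_nth_less by auto
  have down: "w ! i \<in> X" if "i < j" "j < length w" "w ! j \<in> X" for i j
  proof (rule ccontr)
    assume "w ! i \<notin> X"
    then have "x \<le> p (w ! i)" "q (w ! j) \<le> x" using assms(3) that(3) unfolding left_of_def by auto
    then show False using le[OF that(1,2)] tilesD(2)[OF assms(1), of "w ! i"]
      tilesD(2)[OF assms(1), of "w ! j"] by linarith
  qed
  define k where "k = (LEAST k. k \<ge> length w \<or> w ! k \<notin> X)"
  have k: "k \<ge> length w \<or> w ! k \<notin> X" unfolding k_def by (rule LeastI[of _ "length w"]) simp
  have kl: "k \<le> length w" unfolding k_def by (rule Least_le) simp
  have below: "w ! i \<in> X" if "i < k" for i using not_less_Least[of i] that unfolding k_def by blast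
  have "set (take k w) = X"
  proof (intro equalityI subsetI)
    fix z assume "z \<in> set (take k w)"
    then show "z \<in> X" using below kl by (auto simp: in_set_conv_nth)
  next
    fix z assume z: "z \<in> X"
    obtain i where i: "i < length w" "w ! i = z" using s by (metis UNIV_I in_set_conv_nth)
    have "i < k"
    proof (rule ccontr)
      assume "\<not> i < k"
      then show False using k down[of k i] i z by (cases "i = k") auto
    qed
    then show "z \<in> set (take k w)" using i by (auto simp: in_set_conv_nth)
  qed
  moreover have "card (set (take k w)) = k" using d kl by (simp add: distinct_card)
  ultimately show ?thesis by metis
qed

lemma irreducible_not_splits:
  fixes T :: "'d::finite giet"
  assumes "pgiet T" "irreducible_datum (datum T)"
  shows "\<not> splits (tl0 T) (tr0 T) (bl0 T) (br0 T)"
proof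
  assume "splits (tl0 T) (tr0 T) (bl0 T) (br0 T)"
  then obtain X x y where X: "X \<noteq> {}" "X \<noteq> UNIV" and l: "left_of (tl0 T) (tr0 T) X x" "left_of (bl0 T) (br0 T) X y"
    unfolding splits_def by blast
  note i = pgiet_intervals(3,4)[OF assms(1)]
  have wt: "sorted_word (tl0 T) (tr0 T) (word_of (topI T))"
    and wb: "sorted_word (bl0 T) (br0 T) (word_of (botI T))"
    using assms unfolding pgiet_def by (blast intro: word_of_sorted)+
  have "set (take (card X) (fst (datum T))) = set (take (card X) (snd (datum T)))"
    unfolding datum_def fst_conv snd_conv prefix_of_word[OF i(1) wt l(1)] prefix_of_word[OF i(2) wb l(2)] ..
  moreover have "1 \<le> card X" using X by (simp add: Suc_le_eq card_gt_0_iff)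
  moreover have "card X < CARD('d)" using X by (intro psubset_card_mono) auto
  ultimately show False using assms(2) unfolding irreducible_datum_def by blast
qed

text \<open>If both last labels agreed, all the other labels would form a splitting set; it is
  nonempty because there are at least two labels.\<close>

lemma not_splits_last_ne:
  fixes T :: "'d::finite giet"
  assumes "pgiet T" "2 \<le> CARD('d)" "\<not> splits (tl0 T) (tr0 T) (bl0 T) (br0 T)"
  shows "top_last T \<noteq> bot_last T"
proof
  assume eq: "top_last T = bot_last T"
  note i = pgiet_intervals(3,4)[OF assms(1)] and la = pgiet_last(1,2)[OF assms(1)]
  let ?X = "UNIV - {top_last T}"
  have "left_of p q ?X (p (top_last T))" if "tiles 1 p q" "q (top_last T) = 1" for p q
  proof -
    have "q j \<le> p (top_last T)" if "j \<noteq> top_last T" for j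
      using tilesD(4)[OF \<open>tiles 1 p q\<close> that] tilesD(2,3)[OF \<open>tiles 1 p q\<close>, of j] \<open>q (top_last T) = 1\<close> by auto
    then show ?thesis unfolding left_of_def by auto
  qed
  from this[OF i(1) la(1)] this[OF i(2) la(2)[folded eq]]
  have lo: "left_of (tl0 T) (tr0 T) ?X (tl0 T (top_last T))" "left_of (bl0 T) (br0 T) ?X (bl0 T (top_last T))"
    by auto
  have "card ?X \<ge> 1" using assms(2) by (simp add: card_Diff_singleton)
  then have "?X \<noteq> {}" by (metis card.empty not_one_le_zero)
  moreover have "?X \<noteq> UNIV" by blast
  ultimately have "splits (tl0 T) (tr0 T) (bl0 T) (br0 T)"
    unfolding splits_def using lo by (intro exI conjI)
  then show False using assms(3) by simp
qed

lemma (in rauzy_step) not_splits_rauzy: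
  assumes "\<not> splits (tl0 T) (tr0 T) (bl0 T) (br0 T)"
  shows "\<not> splits (tl0 (rauzy T)) (tr0 (rauzy T)) (bl0 (rauzy T)) (br0 (rauzy T))"
proof (cases "step_type T")
  case Top
  then obtain c where "istep l \<alpha> \<beta> c (tl0 T) (tr0 T) (bl0 T) (br0 T)
      (tl0 (rauzy T)) (tr0 (rauzy T)) (bl0 (rauzy T)) (br0 (rauzy T))" by (rule rauzy_Top) (rule that)
  from istep_splits[OF this ivs(3,4)] show ?thesis using assms by blast
next
  case Bottom
  then obtain c where "istep l \<beta> \<alpha> c (bl0 T) (br0 T) (tl0 T) (tr0 T)
      (bl0 (rauzy T)) (br0 (rauzy T)) (tl0 (rauzy T)) (tr0 (rauzy T))" by (rule rauzy_Bottom) (rule that)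
  from istep_splits[OF this ivs(4,3)] show ?thesis using assms splits_commute by blast
qed

subsection \<open>Coding of first returns\<close>

abbreviation "tlast \<gamma> n \<equiv> last (fst (fst (\<gamma> n)))"
abbreviation "blast \<gamma> n \<equiv> last (snd (fst (\<gamma> n)))"

definition losing :: "'d rotation_number \<Rightarrow> nat \<Rightarrow> 'd" where
  "losing \<gamma> n = (case snd (\<gamma> n) of Top \<Rightarrow> blast \<gamma> n | Bottom \<Rightarrow> tlast \<gamma> n)"

definition shift :: "'d rotation_number \<Rightarrow> nat \<Rightarrow> 'd rotation_number" where
  "shift \<gamma> m = (\<lambda>n. \<gamma> (m + n))"

text \<open>The last condition concerns \<gamma> alone. It is derived once, from the irreducibility
  of T, and then holds for every map with the same rotation number, in particular for the affine and
  the standard one.\<close>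

definition follows :: "'d::finite giet \<Rightarrow> 'd rotation_number \<Rightarrow> bool" where
  "follows T \<gamma> \<longleftrightarrow> pgiet T \<and> has_rotation_number T \<gamma> \<and> (\<forall>n. tlast \<gamma> n \<noteq> blast \<gamma> n)"

lemma rauzy_pow_add: "(rauzy ^^ (m + n)) T = (rauzy ^^ n) ((rauzy ^^ m) T)"
  by (simp add: funpow_add add.commute[of m n])

lemma has_rotation_number_shift:
  "has_rotation_number T \<gamma> \<Longrightarrow> has_rotation_number ((rauzy ^^ m) T) (shift \<gamma> m)"
  unfolding has_rotation_number_def infinitely_renormalizable_def shift_def rauzy_pow_add[symmetric] by blast

lemma follows_data:
  assumes "follows T \<gamma>"
  shows "top_last ((rauzy ^^ n) T) = tlast \<gamma> n" "bot_last ((rauzy ^^ n) T) = blast \<gamma> n"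
    "step_type ((rauzy ^^ n) T) = snd (\<gamma> n)" "loser ((rauzy ^^ n) T) = losing \<gamma> n"
    "renormalizable ((rauzy ^^ n) T)" "tlast \<gamma> n \<noteq> blast \<gamma> n"
proof -
  have g: "\<gamma> n = (datum ((rauzy ^^ n) T), step_type ((rauzy ^^ n) T))"
    and r: "renormalizable ((rauzy ^^ n) T)" and ne: "tlast \<gamma> n \<noteq> blast \<gamma> n"
    using assms unfolding follows_def has_rotation_number_def infinitely_renormalizable_def by blast+
  show "top_last ((rauzy ^^ n) T) = tlast \<gamma> n" "bot_last ((rauzy ^^ n) T) = blast \<gamma> n"
    "step_type ((rauzy ^^ n) T) = snd (\<gamma> n)" "loser ((rauzy ^^ n) T) = losing \<gamma> n"
    unfolding loser_def losing_def top_last_def bot_last_def g by (auto split: side.split)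
  show "renormalizable ((rauzy ^^ n) T)" "tlast \<gamma> n \<noteq> blast \<gamma> n" using r ne .
qed

lemma follows_pgiet:
  assumes "follows T \<gamma>"
  shows "pgiet ((rauzy ^^ n) T)"
proof (induction n)
  case 0
  then show ?case using assms unfolding follows_def by simp
next
  case (Suc n)
  interpret rauzy_step "(rauzy ^^ n) T"
    using follows_data[OF assms, of n] Suc by unfold_locales auto
  show ?case using pgiet_rauzy by simp
qed

lemma follows_step:
  assumes "follows T \<gamma>"
  shows "rauzy_step ((rauzy ^^ n) T)"
  using follows_data[OF assms, of n] follows_pgiet[OF assms] by unfold_locales auto

lemma follows_shift:
  assumes "follows T \<gamma>"
  shows "follows ((rauzy ^^ m) T) (shift \<gamma> m)"
  using follows_pgiet[OF assms] has_rotation_number_shift[of T \<gamma> m] assms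
  unfolding follows_def by (auto simp: shift_def)

lemma follows_of_irreducible:
  fixes T :: "'d::finite giet"
  assumes "pgiet T" "2 \<le> CARD('d)" "irreducible_datum (datum T)" "has_rotation_number T \<gamma>"
  shows "follows T \<gamma>"
proof -
  have ren: "renormalizable ((rauzy ^^ n) T)" for n
    using assms(4) unfolding has_rotation_number_def infinitely_renormalizable_def by blast
  have *: "pgiet ((rauzy ^^ n) T) \<and> \<not> splits (tl0 ((rauzy ^^ n) T)) (tr0 ((rauzy ^^ n) T))
    (bl0 ((rauzy ^^ n) T)) (br0 ((rauzy ^^ n) T))" for n
  proof (induction n)
    case 0
    then show ?case using irreducible_not_splits[OF assms(1,3)] assms(1) by simp
  next
    case (Suc n)
    interpret rauzy_step "(rauzy ^^ n) T"
      using not_splits_last_ne[OF _ assms(2)] Suc ren by unfold_locales auto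
    show ?case using pgiet_rauzy not_splits_rauzy Suc by simp
  qed
  have "tlast \<gamma> n \<noteq> blast \<gamma> n" for n
  proof -
    have g: "\<gamma> n = (datum ((rauzy ^^ n) T), step_type ((rauzy ^^ n) T))"
      using assms(4) unfolding has_rotation_number_def by blast
    show ?thesis using not_splits_last_ne[OF _ assms(2), of "(rauzy ^^ n) T"] *[of n]
      unfolding g top_last_def bot_last_def by simp
  qed
  then show ?thesis unfolding follows_def using assms by blast
qed

text \<open>
  In a step of either type, the points with return time 2 visit the top interval of the last bottom
  label, and then the last top interval.
\<close>

primrec cword :: "'d rotation_number \<Rightarrow> nat \<Rightarrow> 'd \<Rightarrow> 'd list" where
  "cword \<gamma> 0 j = [j]"
| "cword \<gamma> (Suc n) j = (if j = losing \<gamma> n then cword \<gamma> n (blast \<gamma> n) @ cword \<gamma> n (tlast \<gamma> n)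
     else cword \<gamma> n j)"

definition rlen :: "'d giet \<Rightarrow> nat \<Rightarrow> real" where
  "rlen T n = (\<Prod>k<n. step_length ((rauzy ^^ k) T))"

lemma rlen_Suc: "rlen T (Suc n) = rlen T n * step_length ((rauzy ^^ n) T)" and rlen_0: "rlen T 0 = 1"
  unfolding rlen_def by simp_all

lemma rlen_add: "rlen T (m + n) = rlen T m * rlen ((rauzy ^^ m) T) n"
  by (induction n) (simp_all add: rlen_0 rlen_Suc rauzy_pow_add mult.assoc)

lemma rlen_bounds:
  assumes "follows T \<gamma>"
  shows "0 < rlen T n" "rlen T n \<le> 1"
proof -
  have s: "0 < step_length ((rauzy ^^ k) T)" "step_length ((rauzy ^^ k) T) < 1" for k
    using rauzy_step.l_bounds[OF follows_step[OF assms]] by auto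
  show "0 < rlen T n" unfolding rlen_def using s by (intro prod_pos) auto
  show "rlen T n \<le> 1" unfolding rlen_def using s by (intro prod_le_1) (auto intro: less_imp_le)
qed

lemma rlen_antimono: "follows T \<gamma> \<Longrightarrow> m \<le> n \<Longrightarrow> rlen T n \<le> rlen T m"
  using rlen_add[of T m "n - m"] rlen_bounds[of T \<gamma> m] rlen_bounds(2)[OF follows_shift, of T \<gamma> m "n - m"]
  by (simp add: mult_left_le)

lemma cword_ne: "cword \<gamma> n j \<noteq> []"
  by (induction n arbitrary: j) auto

lemma cword_add: "cword \<gamma> (m + k) j = concat (map (cword \<gamma> m) (cword (shift \<gamma> m) k j))"
proof (induction k arbitrary: j)
  case (Suc k)
  have "losing (shift \<gamma> m) k = losing \<gamma> (m + k)" unfolding losing_def shift_def ..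
  then show ?case using Suc by (simp add: shift_def)
qed simp

lemma gmap_range:
  assumes "follows T \<gamma>" "y \<in> {0..<1}"
  shows "gmap ((rauzy ^^ n) T) y \<in> {0..<1}" "(gmap ((rauzy ^^ n) T) ^^ k) y \<in> {0..<1}"
proof -
  have b: "gmap ((rauzy ^^ n) T) z \<in> {0..<1}" if "z \<in> {0..<1}" for z
    using bij_betwE[OF pgiet_bij[OF follows_pgiet[OF assms(1), of n]]] that by blast
  show "gmap ((rauzy ^^ n) T) y \<in> {0..<1}" using b assms by blast
  show "(gmap ((rauzy ^^ n) T) ^^ k) y \<in> {0..<1}" by (induction k) (use b assms in auto)
qed

text \<open>Induction over the steps: by \<open>rauzy_orbit\<close> a point with the loser's label
  climbs the tower of the last bottom label and then that of the last top label. The lower bound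
  \<open>rlen T n\<close> for the intermediate points is what makes the length of the word the first
  return time.\<close>

lemma orbit_coding:
  assumes "follows T \<gamma>" "y \<in> topI ((rauzy ^^ n) T) j"
  defines "x \<equiv> rlen T n * y" and "w \<equiv> cword \<gamma> n j"
  shows "(\<forall>k<length w. (gmap T ^^ k) x \<in> topI T (w ! k)) \<and>
    (\<forall>k. 0 < k \<and> k < length w \<longrightarrow> rlen T n \<le> (gmap T ^^ k) x) \<and>
    (gmap T ^^ length w) x = rlen T n * gmap ((rauzy ^^ n) T) y"
  using assms(2) unfolding x_def w_def
proof (induction n arbitrary: y j)
  case 0
  then show ?case by (simp add: rlen_0)
next
  case (Suc n)
  let ?R = "(rauzy ^^ n) T"
  let ?l = "step_length ?R"
  interpret rauzy_step ?R using follows_step[OF assms(1)] .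
  note d = follows_data[OF assms(1), of n]
  have rl: "rlen T (Suc n) = rlen T n * ?l" by (rule rlen_Suc)
  have y: "y \<in> topI (rauzy ?R) j" using Suc.prems by simp
  note o = rauzy_orbit[OF y]
  have le: "rlen T (Suc n) \<le> rlen T n" using rlen_antimono[OF assms(1)] by simp
  have ass: "rlen T (Suc n) * z = rlen T n * (?l * z)" for z unfolding rl by simp
  show ?case
  proof (cases "j = losing \<gamma> n")
    case False
    then have o3: "?l * y \<in> topI ?R j" "?l * gmap (rauzy ?R) y = gmap ?R (?l * y)"
      using o(3) d(4) by auto
    from Suc.IH[OF o3(1)] show ?thesis
      using False le unfolding ass by (auto simp: o3(2)[symmetric] intro: order_trans[OF le])
  next
    case True
    have o4: "?l * y \<in> topI ?R (blast \<gamma> n)" "gmap ?R (?l * y) \<in> topI ?R (tlast \<gamma> n)"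
      "?l \<le> gmap ?R (?l * y)" "?l * gmap (rauzy ?R) y = gmap ?R (gmap ?R (?l * y))"
      using o(4) d True by auto
    define u where "u = cword \<gamma> n (blast \<gamma> n)"
    define v where "v = cword \<gamma> n (tlast \<gamma> n)"
    define x where "x = rlen T (Suc n) * y"
    define x2 where "x2 = rlen T n * gmap ?R (?l * y)"
    note I1 = Suc.IH[OF o4(1), folded ass u_def x_def x2_def] and I2 = Suc.IH[OF o4(2), folded v_def x2_def]
    have w: "cword \<gamma> (Suc n) j = u @ v" using True unfolding u_def v_def by simp
    have shift: "(gmap T ^^ (length u + k)) x = (gmap T ^^ k) x2" for k
      using I1 by (simp add: funpow_add add.commute[of "length u" k])
    have x2: "rlen T (Suc n) \<le> x2" unfolding x2_def rl
      using o4(3) rlen_bounds(1)[OF assms(1), of n] by (intro mult_left_mono) auto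
    have "(gmap T ^^ k) x \<in> topI T ((u @ v) ! k)" if "k < length (u @ v)" for k
    proof (cases "k < length u")
      case True
      then show ?thesis using I1 by (simp add: nth_append)
    next
      case False
      then show ?thesis using shift[of "k - length u"] I2 that by (simp add: nth_append)
    qed
    moreover have "rlen T (Suc n) \<le> (gmap T ^^ k) x" if "0 < k" "k < length (u @ v)" for k
    proof -
      consider "k < length u" | "k = length u" | "k > length u" by linarith
      then show ?thesis
      proof cases
        case 1
        then have "rlen T n \<le> (gmap T ^^ k) x" using I1 that by blast
        then show ?thesis using le by linarith
      next
        case 2
        then show ?thesis using shift[of 0] x2 by simp
      next
        case 3
        then have "rlen T n \<le> (gmap T ^^ k) x" using shift[of "k - length u"] I2 that by simp
        then show ?thesis using le by linarith
      qed
    qed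
    moreover have "(gmap T ^^ length (u @ v)) x = rlen T (Suc n) * gmap (rauzy ?R) y"
      using shift[of "length v"] I2 o4(4) unfolding ass by simp
    ultimately show ?thesis unfolding w x_def by simp
  qed
qed

lemma ret_coding:
  assumes "follows T \<gamma>" "y \<in> topI ((rauzy ^^ n) T) j"
  shows "ret_time (gmap T) {0..<rlen T n} (rlen T n * y) = length (cword \<gamma> n j)"
    "ret_map (gmap T) {0..<rlen T n} (rlen T n * y) = rlen T n * gmap ((rauzy ^^ n) T) y"
proof -
  note o = orbit_coding[OF assms]
  let ?w = "cword \<gamma> n j" and ?x = "rlen T n * y"
  have "y \<in> {0..<1}" using pgiet_maps(3)[OF follows_pgiet[OF assms(1)] assms(2)] .
  then have g: "gmap ((rauzy ^^ n) T) y \<in> {0..<1}" by (rule gmap_range(1)[OF assms(1)])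
  show 1: "ret_time (gmap T) {0..<rlen T n} ?x = length ?w"
    unfolding ret_time_def
  proof (rule Least_equality)
    show "1 \<le> length ?w \<and> (gmap T ^^ length ?w) ?x \<in> {0..<rlen T n}"
      using o g rlen_bounds(1)[OF assms(1), of n] cword_ne[of \<gamma> n j]
      by (auto simp: Suc_le_eq)
  next
    fix k assume "1 \<le> k \<and> (gmap T ^^ k) ?x \<in> {0..<rlen T n}"
    then show "length ?w \<le> k" using o by (metis atLeastLessThan_iff less_eq_Suc_le linorder_not_le One_nat_def)
  qed
  show "ret_map (gmap T) {0..<rlen T n} ?x = rlen T n * gmap ((rauzy ^^ n) T) y"
    unfolding ret_map_def 1 using o by blast
qed

text \<open>Translates between two clocks: i returns to the base of level m take as many iterates of
  T as the total length of the level-m words of the first i coarse letters.\<close>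

lemma sync_coding:
  assumes "follows T \<gamma>" "y \<in> topI ((rauzy ^^ (m + k)) T) j"
  defines "w \<equiv> cword (shift \<gamma> m) k j" and "z \<equiv> rlen ((rauzy ^^ m) T) k * y"
  assumes "i \<le> length w"
  shows "(gmap T ^^ length (concat (map (cword \<gamma> m) (take i w)))) (rlen T (m + k) * y) =
      rlen T m * (gmap ((rauzy ^^ m) T) ^^ i) z"
    "i < length w \<Longrightarrow> (gmap ((rauzy ^^ m) T) ^^ i) z \<in> topI ((rauzy ^^ m) T) (w ! i)"
proof -
  have y: "y \<in> topI ((rauzy ^^ k) ((rauzy ^^ m) T)) j" using assms(2) unfolding rauzy_pow_add .
  note o = orbit_coding[OF follows_shift[OF assms(1)] y, folded w_def z_def]
  show *: "i < length w \<Longrightarrow> (gmap ((rauzy ^^ m) T) ^^ i) z \<in> topI ((rauzy ^^ m) T) (w ! i)" for i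
    using o by blast
  show "(gmap T ^^ length (concat (map (cword \<gamma> m) (take i w)))) (rlen T (m + k) * y) =
      rlen T m * (gmap ((rauzy ^^ m) T) ^^ i) z"
    using assms(5)
  proof (induction i)
    case 0
    then show ?case unfolding z_def rlen_add by simp
  next
    case (Suc i)
    then have i: "i < length w" by simp
    show ?case
      using Suc.IH i orbit_coding[OF assms(1) *[OF i]]
      by (simp add: take_Suc_conv_app_nth funpow_add add.commute)
  qed
qed

subsection \<open>The Zorich cocycle\<close>

text \<open>The Zorich cocycle with elementary steps as time. As a matrix of letter counts it
  depends on \<gamma> only, which lets estimates for one map be used for another.\<close>

definition Qw :: "'d::finite rotation_number \<Rightarrow> nat \<Rightarrow> nat \<Rightarrow> real ^ 'd ^ 'd" where
  "Qw \<gamma> a b = (\<chi> i j. real (count_list (cword (shift \<gamma> a) (b - a) i) j))"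

primrec ztime :: "'d rotation_number \<Rightarrow> nat \<Rightarrow> nat" where
  "ztime \<gamma> 0 = 0"
| "ztime \<gamma> (Suc n) = (LEAST m. ztime \<gamma> n < m \<and> snd (\<gamma> m) \<noteq> snd (\<gamma> (ztime \<gamma> n)))"

lemma zorich_time_eq:
  assumes "has_rotation_number T \<gamma>"
  shows "zorich_time T n = ztime \<gamma> n"
proof -
  have "step_type ((rauzy ^^ m) T) = snd (\<gamma> m)" for m
    using assms unfolding has_rotation_number_def by simp
  then show ?thesis by (induction n) simp_all
qed

text \<open>If the type were eventually constant, so would be the winner, whereas every label wins
  infinitely often and there are at least two labels. Hence the minimum in \<open>ztime\<close> is
  attained.\<close>

lemma type_change:
  assumes "follows T \<gamma>" "irrational \<gamma>"
  shows "\<exists>m>a. snd (\<gamma> m) \<noteq> snd (\<gamma> a)"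
proof (rule ccontr)
  assume "\<not> ?thesis"
  then have c: "snd (\<gamma> m) = snd (\<gamma> a)" if "m \<ge> a" for m using that by (metis le_neq_implies_less)
  obtain i where w: "winner (\<gamma> m) = i" if "m \<ge> a" for m
  proof (cases "snd (\<gamma> a)")
    case Top
    have *: "tlast \<gamma> (a + k) = tlast \<gamma> a" for k
    proof (induction k)
      case (Suc k)
      interpret rauzy_step "(rauzy ^^ (a + k)) T" using follows_step[OF assms(1)] .
      have "step_type ((rauzy ^^ (a + k)) T) = Top" using follows_data(3)[OF assms(1), of "a + k"] c Top by simp
      then have "top_last ((rauzy ^^ (a + Suc k)) T) = top_last ((rauzy ^^ (a + k)) T)"
        using last_rauzy(1) by simp
      then show ?case using Suc follows_data(1)[OF assms(1)] by metis
    qed simp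
    have "winner (\<gamma> m) = tlast \<gamma> a" if "m \<ge> a" for m
    proof -
      have "\<gamma> m = ((fst (fst (\<gamma> m)), snd (fst (\<gamma> m))), Top)"
        using c[OF that] Top by (metis prod.collapse)
      then have "winner (\<gamma> m) = tlast \<gamma> m" by (metis winner.simps(1))
      then show ?thesis using *[of "m - a"] that by simp
    qed
    then show ?thesis by (rule that)
  next
    case Bottom
    have *: "blast \<gamma> (a + k) = blast \<gamma> a" for k
    proof (induction k)
      case (Suc k)
      interpret rauzy_step "(rauzy ^^ (a + k)) T" using follows_step[OF assms(1)] .
      have "step_type ((rauzy ^^ (a + k)) T) = Bottom" using follows_data(3)[OF assms(1), of "a + k"] c Bottom by simp
      then have "bot_last ((rauzy ^^ (a + Suc k)) T) = bot_last ((rauzy ^^ (a + k)) T)"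
        using last_rauzy(2) by simp
      then show ?case using Suc follows_data(2)[OF assms(1)] by metis
    qed simp
    have "winner (\<gamma> m) = blast \<gamma> a" if "m \<ge> a" for m
    proof -
      have "\<gamma> m = ((fst (fst (\<gamma> m)), snd (fst (\<gamma> m))), Bottom)"
        using c[OF that] Bottom by (metis prod.collapse)
      then have "winner (\<gamma> m) = blast \<gamma> m" by (metis winner.simps(2))
      then show ?thesis using *[of "m - a"] that by simp
    qed
    then show ?thesis by (rule that)
  qed
  obtain j where "j \<noteq> i" using follows_data(6)[OF assms(1), of a] by metis
  then have "{n. winner (\<gamma> n) = j} \<subseteq> {..<a}" using w by (auto simp: not_le[symmetric])
  then show False using assms(2) finite_subset unfolding irrational_def by blast
qed


lemma ztime_Suc:
  assumes "follows T \<gamma>" "irrational \<gamma>"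
  shows "ztime \<gamma> n < ztime \<gamma> (Suc n)"
  using LeastI_ex[OF type_change[OF assms, of "ztime \<gamma> n"]] by simp

lemma ztime_strict_mono: "follows T \<gamma> \<Longrightarrow> irrational \<gamma> \<Longrightarrow> strict_mono (ztime \<gamma>)"
  using ztime_Suc by (auto simp: strict_mono_Suc_iff)

lemma base_length_eq:
  assumes "has_rotation_number T \<gamma>"
  shows "base_length T n = rlen T (ztime \<gamma> n)"
  unfolding base_length_def rlen_def zorich_time_eq[OF assms] ..

lemma base_eq: "has_rotation_number T \<gamma> \<Longrightarrow> base T n = {0..<rlen T (ztime \<gamma> n)}"
  unfolding base_def by (simp add: base_length_eq)

lemma piece_eq:
  "has_rotation_number T \<gamma> \<Longrightarrow>
    piece T n j = (\<lambda>y. rlen T (ztime \<gamma> n) * y) ` topI ((rauzy ^^ ztime \<gamma> n) T) j"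
  unfolding piece_def zorich_def by (simp add: base_length_eq zorich_time_eq)

lemma followsD: "follows T \<gamma> \<Longrightarrow> has_rotation_number T \<gamma>"
  unfolding follows_def by simp

lemma piece_ne:
  assumes "follows T \<gamma>"
  shows "piece T n j \<noteq> {}"
  unfolding piece_eq[OF followsD[OF assms]] using pgiet_maps(8)[OF follows_pgiet[OF assms]] by simp

lemma height_eq:
  assumes "follows T \<gamma>"
  shows "height T n j = length (cword \<gamma> (ztime \<gamma> n) j)"
proof -
  have "(SOME x. x \<in> piece T n j) \<in> piece T n j" using piece_ne[OF assms] by (simp add: some_in_eq)
  then show ?thesis
    unfolding height_def base_eq[OF followsD[OF assms]]
    by (subst (asm) (2) piece_eq[OF followsD[OF assms]]) (auto simp: ret_coding(1)[OF assms])
qed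

lemma Q_eq_Qw:
  fixes T :: "'d::finite giet"
  assumes f: "follows T \<gamma>" and "irrational \<gamma>" and mn: "m \<le> n"
  shows "Q T m n = Qw \<gamma> (ztime \<gamma> m) (ztime \<gamma> n)"
proof -
  note h = followsD[OF f]
  define a k where "a = ztime \<gamma> m" and "k = ztime \<gamma> n - ztime \<gamma> m"
  have ak: "ztime \<gamma> n = a + k"
    using mn ztime_strict_mono[OF f assms(2)] unfolding a_def k_def by (simp add: strict_mono_less_eq)
  let ?R = "(rauzy ^^ a) T"
  have fR: "follows ?R (shift \<gamma> a)" using follows_shift[OF f] .
  have ra: "0 < rlen T a" using rlen_bounds[OF f] by blast
  \<comment> \<open>Up to scaling, the return map to the base of level m is the renormalized map, so
    the visits are read off its coding by the shifted rotation number.\<close>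
  have ret: "(return_map T m ^^ i) (rlen T a * y) = rlen T a * (gmap ?R ^^ i) y" if "y \<in> {0..<1}" for y i
  proof (induction i)
    case (Suc i)
    let ?y = "(gmap ?R ^^ i) y"
    have "?y \<in> {0..<1}" using gmap_range(2)[OF f that] .
    then obtain j where "?y \<in> topI ?R j" using pgiet_maps(2)[OF follows_pgiet[OF f]] by blast
    from ret_coding(2)[OF f this] show ?case
      using Suc unfolding return_map_def base_eq[OF h] a_def[symmetric] by simp
  qed simp
  have "Q T m n $ i $ j = Qw \<gamma> (ztime \<gamma> m) (ztime \<gamma> n) $ i $ j" for i j
  proof -
    let ?w = "cword (shift \<gamma> a) k i"
    define x where "x = (SOME x. x \<in> piece T n i)"
    have "x \<in> piece T n i" unfolding x_def using piece_ne[OF f] by (simp add: some_in_eq)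
    then obtain y where y: "y \<in> topI ((rauzy ^^ (a + k)) T) i" "x = rlen T (a + k) * y"
      unfolding piece_eq[OF h] ak by blast
    define z where "z = rlen ?R k * y"
    have xz: "x = rlen T a * z" unfolding y z_def rlen_add by simp
    have y': "y \<in> topI ((rauzy ^^ k) ?R) i" using y(1) unfolding rauzy_pow_add .
    note o = orbit_coding[OF fR y', folded z_def] and rt = ret_coding(1)[OF fR y', folded z_def]
    have yb: "0 \<le> y" "y < 1" using pgiet_maps(3)[OF follows_pgiet[OF fR] y'] by auto
    have "rlen ?R k * y < 1" using rlen_bounds[OF fR, of k] yb mult_le_less_imp_less[of "rlen ?R k" 1 y 1] by simp
    then have zb: "z \<in> {0..<1}" using rlen_bounds(1)[OF fR, of k] yb unfolding z_def by simp
    have mem: "rlen T a * u \<in> base T n \<longleftrightarrow> u \<in> {0..<rlen ?R k}" for u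
      unfolding base_eq[OF h] ak rlen_add using ra by (auto simp: zero_le_mult_iff mult_less_cancel_left)
    have rt': "ret_time (return_map T m) (base T n) x = length ?w"
      unfolding ret_time_def xz ret[OF zb] mem using rt unfolding ret_time_def .
    have pm: "rlen T a * u \<in> piece T m j \<longleftrightarrow> u \<in> topI ?R j" for u
      unfolding piece_eq[OF h] a_def[symmetric] using ra by auto
    have code: "(return_map T m ^^ l) x \<in> piece T m j \<longleftrightarrow> ?w ! l = j" if "l < length ?w" for l
      unfolding xz ret[OF zb] pm
      using o that pgiet_maps(6)[OF follows_pgiet[OF f, of a]] by blast
    have "{l. l < ret_time (return_map T m) (base T n) x \<and> (return_map T m ^^ l) x \<in> piece T m j} =
        {l. l < length ?w \<and> j = ?w ! l}"
      unfolding rt' using code by auto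
    then have "Q T m n $ i $ j = real (count_list ?w j)"
      unfolding Q_def Let_def x_def by (simp add: count_list_eq_length_filter length_filter_conv_card)
    then show ?thesis unfolding Qw_def a_def k_def by simp
  qed
  then show ?thesis by (simp add: vec_eq_iff)
qed

lemma sum_count_list:
  fixes w :: "'d::finite \<Rightarrow> real"
  shows "(\<Sum>j\<in>UNIV. real (count_list xs j) * w j) = sum_list (map w xs)"
proof (induction xs)
  case (Cons a xs)
  have "real (count_list (a # xs) j) * w j = real (count_list xs j) * w j + (if a = j then w j else 0)" for j
    by (simp add: algebra_simps)
  then show ?case using Cons by (simp add: sum.distrib)
qed simp

lemma Qw_mult: "(Qw \<gamma> a b *v w) $ i = sum_list (map (($) w) (cword (shift \<gamma> a) (b - a) i))"
  unfolding Qw_def matrix_vector_mult_def by (simp add: sum_count_list)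

lemma shift_shift: "shift (shift \<gamma> a) b = shift \<gamma> (a + b)"
  unfolding shift_def by (simp add: add.assoc)

lemma sum_list_concat_map: "sum_list (map f (concat (map g xs))) = sum_list (map (\<lambda>x. sum_list (map f (g x))) xs)"
  by (induction xs) simp_all

lemma Qw_compose:
  assumes "a \<le> b" "b \<le> c"
  shows "Qw \<gamma> b c *v (Qw \<gamma> a b *v w) = Qw \<gamma> a c *v w"
proof -
  have "(Qw \<gamma> b c *v (Qw \<gamma> a b *v w)) $ i = (Qw \<gamma> a c *v w) $ i" for i
  proof -
    have "c - a = (b - a) + (c - b)" using assms by simp
    moreover have "shift (shift \<gamma> a) (b - a) = shift \<gamma> b" using assms by (simp add: shift_shift)
    ultimately have "cword (shift \<gamma> a) (c - a) i =
        concat (map (cword (shift \<gamma> a) (b - a)) (cword (shift \<gamma> b) (c - b) i))"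
      using cword_add[of "shift \<gamma> a" "b - a" "c - b" i] by simp
    moreover have "($) (Qw \<gamma> a b *v w) = (\<lambda>x. sum_list (map (($) w) (cword (shift \<gamma> a) (b - a) x)))"
      by (rule ext) (rule Qw_mult)
    ultimately show ?thesis by (simp add: Qw_mult sum_list_concat_map)
  qed
  then show ?thesis by (simp add: vec_eq_iff)
qed

lemma Qw_same: "Qw \<gamma> a a *v w = w"
  by (simp add: vec_eq_iff Qw_mult)

text \<open>Only the loser's row changes. The last top and last bottom labels are the winner and the
  loser in some order, so the same sum serves both types.\<close>

lemma Qw_Suc:
  assumes "a \<le> b"
  shows "(Qw \<gamma> a (Suc b) *v w) $ j = (if j = losing \<gamma> b then (Qw \<gamma> a b *v w) $ blast \<gamma> b + (Qw \<gamma> a b *v w) $ tlast \<gamma> b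
     else (Qw \<gamma> a b *v w) $ j)"
proof -
  have sh: "Suc b - a = Suc (b - a)" "shift \<gamma> a (b - a) = \<gamma> b"
    using assms unfolding shift_def by auto
  have "losing (shift \<gamma> a) (b - a) = losing \<gamma> b" unfolding losing_def sh(2) ..
  with sh show ?thesis by (simp add: Qw_mult)
qed

lemma Qw_inj:
  assumes "\<And>n. tlast \<gamma> n \<noteq> blast \<gamma> n" "a \<le> b" "Qw \<gamma> a b *v w = 0"
  shows "w = 0"
  using assms(2,3)
proof (induction b rule: dec_induct)
  case base
  then show ?case by (simp add: Qw_same)
next
  case (step b)
  let ?u = "Qw \<gamma> a b *v w"
  have z: "(if j = losing \<gamma> b then ?u $ blast \<gamma> b + ?u $ tlast \<gamma> b else ?u $ j) = 0" for j
    using Qw_Suc[OF step(1), of \<gamma> w j] step.prems by simp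
  have "losing \<gamma> b = blast \<gamma> b \<or> losing \<gamma> b = tlast \<gamma> b" unfolding losing_def by (cases "snd (\<gamma> b)") auto
  then have "?u $ j = 0" for j
    using z[of j] z[of "losing \<gamma> b"] z[of "blast \<gamma> b"] z[of "tlast \<gamma> b"] assms(1)[of b] by (auto split: if_splits)
  then have "?u = 0" by (simp add: vec_eq_iff)
  then show ?case by (rule step.IH)
qed

lemma Qw_inverse:
  assumes "\<And>n. tlast \<gamma> n \<noteq> blast \<gamma> n" "a \<le> b"
  shows "matrix_inv (Qw \<gamma> a b) *v (Qw \<gamma> a b *v w) = w" "Qw \<gamma> a b *v (matrix_inv (Qw \<gamma> a b) *v w) = w"
proof -
  have "inj ((*v) (Qw \<gamma> a b))"
    unfolding linear_injective_0[OF matrix_vector_mul_linear]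
    using Qw_inj[OF assms(1,2)] by (intro allI impI)
  then have "invertible (Qw \<gamma> a b)"
    by (metis matrix_left_invertible_injective invertible_left_inverse)
  then have "Qw \<gamma> a b ** matrix_inv (Qw \<gamma> a b) = mat 1 \<and> matrix_inv (Qw \<gamma> a b) ** Qw \<gamma> a b = mat 1"
    unfolding matrix_inv_def invertible_def by (rule someI_ex)
  then show "matrix_inv (Qw \<gamma> a b) *v (Qw \<gamma> a b *v w) = w" "Qw \<gamma> a b *v (matrix_inv (Qw \<gamma> a b) *v w) = w"
    by (simp_all add: matrix_vector_mul_assoc)
qed

subsection \<open>Distortion\<close>

definition Ico :: "real set \<Rightarrow> bool" where
  "Ico J \<longleftrightarrow> (\<exists>u v. u < v \<and> J = {u..<v})"

lemma Ico_len: "Ico J \<Longrightarrow> len J > 0"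
  unfolding Ico_def by (auto simp: len_Ico)

definition growth :: "(real \<Rightarrow> real) \<Rightarrow> real set \<Rightarrow> nat \<Rightarrow> real" where
  "growth F J N = ln (len ((F ^^ N) ` J)) - ln (len J)"

lemma growth_0: "growth F J 0 = 0"
  unfolding growth_def by simp

lemma growth_add: "growth F J (M + N) = growth F J M + growth F ((F ^^ M) ` J) N"
  unfolding growth_def by (simp add: image_image funpow_add add.commute[of M N])

text \<open>The bound is proportional to the length of the larger interval. Along a chain of
  disjoint images in [0, 1) the errors then add up to at most L.\<close>

definition distortion_le :: "'d giet \<Rightarrow> real \<Rightarrow> bool" where
  "distortion_le T L \<longleftrightarrow> 0 \<le> L \<and> (\<forall>j I J. Ico I \<and> Ico J \<and> J \<subseteq> I \<and> I \<subseteq> topI T j \<longrightarrow>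
     \<bar>growth (gmap T) J 1 - growth (gmap T) I 1\<bar> \<le> L * len I)"

text \<open>The mean value theorem turns each quotient into a value of F', and ln F' is Lipschitz:
  F'' is bounded, and F' has no zero because the inverse of F is differentiable up to the boundary
  as well.\<close>

lemma diffeo_distortion:
  fixes F :: "real \<Rightarrow> real"
  assumes ab: "a < b" and F: "Cr_diffeo 3 {a..b} {a'..b'} F" and mono: "strict_mono_on {a..b} F"
  shows "\<exists>L\<ge>0. \<forall>u v p q. a \<le> p \<and> p \<le> u \<and> u < v \<and> v \<le> q \<and> q \<le> b \<longrightarrow>
    \<bar>ln ((F v - F u) / (v - u)) - ln ((F q - F p) / (q - p))\<bar> \<le> L * (q - p)"
proof -
  let ?S = "{a..b}"
  obtain D where D0: "\<forall>x\<in>?S. D 0 x = F x"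
    and D: "\<forall>k<3. \<forall>x\<in>?S. (D k has_real_derivative D (Suc k) x) (at x within ?S)"
    and Dc: "\<forall>k\<le>3. continuous_on ?S (D k)"
    using F unfolding Cr_diffeo_def Cr_on_def by blast
  define F1 F2 where "F1 = D 1" and "F2 = D 2"
  let ?G = "inv_into ?S F"
  have bij: "bij_betw F ?S {a'..b'}" using F unfolding Cr_diffeo_def by blast
  obtain E where E0: "\<forall>x\<in>{a'..b'}. E 0 x = ?G x"
    and E: "\<forall>k<3. \<forall>x\<in>{a'..b'}. (E k has_real_derivative E (Suc k) x) (at x within {a'..b'})"
    using F unfolding Cr_diffeo_def Cr_on_def by blast
  have d1: "(F has_real_derivative F1 x) (at x within ?S)" if "x \<in> ?S" for x
  proof -
    have "(D 0 has_real_derivative F1 x) (at x within ?S)" using D that unfolding F1_def by auto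
    then show ?thesis using D0 that by (auto elim!: has_field_derivative_transform_within[where d = 1])
  qed
  have d2: "(F1 has_real_derivative F2 x) (at x within ?S)" if "x \<in> ?S" for x
    using D that unfolding F1_def F2_def by (auto simp: numeral_2_eq_2 dest!: spec[of _ "1::nat"])
  have nz: "F1 x \<noteq> 0" if x: "x \<in> ?S" for x
  proof
    assume z: "F1 x = 0"
    have Fx: "F x \<in> {a'..b'}" using bij x by (auto dest: bij_betwE)
    have "(E 0 has_real_derivative E 1 (F x)) (at (F x) within F ` ?S)"
      using E Fx bij unfolding bij_betw_def by auto
    from DERIV_image_chain[OF this d1[OF x]]
    have "(E 0 \<circ> F has_real_derivative 0) (at x within ?S)" using z by simp
    moreover have "E 0 (F y) = y" if "y \<in> ?S" for y
      using E0 bij that by (metis bij_betwE bij_betw_inv_into_left)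
    ultimately have "((\<lambda>y. y) has_real_derivative 0) (at x within ?S)"
      using x by (auto elim!: has_field_derivative_transform_within[where d = 1])
    moreover have "((\<lambda>y. y) has_real_derivative 1) (at x within ?S)" by (rule DERIV_ident)
    moreover have "at x within ?S \<noteq> bot" using x ab by (simp add: trivial_limit_within islimpt_Icc)
    ultimately show False by (metis has_field_derivative_unique zero_neq_one)
  qed
  \<comment> \<open>This is ln |F'|, differentiable as soon as F' has no zero. The sign of F' is
    found only in \<open>mvt\<close>, from the monotonicity of F.\<close>
  define h where "h x = ln ((F1 x)\<^sup>2) / 2" for x
  have h: "(h has_real_derivative F2 x / F1 x) (at x within ?S)" if "x \<in> ?S" for x
  proof -
    have "F1 x * F1 x > 0" using nz[OF that] by (metis not_real_square_gt_zero)
    then show ?thesis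
      unfolding h_def using nz[OF that]
      by (auto intro!: derivative_eq_intros d2[OF that] simp: power2_eq_square field_simps)
  qed
  have "continuous_on ?S (\<lambda>x. F2 x / F1 x)"
    using Dc nz unfolding F1_def F2_def by (intro continuous_on_divide) auto
  then have "bounded ((\<lambda>x. F2 x / F1 x) ` ?S)"
    by (intro compact_imp_bounded compact_continuous_image compact_Icc)
  then obtain L where L: "L > 0" "\<forall>x\<in>?S. \<bar>F2 x / F1 x\<bar> \<le> L"
    unfolding bounded_pos by auto
  have lip: "\<bar>h x - h y\<bar> \<le> L * \<bar>x - y\<bar>" if "x \<in> ?S" "y \<in> ?S" for x y
    using field_differentiable_bound[of ?S h "\<lambda>x. F2 x / F1 x" L y x] h L(2) that by (auto simp: abs_minus_commute)
  have mvt: "\<exists>x. u < x \<and> x < v \<and> ln ((F v - F u) / (v - u)) = h x" if uv: "a \<le> u" "u < v" "v \<le> b" for u v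
  proof -
    have "continuous_on {u..v} F"
      by (rule continuous_on_subset[of ?S], rule DERIV_continuous_on[of _ _ F1]) (use d1 uv in auto)
    moreover have "(F has_derivative (*) (F1 x)) (at x)" if "u < x" "x < v" for x
    proof -
      have "at x within ?S = at x" using that uv by (intro at_within_Icc_at) auto
      then show ?thesis using d1[of x] that uv unfolding has_field_derivative_def by auto
    qed
    ultimately obtain x where x: "x \<in> {u<..<v}" "F v - F u = F1 x * (v - u)"
      using mvt[of u v F "\<lambda>x. (*) (F1 x)"] uv by auto
    have "F u < F v" using uv by (intro strict_mono_onD[OF mono]) auto
    then have "0 < F1 x * (v - u)" using x by simp
    then have "F1 x > 0" using uv by (simp add: zero_less_mult_iff)
    then have "ln ((F v - F u) / (v - u)) = h x" unfolding x(2) h_def using uv by (simp add: ln_realpow)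
    then show ?thesis using x by auto
  qed
  have "\<bar>ln ((F v - F u) / (v - u)) - ln ((F q - F p) / (q - p))\<bar> \<le> L * (q - p)"
    if c: "a \<le> p" "p \<le> u" "u < v" "v \<le> q" "q \<le> b" for u v p q
  proof -
    obtain x where x: "u < x" "x < v" "ln ((F v - F u) / (v - u)) = h x" using mvt[of u v] c by auto
    obtain y where y: "p < y" "y < q" "ln ((F q - F p) / (q - p)) = h y" using mvt[of p q] c by auto
    have "\<bar>h x - h y\<bar> \<le> L * \<bar>x - y\<bar>" using lip x y c by auto
    also have "\<dots> \<le> L * (q - p)" using L x y c by (intro mult_left_mono) auto
    finally show ?thesis unfolding x y .
  qed
  then show ?thesis using L by (intro exI[of _ L]) auto
qed

lemma giet_distortion:
  assumes "giet 3 T"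
  shows "\<exists>L. distortion_le T L"
proof -
  note pg = giet_imp_pgiet[OF assms]
  note iv = pgiet_intervals[OF pg]
  have "\<exists>L\<ge>0. \<forall>I J. Ico I \<and> Ico J \<and> J \<subseteq> I \<and> I \<subseteq> topI T j \<longrightarrow>
     \<bar>growth (gmap T) J 1 - growth (gmap T) I 1\<bar> \<le> L * len I" for j
  proof -
    define a b a' b' where "a = tl0 T j" and "b = tr0 T j" and "a' = bl0 T j" and "b' = br0 T j"
    have top: "topI T j = {a..<b}" and bot: "botI T j = {a'..<b'}" and ab: "a < b" "a' < b'"
      using iv(1,2)[of j] tilesD(2)[OF iv(3), of j] tilesD(2)[OF iv(4), of j]
      unfolding a_def b_def a'_def b'_def by blast+
    obtain F where F: "\<forall>x\<in>topI T j. F x = gmap T x" "strict_mono_on (closure (topI T j)) F"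
      "Cr_diffeo 3 (closure (topI T j)) (closure (botI T j)) F"
      using assms unfolding giet_def by blast
    have cl: "closure (topI T j) = {a..b}" "closure (botI T j) = {a'..b'}"
      unfolding top bot using ab by simp_all
    obtain L where L: "L \<ge> 0" "\<forall>u v p q. a \<le> p \<and> p \<le> u \<and> u < v \<and> v \<le> q \<and> q \<le> b \<longrightarrow>
      \<bar>ln ((F v - F u) / (v - u)) - ln ((F q - F p) / (q - p))\<bar> \<le> L * (q - p)"
      using diffeo_distortion[OF ab(1) F(3)[unfolded cl] F(2)[unfolded cl]] by blast
    have cont: "continuous_on {a..b} F"
    proof -
      obtain D where D: "\<forall>x\<in>{a..b}. D (0::nat) x = F x" "\<forall>k\<le>3. continuous_on {a..b} (D k)"
        using F(3) unfolding cl Cr_diffeo_def Cr_on_def by blast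
      then show ?thesis using continuous_on_cong[of "{a..b}" "{a..b}" "D 0" F] by auto
    qed
    have gr: "growth (gmap T) {u..<v} 1 = ln ((F v - F u) / (v - u))" if uv: "a \<le> u" "u < v" "v \<le> b" for u v
    proof -
      have lt: "F x < F y" if "a \<le> x" "x < y" "y \<le> b" for x y
        using that by (intro strict_mono_onD[OF F(2)[unfolded cl]]) auto
      have "gmap T ` {u..<v} = F ` {u..<v}" using F(1) uv unfolding top by (intro image_cong) auto
      also have "\<dots> = {F u..<F v}"
      proof (intro equalityI subsetI)
        fix y assume "y \<in> F ` {u..<v}"
        then obtain x where x: "u \<le> x" "x < v" "y = F x" by auto
        then show "y \<in> {F u..<F v}" using lt[of u x] lt[of x v] uv by (cases "u = x") auto
      next
        fix y assume y: "y \<in> {F u..<F v}"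
        obtain x where x: "u \<le> x" "x \<le> v" "F x = y"
          using IVT'[of F u y v] y uv continuous_on_subset[OF cont, of "{u..v}"] by auto
        then have "x \<noteq> v" using y by auto
        then show "y \<in> F ` {u..<v}" using x by auto
      qed
      finally have "gmap T ` {u..<v} = {F u..<F v}" .
      then show ?thesis unfolding growth_def using lt[of u v] uv by (simp add: len_Ico ln_div)
    qed
    have "\<bar>growth (gmap T) J 1 - growth (gmap T) I 1\<bar> \<le> L * len I"
      if IJ: "Ico I" "Ico J" "J \<subseteq> I" "I \<subseteq> topI T j" for I J
    proof -
      obtain u v p q where e: "u < v" "J = {u..<v}" "p < q" "I = {p..<q}" using IJ unfolding Ico_def by blast
      then have "p \<le> u" "v \<le> q" "a \<le> p" "q \<le> b"
        using IJ(3,4) unfolding e top by (simp_all add: atLeastLessThan_subset_iff)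
      then show ?thesis using L(2) gr[of u v] gr[of p q] e by (simp add: len_Ico)
    qed
    then show ?thesis using L by blast
  qed
  then obtain L where L: "\<And>j. L j \<ge> 0" "\<And>j I J. Ico I \<and> Ico J \<and> J \<subseteq> I \<and> I \<subseteq> topI T j \<Longrightarrow>
     \<bar>growth (gmap T) J 1 - growth (gmap T) I 1\<bar> \<le> L j * len I" by metis
  have "\<bar>growth (gmap T) J 1 - growth (gmap T) I 1\<bar> \<le> (\<Sum>j\<in>UNIV. L j) * len I"
    if "Ico I \<and> Ico J \<and> J \<subseteq> I \<and> I \<subseteq> topI T j" for I J j
  proof -
    have "L j \<le> (\<Sum>j\<in>UNIV. L j)" using L(1) by (intro member_le_sum) auto
    then have "L j * len I \<le> (\<Sum>j\<in>UNIV. L j) * len I"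
      using Ico_len[of I] that by (intro mult_right_mono) auto
    then show ?thesis using L(2)[OF that] by linarith
  qed
  then have "distortion_le T (\<Sum>j\<in>UNIV. L j)" unfolding distortion_le_def using L(1) by (auto intro: sum_nonneg)
  then show ?thesis by blast
qed

lemma Ico_image:
  assumes "pgiet T" "Ico J" "J \<subseteq> topI T j"
  shows "Ico (gmap T ` J)"
proof -
  note iv = pgiet_intervals[OF assms(1)]
  obtain u v where uv: "u < v" "J = {u..<v}" using assms(2) unfolding Ico_def by blast
  have "{u..<v} \<subseteq> {tl0 T j..<tr0 T j}" using assms(3) iv(1)[of j] uv by simp
  then have "tl0 T j \<le> u" "v \<le> tr0 T j" using uv(1) by (simp_all add: atLeastLessThan_subset_iff)
  moreover have "strict_mono_on {tl0 T j..<tr0 T j} (gmap T)" "gmap T ` {tl0 T j..<tr0 T j} = {bl0 T j..<br0 T j}"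
    using assms(1) iv(1)[of j, symmetric] iv(2)[of j, symmetric] unfolding pgiet_def botI_def by simp_all
  ultimately show ?thesis
    using strict_mono_image_sub[of "tl0 T j" "tr0 T j" "gmap T" "bl0 T j" "br0 T j" u v] uv
    unfolding Ico_def by metis
qed

lemma Ico_orbit:
  assumes "pgiet T" "Ico J" "\<And>k. k < N \<Longrightarrow> (gmap T ^^ k) ` J \<subseteq> topI T (c k)"
  shows "k \<le> N \<Longrightarrow> Ico ((gmap T ^^ k) ` J)"
proof (induction k)
  case (Suc k)
  have "(gmap T ^^ Suc k) ` J = gmap T ` (gmap T ^^ k) ` J" by (simp add: image_image)
  then show ?case using Ico_image[OF assms(1)] Suc assms(3)[of k] by auto
qed (use assms in simp)

lemma growth_sum: "growth F J N = (\<Sum>k<N. growth F ((F ^^ k) ` J) 1)"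
proof (induction N)
  case (Suc N)
  then show ?case using growth_add[of F J N 1] by simp
qed (simp add: growth_0)

lemma sum_len_disjoint:
  assumes "finite K" "\<And>k. k \<in> K \<Longrightarrow> Ico (X k)" "\<And>k. k \<in> K \<Longrightarrow> X k \<subseteq> {0..<1}" "disjoint_family_on X K"
  shows "(\<Sum>k\<in>K. len (X k)) = len (\<Union>k\<in>K. X k)" "(\<Sum>k\<in>K. len (X k)) \<le> 1"
proof -
  have m: "X k \<in> sets lborel \<and> emeasure lborel (X k) \<noteq> \<infinity>" if "k \<in> K" for k
    using assms(2)[OF that] unfolding Ico_def by auto
  show 1: "(\<Sum>k\<in>K. len (X k)) = len (\<Union>k\<in>K. X k)"
    unfolding len_def by (rule measure_finite_Union[symmetric]) (use assms m in auto)
  have "measure lborel (\<Union>k\<in>K. X k) \<le> measure lborel {0..<1::real}"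
    using assms m by (intro measure_mono_fmeasurable) (auto intro!: sets.finite_UN simp: fmeasurable_def)
  then show "(\<Sum>k\<in>K. len (X k)) \<le> 1" unfolding 1 unfolding len_def by simp
qed

text \<open>Denjoy's argument: the logarithmic errors of the single iterates are at most L times the
  lengths of the images of I, and these images are disjoint in [0, 1).\<close>

lemma iterated_distortion:
  assumes "pgiet T" "distortion_le T L" "Ico I" "Ico J" "J \<subseteq> I"
    and top: "\<And>k. k < N \<Longrightarrow> (gmap T ^^ k) ` I \<subseteq> topI T (c k)"
    and dis: "disjoint_family_on (\<lambda>k. (gmap T ^^ k) ` I) {..<N}"
  shows "\<bar>growth (gmap T) J N - growth (gmap T) I N\<bar> \<le> L"
proof -
  let ?F = "gmap T"
  have L: "L \<ge> 0" using assms(2) unfolding distortion_le_def by blast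
  have sub: "(?F ^^ k) ` J \<subseteq> (?F ^^ k) ` I" for k using assms(5) by blast
  have iI: "Ico ((?F ^^ k) ` I)" if "k < N" for k
    using Ico_orbit[OF assms(1,3) top] that by auto
  have iJ: "Ico ((?F ^^ k) ` J)" if "k < N" for k
    by (rule Ico_orbit[OF assms(1,4), of N c]) (use sub top that in \<open>blast, simp\<close>)
  have "\<bar>growth ?F J N - growth ?F I N\<bar> = \<bar>\<Sum>k<N. growth ?F ((?F ^^ k) ` J) 1 - growth ?F ((?F ^^ k) ` I) 1\<bar>"
    unfolding growth_sum[of _ _ N] by (simp add: sum_subtractf)
  also have "\<dots> \<le> (\<Sum>k<N. \<bar>growth ?F ((?F ^^ k) ` J) 1 - growth ?F ((?F ^^ k) ` I) 1\<bar>)" by (rule sum_abs)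
  also have "\<dots> \<le> (\<Sum>k<N. L * len ((?F ^^ k) ` I))"
    using assms(2) iI iJ sub top unfolding distortion_le_def by (intro sum_mono) (metis lessThan_iff)
  also have "\<dots> = L * (\<Sum>k<N. len ((?F ^^ k) ` I))" by (simp add: sum_distrib_left)
  also have "\<dots> \<le> L * 1"
  proof (intro mult_left_mono L sum_len_disjoint(2))
    fix k assume "k \<in> {..<N}"
    then show "(?F ^^ k) ` I \<subseteq> {0..<1}" using top[of k] pgiet_maps(3)[OF assms(1)] by blast
  qed (use iI dis in auto)
  finally show ?thesis by simp
qed

subsection \<open>Towers\<close>

definition rpiece :: "'d giet \<Rightarrow> nat \<Rightarrow> 'd \<Rightarrow> real set" where
  "rpiece T n j = (\<lambda>y. rlen T n * y) ` topI ((rauzy ^^ n) T) j"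

lemma piece_eq_rpiece: "has_rotation_number T \<gamma> \<Longrightarrow> piece T n j = rpiece T (ztime \<gamma> n) j"
  unfolding rpiece_def by (rule piece_eq)

lemma image_mult_Ico: "l > 0 \<Longrightarrow> (\<lambda>y. l * y) ` {p..<q} = {l * p..<l * q :: real}"
  using image_divide_Ico[of "1 / l" p q] by (simp add: mult.commute)

lemma Ico_top: "pgiet T \<Longrightarrow> Ico (topI T j)" and Ico_bot: "pgiet T \<Longrightarrow> Ico (botI T j)"
  using pgiet_intervals tilesD(2) unfolding Ico_def by metis+

lemma Ico_scale: "l > 0 \<Longrightarrow> Ico J \<Longrightarrow> Ico ((\<lambda>y. l * y) ` J) \<and> len ((\<lambda>y. l * y) ` J) = l * len J"
proof -
  assume l: "l > 0" and "Ico J"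
  then obtain u v where uv: "u < v" "J = {u..<v}" unfolding Ico_def by blast
  have "(\<lambda>y. l * y) ` J = {l * u..<l * v}" "l * u < l * v"
    unfolding uv image_mult_Ico[OF l] using uv l by auto
  then show ?thesis unfolding Ico_def using uv by (auto simp: len_Ico right_diff_distrib)
qed

lemma Ico_rpiece: "follows T \<gamma> \<Longrightarrow> Ico (rpiece T n j)"
  unfolding rpiece_def using Ico_scale Ico_top follows_pgiet rlen_bounds(1) by blast

lemma rpiece_bounds: "follows T \<gamma> \<Longrightarrow> rpiece T n j \<subseteq> {0..<rlen T n}"
  unfolding rpiece_def using pgiet_maps(3)[OF follows_pgiet] rlen_bounds(1)[of T \<gamma> n] by force

lemma rpiece_orbit:
  assumes "follows T \<gamma>" "x \<in> rpiece T n j"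
  shows "k < length (cword \<gamma> n j) \<Longrightarrow> (gmap T ^^ k) x \<in> topI T (cword \<gamma> n j ! k)"
    "0 < k \<Longrightarrow> k < length (cword \<gamma> n j) \<Longrightarrow> rlen T n \<le> (gmap T ^^ k) x"
  using orbit_coding[OF assms(1)] assms(2) unfolding rpiece_def by blast+

lemma rpiece_return:
  assumes "follows T \<gamma>"
  shows "(gmap T ^^ length (cword \<gamma> n j)) ` rpiece T n j = (\<lambda>y. rlen T n * y) ` botI ((rauzy ^^ n) T) j"
  unfolding rpiece_def botI_def image_image using orbit_coding[OF assms] by (intro image_cong) auto

lemma gmap_pow_inj:
  assumes "pgiet T" "x \<in> {0..<1}" "y \<in> {0..<1}" "(gmap T ^^ k) x = (gmap T ^^ k) y"
  shows "x = y"
proof -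
  have "bij_betw (gmap T ^^ k) {0..<1} {0..<1}"
    by (rule bij_betw_funpow[OF pgiet_bij[OF assms(1)]])
  then show ?thesis using assms(2-4) by (meson bij_betw_imp_inj_on inj_onD)
qed

text \<open>If floors at heights k < l met, undoing k iterates would put a point of the base on a
  floor of positive height, although orbits stay outside the base until they return.\<close>

lemma floors_disjoint:
  assumes "follows T \<gamma>" "x \<in> rpiece T n i" "y \<in> rpiece T n j"
    "k < length (cword \<gamma> n i)" "l < length (cword \<gamma> n j)" "(gmap T ^^ k) x = (gmap T ^^ l) y"
  shows "k = l" "i = j"
proof -
  have pg: "pgiet T" using follows_pgiet[OF assms(1), of 0] by simp
  have no: "\<not> k < l" if "x \<in> rpiece T n i" "y \<in> rpiece T n j"
    "k < length (cword \<gamma> n i)" "l < length (cword \<gamma> n j)" "(gmap T ^^ k) x = (gmap T ^^ l) y" for x y i j k l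
  proof
    assume kl: "k < l"
    have x: "x \<in> {0..<rlen T n}" and y: "y \<in> {0..<rlen T n}" using rpiece_bounds[OF assms(1)] that by blast+
    have r: "rlen T n \<le> 1" using rlen_bounds[OF assms(1)] by blast
    have "(gmap T ^^ k) ((gmap T ^^ (l - k)) y) = (gmap T ^^ l) y"
      using kl by (metis add_diff_inverse_nat comp_apply funpow_add nat_less_le not_less_iff_gr_or_eq)
    moreover have "(gmap T ^^ (l - k)) y \<in> {0..<1}"
      using gmap_range(2)[OF assms(1), where y = y and n = 0 and k = "l - k"] y r by simp
    ultimately have "x = (gmap T ^^ (l - k)) y" using gmap_pow_inj[OF pg, of x _ k] x r that(5) by auto
    moreover have "rlen T n \<le> (gmap T ^^ (l - k)) y"
      using rpiece_orbit(2)[OF assms(1) that(2), of "l - k"] kl that(4) by auto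
    ultimately show False using x by auto
  qed
  show kl: "k = l" using no[OF assms(2-6)] no[OF assms(3,2,5,4) assms(6)[symmetric]] by simp
  have "x \<in> {0..<1}" "y \<in> {0..<1}" using rpiece_bounds[OF assms(1)] assms(2,3) rlen_bounds(2)[OF assms(1), of n]
    by (meson atLeastLessThan_iff less_le_trans subsetD)+
  then have "x = y" using gmap_pow_inj[OF pg, of x y k] assms(6) kl by auto
  moreover obtain x' y' where "x' \<in> topI ((rauzy ^^ n) T) i" "x = rlen T n * x'" "y' \<in> topI ((rauzy ^^ n) T) j" "y = rlen T n * y'"
    using assms(2,3) unfolding rpiece_def by blast
  ultimately show "i = j" using rlen_bounds(1)[OF assms(1), of n] pgiet_maps(6)[OF follows_pgiet[OF assms(1)], of x' n i j] by auto
qed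

text \<open>On the whole piece, the climb through the tower is a branch of the renormalized map up
  to a scaling that cancels, so its growth is exactly the log-slope. A smaller interval deviates by
  at most the distortion of one passage.\<close>

lemma growth_full:
  assumes "follows T \<gamma>" "distortion_le T L" "Ico J" "J \<subseteq> rpiece T n j"
  shows "\<bar>growth (gmap T) J (length (cword \<gamma> n j)) - log_slope ((rauzy ^^ n) T) $ j\<bar> \<le> L"
proof -
  let ?q = "length (cword \<gamma> n j)" and ?R = "(rauzy ^^ n) T"
  have pg: "pgiet T" "pgiet ?R" using follows_pgiet[OF assms(1), of 0] follows_pgiet[OF assms(1)] by auto
  have r: "rlen T n > 0" using rlen_bounds[OF assms(1)] by blast
  have lt: "len (topI ?R j) > 0" "len (botI ?R j) > 0" using Ico_len Ico_top[OF pg(2)] Ico_bot[OF pg(2)] by blast+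
  have "growth (gmap T) (rpiece T n j) ?q = ln (rlen T n * len (botI ?R j)) - ln (rlen T n * len (topI ?R j))"
    unfolding growth_def rpiece_return[OF assms(1)]
    using Ico_scale[OF r Ico_top[OF pg(2), of j]] Ico_scale[OF r Ico_bot[OF pg(2), of j]]
    by (simp add: rpiece_def)
  also have "\<dots> = log_slope ?R $ j" unfolding log_slope_def using lt r by (simp add: ln_div ln_mult)
  finally have e: "growth (gmap T) (rpiece T n j) ?q = log_slope ?R $ j" .
  have "\<bar>growth (gmap T) J ?q - growth (gmap T) (rpiece T n j) ?q\<bar> \<le> L"
  proof (rule iterated_distortion[OF pg(1) assms(2) Ico_rpiece[OF assms(1)] assms(3,4)])
    show "(gmap T ^^ k) ` rpiece T n j \<subseteq> topI T (cword \<gamma> n j ! k)" if "k < ?q" for k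
      using rpiece_orbit(1)[OF assms(1)] that by blast
    show "disjoint_family_on (\<lambda>k. (gmap T ^^ k) ` rpiece T n j) {..<?q}"
      unfolding disjoint_family_on_def using floors_disjoint(1)[OF assms(1)] by auto
  qed
  then show ?thesis unfolding e .
qed

abbreviation "offs \<gamma> w m i \<equiv> length (concat (map (cword \<gamma> m) (take i w)))"

lemma block_start:
  assumes "follows T \<gamma>" "J \<subseteq> rpiece T (m + k) j" "i < length (cword (shift \<gamma> m) k j)"
  shows "(gmap T ^^ offs \<gamma> (cword (shift \<gamma> m) k j) m i) ` J \<subseteq> rpiece T m (cword (shift \<gamma> m) k j ! i)"
proof
  fix z assume "z \<in> (gmap T ^^ offs \<gamma> (cword (shift \<gamma> m) k j) m i) ` J"
  then obtain y where y: "y \<in> topI ((rauzy ^^ (m + k)) T) j"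
    "z = (gmap T ^^ offs \<gamma> (cword (shift \<gamma> m) k j) m i) (rlen T (m + k) * y)"
    using assms(2) unfolding rpiece_def by blast
  show "z \<in> rpiece T m (cword (shift \<gamma> m) k j ! i)"
    unfolding y(2) rpiece_def using sync_coding[OF assms(1) y(1), of i] assms(3) by auto
qed

lemma offs_Suc: "i < length w \<Longrightarrow> offs \<gamma> w m (Suc i) = offs \<gamma> w m i + length (cword \<gamma> m (w ! i))"
  by (simp add: take_Suc_conv_app_nth)

lemma growth_blocks:
  "i \<le> length w \<Longrightarrow> growth F J (offs \<gamma> w m i) =
     (\<Sum>k<i. growth F ((F ^^ offs \<gamma> w m k) ` J) (length (cword \<gamma> m (w ! k))))"
proof (induction i)
  case (Suc i)
  then have i: "i < length w" by simp
  show ?case unfolding offs_Suc[OF i] growth_add using Suc i by simp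
qed (simp add: growth_0)

lemma sum_list_map_nth: "sum_list (map f w) = (\<Sum>k<length w. f (w ! k))"
  by (simp add: sum_list_sum_nth atLeast0LessThan)

lemma Ico_sub_rpiece:
  assumes "follows T \<gamma>" "Ico J" "J \<subseteq> rpiece T n j" "k \<le> length (cword \<gamma> n j)"
  shows "Ico ((gmap T ^^ k) ` J)"
proof (rule Ico_orbit[OF _ assms(2) _ assms(4)])
  show "pgiet T" using follows_pgiet[OF assms(1), of 0] by simp
  show "(gmap T ^^ i) ` J \<subseteq> topI T (cword \<gamma> n j ! i)" if "i < length (cword \<gamma> n j)" for i
    using rpiece_orbit(1)[OF assms(1)] assms(3) that by blast
qed

lemma offs_le: "offs \<gamma> w m i \<le> length (concat (map (cword \<gamma> m) w))"
proof -
  have "concat (map (cword \<gamma> m) w) = concat (map (cword \<gamma> m) (take i w)) @ concat (map (cword \<gamma> m) (drop i w))"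
    by (metis append_take_drop_id concat_append map_append)
  then show ?thesis by simp
qed

text \<open>The tower of level n consists of complete climbs through towers of level m, each with an
  error of at most L. The identification of the log-slope at level n costs a further L, which is
  absorbed into the factor 2 because there is at least one block.\<close>

lemma log_slope_cocycle:
  assumes "follows T \<gamma>" "distortion_le T L" "m \<le> n"
  shows "\<bar>(log_slope ((rauzy ^^ n) T) - Qw \<gamma> m n *v log_slope ((rauzy ^^ m) T)) $ j\<bar>
      \<le> 2 * L * length (cword (shift \<gamma> m) (n - m) j)"
proof -
  define k where "k = n - m"
  have n: "n = m + k" using assms(3) k_def by simp
  let ?w = "cword (shift \<gamma> m) k j" and ?P = "rpiece T n j" and ?F = "gmap T"
  let ?o = "log_slope ((rauzy ^^ m) T)"
  have L: "L \<ge> 0" using assms(2) unfolding distortion_le_def by blast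
  have len: "length (cword \<gamma> n j) = offs \<gamma> ?w m (length ?w)" unfolding n cword_add by simp
  have iP: "Ico ?P" using Ico_rpiece[OF assms(1)] .
  have b: "\<bar>growth ?F ((?F ^^ offs \<gamma> ?w m i) ` ?P) (length (cword \<gamma> m (?w ! i))) - ?o $ (?w ! i)\<bar> \<le> L"
    if "i < length ?w" for i
    by (rule growth_full[OF assms(1,2) Ico_sub_rpiece[OF assms(1) iP order_refl] block_start[OF assms(1) _ that]])
      (use offs_le[where \<gamma> = \<gamma> and w = ?w and m = m and i = i] in \<open>auto simp: n cword_add\<close>)
  have "\<bar>growth ?F ?P (length (cword \<gamma> n j)) - (Qw \<gamma> m n *v ?o) $ j\<bar> =
     \<bar>\<Sum>i<length ?w. growth ?F ((?F ^^ offs \<gamma> ?w m i) ` ?P) (length (cword \<gamma> m (?w ! i))) - ?o $ (?w ! i)\<bar>"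
    unfolding len growth_blocks[OF order_refl] Qw_mult k_def[symmetric] sum_list_map_nth sum_subtractf ..
  also have "\<dots> \<le> (\<Sum>i<length ?w. L)" by (rule order_trans[OF sum_abs sum_mono]) (use b in auto)
  finally have 1: "\<bar>growth ?F ?P (length (cword \<gamma> n j)) - (Qw \<gamma> m n *v ?o) $ j\<bar> \<le> L * length ?w"
    by (simp add: mult.commute)
  have 2: "\<bar>growth ?F ?P (length (cword \<gamma> n j)) - log_slope ((rauzy ^^ n) T) $ j\<bar> \<le> L"
    by (rule growth_full[OF assms(1,2) iP order_refl])
  have "1 \<le> length ?w" using cword_ne[of "shift \<gamma> m" k j] by (simp add: Suc_le_eq)
  then have "L * 1 \<le> L * length ?w" using L by (intro mult_left_mono) auto
  then show ?thesis using 1 2 unfolding k_def[symmetric] by simp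
qed

text \<open>On an affine branch the growth is the same for all intervals, so the word sum is exact.
  All the error in the later comparison thus comes from T.\<close>

lemma affine_growth:
  assumes "follows A \<gamma>" "affine_iet A" "Ico J" "J \<subseteq> rpiece A n j" "s \<le> length (cword \<gamma> n j)"
  shows "growth (gmap A) J s = (\<Sum>k<s. log_slope A $ (cword \<gamma> n j ! k))"
proof -
  have pg: "pgiet A" using follows_pgiet[OF assms(1), of 0] by simp
  have one: "growth (gmap A) I 1 = log_slope A $ i" if I: "Ico I" "I \<subseteq> topI A i" for I i
  proof -
    obtain a b where ab: "\<forall>x\<in>topI A i. gmap A x = a * x + b" using assms(2) unfolding affine_iet_def by blast
    obtain p q where pq: "p < q" "topI A i = {p..<q}" using Ico_top[OF pg] unfolding Ico_def by blast
    have a: "a > 0"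
    proof -
      have "gmap A p < gmap A ((p + q) / 2)"
      proof (rule strict_mono_onD[of "topI A i" "gmap A"])
        show "strict_mono_on (topI A i) (gmap A)" using pg unfolding pgiet_def by blast
      qed (use pq in auto)
      then have "a * p < a * ((p + q) / 2)" using ab pq by simp
      moreover have "p < (p + q) / 2" using pq by simp
      ultimately show ?thesis using mult_left_mono_neg[of p "(p + q) / 2" a] by linarith
    qed
    have ln: "len (gmap A ` K) = a * len K" if "Ico K" "K \<subseteq> topI A i" for K
    proof -
      obtain u v where uv: "u < v" "K = {u..<v}" using \<open>Ico K\<close> unfolding Ico_def by blast
      have "gmap A ` K = (\<lambda>x. a * x + b) ` K" using ab that by (intro image_cong) auto
      also have "\<dots> = (\<lambda>x. x + b) ` (\<lambda>x. a * x) ` K" by (simp add: image_image)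
      also have "\<dots> = {a * u + b..<a * v + b}" unfolding uv image_mult_Ico[OF a] by simp
      finally show ?thesis using uv a by (simp add: len_Ico algebra_simps)
    qed
    have "log_slope A $ i = ln a"
      unfolding log_slope_def botI_def using ln[OF Ico_top[OF pg] order_refl] Ico_len[OF Ico_top[OF pg, of i]] by simp
    moreover have "growth (gmap A) I 1 = ln a"
      unfolding growth_def using ln[OF I] Ico_len[OF I(1)] a by (simp add: ln_mult)
    ultimately show ?thesis by simp
  qed
  show ?thesis unfolding growth_sum[of _ _ s]
  proof (rule sum.cong)
    fix k assume "k \<in> {..<s}"
    then have k: "k < length (cword \<gamma> n j)" using assms(5) by simp
    show "growth (gmap A) ((gmap A ^^ k) ` J) 1 = log_slope A $ (cword \<gamma> n j ! k)"
      by (rule one[OF Ico_sub_rpiece[OF assms(1,3,4)]]) (use k rpiece_orbit(1)[OF assms(1)] assms(4) in auto)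
  qed simp
qed

subsection \<open>Bounded invariant functionals from the vertices of the suspension\<close>

text \<open>
  A vector \<open>w\<close> is seen as a cocycle on the suspension punctured at its vertices. Its value on a small
  loop around a vertex is a functional with coefficients in \<open>{-1, 0, 1}\<close> which is invariant under
  the Rauzy--Veech cocycle. The functions \<open>S\<close> and \<open>E\<close> give the vertices at the two ends of the sides.
\<close>

definition vlab :: "('d \<Rightarrow> real) \<Rightarrow> ('d \<Rightarrow> real) \<Rightarrow> ('d \<Rightarrow> real) \<Rightarrow> ('d \<Rightarrow> real) \<Rightarrow> ('d \<Rightarrow> 'v) \<Rightarrow> ('d \<Rightarrow> 'v) \<Rightarrow> bool" where
  "vlab p q r s S E \<longleftrightarrow>
     (\<forall>i j. q i = p j \<longrightarrow> E i = S j) \<and> (\<forall>i j. s i = r j \<longrightarrow> E i = S j) \<and>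
     (\<forall>i j. p i = 0 \<and> r j = 0 \<longrightarrow> S i = S j) \<and> (\<forall>i j. q i = 1 \<and> s j = 1 \<longrightarrow> E i = E j)"

lemma vlab_commute:
  assumes "vlab p q r s S E"
  shows "vlab r s p q S E"
  using assms unfolding vlab_def by (intro conjI allI impI) (blast, blast, metis, metis)

text \<open>The winner's interval is now cut where the loser's interval begins in the other
  partition, so its right end becomes the vertex \<open>S \<beta>\<close>. Left ends keep their
  vertices. Before the step the intervals of \<alpha> and \<beta> both end at 1, which gives the
  second claim.\<close>

lemma istep_vlab:
  assumes st: "istep l \<alpha> \<beta> c p q r s p' q' r' s'" and t: "tiles 1 p q" "tiles 1 r s"
    and v: "vlab p q r s S E"
  shows "vlab p' q' r' s' S (E(\<alpha> := S \<beta>))" "E \<alpha> = E \<beta>"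
proof -
  note i = istepD[OF st]
  note t' = istep_tiles[OF st t]
  note ta = tilesD[OF t(1)] and tb = tilesD[OF t(2)] and ta' = tilesD[OF t'(1)] and tb' = tilesD[OF t'(2)]
  have l: "l > 0" using i(5) ta(1)[of \<alpha>] by linarith
  have v1: "\<And>i j. q i = p j \<Longrightarrow> E i = S j" and v2: "\<And>i j. s i = r j \<Longrightarrow> E i = S j"
    and v3: "\<And>i j. p i = 0 \<Longrightarrow> r j = 0 \<Longrightarrow> S i = S j" and v4: "\<And>i j. q i = 1 \<Longrightarrow> s j = 1 \<Longrightarrow> E i = E j"
    using v unfolding vlab_def by blast+
  show E\<alpha>\<beta>: "E \<alpha> = E \<beta>" using v4 i by blast
  let ?E = "E(\<alpha> := S \<beta>)"
  have eq: "x / l = y / l \<longleftrightarrow> x = y" "x / l = 0 \<longleftrightarrow> x = 0" "x / l = 1 \<longleftrightarrow> x = l" for x y using l by auto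
  have "?E x = S y" if "q' x = p' y" for x y
  proof (cases "x = \<alpha>")
    case True
    then have "p' y = 1" using that i(10)[of x] l by simp
    then show ?thesis using ta'(2,3)[of y] by simp
  next
    case False
    then show ?thesis using that v1[of x y] i(9)[of y] i(10)[of x] eq by simp
  qed
  moreover have "?E x = S y" if xy: "s' x = r' y" for x y
  proof -
    have no: "r y \<noteq> c" "s y \<noteq> c" for y
      using tb(4)[of y \<alpha>] tb(2)[of y] i(7,8) by (cases "y = \<alpha>"; auto)+
    consider "x = \<alpha>" "y = \<beta>" | "x = \<alpha>" "y \<noteq> \<beta>" | "x = \<beta>" "y = \<beta>" | "x = \<beta>" "y \<noteq> \<beta>" |
      "x \<noteq> \<alpha>" "x \<noteq> \<beta>" "y = \<beta>" | "x \<noteq> \<alpha>" "x \<noteq> \<beta>" "y \<noteq> \<beta>" by blast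
    then show ?thesis
    proof cases
      case 2
      then show ?thesis using xy i(1) i(11)[of y] i(12)[of x] eq no(1)[of y] by auto
    next
      case 3
      then show ?thesis using xy i(1,8) i(11)[of y] i(12)[of x] eq by auto
    next
      case 4
      then have "s \<alpha> = r y" using xy i(11)[of y] i(12)[of x] eq by simp
      then show ?thesis using v2[of \<alpha> y] E\<alpha>\<beta> 4 i(1) by simp
    next
      case 5
      then show ?thesis using xy i(11)[of y] i(12)[of x] eq no(2)[of x] by auto
    next
      case 6
      then show ?thesis using xy i(11)[of y] i(12)[of x] eq v2[of x y] by auto
    qed simp
  qed
  moreover have "S x = S y" if "p' x = 0 \<and> r' y = 0" for x y
  proof (cases "y = \<beta>")
    case True
    then have "c = 0" using that i(11)[of y] eq by simp
    then show ?thesis using tb(1)[of \<alpha>] i(7) by simp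
  next
    case False
    then show ?thesis using that i(9)[of x] i(11)[of y] eq v3[of x y] by simp
  qed
  moreover have "?E x = ?E y" if xy: "q' x = 1 \<and> s' y = 1" for x y
  proof -
    have x: "x = \<alpha>"
    proof (rule ccontr)
      assume "x \<noteq> \<alpha>"
      then have "q x = l" using xy i(10)[of x] eq by simp
      then show False using ta(4)[OF \<open>x \<noteq> \<alpha>\<close>] ta(2)[of x] ta(3)[of x] i(2,5) by auto
    qed
    have y: "y \<noteq> \<alpha>"
    proof
      assume "y = \<alpha>"
      then have "c = l" using xy i(1) i(12)[of y] eq by simp
      moreover have "s' \<beta> = s \<alpha> / l" using i(12)[of \<beta>] by simp
      then have "s \<alpha> \<le> l" using tb'(3)[of \<beta>] l by (simp add: divide_le_eq)
      ultimately show False using i(8) by simp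
    qed
    have "(if y = \<beta> then s \<alpha> else s y) = r \<beta>" using xy y i(4) i(12)[of y] eq by (auto split: if_splits)
    then have "E (if y = \<beta> then \<alpha> else y) = S \<beta>" using v2[of "if y = \<beta> then \<alpha> else y" \<beta>] by (auto split: if_splits)
    then show ?thesis using x y E\<alpha>\<beta> by (auto split: if_splits)
  qed
  ultimately show "vlab p' q' r' s' S ?E" unfolding vlab_def by blast
qed

definition winning :: "'d rotation_number \<Rightarrow> nat \<Rightarrow> 'd" where
  "winning \<gamma> n = (case snd (\<gamma> n) of Top \<Rightarrow> tlast \<gamma> n | Bottom \<Rightarrow> blast \<gamma> n)"

primrec vend :: "'d rotation_number \<Rightarrow> ('d \<Rightarrow> 'v) \<Rightarrow> ('d \<Rightarrow> 'v) \<Rightarrow> nat \<Rightarrow> 'd \<Rightarrow> 'v" where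
  "vend \<gamma> S E 0 = E"
| "vend \<gamma> S E (Suc n) = (vend \<gamma> S E n)(winning \<gamma> n := S (losing \<gamma> n))"

lemma vlab_step:
  assumes "follows T \<gamma>" "vlab (tl0 T) (tr0 T) (bl0 T) (br0 T) S E"
  shows "vlab (tl0 ((rauzy ^^ n) T)) (tr0 ((rauzy ^^ n) T)) (bl0 ((rauzy ^^ n) T)) (br0 ((rauzy ^^ n) T)) S (vend \<gamma> S E n) \<and>
     vend \<gamma> S E n (winning \<gamma> n) = vend \<gamma> S E n (losing \<gamma> n)"
proof (induction n)
  case 0
  have *: "vend \<gamma> S E m (winning \<gamma> m) = vend \<gamma> S E m (losing \<gamma> m)"
    if v: "vlab (tl0 ((rauzy ^^ m) T)) (tr0 ((rauzy ^^ m) T)) (bl0 ((rauzy ^^ m) T)) (br0 ((rauzy ^^ m) T)) S (vend \<gamma> S E m)" for m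
  proof -
    interpret rauzy_step "(rauzy ^^ m) T" using follows_step[OF assms(1)] .
    have "vend \<gamma> S E m (tlast \<gamma> m) = vend \<gamma> S E m (blast \<gamma> m)"
      using v lasts follows_data(1,2)[OF assms(1), of m] unfolding vlab_def by metis
    then show ?thesis unfolding winning_def losing_def by (cases "snd (\<gamma> m)") auto
  qed
  show ?case using assms(2) *[of 0] by simp
next
  case (Suc n)
  let ?R = "(rauzy ^^ n) T"
  interpret rauzy_step ?R using follows_step[OF assms(1)] .
  note d = follows_data[OF assms(1), of n]
  have v: "vlab (tl0 (rauzy ?R)) (tr0 (rauzy ?R)) (bl0 (rauzy ?R)) (br0 (rauzy ?R)) S (vend \<gamma> S E (Suc n))"
  proof (cases "step_type ?R")
    case Top
    then obtain c where "istep l \<alpha> \<beta> c (tl0 ?R) (tr0 ?R) (bl0 ?R) (br0 ?R)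
      (tl0 (rauzy ?R)) (tr0 (rauzy ?R)) (bl0 (rauzy ?R)) (br0 (rauzy ?R))" by (rule rauzy_Top) (rule that)
    from istep_vlab(1)[OF this ivs(3,4) conjunct1[OF Suc]] show ?thesis
      using Top d unfolding vend.simps winning_def losing_def by simp
  next
    case Bottom
    then obtain c where "istep l \<beta> \<alpha> c (bl0 ?R) (br0 ?R) (tl0 ?R) (tr0 ?R)
      (bl0 (rauzy ?R)) (br0 (rauzy ?R)) (tl0 (rauzy ?R)) (tr0 (rauzy ?R))" by (rule rauzy_Bottom) (rule that)
    from vlab_commute[OF istep_vlab(1)[OF this ivs(4,3) vlab_commute[OF conjunct1[OF Suc]]]] show ?thesis
      using Bottom d unfolding vend.simps winning_def losing_def by simp
  qed
  moreover have "vend \<gamma> S E (Suc n) (winning \<gamma> (Suc n)) = vend \<gamma> S E (Suc n) (losing \<gamma> (Suc n))"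
  proof -
    interpret R': rauzy_step "(rauzy ^^ Suc n) T" using follows_step[OF assms(1)] .
    have "vend \<gamma> S E (Suc n) (tlast \<gamma> (Suc n)) = vend \<gamma> S E (Suc n) (blast \<gamma> (Suc n))"
      using v R'.lasts follows_data(1,2)[OF assms(1), of "Suc n"] unfolding vlab_def by simp
    then show ?thesis unfolding winning_def losing_def by (cases "snd (\<gamma> (Suc n))") auto
  qed
  ultimately show ?case unfolding funpow.simps comp_apply by (rule conjI)
qed

text \<open>The functional attached to a function h on the vertices. The loop around one vertex is
  the case of its indicator function; general h make the set of these functionals a vector
  space.\<close>

definition bvec :: "('d::finite \<Rightarrow> 'v) \<Rightarrow> ('d \<Rightarrow> 'v) \<Rightarrow> ('v \<Rightarrow> real) \<Rightarrow> real ^ 'd" where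
  "bvec S E h = (\<chi> j. h (S j) - h (E j))"

lemma Qw_Suc_winning:
  assumes "tlast \<gamma> b \<noteq> blast \<gamma> b"
  shows "(Qw \<gamma> 0 (Suc b) *v w) $ j = (Qw \<gamma> 0 b *v w) $ j + (if j = losing \<gamma> b then (Qw \<gamma> 0 b *v w) $ winning \<gamma> b else 0)"
  unfolding Qw_Suc[OF le0] losing_def winning_def by (cases "snd (\<gamma> b)") auto

text \<open>A step adds the winner's coordinate to the loser's and moves the right vertex of the
  winner to that at the left of the loser. The two resulting corrections are opposite because winner
  and loser had the same right vertex before.\<close>

lemma bvec_invariant:
  assumes "follows T \<gamma>" "vlab (tl0 T) (tr0 T) (bl0 T) (br0 T) S E"
  shows "bvec S (vend \<gamma> S E n) h \<bullet> (Qw \<gamma> 0 n *v w) = bvec S E h \<bullet> w"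
proof (induction n)
  case (Suc n)
  let ?u = "Qw \<gamma> 0 n *v w" and ?E = "vend \<gamma> S E n" and ?\<alpha> = "winning \<gamma> n" and ?\<beta> = "losing \<gamma> n"
  have ne: "?\<alpha> \<noteq> ?\<beta>" using follows_data(6)[OF assms(1), of n] unfolding winning_def losing_def by (cases "snd (\<gamma> n)") auto
  have E: "?E ?\<alpha> = ?E ?\<beta>" using vlab_step[OF assms] by blast
  have "(h (S j) - h ((?E(?\<alpha> := S ?\<beta>)) j)) * (?u $ j + (if j = ?\<beta> then ?u $ ?\<alpha> else 0)) =
      (h (S j) - h (?E j)) * ?u $ j + ((if j = ?\<alpha> then (h (?E j) - h (S ?\<beta>)) * ?u $ ?\<alpha> else 0)
        + (if j = ?\<beta> then (h (S ?\<beta>) - h (?E ?\<beta>)) * ?u $ ?\<alpha> else 0))" for j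
    using ne by (auto simp: algebra_simps)
  then have "bvec S (vend \<gamma> S E (Suc n)) h \<bullet> (Qw \<gamma> 0 (Suc n) *v w) =
      bvec S ?E h \<bullet> ?u + ((h (?E ?\<alpha>) - h (S ?\<beta>)) * ?u $ ?\<alpha> + (h (S ?\<beta>) - h (?E ?\<beta>)) * ?u $ ?\<alpha>)"
    unfolding inner_vec_def bvec_def Qw_Suc_winning[OF follows_data(6)[OF assms(1)]]
    by (simp add: sum.distrib)
  also have "\<dots> = bvec S ?E h \<bullet> ?u" unfolding E by (simp add: algebra_simps)
  finally show ?case unfolding Suc .
qed (simp add: Qw_same)

section \<open>The vertices of the glued polygon and the rank of their functionals\<close>

definition vertex :: "'d::finite datum \<Rightarrow> side \<times> nat \<Rightarrow> (side \<times> nat) set" where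
  "vertex \<pi> x = ((glued \<pi> \<union> (glued \<pi>)\<inverse>)\<^sup>*) `` {x}"

definition pos :: "'d list \<Rightarrow> 'd \<Rightarrow> nat" where
  "pos w j = (LEAST p. p < length w \<and> w ! p = j)"

lemma pos:
  assumes "set w = UNIV"
  shows "pos w j < length w" "w ! pos w j = j"
proof -
  have "\<exists>p. p < length w \<and> w ! p = j" using assms by (metis UNIV_I in_set_conv_nth)
  from LeastI_ex[OF this] show "pos w j < length w" "w ! pos w j = j" unfolding pos_def by auto
qed

lemma pos_nth: "distinct w \<Longrightarrow> set w = UNIV \<Longrightarrow> p < length w \<Longrightarrow> pos w (w ! p) = p"
  using pos[of w "w ! p"] by (simp add: nth_eq_iff_index_eq)

lemma vertex_glued:
  assumes "(x, y) \<in> glued \<pi>"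
  shows "vertex \<pi> x = vertex \<pi> y"
proof -
  let ?r = "(glued \<pi> \<union> (glued \<pi>)\<inverse>)\<^sup>*"
  have "(x, y) \<in> ?r" "(y, x) \<in> ?r" using assms by auto
  then show ?thesis unfolding vertex_def by (auto intro: rtrancl_trans)
qed

text \<open>The second claim expresses that the boundary of the polygon is connected: a function
  taking equal values at the two ends of every side is constant along the upper and the lower line,
  and these start at one common vertex.\<close>

lemma vertices_of_datum:
  fixes T :: "'d::finite giet"
  assumes "pgiet T"
  defines "\<pi> \<equiv> datum T"
  defines "S \<equiv> \<lambda>j. vertex \<pi> (Top, pos (fst \<pi>) j)" and "E \<equiv> \<lambda>j. vertex \<pi> (Top, Suc (pos (fst \<pi>) j))"
  shows "vlab (tl0 T) (tr0 T) (bl0 T) (br0 T) S E"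
    "(\<forall>j. h (S j) = h (E j)) \<Longrightarrow> p \<le> CARD('d) \<Longrightarrow> h (vertex \<pi> (z, p)) = h (vertex \<pi> (Top, 0))"
proof -
  define t b where "t = fst \<pi>" and "b = snd \<pi>"
  note i = pgiet_intervals(3,4)[OF assms(1)]
  have wt: "sorted_word (tl0 T) (tr0 T) t" and wb: "sorted_word (bl0 T) (br0 T) b"
    using assms(1) unfolding t_def b_def \<pi>_def datum_def pgiet_def by (auto intro: word_of_sorted)
  note lt = sorted_wordD[OF i(1) wt] and lb = sorted_wordD[OF i(2) wb]
  have dt: "distinct t" "set t = UNIV" and db: "distinct b" "set b = UNIV"
    using wt wb unfolding sorted_word_def by auto
  note pt = pos[OF dt(2)] and pb = pos[OF db(2)]
  have gl: "vertex \<pi> (Top, pos t j + e) = vertex \<pi> (Bottom, pos b j + e)" if "e \<le> 1" for j e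
  proof (rule vertex_glued)
    have "pos t j < CARD('d) \<and> pos b j < CARD('d) \<and> fst \<pi> ! pos t j = snd \<pi> ! pos b j \<and> e \<le> 1"
      using pt[of j] pb[of j] lt(1) lb(1) that unfolding t_def b_def by simp
    then show "((Top, pos t j + e), (Bottom, pos b j + e)) \<in> glued \<pi>" unfolding glued_def by blast
  qed
  have S: "S j = vertex \<pi> (Top, pos t j)" "S j = vertex \<pi> (Bottom, pos b j)"
    and E: "E j = vertex \<pi> (Top, Suc (pos t j))" "E j = vertex \<pi> (Bottom, Suc (pos b j))" for j
    using gl[of 0 j] gl[of 1 j] unfolding S_def E_def t_def by auto
  have c0: "vertex \<pi> (Top, 0) = vertex \<pi> (Bottom, 0)" and cd: "vertex \<pi> (Top, CARD('d)) = vertex \<pi> (Bottom, CARD('d))"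
    by (rule vertex_glued, simp add: glued_def)+
  have next_pos: "pos w j = Suc (pos w i)"
    if w: "tiles 1 p q" "sorted_word p q w" and ij: "q i = p j" for w i j and p q :: "'d \<Rightarrow> real"
  proof -
    have d: "distinct w" "set w = UNIV" using w(2) unfolding sorted_word_def by auto
    note pw = pos[OF d(2)] and lw = sorted_wordD[OF w]
    have "Suc (pos w i) < length w"
    proof (rule ccontr)
      assume "\<not> ?thesis"
      then have "pos w i = length w - 1" using pw(1)[of i] by simp
      then have "i = last w" using pw(2)[of i] lw(2) by (simp add: last_conv_nth)
      then show False using lw(4) ij tilesD(2,3)[OF w(1), of j] by simp
    qed
    then have "w ! Suc (pos w i) = j"
      using lw(5)[of "pos w i"] pw(2)[of i] ij tiles_inj(1)[OF w(1), of _ j] by simp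
    then show ?thesis using pos_nth[OF d \<open>Suc (pos w i) < length w\<close>] by simp
  qed
  have first_pos: "pos w j = 0"
    if w: "tiles 1 p q" "sorted_word p q w" and j: "p j = 0" for w j and p q :: "'d \<Rightarrow> real"
  proof -
    have d: "distinct w" "set w = UNIV" using w(2) unfolding sorted_word_def by auto
    have "j = hd w" using sorted_wordD(3)[OF w] tiles_inj(1)[OF w(1), of j "hd w"] j by simp
    then show ?thesis using pos_nth[OF d, of 0] sorted_wordD(2)[OF w] by (simp add: hd_conv_nth)
  qed
  have last_pos: "Suc (pos w j) = CARD('d)"
    if w: "tiles 1 p q" "sorted_word p q w" and j: "q j = 1" for w j and p q :: "'d \<Rightarrow> real"
  proof -
    have d: "distinct w" "set w = UNIV" using w(2) unfolding sorted_word_def by auto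
    have "j = last w" using sorted_wordD(4)[OF w] tiles_inj(2)[OF w(1), of j "last w"] j by simp
    then show ?thesis using pos_nth[OF d, of "length w - 1"] sorted_wordD(1,2)[OF w] by (simp add: last_conv_nth)
  qed
  show "vlab (tl0 T) (tr0 T) (bl0 T) (br0 T) S E"
    unfolding vlab_def
  proof (intro conjI allI impI)
    show "E i = S j" if "tr0 T i = tl0 T j" for i j
      unfolding S(1) E(1) next_pos[OF pgiet_intervals(3)[OF assms(1)] wt that] ..
    show "E i = S j" if "br0 T i = bl0 T j" for i j
      unfolding S(2) E(2) next_pos[OF pgiet_intervals(4)[OF assms(1)] wb that] ..
    show "S i = S j" if "tl0 T i = 0 \<and> bl0 T j = 0" for i j
      unfolding S(1)[of i] S(2)[of j]
        first_pos[OF pgiet_intervals(3)[OF assms(1)] wt conjunct1[OF that]]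
        first_pos[OF pgiet_intervals(4)[OF assms(1)] wb conjunct2[OF that]] by (rule c0)
    show "E i = E j" if "tr0 T i = 1 \<and> br0 T j = 1" for i j
      unfolding E(1)[of i] E(2)[of j]
        last_pos[OF pgiet_intervals(3)[OF assms(1)] wt conjunct1[OF that]]
        last_pos[OF pgiet_intervals(4)[OF assms(1)] wb conjunct2[OF that]] by (rule cd)
  qed
  assume h: "\<forall>j. h (S j) = h (E j)"
  have top: "p \<le> CARD('d) \<Longrightarrow> h (vertex \<pi> (Top, p)) = h (vertex \<pi> (Top, 0))" for p
  proof (induction p)
    case (Suc p)
    then have "pos t (t ! p) = p" using pos_nth[OF dt] lt(1) by simp
    then have "S (t ! p) = vertex \<pi> (Top, p)" "E (t ! p) = vertex \<pi> (Top, Suc p)"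
      by (simp_all add: S(1)[of "t ! p"] E(1)[of "t ! p"])
    then show ?case using spec[OF h, of "t ! p"] Suc by simp
  qed simp
  have bot: "p \<le> CARD('d) \<Longrightarrow> h (vertex \<pi> (Bottom, p)) = h (vertex \<pi> (Top, 0))" for p
  proof (induction p)
    case (Suc p)
    then have "pos b (b ! p) = p" using pos_nth[OF db] lb(1) by simp
    then have "S (b ! p) = vertex \<pi> (Bottom, p)" "E (b ! p) = vertex \<pi> (Bottom, Suc p)"
      by (simp_all add: S(2)[of "b ! p"] E(2)[of "b ! p"])
    then show ?case using spec[OF h, of "b ! p"] Suc by simp
  qed (simp add: c0)
  assume "p \<le> CARD('d)"
  then show "h (vertex \<pi> (z, p)) = h (vertex \<pi> (Top, 0))" using top[of p] bot[of p] by (cases z) simp_all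
qed

lemma linear_bvec: "bvec S E (\<lambda>x. \<Sum>s\<in>A. a s * f s x) = (\<Sum>s\<in>A. a s *\<^sub>R bvec S E (f s))"
  unfolding bvec_def vec_eq_iff by (simp add: sum_subtractf right_diff_distrib)

text \<open>By connectedness only constant functions on the vertices give the zero functional. A
  combination of indicators of the vertices other than \<open>v0\<close> is zero at
  \<open>v0\<close>, so it is constant only if all its coefficients vanish.\<close>

lemma vertex_count_le:
  fixes T :: "'d::finite giet"
  assumes "pgiet T"
  defines "\<pi> \<equiv> datum T"
  defines "S \<equiv> \<lambda>j. vertex \<pi> (Top, pos (fst \<pi>) j)" and "E \<equiv> \<lambda>j. vertex \<pi> (Top, Suc (pos (fst \<pi>) j))"
  shows "vertex_count \<pi> \<le> dim (range (bvec S E)) + 1"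
proof -
  let ?X = "(UNIV :: side set) \<times> {0..CARD('d)}"
  define V where "V = vertex \<pi> ` ?X"
  have finite_side: "finite (UNIV :: side set)"
  proof -
    have "(UNIV :: side set) = {Top, Bottom}" by (auto intro: side.exhaust)
    then show ?thesis by (metis finite.emptyI finite_insert)
  qed
  have fV: "finite V" unfolding V_def using finite_side by simp
  have cV: "vertex_count \<pi> = card V"
    unfolding vertex_count_def V_def vertex_def quotient_def by (intro arg_cong[of _ _ card]) auto
  define v0 where "v0 = vertex \<pi> (Top, 0)"
  have v0: "v0 \<in> V" unfolding v0_def V_def by auto
  let ?V = "V - {v0}"
  let ?f = "\<lambda>s. bvec S E (\<lambda>x. if x = s then 1 else 0)"
  have zero: "a s = 0" if sum: "(\<Sum>s\<in>?V. a s *\<^sub>R ?f s) = 0" and s: "s \<in> ?V" for a s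
  proof -
    let ?h = "\<lambda>x. \<Sum>s\<in>?V. a s * (if x = s then 1 else 0)"
    have h: "?h x = (if x \<in> ?V then a x else 0)" for x
    proof -
      have "?h x = (\<Sum>s\<in>?V. if x = s then a s else 0)" by (intro sum.cong) auto
      then show ?thesis using fV by simp
    qed
    have "bvec S E ?h = 0" using sum unfolding linear_bvec .
    then have "\<forall>j. ?h (S j) = ?h (E j)" unfolding bvec_def vec_eq_iff by simp
    then have "\<forall>j. ?h (vertex (datum T) (Top, pos (fst (datum T)) j)) =
        ?h (vertex (datum T) (Top, Suc (pos (fst (datum T)) j)))"
      unfolding S_def E_def \<pi>_def .
    note con = vertices_of_datum(2)[where h = ?h, OF assms(1) this, folded \<pi>_def]
    obtain z p where zp: "s = vertex \<pi> (z, p)" "p \<le> CARD('d)" using s unfolding V_def by force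
    have "?h s = ?h v0" using con[OF zp(2), of z] unfolding zp(1) v0_def[symmetric] .
    then show ?thesis using h[of s] h[of v0] s by simp
  qed
  have inj: "inj_on ?f ?V"
  proof (rule inj_onI, rule ccontr)
    fix x y assume xy: "x \<in> ?V" "y \<in> ?V" "?f x = ?f y" "x \<noteq> y"
    let ?a = "\<lambda>s. if s = x then 1 else if s = y then -1 else (0::real)"
    have "(\<Sum>s\<in>?V. ?a s *\<^sub>R ?f s) = (\<Sum>s\<in>?V. (if s = x then ?f x else 0) - (if s = y then ?f y else 0))"
      using xy(4) by (intro sum.cong) auto
    also have "\<dots> = 0" using fV xy by (simp add: sum_subtractf)
    finally have "?a x = 0" by (rule zero) (rule xy(1))
    then show False by simp
  qed
  have "independent (?f ` ?V)"
  proof (rule independent_if_scalars_zero)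
    show "finite (?f ` ?V)" using fV by simp
    fix g y assume g: "(\<Sum>x\<in>?f ` ?V. g x *\<^sub>R x) = 0" and y: "y \<in> ?f ` ?V"
    obtain s where s: "s \<in> ?V" "y = ?f s" using y by blast
    have "(\<Sum>s\<in>?V. g (?f s) *\<^sub>R ?f s) = 0" using g unfolding sum.reindex[OF inj] comp_def .
    from zero[OF this s(1)] show "g y = 0" unfolding s(2) .
  qed
  then have "card (?f ` ?V) \<le> dim (range (bvec S E))"
    by (intro independent_card_le_dim) auto
  then have "card ?V \<le> dim (range (bvec S E))" using card_image[OF inj] by simp
  then show ?thesis unfolding cV using card_Diff_singleton[OF v0] by linarith
qed

text \<open>The hypothesis says that the elements of W restrict injectively to functionals on C, so
  they impose \<open>dim W\<close> independent conditions there. In the proof, W meets the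
  orthogonal complement of C trivially, and both are orthogonal to the common kernel.\<close>

lemma dim_central_kernel:
  fixes C W :: "(real ^ 'd::finite) set"
  assumes "subspace C" "subspace W" and tr: "\<And>w. w \<in> W \<Longrightarrow> (\<forall>c\<in>C. w \<bullet> c = 0) \<Longrightarrow> w = 0"
  shows "dim (C \<inter> {x. \<forall>w\<in>W. w \<bullet> x = 0}) + dim W \<le> dim C"
proof -
  let ?Cp = "{y \<in> UNIV. \<forall>x\<in>C. orthogonal x y}"
  let ?K = "C \<inter> {x. \<forall>w\<in>W. w \<bullet> x = 0}"
  have sK: "subspace ?K"
    using assms(1) unfolding subspace_def by (auto simp: inner_add_right)
  have sC: "subspace ?Cp" unfolding subspace_def by (auto simp: orthogonal_def inner_add_right)
  have d1: "dim ?Cp + dim C = CARD('d)"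
    using dim_subspace_orthogonal_to_vectors[OF assms(1) subspace_UNIV] by simp
  have d2: "dim {y \<in> UNIV. \<forall>x\<in>?K. orthogonal x y} + dim ?K = CARD('d)"
    using dim_subspace_orthogonal_to_vectors[OF sK subspace_UNIV] by simp
  have "?Cp \<inter> W \<subseteq> {0}" using tr by (auto simp: orthogonal_def inner_commute)
  then have "dim (?Cp \<inter> W) = 0" by (simp add: dim_eq_0)
  then have d3: "dim {x + y |x y. x \<in> ?Cp \<and> y \<in> W} = dim ?Cp + dim W"
    using dim_sums_Int[OF sC assms(2)] by linarith
  have "{x + y |x y. x \<in> ?Cp \<and> y \<in> W} \<subseteq> {y \<in> UNIV. \<forall>x\<in>?K. orthogonal x y}"
    by (auto simp: orthogonal_def inner_add_right inner_commute)
  from dim_subset[OF this] show ?thesis using d1 d2 d3 by linarith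
qed

subsection \<open>Subexponential sequences\<close>

text \<open>Neither [S] nor the central exponents provide a rate, so all bounds are kept in this
  class. It is closed under products, partial sums and reindexing by sequences of linear
  growth.\<close>

definition subexp :: "(nat \<Rightarrow> real) \<Rightarrow> bool" where
  "subexp f \<longleftrightarrow> (\<forall>\<epsilon>>0. \<exists>C>0. \<forall>m. \<bar>f m\<bar> \<le> C * exp (\<epsilon> * real m))"

lemma subexpD: "subexp f \<Longrightarrow> \<epsilon> > 0 \<Longrightarrow> \<exists>C>0. \<forall>m. \<bar>f m\<bar> \<le> C * exp (\<epsilon> * real m)"
  unfolding subexp_def by blast

lemma subexp_mono:
  assumes "subexp g" "\<And>m. \<bar>f m\<bar> \<le> g m"
  shows "subexp f"
  unfolding subexp_def
proof (intro allI impI)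
  fix \<epsilon> :: real assume "\<epsilon> > 0"
  then obtain C where C: "C > 0" "\<forall>m. \<bar>g m\<bar> \<le> C * exp (\<epsilon> * real m)" using subexpD[OF assms(1)] by blast
  have "\<bar>f m\<bar> \<le> C * exp (\<epsilon> * real m)" for m using assms(2)[of m] spec[OF C(2), of m] by linarith
  then show "\<exists>C>0. \<forall>m. \<bar>f m\<bar> \<le> C * exp (\<epsilon> * real m)" using C(1) by blast
qed

lemma subexp_const: "subexp (\<lambda>m. c)"
  unfolding subexp_def
proof (intro allI impI)
  fix \<epsilon> :: real assume "\<epsilon> > 0"
  then have "\<bar>c\<bar> \<le> (\<bar>c\<bar> + 1) * exp (\<epsilon> * real m)" for m
    using mult_mono[of "\<bar>c\<bar>" "\<bar>c\<bar> + 1" 1 "exp (\<epsilon> * real m)"] by simp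
  then show "\<exists>C>0. \<forall>m. \<bar>c\<bar> \<le> C * exp (\<epsilon> * real m)" by (intro exI[of _ "\<bar>c\<bar> + 1"]) auto
qed

lemma subexp_add:
  assumes "subexp f" "subexp g"
  shows "subexp (\<lambda>m. f m + g m)"
  unfolding subexp_def
proof (intro allI impI)
  fix \<epsilon> :: real assume "\<epsilon> > 0"
  obtain C where C: "C > 0" "\<forall>m. \<bar>f m\<bar> \<le> C * exp (\<epsilon> * real m)" using subexpD[OF assms(1) \<open>\<epsilon> > 0\<close>] by blast
  obtain D where D: "D > 0" "\<forall>m. \<bar>g m\<bar> \<le> D * exp (\<epsilon> * real m)" using subexpD[OF assms(2) \<open>\<epsilon> > 0\<close>] by blast
  have "\<bar>f m + g m\<bar> \<le> (C + D) * exp (\<epsilon> * real m)" for m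
    using spec[OF C(2), of m] spec[OF D(2), of m] by (simp add: distrib_right)
  then show "\<exists>C>0. \<forall>m. \<bar>f m + g m\<bar> \<le> C * exp (\<epsilon> * real m)" using C D by (intro exI[of _ "C + D"]) auto
qed

lemma subexp_mult:
  assumes "subexp f" "subexp g"
  shows "subexp (\<lambda>m. f m * g m)"
  unfolding subexp_def
proof (intro allI impI)
  fix \<epsilon> :: real assume "\<epsilon> > 0"
  then have e: "\<epsilon> / 2 > 0" by simp
  obtain C where C: "C > 0" "\<forall>m. \<bar>f m\<bar> \<le> C * exp (\<epsilon> / 2 * real m)" using subexpD[OF assms(1) e] by blast
  obtain D where D: "D > 0" "\<forall>m. \<bar>g m\<bar> \<le> D * exp (\<epsilon> / 2 * real m)" using subexpD[OF assms(2) e] by blast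
  have "\<bar>f m * g m\<bar> \<le> (C * D) * exp (\<epsilon> * real m)" for m
  proof -
    have "\<bar>f m\<bar> * \<bar>g m\<bar> \<le> (C * exp (\<epsilon> / 2 * real m)) * (D * exp (\<epsilon> / 2 * real m))"
      using C D by (intro mult_mono) auto
    also have "\<dots> = (C * D) * (exp (\<epsilon> / 2 * real m) * exp (\<epsilon> / 2 * real m))" by simp
    also have "exp (\<epsilon> / 2 * real m) * exp (\<epsilon> / 2 * real m) = exp (\<epsilon> * real m)"
      by (simp add: exp_add[symmetric] field_simps)
    finally show ?thesis by (simp add: abs_mult)
  qed
  then show "\<exists>C>0. \<forall>m. \<bar>f m * g m\<bar> \<le> C * exp (\<epsilon> * real m)" using C D by (intro exI[of _ "C * D"]) auto
qed

lemma subexp_real: "subexp real"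
  unfolding subexp_def
proof (intro allI impI)
  fix \<epsilon> :: real assume e: "\<epsilon> > 0"
  have "\<bar>real m\<bar> \<le> 1 / \<epsilon> * exp (\<epsilon> * real m)" for m
  proof -
    have "\<epsilon> * real m \<le> exp (\<epsilon> * real m)" using exp_ge_add_one_self[of "\<epsilon> * real m"] by linarith
    then show ?thesis using e by (simp add: field_simps)
  qed
  then show "\<exists>C>0. \<forall>m. \<bar>real m\<bar> \<le> C * exp (\<epsilon> * real m)" using e by (intro exI[of _ "1 / \<epsilon>"]) auto
qed

lemma subexp_sum:
  assumes "subexp f"
  shows "subexp (\<lambda>m. \<Sum>k<m. f k)"
proof -
  have "subexp (\<lambda>m. \<Sum>k<m. \<bar>f k\<bar>)"
    unfolding subexp_def
  proof (intro allI impI)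
    fix \<epsilon> :: real assume "\<epsilon> > 0"
    then have e: "\<epsilon> / 2 > 0" by simp
    obtain C where C: "C > 0" "\<forall>m. \<bar>f m\<bar> \<le> C * exp (\<epsilon> / 2 * real m)" using subexpD[OF assms e] by blast
    obtain D where D: "D > 0" "\<forall>m. \<bar>real m\<bar> \<le> D * exp (\<epsilon> / 2 * real m)" using subexpD[OF subexp_real e] by blast
    have "\<bar>\<Sum>k<m. \<bar>f k\<bar>\<bar> \<le> (C * D) * exp (\<epsilon> * real m)" for m
    proof -
      have "(\<Sum>k<m. \<bar>f k\<bar>) \<le> (\<Sum>k<m. C * exp (\<epsilon> / 2 * real m))"
      proof (rule sum_mono)
        fix k assume "k \<in> {..<m}"
        then have "exp (\<epsilon> / 2 * real k) \<le> exp (\<epsilon> / 2 * real m)" using e by auto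
        then show "\<bar>f k\<bar> \<le> C * exp (\<epsilon> / 2 * real m)"
          using spec[OF C(2), of k] C(1) by (meson mult_left_mono order_trans less_imp_le)
      qed
      also have "\<dots> = real m * (C * exp (\<epsilon> / 2 * real m))" by simp
      also have "\<dots> \<le> (D * exp (\<epsilon> / 2 * real m)) * (C * exp (\<epsilon> / 2 * real m))"
        using spec[OF D(2), of m] C(1) by (intro mult_right_mono) auto
      also have "\<dots> = (C * D) * (exp (\<epsilon> / 2 * real m) * exp (\<epsilon> / 2 * real m))" by simp
      also have "exp (\<epsilon> / 2 * real m) * exp (\<epsilon> / 2 * real m) = exp (\<epsilon> * real m)"
        by (simp add: exp_add[symmetric] field_simps)
      finally show ?thesis by (simp add: sum_nonneg)
    qed
    then show "\<exists>C>0. \<forall>m. \<bar>\<Sum>k<m. \<bar>f k\<bar>\<bar> \<le> C * exp (\<epsilon> * real m)" using C D by (intro exI[of _ "C * D"]) auto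
  qed
  then show ?thesis by (rule subexp_mono) (rule sum_abs)
qed

lemma subexp_Suc:
  assumes "subexp f"
  shows "subexp (\<lambda>m. f (Suc m))"
  unfolding subexp_def
proof (intro allI impI)
  fix \<epsilon> :: real assume "\<epsilon> > 0"
  then obtain C where C: "C > 0" "\<forall>m. \<bar>f m\<bar> \<le> C * exp (\<epsilon> * real m)" using subexpD[OF assms(1)] by blast
  have "\<bar>f (Suc m)\<bar> \<le> (C * exp \<epsilon>) * exp (\<epsilon> * real m)" for m
    using spec[OF C(2), of "Suc m"] by (simp add: exp_add algebra_simps)
  then show "\<exists>C>0. \<forall>m. \<bar>f (Suc m)\<bar> \<le> C * exp (\<epsilon> * real m)" using C by (intro exI[of _ "C * exp \<epsilon>"]) auto
qed

text \<open>Here the limits required of \<open>n\<close> and \<kappa> are used: since the times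
  \<open>n (\<kappa> m)\<close> grow at most linearly, being subexponential in time implies being
  subexponential in m.\<close>

lemma subexp_reindex:
  assumes "subexp f" and N: "\<And>m. real (N m) \<le> c * real m + b"
  shows "subexp (\<lambda>m. f (N m))"
  unfolding subexp_def
proof (intro allI impI)
  fix \<epsilon> :: real assume "\<epsilon> > 0"
  define c' where "c' = \<bar>c\<bar> + 1"
  have c': "c' > 0" "c \<le> c'" unfolding c'_def by auto
  have e: "\<epsilon> / c' > 0" using \<open>\<epsilon> > 0\<close> c' by simp
  obtain C where C: "C > 0" "\<forall>m. \<bar>f m\<bar> \<le> C * exp (\<epsilon> / c' * real m)" using subexpD[OF assms(1) e] by blast
  have "\<bar>f (N m)\<bar> \<le> (C * exp (\<epsilon> / c' * b)) * exp (\<epsilon> * real m)" for m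
  proof -
    have "real (N m) \<le> c' * real m + b" using N[of m] c' mult_right_mono[of c c' "real m"] by simp
    then have "\<epsilon> / c' * real (N m) \<le> \<epsilon> / c' * (c' * real m + b)" using e by (intro mult_left_mono) auto
    also have "\<dots> = \<epsilon> / c' * b + \<epsilon> * real m" using c' by (simp add: field_simps)
    finally have "exp (\<epsilon> / c' * real (N m)) \<le> exp (\<epsilon> / c' * b) * exp (\<epsilon> * real m)" by (simp add: exp_add[symmetric])
    then have "C * exp (\<epsilon> / c' * real (N m)) \<le> C * (exp (\<epsilon> / c' * b) * exp (\<epsilon> * real m))" using C by (intro mult_left_mono) auto
    then show ?thesis using spec[OF C(2), of "N m"] by simp
  qed
  then show "\<exists>C>0. \<forall>m. \<bar>f (N m)\<bar> \<le> C * exp (\<epsilon> * real m)" using C by (intro exI[of _ "C * exp (\<epsilon> / c' * b)"]) auto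
qed

lemma subexp_eventually:
  assumes "\<And>\<epsilon>. \<epsilon> > 0 \<Longrightarrow> \<forall>\<^sub>F m in sequentially. \<bar>f m\<bar> \<le> exp (\<epsilon> * real m)"
  shows "subexp f"
  unfolding subexp_def
proof (intro allI impI)
  fix \<epsilon> :: real assume e: "\<epsilon> > 0"
  obtain M where M: "\<And>m. m \<ge> M \<Longrightarrow> \<bar>f m\<bar> \<le> exp (\<epsilon> * real m)"
    using assms[OF e] unfolding eventually_sequentially by blast
  let ?C = "1 + (\<Sum>k<M. \<bar>f k\<bar>)"
  have C: "?C \<ge> 1" by (simp add: sum_nonneg)
  have "\<bar>f m\<bar> \<le> ?C * exp (\<epsilon> * real m)" for m
  proof (cases "m < M")
    case True
    then have "\<bar>f m\<bar> \<le> (\<Sum>k<M. \<bar>f k\<bar>)" by (intro member_le_sum) auto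
    then have "\<bar>f m\<bar> \<le> ?C * 1" by simp
    also have "\<dots> \<le> ?C * exp (\<epsilon> * real m)" using e C by (intro mult_left_mono) auto
    finally show ?thesis .
  next
    case False
    then have "\<bar>f m\<bar> \<le> 1 * exp (\<epsilon> * real m)" using M by simp
    also have "\<dots> \<le> ?C * exp (\<epsilon> * real m)" using C by (intro mult_right_mono) auto
    finally show ?thesis .
  qed
  moreover have "?C > 0" using C by linarith
  ultimately show "\<exists>C>0. \<forall>m. \<bar>f m\<bar> \<le> C * exp (\<epsilon> * real m)" by blast
qed

lemma subexp_of_log_limit:
  assumes "(\<lambda>m. 1 / real m * ln (f m)) \<longlonglongrightarrow> 0" "\<And>m. f m > 0"
  shows "subexp f" "subexp (\<lambda>m. 1 / f m)"
proof -
  have *: "\<forall>\<^sub>F m in sequentially. f m \<le> exp (\<epsilon> * real m) \<and> 1 / f m \<le> exp (\<epsilon> * real m)" if "\<epsilon> > 0" for \<epsilon>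
  proof -
    have "\<forall>\<^sub>F m in sequentially. dist (1 / real m * ln (f m)) 0 < \<epsilon>" using assms(1) that by (rule tendstoD)
    then show ?thesis using eventually_gt_at_top[of 0]
    proof eventually_elim
      case (elim m)
      then have "\<bar>ln (f m)\<bar> < \<epsilon> * real m" by (simp add: field_simps abs_mult)
      then have "ln (f m) \<le> \<epsilon> * real m" "- ln (f m) \<le> \<epsilon> * real m" by auto
      then have "exp (ln (f m)) \<le> exp (\<epsilon> * real m)" "exp (- ln (f m)) \<le> exp (\<epsilon> * real m)" by auto
      then show ?case using assms(2)[of m] by (simp add: exp_minus inverse_eq_divide)
    qed
  qed
  show "subexp f"
    by (rule subexp_eventually) (use *[THEN eventually_mono] assms(2) in \<open>auto simp: less_imp_le\<close>)
  show "subexp (\<lambda>m. 1 / f m)"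
    by (rule subexp_eventually) (use *[THEN eventually_mono] assms(2) in \<open>auto simp: less_imp_le\<close>)
qed

section \<open>Projections, central growth and the shadowing error under the RDC\<close>

lemma dim_le_one_line:
  fixes V :: "(real ^ 'd::finite) set"
  assumes "subspace V" "dim V \<le> 1"
  obtains u where "u \<in> V" "norm u \<le> 1" "u = 0 \<or> norm u = 1" "\<And>x. x \<in> V \<Longrightarrow> \<exists>t. x = t *\<^sub>R u"
proof -
  obtain B where B: "B \<subseteq> V" "pairwise orthogonal B" "\<And>x. x \<in> B \<Longrightarrow> norm x = 1" "independent B" "card B = dim V" "span B = V"
    using orthonormal_basis_subspace[OF assms(1)] by metis
  have fB: "finite B" using B(4) independent_imp_finite by blast
  show ?thesis
  proof (cases "B = {}")
    case True
    then have "V = {0}" using B(6) by simp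
    then show ?thesis using that[of 0] by simp
  next
    case False
    then have "card B \<noteq> 0" using fB by simp
    then have "card B = 1" using assms(2) B(5) by linarith
    then obtain u where u: "B = {u}" by (auto simp: card_1_singleton_iff)
    have "\<exists>t. x = t *\<^sub>R u" if "x \<in> V" for x using that B(6) unfolding u span_singleton by auto
    then show ?thesis using that[of u] B(1,3) unfolding u by auto
  qed
qed

text \<open>Linear algebra separated from the dynamics: M is the cocycle of the standard map, and
  \<open>b i h\<close> is the vertex functional of h transported to time i. By \<open>b_gap\<close>
  a functional cannot become small without vanishing, and \<open>b_dim\<close> is the dimension
  count that leaves at most one central direction uncontrolled.\<close>

locale rdc_setting =
  fixes M :: "nat \<Rightarrow> nat \<Rightarrow> real ^ 'd::finite ^ 'd"
    and \<Gamma> :: "'d splitting" and n \<kappa> :: "nat \<Rightarrow> nat"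
    and b :: "nat \<Rightarrow> 'h \<Rightarrow> real ^ 'd"
    and \<theta> C\<^sub>0 K\<^sub>m K\<^sub>p \<delta> :: real
  assumes compose: "\<And>i j k w. i \<le> j \<Longrightarrow> j \<le> k \<Longrightarrow> M j k *v (M i j *v w) = M i k *v w"
    and same: "\<And>i w. M i i *v w = w"
    and inv_left: "\<And>i j w. i \<le> j \<Longrightarrow> matrix_inv (M i j) *v (M i j *v w) = w"
    and inv_right: "\<And>i j w. i \<le> j \<Longrightarrow> M i j *v (matrix_inv (M i j) *v w) = w"
    and onorm_ge: "\<And>i j. i \<le> j \<Longrightarrow> 1 \<le> onorm ((*v) (M i j))"
    and sub: "\<And>x i. subspace (\<Gamma> x i)"
    and dec: "\<And>i w. \<exists>!f. decomposes \<Gamma> i w f"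
    and inv: "\<And>x i j. i \<le> j \<Longrightarrow> (\<lambda>w. M i j *v w) ` \<Gamma> x i = \<Gamma> x j"
    and \<theta>: "\<theta> > 0" "C\<^sub>0 > 0"
    and stable: "\<And>i w. w \<in> \<Gamma> Stable 0 \<Longrightarrow> norm (M 0 i *v w) \<le> C\<^sub>0 * exp (- \<theta> * real i) * norm w"
    and unstable: "\<And>i w. w \<in> \<Gamma> Unstable i \<Longrightarrow> norm (matrix_inv (M 0 i) *v w) \<le> C\<^sub>0 * exp (- \<theta> * real i) * norm w"
    and central: "\<And>w. w \<in> \<Gamma> Central 0 \<Longrightarrow> w \<noteq> 0 \<Longrightarrow> (\<lambda>i. 1 / real i * ln (norm (M 0 i *v w))) \<longlonglongrightarrow> 0"
    and n: "n 0 = 0" "mono n" "strict_mono \<kappa>"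
    and linear_growth: "\<exists>c e. \<forall>m. real (n (\<kappa> m)) \<le> c * real m + e"
    and N_unbounded: "filterlim (\<lambda>m. n (\<kappa> m)) at_top sequentially"
    and condB: "\<And>m. (\<Sum>k = 1..\<kappa> m. onorm_on ((*v) (M (n k) (n (\<kappa> m)))) (\<Gamma> Stable (n k)) *
            onorm (splitting_proj \<Gamma> Stable (n k)) * onorm ((*v) (M (n (k - 1)) (n k)))) \<le> K\<^sub>m"
    and condF: "\<And>m. summable (\<lambda>i. onorm_on ((*v) (matrix_inv (M (n (\<kappa> m)) (n (\<kappa> m + 1 + i))))) (\<Gamma> Unstable (n (\<kappa> m + 1 + i))) *
            onorm (splitting_proj \<Gamma> Unstable (n (\<kappa> m + 1 + i))) * onorm ((*v) (M (n (\<kappa> m + 1 + i - 1)) (n (\<kappa> m + 1 + i)))))"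
      "\<And>m. (\<Sum>i. onorm_on ((*v) (matrix_inv (M (n (\<kappa> m)) (n (\<kappa> m + 1 + i))))) (\<Gamma> Unstable (n (\<kappa> m + 1 + i))) *
            onorm (splitting_proj \<Gamma> Unstable (n (\<kappa> m + 1 + i))) * onorm ((*v) (M (n (\<kappa> m + 1 + i - 1)) (n (\<kappa> m + 1 + i))))) \<le> K\<^sub>p"
    and condS: "(\<lambda>m. 1 / real m * ln (onorm ((*v) (M (n (\<kappa> m)) (n (\<kappa> (Suc m))))))) \<longlonglongrightarrow> 0"
    and condA: "\<delta> > 0" "\<And>m x y. x \<noteq> y \<Longrightarrow> min_angle (\<Gamma> x (n (\<kappa> m))) (\<Gamma> y (n (\<kappa> m))) > \<delta>"
    and b_inv: "\<And>i h w. b i h \<bullet> (M 0 i *v w) = b 0 h \<bullet> w"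
    and b_bound: "\<And>h. \<exists>C. \<forall>i. norm (b i h) \<le> C"
    and b_gap: "\<And>h. \<exists>c>0. \<forall>i. b i h \<noteq> 0 \<longrightarrow> c \<le> norm (b i h)"
    and b_sub: "subspace (range (b 0))"
    and b_dim: "dim (\<Gamma> Central 0) \<le> dim (range (b 0)) + 1"
begin

abbreviation "P \<equiv> splitting_proj \<Gamma>"

lemma P_decomposes: "decomposes \<Gamma> i w (\<lambda>x. P x i w)"
  using theI'[OF dec[of i w]] unfolding splitting_proj_def by simp

lemma P_mem: "P x i w \<in> \<Gamma> x i" and P_sum: "w = P Stable i w + P Central i w + P Unstable i w"
  using P_decomposes[of i w] unfolding decomposes_def by auto

lemma P_unique: "decomposes \<Gamma> i w f \<Longrightarrow> P x i w = f x"
  using dec[of i w] P_decomposes[of i w] by (metis (no_types, lifting))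

lemma P_add: "P x i (v + w) = P x i v + P x i w"
proof (rule P_unique)
  show "decomposes \<Gamma> i (v + w) (\<lambda>x. P x i v + P x i w)"
    unfolding decomposes_def
  proof (intro conjI allI)
    show "P y i v + P y i w \<in> \<Gamma> y i" for y using P_mem subspace_add[OF sub] by blast
    have "v + w = (P Stable i v + P Central i v + P Unstable i v) + (P Stable i w + P Central i w + P Unstable i w)"
      using P_sum[of v i] P_sum[of w i] by simp
    then show "v + w = P Stable i v + P Stable i w + (P Central i v + P Central i w) + (P Unstable i v + P Unstable i w)"
      by (simp add: algebra_simps)
  qed
qed

lemma P_scale: "P x i (c *\<^sub>R w) = c *\<^sub>R P x i w"
proof (rule P_unique)
  have "c *\<^sub>R w = c *\<^sub>R (P Stable i w + P Central i w + P Unstable i w)" using P_sum[of w i] by simp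
  then show "decomposes \<Gamma> i (c *\<^sub>R w) (\<lambda>x. c *\<^sub>R P x i w)"
    using P_mem[of _ i w] subspace_scale[OF sub] unfolding decomposes_def by (simp add: scaleR_add_right)
qed

lemma P_linear: "linear (P x i)"
  by (rule linearI) (rule P_add P_scale)+

lemma P_bounded_linear: "bounded_linear (P x i)"
  using P_linear linear_conv_bounded_linear by blast

lemma M_mem: "i \<le> j \<Longrightarrow> w \<in> \<Gamma> x i \<Longrightarrow> M i j *v w \<in> \<Gamma> x j"
  using inv[of i j x] by blast

lemma Minv_mem: "i \<le> j \<Longrightarrow> w \<in> \<Gamma> x j \<Longrightarrow> matrix_inv (M i j) *v w \<in> \<Gamma> x i"
  using inv[of i j x] inv_left[of i j] by (metis imageE)

lemma P_M: "i \<le> j \<Longrightarrow> P x j (M i j *v w) = M i j *v P x i w"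
proof (rule P_unique)
  assume ij: "i \<le> j"
  have "M i j *v w = M i j *v (P Stable i w + P Central i w + P Unstable i w)" using P_sum[of w i] by simp
  then show "decomposes \<Gamma> j (M i j *v w) (\<lambda>x. M i j *v P x i w)"
    unfolding decomposes_def using M_mem[OF ij P_mem] by (simp add: matrix_vector_right_distrib)
qed

lemma Minv_compose:
  assumes "i \<le> j" "j \<le> k"
  shows "matrix_inv (M i j) *v (matrix_inv (M j k) *v w) = matrix_inv (M i k) *v w"
proof -
  let ?z = "matrix_inv (M i j) *v (matrix_inv (M j k) *v w)"
  have "M i k *v ?z = M j k *v (M i j *v ?z)" using compose[OF assms] by simp
  also have "\<dots> = w" using inv_right assms by simp
  finally show ?thesis using inv_left[of i k ?z] assms by simp
qed

lemma onorm_on_bdd: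
  fixes R :: "real ^ 'd ^ 'd"
  shows "bdd_above ((\<lambda>w. norm (R *v w)) ` {w \<in> V. norm w \<le> 1})"
proof (rule bdd_aboveI2)
  fix x assume "x \<in> {w \<in> V. norm w \<le> 1}"
  then have "onorm ((*v) R) * norm x \<le> onorm ((*v) R) * 1"
    using onorm_pos_le[OF matrix_vector_mul_bounded_linear, of R] by (intro mult_left_mono) auto
  then show "norm (R *v x) \<le> onorm ((*v) R)"
    using onorm[OF matrix_vector_mul_bounded_linear, of R x] by simp
qed

lemma onorm_on_bound:
  fixes R :: "real ^ 'd ^ 'd"
  assumes "subspace V" "w \<in> V"
  shows "norm (R *v w) \<le> onorm_on ((*v) R) V * norm w"
proof (cases "w = 0")
  case False
  let ?u = "(1 / norm w) *\<^sub>R w"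
  have "?u \<in> {w \<in> V. norm w \<le> 1}" using subspace_scale[OF assms] False by simp
  then have "norm (R *v ?u) \<le> onorm_on ((*v) R) V" unfolding onorm_on_def by (rule cSUP_upper[OF _ onorm_on_bdd])
  moreover have "norm (R *v ?u) = norm (R *v w) / norm w"
    using False by (simp add: matrix_vector_mult_scaleR)
  ultimately show ?thesis using False by (simp add: divide_le_eq)
qed simp

lemma onorm_on_nonneg:
  fixes R :: "real ^ 'd ^ 'd"
  shows "subspace V \<Longrightarrow> 0 \<le> onorm_on ((*v) R) V"
  unfolding onorm_on_def
  by (rule cSUP_upper2[OF onorm_on_bdd, of 0]) (auto intro: subspace_0)

lemma n_le: "i \<le> j \<Longrightarrow> n i \<le> n j"
  using n(2) by (rule monoD)

lemma \<kappa>_le: "i \<le> j \<Longrightarrow> \<kappa> i \<le> \<kappa> j"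
  using n(3) by (simp add: strict_mono_less_eq)

abbreviation "N m \<equiv> n (\<kappa> m)"

text \<open>The last summand of [B], k = \<open>\<kappa> m\<close>, contains the norm of the
  identity on a nonzero stable space and the norm of a cocycle matrix. Both are at least 1, so this
  summand bounds the projection. It is present as soon as \<open>\<kappa> m\<close> is positive,
  hence the condition on m.\<close>

lemma P_stable_bound:
  assumes "m \<ge> 1"
  shows "norm (P Stable (N m) w) \<le> \<bar>K\<^sub>m\<bar> * norm w"
proof (cases "\<exists>u\<in>\<Gamma> Stable (N m). u \<noteq> 0")
  case True
  then obtain u where u: "u \<in> \<Gamma> Stable (N m)" "u \<noteq> 0" by blast
  have \<kappa>: "1 \<le> \<kappa> m" using assms strict_mono_imp_increasing[OF n(3), of m] by linarith
  let ?t = "\<lambda>k. onorm_on ((*v) (M (n k) (N m))) (\<Gamma> Stable (n k)) *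
            onorm (P Stable (n k)) * onorm ((*v) (M (n (k - 1)) (n k)))"
  have "?t (\<kappa> m) \<le> (\<Sum>k = 1..\<kappa> m. ?t k)"
    using \<kappa> by (intro member_le_sum mult_nonneg_nonneg onorm_on_nonneg sub
        onorm_pos_le P_bounded_linear matrix_vector_mul_bounded_linear) auto
  then have t: "?t (\<kappa> m) \<le> K\<^sub>m" using condB[of m] by linarith
  have 1: "1 \<le> onorm_on ((*v) (M (N m) (N m))) (\<Gamma> Stable (N m))"
    using onorm_on_bound[OF sub u(1), of "M (N m) (N m)"] u(2) unfolding same by simp
  have 2: "1 \<le> onorm ((*v) (M (n (\<kappa> m - 1)) (N m)))" by (rule onorm_ge) (rule n_le, simp)
  have 3: "0 \<le> onorm (P Stable (N m))" by (rule onorm_pos_le[OF P_bounded_linear])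
  have "1 * onorm (P Stable (N m)) * 1 \<le> ?t (\<kappa> m)"
    using 1 2 3 by (intro mult_mono) auto
  then have "onorm (P Stable (N m)) \<le> \<bar>K\<^sub>m\<bar>" using t by simp
  then have "onorm (P Stable (N m)) * norm w \<le> \<bar>K\<^sub>m\<bar> * norm w" by (rule mult_right_mono) simp
  then show ?thesis using onorm[OF P_bounded_linear, of Stable "N m" w] by linarith
next
  case False
  then have "P Stable (N m) w = 0" using P_mem by blast
  then show ?thesis by simp
qed

text \<open>The law of cosines for u and -v, combined with 2 |u| |v| <= |u|^2 + |v|^2. The value
  \<pi>/2 inserted in \<open>min_angle\<close> forces \<delta> < \<pi>/2, so cos \<delta> is
  nonnegative.\<close>

lemma angle_bound:
  assumes "x \<noteq> y" "u \<in> \<Gamma> x (N m)" "v \<in> \<Gamma> y (N m)"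
  shows "(1 - cos \<delta>) * (norm u)\<^sup>2 \<le> (norm (u + v))\<^sup>2" "0 < 1 - cos \<delta>"
proof -
  let ?S = "insert (pi / 2) {arccos (v \<bullet> w / (norm v * norm w)) | v w. v \<in> \<Gamma> x (N m) \<and> w \<in> \<Gamma> y (N m) \<and> v \<noteq> 0 \<and> w \<noteq> 0}"
  have cs: "\<bar>v \<bullet> w / (norm v * norm w)\<bar> \<le> 1" for v w :: "real ^ 'd"
    using Cauchy_Schwarz_ineq2[of v w] by (cases "norm v * norm w = 0") (auto simp: divide_le_eq abs_mult)
  have arc: "0 \<le> arccos (v \<bullet> w / (norm v * norm w))" for v w :: "real ^ 'd"
    using cs[of v w] unfolding abs_le_iff by (intro arccos_lbound) linarith+
  have bdd: "bdd_below ?S"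
  proof (rule bdd_belowI[of _ 0])
    have "0 \<le> pi / 2" by simp
    then show "0 \<le> s" if "s \<in> ?S" for s using that arc by blast
  qed
  have \<delta>: "\<delta> < s" if "s \<in> ?S" for s
    using condA(2)[OF assms(1), of m] cInf_lower[OF that bdd] unfolding min_angle_def by linarith
  have \<delta>2: "0 < \<delta>" "\<delta> < pi / 2" using condA(1) \<delta>[of "pi / 2"] by auto
  have "cos \<delta> < cos 0" using \<delta>2 by (intro cos_monotone_0_pi) auto
  then show pos: "0 < 1 - cos \<delta>" by simp
  have cpos: "0 \<le> cos \<delta>" using \<delta>2 by (intro cos_ge_zero) auto
  show "(1 - cos \<delta>) * (norm u)\<^sup>2 \<le> (norm (u + v))\<^sup>2"
  proof (cases "u = 0 \<or> v = 0")
    case True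
    have "(1 - cos \<delta>) * (norm u)\<^sup>2 \<le> 1 * (norm u)\<^sup>2" using cpos by (intro mult_right_mono) auto
    then show ?thesis using True by auto
  next
    case False
    let ?c = "- (u \<bullet> v) / (norm u * norm v)"
    have "- v \<in> \<Gamma> y (N m)" using subspace_neg[OF sub assms(3)] .
    then have "arccos (u \<bullet> (- v) / (norm u * norm (- v))) \<in> ?S"
      using assms(2) False by (intro insertI2 CollectI exI[of _ u] exI[of _ "- v"]) auto
    then have "\<delta> < arccos ?c" using \<delta> by fastforce
    moreover have "\<bar>?c\<bar> \<le> 1" using cs[of u "- v"] by simp
    then have "arccos ?c \<le> pi" unfolding abs_le_iff by (intro arccos_ubound) linarith+
    ultimately have "cos (arccos ?c) < cos \<delta>" using \<delta>2 by (intro cos_monotone_0_pi) auto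
    then have "?c < cos \<delta>" using cs[of u "- v"] by (simp add: cos_arccos_abs)
    moreover have "0 < norm u * norm v" using False by simp
    ultimately have "- (u \<bullet> v) < cos \<delta> * (norm u * norm v)" by (simp only: pos_divide_less_eq)
    moreover have "(norm (u + v))\<^sup>2 = (norm u)\<^sup>2 + (norm v)\<^sup>2 + 2 * (u \<bullet> v)"
      by (simp add: power2_norm_eq_inner inner_add inner_commute)
    ultimately have "(norm (u + v))\<^sup>2 \<ge> (norm u)\<^sup>2 + (norm v)\<^sup>2 - 2 * (cos \<delta> * (norm u * norm v))"
      by linarith
    moreover have "2 * (cos \<delta> * (norm u * norm v)) \<le> cos \<delta> * ((norm u)\<^sup>2 + (norm v)\<^sup>2)"
      using mult_left_mono[OF sum_squares_bound[of "norm u" "norm v"] cpos] by (simp add: algebra_simps)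
    moreover have "0 \<le> (1 - cos \<delta>) * (norm v)\<^sup>2" using pos by simp
    ultimately show ?thesis by (simp add: algebra_simps)
  qed
qed

text \<open>Lower bounds for pairwise angles do not control the projections of a splitting into
  three spaces, which may be nearly coplanar lines. Once the stable component, bounded by [B], is
  removed, two spaces are left, and the angle between them suffices.\<close>

lemma P_bound: "\<exists>K>0. \<forall>m\<ge>1. \<forall>x w. norm (P x (N m) w) \<le> K * norm w"
proof -
  define s where "s = sqrt (1 - cos \<delta>)"
  have s: "s > 0" unfolding s_def using angle_bound(2)[of Stable Central 0 0 0] subspace_0[OF sub] by simp
  define K where "K = (\<bar>K\<^sub>m\<bar> + 1) * (1 + 1 / s)"
  have ang: "s * norm u \<le> norm (u + v)" if "x \<noteq> y" "u \<in> \<Gamma> x (N m)" "v \<in> \<Gamma> y (N m)" for u v x y m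
  proof (rule power2_le_imp_le)
    show "(s * norm u)\<^sup>2 \<le> (norm (u + v))\<^sup>2"
      using angle_bound[OF that] unfolding s_def power_mult_distrib by simp
  qed simp
  have K1: "\<bar>K\<^sub>m\<bar> \<le> K" "(\<bar>K\<^sub>m\<bar> + 1) / s \<le> K" unfolding K_def using s by (auto simp: field_simps)
  have "norm (P x (N m) w) \<le> K * norm w" if m: "m \<ge> 1" for m x w
  proof -
    have st: "norm (P Stable (N m) w) \<le> \<bar>K\<^sub>m\<bar> * norm w" by (rule P_stable_bound[OF m])
    have cu: "norm (P Central (N m) w + P Unstable (N m) w) \<le> (\<bar>K\<^sub>m\<bar> + 1) * norm w"
    proof -
      have "P Central (N m) w + P Unstable (N m) w = w - P Stable (N m) w"
        using P_sum[of w "N m"] by (simp add: algebra_simps)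
      then have "norm (P Central (N m) w + P Unstable (N m) w) \<le> norm w + norm (P Stable (N m) w)"
        using norm_triangle_ineq4[of w "P Stable (N m) w"] by simp
      then show ?thesis using st by (simp add: distrib_right)
    qed
    have c: "s * norm (P Central (N m) w) \<le> norm (P Central (N m) w + P Unstable (N m) w)"
      by (rule ang[of Central Unstable]) (auto intro: P_mem)
    have u: "s * norm (P Unstable (N m) w) \<le> norm (P Unstable (N m) w + P Central (N m) w)"
      by (rule ang[of Unstable Central]) (auto intro: P_mem)
    have "norm (P Central (N m) w) \<le> (\<bar>K\<^sub>m\<bar> + 1) / s * norm w" "norm (P Unstable (N m) w) \<le> (\<bar>K\<^sub>m\<bar> + 1) / s * norm w"
      using c u cu s by (auto simp: field_simps add.commute)
    then show ?thesis
      using st K1 mult_right_mono[OF K1(1), of "norm w"] mult_right_mono[OF K1(2), of "norm w"]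
      by (cases x) auto
  qed
  moreover have "K > 0" unfolding K_def using s by (simp add: add_pos_pos add_nonneg_pos)
  ultimately show ?thesis by blast
qed


lemma exp_decay: "(\<lambda>i. K * exp (- \<theta> * real i)) \<longlonglongrightarrow> 0"
proof -
  have "norm (exp (- \<theta>)) < 1" using \<theta>(1) by simp
  then have "(\<lambda>i. exp (- \<theta>) ^ i) \<longlonglongrightarrow> 0" by (rule LIMSEQ_power_zero)
  then have "(\<lambda>i. K * exp (- \<theta>) ^ i) \<longlonglongrightarrow> K * 0" by (rule tendsto_mult[OF tendsto_const])
  moreover have "exp (- \<theta>) ^ i = exp (- \<theta> * real i)" for i
    using exp_of_nat_mult[of i "- \<theta>"] by (simp add: mult.commute)
  ultimately show ?thesis by simp
qed

text \<open>The pairing does not depend on the time, while the functional stays bounded and the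
  stable vector tends to 0.\<close>

lemma b_stable:
  assumes "w \<in> \<Gamma> Stable 0"
  shows "b 0 h \<bullet> w = 0"
proof -
  obtain C where C: "\<And>i. norm (b i h) \<le> C" using b_bound by blast
  have C0: "C \<ge> 0" using C[of 0] norm_ge_zero[of "b 0 h"] by linarith
  have "\<bar>b 0 h \<bullet> w\<bar> \<le> (C * C\<^sub>0 * norm w) * exp (- \<theta> * real i)" for i
  proof -
    have "\<bar>b 0 h \<bullet> w\<bar> \<le> norm (b i h) * norm (M 0 i *v w)"
      unfolding b_inv[symmetric, of h w i] by (rule Cauchy_Schwarz_ineq2)
    also have "\<dots> \<le> C * (C\<^sub>0 * exp (- \<theta> * real i) * norm w)"
      using C stable[OF assms] C0 by (intro mult_mono) auto
    finally show ?thesis by (simp add: algebra_simps)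
  qed
  then have "\<bar>b 0 h \<bullet> w\<bar> \<le> 0" by (intro LIMSEQ_le_const[OF exp_decay]) blast
  then show ?thesis by simp
qed

text \<open>
  A functional vanishing on the stable and central spaces is carried by the unstable space, where it
  decays in the past; its coefficients range over a finite set, so it vanishes.
\<close>

lemma b_central:
  assumes c: "\<And>w. w \<in> \<Gamma> Central 0 \<Longrightarrow> b 0 h \<bullet> w = 0"
  shows "b 0 h = 0"
proof -
  obtain K where K: "K > 0" "\<And>m x w. m \<ge> 1 \<Longrightarrow> norm (P x (N m) w) \<le> K * norm w" using P_bound by blast
  obtain g where g: "g > 0" "\<And>i. b i h \<noteq> 0 \<Longrightarrow> g \<le> norm (b i h)" using b_gap by blast
  have tr: "b i h \<bullet> w = b 0 h \<bullet> (matrix_inv (M 0 i) *v w)" for i w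
    using b_inv[of i h "matrix_inv (M 0 i) *v w"] inv_right[of 0 i w] by simp
  let ?E = "\<lambda>i. (norm (b 0 h) * C\<^sub>0 * K) * exp (- \<theta> * real i)"
  \<comment> \<open>The functional is paired with its own coefficient vector. Only the unstable
    component contributes, and pulling it back to time 0 contracts it exponentially. The factor K
    from \<open>P_bound\<close> restricts this to the times \<open>N m\<close>.\<close>
  have small: "norm (b (N m) h) \<le> ?E (N m)" if m: "m \<ge> 1" for m
  proof -
    let ?i = "N m" and ?w = "b (N m) h"
    have "b ?i h \<bullet> ?w = b ?i h \<bullet> P Stable ?i ?w + b ?i h \<bullet> P Central ?i ?w + b ?i h \<bullet> P Unstable ?i ?w"
      using P_sum[of ?w ?i] by (metis inner_add_right)
    also have "b ?i h \<bullet> P Stable ?i ?w = 0" unfolding tr[of ?i] by (rule b_stable[OF Minv_mem[OF le0 P_mem]])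
    also have "b ?i h \<bullet> P Central ?i ?w = 0" unfolding tr[of ?i] by (rule c[OF Minv_mem[OF le0 P_mem]])
    finally have "norm ?w * norm ?w = b 0 h \<bullet> (matrix_inv (M 0 ?i) *v P Unstable ?i ?w)"
      using tr[of ?i "P Unstable ?i ?w"] by (simp add: power2_norm_eq_inner[symmetric] power2_eq_square)
    also have "\<dots> \<le> norm (b 0 h) * norm (matrix_inv (M 0 ?i) *v P Unstable ?i ?w)" by (rule norm_cauchy_schwarz)
    also have "\<dots> \<le> norm (b 0 h) * (C\<^sub>0 * exp (- \<theta> * real ?i) * norm (P Unstable ?i ?w))"
      by (intro mult_left_mono unstable P_mem) auto
    also have "\<dots> \<le> norm (b 0 h) * (C\<^sub>0 * exp (- \<theta> * real ?i) * (K * norm ?w))"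
      using K(2)[OF m] \<theta> by (intro mult_left_mono) auto
    also have "\<dots> = ?E ?i * norm ?w" by (simp add: algebra_simps)
    finally show ?thesis
    proof (cases "norm ?w = 0")
      case True
      then show ?thesis using K(1) \<theta> by simp
    next
      case False
      assume "norm ?w * norm ?w \<le> ?E ?i * norm ?w"
      then show ?thesis using False by (metis mult_right_le_imp_le norm_ge_zero order_le_less)
    qed
  qed
  have "(\<lambda>m. ?E (N m)) \<longlonglongrightarrow> 0" by (rule filterlim_compose[OF exp_decay N_unbounded])
  then have "\<forall>\<^sub>F m in sequentially. ?E (N m) < g" using g(1) by (rule order_tendstoD)
  then obtain m where m: "m \<ge> 1" "?E (N m) < g"
    using eventually_ge_at_top[of "1::nat"] eventually_happens[OF eventually_conj] by (metis (mono_tags, lifting) sequentially_bot)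
  have "b (N m) h = 0" using small[OF m(1)] g(2)[of "N m"] m(2) by force
  then have "b 0 h \<bullet> w = 0" for w using b_inv[of "N m" h w] by simp
  then show ?thesis using inner_eq_zero_iff by blast
qed

lemma M_nz: "w \<noteq> 0 \<Longrightarrow> M 0 i *v w \<noteq> 0"
  using inv_left[of 0 i w] by (metis le0 matrix_vector_mult_0_right)

text \<open>A basis reduces the uniform bound to finitely many vectors of exponent zero. This
  reduction works only from above: a combination of basis vectors may become much shorter than each
  of them.\<close>

lemma central_upper:
  assumes "\<epsilon> > 0"
  shows "\<exists>C>0. \<forall>i. \<forall>w\<in>\<Gamma> Central 0. norm (M 0 i *v w) \<le> C * exp (\<epsilon> * real i) * norm w"
proof -
  obtain B where B: "B \<subseteq> \<Gamma> Central 0" "pairwise orthogonal B" "\<And>x. x \<in> B \<Longrightarrow> norm x = 1" "independent B" "span B = \<Gamma> Central 0"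
    using orthonormal_basis_subspace[OF sub] by metis
  have fB: "finite B" using B(4) independent_imp_finite by blast
  have "\<exists>C>0. \<forall>i. \<bar>norm (M 0 i *v u)\<bar> \<le> C * exp (\<epsilon> * real i)" if "u \<in> B" for u
  proof (rule subexpD[OF subexp_of_log_limit(1) assms])
    have "u \<in> \<Gamma> Central 0" "u \<noteq> 0" using that B(1) B(3)[of u] by auto
    then show "(\<lambda>i. 1 / real i * ln (norm (M 0 i *v u))) \<longlonglongrightarrow> 0" "\<And>i. 0 < norm (M 0 i *v u)"
      using central M_nz by auto
  qed
  then obtain C where C: "\<And>u. u \<in> B \<Longrightarrow> C u > 0 \<and> (\<forall>i. norm (M 0 i *v u) \<le> C u * exp (\<epsilon> * real i))"
    by (metis abs_norm_cancel)
  have "norm (M 0 i *v w) \<le> (1 + (\<Sum>u\<in>B. C u)) * exp (\<epsilon> * real i) * norm w" if w: "w \<in> \<Gamma> Central 0" for i w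
  proof -
    have "w = (\<Sum>u\<in>B. (w \<bullet> u) *\<^sub>R u)"
      using orthonormal_basis_expand[OF B(2) B(3) _ fB] B(5) w by auto
    then have "M 0 i *v w = (\<Sum>u\<in>B. (w \<bullet> u) *\<^sub>R (M 0 i *v u))"
      by (metis (no_types, lifting) linear_sum matrix_vector_mul_linear matrix_vector_mult_scaleR sum.cong)
    then have "norm (M 0 i *v w) \<le> (\<Sum>u\<in>B. norm ((w \<bullet> u) *\<^sub>R (M 0 i *v u)))" by (simp only: norm_sum)
    also have "\<dots> \<le> (\<Sum>u\<in>B. norm w * (C u * exp (\<epsilon> * real i)))"
    proof (rule sum_mono)
      fix u assume u: "u \<in> B"
      have "\<bar>w \<bullet> u\<bar> \<le> norm w" using Cauchy_Schwarz_ineq2[of w u] B(3)[OF u] by simp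
      then show "norm ((w \<bullet> u) *\<^sub>R (M 0 i *v u)) \<le> norm w * (C u * exp (\<epsilon> * real i))"
        using C[OF u] by (auto intro: mult_mono)
    qed
    also have "\<dots> = (\<Sum>u\<in>B. C u) * (exp (\<epsilon> * real i) * norm w)"
      by (simp add: sum_distrib_left sum_distrib_right algebra_simps)
    also have "\<dots> \<le> (1 + (\<Sum>u\<in>B. C u)) * (exp (\<epsilon> * real i) * norm w)" by (intro mult_right_mono) auto
    finally show ?thesis by (simp add: algebra_simps)
  qed
  moreover have "1 + (\<Sum>u\<in>B. C u) > 0" using C by (intro add_pos_nonneg sum_nonneg) (auto intro: less_imp_le)
  ultimately show ?thesis by blast
qed

text \<open>
  The functionals control all of the central space but at most one direction, for which the exponent
  alone is enough.
\<close>

lemma central_lower: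
  assumes "\<epsilon> > 0"
  shows "\<exists>C>0. \<forall>i. \<forall>w\<in>\<Gamma> Central 0. norm w \<le> C * exp (\<epsilon> * real i) * norm (M 0 i *v w)"
proof -
  let ?W = "range (b 0)"
  let ?K = "\<Gamma> Central 0 \<inter> {x. \<forall>w\<in>?W. w \<bullet> x = 0}"
  have "dim ?K + dim ?W \<le> dim (\<Gamma> Central 0)"
  proof (rule dim_central_kernel[OF sub b_sub])
    fix w assume "w \<in> ?W" and w: "\<forall>c\<in>\<Gamma> Central 0. w \<bullet> c = 0"
    then obtain h where h: "w = b 0 h" by blast
    show "w = 0" unfolding h by (rule b_central) (use w h in blast)
  qed
  then have dK: "dim ?K \<le> 1" using b_dim by linarith
  have sK: "subspace ?K"
    using sub[of Central 0] unfolding subspace_def by (auto simp: inner_add_right)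
  obtain u where u: "u \<in> ?K" "norm u \<le> 1" "u = 0 \<or> norm u = 1" "\<And>x. x \<in> ?K \<Longrightarrow> \<exists>t. x = t *\<^sub>R u"
    using dim_le_one_line[OF sK dK] by blast
  obtain B where B: "B \<subseteq> ?W" "pairwise orthogonal B" "\<And>x. x \<in> B \<Longrightarrow> norm x = 1" "independent B" "span B = ?W"
    using orthonormal_basis_subspace[OF b_sub] by metis
  have fB: "finite B" using B(4) independent_imp_finite by blast
  let ?D = "\<Gamma> Central 0 \<inter> {x. u \<bullet> x = 0}"
  have sD: "subspace ?D" using sub[of Central 0] unfolding subspace_def by (auto simp: inner_add_right)
  let ?f = "\<lambda>x. \<Sum>y\<in>B. (y \<bullet> x) *\<^sub>R y"
  have lf: "bounded_linear ?f"
    by (intro bounded_linear_sum bounded_linear_scaleR_left[THEN bounded_linear_compose] bounded_linear_inner_right)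
  have inj: "x = 0" if x: "x \<in> ?D" "?f x = 0" for x
  proof -
    have yx: "y \<bullet> x = 0" if "y \<in> B" for y
    proof -
      have "y \<bullet> ?f x = (\<Sum>z\<in>B. if z = y then y \<bullet> x else 0)"
        unfolding inner_sum_right
      proof (rule sum.cong)
        fix z assume "z \<in> B"
        show "y \<bullet> ((z \<bullet> x) *\<^sub>R z) = (if z = y then y \<bullet> x else 0)"
          using B(2) B(3)[OF \<open>y \<in> B\<close>] \<open>y \<in> B\<close> \<open>z \<in> B\<close>
          by (auto simp: pairwise_def orthogonal_def power2_norm_eq_inner[symmetric])
      qed simp
      also have "\<dots> = y \<bullet> x" using fB that by simp
      finally show ?thesis using x(2) by simp
    qed
    have "w \<bullet> x = 0" if "w \<in> ?W" for w
    proof -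
      have "w \<in> span B" using that B(5) by simp
      then show ?thesis
      proof (induction rule: span_induct_alt)
        case (step c a w)
        then show ?case using yx by (simp add: inner_add_left)
      qed simp
    qed
    then have "x \<in> ?K" using x(1) by blast
    then obtain t where t: "x = t *\<^sub>R u" using u(4) by blast
    have "u \<bullet> x = 0" using x(1) by blast
    then have "t * (norm u)\<^sup>2 = 0" unfolding t by (simp add: power2_norm_eq_inner)
    then show "x = 0" using t by auto
  qed
  obtain e where e: "e > 0" "\<And>x. x \<in> ?D \<Longrightarrow> e * norm x \<le> norm (?f x)"
    using injective_imp_isometric[OF closed_subspace[OF sD] sD lf] inj by blast
  have "\<exists>C. \<forall>i. norm (b i h) \<le> C" for h using b_bound .
  then obtain Cb where Cb: "\<And>h i. norm (b i h) \<le> Cb h" by metis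
  obtain hh where hh: "\<And>y. y \<in> B \<Longrightarrow> y = b 0 (hh y)" using B(1) by (metis image_iff subset_iff)
  define Cf where "Cf = 1 + (\<Sum>y\<in>B. Cb (hh y))"
  have Cb0: "Cb h \<ge> 0" for h using order_trans[OF norm_ge_zero Cb] .
  have Cf: "Cf \<ge> 1" unfolding Cf_def using Cb0 by (simp add: sum_nonneg)
  have f_le: "norm (?f x) \<le> Cf * norm (M 0 i *v x)" for x i
  proof -
    have "norm (?f x) \<le> (\<Sum>y\<in>B. norm ((y \<bullet> x) *\<^sub>R y))" by (rule norm_sum)
    also have "\<dots> \<le> (\<Sum>y\<in>B. Cb (hh y) * norm (M 0 i *v x))"
    proof (rule sum_mono)
      fix y assume y: "y \<in> B"
      have "y \<bullet> x = b i (hh y) \<bullet> (M 0 i *v x)" using b_inv[of i "hh y" x] hh[OF y] by simp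
      then have "\<bar>y \<bullet> x\<bar> \<le> norm (b i (hh y)) * norm (M 0 i *v x)" using Cauchy_Schwarz_ineq2 by simp
      also have "\<dots> \<le> Cb (hh y) * norm (M 0 i *v x)" using Cb by (intro mult_right_mono) auto
      finally show "norm ((y \<bullet> x) *\<^sub>R y) \<le> Cb (hh y) * norm (M 0 i *v x)" using B(3)[OF y] by simp
    qed
    also have "\<dots> \<le> Cf * norm (M 0 i *v x)"
      unfolding sum_distrib_right[symmetric] Cf_def by (intro mult_right_mono) auto
    finally show ?thesis .
  qed
  have e2: "\<epsilon> / 2 > 0" using assms by simp
  obtain C1 where C1: "C1 > 0" "\<And>i w. w \<in> \<Gamma> Central 0 \<Longrightarrow> norm (M 0 i *v w) \<le> C1 * exp (\<epsilon> / 2 * real i) * norm w"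
    using central_upper[OF e2] by blast
  obtain C2 where C2: "C2 > 0" "\<And>i. norm u \<le> C2 * exp (\<epsilon> / 2 * real i) * norm (M 0 i *v u)"
  proof (cases "u = 0")
    case False
    then have "(\<lambda>i. 1 / real i * ln (norm (M 0 i *v u))) \<longlonglongrightarrow> 0" using central u(1) by blast
    then have "subexp (\<lambda>i. 1 / norm (M 0 i *v u))" using M_nz[OF False] by (intro subexp_of_log_limit(2)) auto
    then obtain C where C: "C > 0" "\<forall>i. \<bar>1 / norm (M 0 i *v u)\<bar> \<le> C * exp (\<epsilon> / 2 * real i)"
      using subexpD[OF _ e2] by blast
    have "norm u \<le> C * exp (\<epsilon> / 2 * real i) * norm (M 0 i *v u)" for i
      using spec[OF C(2), of i] M_nz[OF False, of i] u(2) by (simp add: field_simps)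
    then show ?thesis using that C by blast
  qed (use that[of 1] in auto)
  \<comment> \<open>The two summands bound the components of w across u and along u. The functionals
    control the component x across u without loss. The other one is recovered from M w - M x, with a
    factor exp(\<epsilon> i / 2) for the growth of x and another for the lower bound on u.\<close>
  define C where "C = Cf / e + C2 * (1 + C1 * (Cf / e))"
  have Cfe: "Cf / e > 0" using Cf e by simp
  have Cpos: "C > 0" unfolding C_def using Cfe C1(1) C2(1)
    by (intro add_pos_pos mult_pos_pos) auto
  have "norm w \<le> C * exp (\<epsilon> * real i) * norm (M 0 i *v w)" if w: "w \<in> \<Gamma> Central 0" for i w
  proof -
    define t where "t = w \<bullet> u"
    define x where "x = w - t *\<^sub>R u"
    define E where "E = exp (\<epsilon> / 2 * real i)"
    define q where "q = norm (M 0 i *v w)"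
    have E: "E \<ge> 1" unfolding E_def using e2 by simp
    have EE: "E * E = exp (\<epsilon> * real i)" unfolding E_def by (simp add: exp_add[symmetric])
    have q0: "q \<ge> 0" unfolding q_def by simp
    have xD: "x \<in> ?D"
    proof -
      have "u \<bullet> x = 0" unfolding x_def t_def using u(3)
        by (auto simp: inner_diff_right inner_commute power2_norm_eq_inner[symmetric])
      moreover have "x \<in> \<Gamma> Central 0" unfolding x_def
        using subspace_diff[OF sub w subspace_scale[OF sub]] u(1) by blast
      ultimately show ?thesis by blast
    qed
    have "?f w = ?f x + t *\<^sub>R ?f u"
      unfolding x_def by (simp add: inner_diff_right scaleR_diff_left sum_subtractf scaleR_sum_right)
    moreover have "?f u = 0" using u(1) B(1) by (intro sum.neutral) auto
    ultimately have "norm (?f x) \<le> Cf * q" using f_le[of w i] unfolding q_def by simp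
    then have x1: "norm x \<le> Cf / e * q" using e(2)[OF xD] e(1) by (simp add: field_simps)
    have "norm (M 0 i *v x) \<le> C1 * E * norm x" using C1(2)[of x i] xD unfolding E_def by blast
    also have "\<dots> \<le> C1 * E * (Cf / e * q)" using x1 C1(1) E by (intro mult_left_mono) auto
    finally have mx: "norm (M 0 i *v x) \<le> C1 * E * (Cf / e * q)" .
    have "norm (t *\<^sub>R u) \<le> C2 * E * norm (M 0 i *v (t *\<^sub>R u))"
      using mult_left_mono[OF C2(2)[of i], of "\<bar>t\<bar>"] unfolding E_def by (simp add: matrix_vector_mult_scaleR algebra_simps)
    also have "M 0 i *v (t *\<^sub>R u) = M 0 i *v w - M 0 i *v x"
      unfolding x_def by (simp add: matrix_vector_mult_diff_distrib)
    also have "C2 * E * norm (M 0 i *v w - M 0 i *v x) \<le> C2 * E * (q + C1 * E * (Cf / e * q))"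
      using mx norm_triangle_ineq4[of "M 0 i *v w" "M 0 i *v x"] C2(1) E unfolding q_def by (intro mult_left_mono) auto
    also have "\<dots> \<le> C2 * E * (E * q + C1 * E * (Cf / e * q))"
      using E q0 C2(1) mult_right_mono[OF E q0] by (intro mult_left_mono add_right_mono) auto
    also have "\<dots> = (E * E) * (C2 * (1 + C1 * (Cf / e)) * q)" by (simp add: algebra_simps)
    finally have tu: "norm (t *\<^sub>R u) \<le> (E * E) * (C2 * (1 + C1 * (Cf / e)) * q)" .
    have "1 * 1 \<le> E * E" using E by (intro mult_mono) auto
    moreover have "0 \<le> Cf / e * q" using Cfe q0 by (intro mult_nonneg_nonneg) auto
    ultimately have "Cf / e * q \<le> (E * E) * (Cf / e * q)" using mult_right_mono[of 1 "E * E" "Cf / e * q"] by simp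
    then have "norm x \<le> (E * E) * (Cf / e * q)" using x1 by linarith
    moreover have "norm w \<le> norm x + norm (t *\<^sub>R u)" unfolding x_def using norm_triangle_ineq[of "w - t *\<^sub>R u" "t *\<^sub>R u"] by simp
    ultimately have "norm w \<le> (E * E) * (Cf / e * q) + (E * E) * (C2 * (1 + C1 * (Cf / e)) * q)" using tu by linarith
    also have "\<dots> = C * exp (\<epsilon> * real i) * q" unfolding EE C_def by (simp add: algebra_simps)
    finally show ?thesis unfolding q_def .
  qed
  then show ?thesis using Cpos by blast
qed


text \<open>Stable errors are pushed forward to the time in question and unstable ones pulled back
  to time 0. The central ones have no summable damping; they are collected between consecutive times
  \<open>N m\<close> rather than \<open>n k\<close>, because \<open>P_bound\<close> controls the
  central projection only there and [S] bounds exactly these longer products.\<close>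

lemma shadow_error:
  fixes \<omega> :: "nat \<Rightarrow> real ^ 'd" and D :: real
  assumes D: "D \<ge> 0" and err: "\<And>i j. i \<le> j \<Longrightarrow> norm (\<omega> j - M i j *v \<omega> i) \<le> D * onorm ((*v) (M i j))"
  defines "v \<equiv> P Unstable 0 (\<omega> 0) + (\<Sum>k. matrix_inv (M 0 (n (Suc k))) *v
        P Unstable (n (Suc k)) (\<omega> (n (Suc k)) - M (n k) (n (Suc k)) *v \<omega> (n k)))"
  shows "subexp (\<lambda>m. norm (\<omega> (N m) - M 0 (N m) *v v))"
proof -
  define e where "e k = \<omega> (n k) - M (n (k - 1)) (n k) *v \<omega> (n (k - 1))" for k
  have e: "norm (e k) \<le> D * onorm ((*v) (M (n (k - 1)) (n k)))" for k
    unfolding e_def by (rule err) (rule n_le, simp)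
  have \<omega>_Suc: "\<omega> (n (Suc k)) = M (n k) (n (Suc k)) *v \<omega> (n k) + e (Suc k)" for k
    unfolding e_def by simp
  have nS: "n k \<le> n (Suc k)" for k by (rule n_le) simp
  have P_Suc: "P x (n (Suc k)) (\<omega> (n (Suc k))) = M (n k) (n (Suc k)) *v P x (n k) (\<omega> (n k)) + P x (n (Suc k)) (e (Suc k))" for x k
    unfolding \<omega>_Suc[of k] P_add P_M[OF nS] ..

  have stab: "\<exists>C. \<forall>m. norm (P Stable (N m) (\<omega> (N m))) \<le> C"
  proof -
    have tel: "P Stable (n k) (\<omega> (n k)) = M 0 (n k) *v P Stable 0 (\<omega> 0) + (\<Sum>i=1..k. M (n i) (n k) *v P Stable (n i) (e i))" for k
    proof (induction k)
      case 0
      then show ?case using n(1) by (simp add: same)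
    next
      case (Suc k)
      have "M (n k) (n (Suc k)) *v P Stable (n k) (\<omega> (n k)) =
          M 0 (n (Suc k)) *v P Stable 0 (\<omega> 0) + (\<Sum>i=1..k. M (n i) (n (Suc k)) *v P Stable (n i) (e i))"
        unfolding Suc matrix_vector_right_distrib compose[OF le0 nS] linear_sum[OF matrix_vector_mul_linear]
        by (intro arg_cong2[of _ _ _ _ "(+)"] sum.cong refl compose n_le) auto
      then show ?case unfolding P_Suc by (simp add: same)
    qed
    have "norm (P Stable (N m) (\<omega> (N m))) \<le> C\<^sub>0 * norm (P Stable 0 (\<omega> 0)) + D * \<bar>K\<^sub>m\<bar>" for m
    proof -
      let ?t = "\<lambda>k. onorm_on ((*v) (M (n k) (N m))) (\<Gamma> Stable (n k)) *
            onorm (P Stable (n k)) * onorm ((*v) (M (n (k - 1)) (n k)))"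
      have "norm (M 0 (N m) *v P Stable 0 (\<omega> 0)) \<le> C\<^sub>0 * exp (- \<theta> * real (N m)) * norm (P Stable 0 (\<omega> 0))"
        by (rule stable[OF P_mem])
      also have "\<dots> \<le> C\<^sub>0 * 1 * norm (P Stable 0 (\<omega> 0))"
        using \<theta> by (intro mult_right_mono mult_left_mono) auto
      finally have 1: "norm (M 0 (N m) *v P Stable 0 (\<omega> 0)) \<le> C\<^sub>0 * norm (P Stable 0 (\<omega> 0))" by simp
      have "norm (M (n k) (N m) *v P Stable (n k) (e k)) \<le> D * ?t k" for k
      proof -
        have "norm (M (n k) (N m) *v P Stable (n k) (e k)) \<le>
            onorm_on ((*v) (M (n k) (N m))) (\<Gamma> Stable (n k)) * norm (P Stable (n k) (e k))"
          by (rule onorm_on_bound[OF sub P_mem])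
        also have "\<dots> \<le> onorm_on ((*v) (M (n k) (N m))) (\<Gamma> Stable (n k)) * (onorm (P Stable (n k)) * norm (e k))"
          by (intro mult_left_mono onorm P_bounded_linear onorm_on_nonneg sub)
        also have "\<dots> \<le> onorm_on ((*v) (M (n k) (N m))) (\<Gamma> Stable (n k)) * (onorm (P Stable (n k)) *
            (D * onorm ((*v) (M (n (k - 1)) (n k)))))"
          by (intro mult_left_mono e onorm_on_nonneg sub onorm_pos_le P_bounded_linear)
        finally show ?thesis by (simp add: algebra_simps)
      qed
      then have "norm (\<Sum>i=1..\<kappa> m. M (n i) (N m) *v P Stable (n i) (e i)) \<le> (\<Sum>i=1..\<kappa> m. D * ?t i)"
        by (intro order_trans[OF norm_sum] sum_mono)
      also have "\<dots> = D * (\<Sum>i=1..\<kappa> m. ?t i)" by (simp only: sum_distrib_left)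
      also have "\<dots> \<le> D * \<bar>K\<^sub>m\<bar>" using condB[of m] D by (intro mult_left_mono) linarith+
      finally have 2: "norm (\<Sum>i=1..\<kappa> m. M (n i) (N m) *v P Stable (n i) (e i)) \<le> D * \<bar>K\<^sub>m\<bar>" .
      show ?thesis unfolding tel[of "\<kappa> m"] by (rule order_trans[OF norm_triangle_ineq add_mono[OF 1 2]])
    qed
    then show ?thesis by blast
  qed

  define a where "a k = matrix_inv (M 0 (n (Suc k))) *v P Unstable (n (Suc k)) (e (Suc k))" for k
  have v: "v = P Unstable 0 (\<omega> 0) + (\<Sum>k. a k)" unfolding v_def a_def e_def by simp
  \<comment> \<open>Since the projections commute with the cocycle, the partial sums telescope.
    Pushed forward to time \<open>N m\<close>, the vector v therefore differs from the unstable part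
    of \<omega> by a tail of the series.\<close>
  have part: "P Unstable 0 (\<omega> 0) + (\<Sum>k<K. a k) = matrix_inv (M 0 (n K)) *v P Unstable (n K) (\<omega> (n K))" for K
  proof (induction K)
    case 0
    have "matrix_inv (M 0 0) *v w = w" for w using inv_left[of 0 0 w] by (simp add: same)
    then show ?case using n(1) by simp
  next
    case (Suc K)
    have "matrix_inv (M 0 (n (Suc K))) *v (M (n K) (n (Suc K)) *v w) = matrix_inv (M 0 (n K)) *v w" for w
      using Minv_compose[OF le0 nS[of K], of "M (n K) (n (Suc K)) *v w"] inv_left[OF nS] by simp
    then show ?case using Suc unfolding P_Suc a_def by (simp add: matrix_vector_right_distrib)
  qed
  have tail: "summable (\<lambda>i. a (i + \<kappa> m))" "norm (M 0 (N m) *v (\<Sum>i. a (i + \<kappa> m))) \<le> D * \<bar>K\<^sub>p\<bar>" for m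
  proof -
    let ?f = "\<lambda>i. onorm_on ((*v) (matrix_inv (M (N m) (n (\<kappa> m + 1 + i))))) (\<Gamma> Unstable (n (\<kappa> m + 1 + i))) *
            onorm (P Unstable (n (\<kappa> m + 1 + i))) * onorm ((*v) (M (n (\<kappa> m + 1 + i - 1)) (n (\<kappa> m + 1 + i))))"
    let ?g = "\<lambda>i. matrix_inv (M (N m) (n (\<kappa> m + 1 + i))) *v P Unstable (n (\<kappa> m + 1 + i)) (e (\<kappa> m + 1 + i))"
    have ai: "a (i + \<kappa> m) = matrix_inv (M 0 (N m)) *v ?g i" for i
      unfolding a_def by (subst Minv_compose) (auto intro: n_le simp: add.commute)
    have g: "norm (?g i) \<le> D * ?f i" for i
    proof -
      let ?k = "\<kappa> m + 1 + i"
      have "norm (?g i) \<le> onorm_on ((*v) (matrix_inv (M (N m) (n ?k)))) (\<Gamma> Unstable (n ?k)) * norm (P Unstable (n ?k) (e ?k))"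
        by (rule onorm_on_bound[OF sub P_mem])
      also have "\<dots> \<le> onorm_on ((*v) (matrix_inv (M (N m) (n ?k)))) (\<Gamma> Unstable (n ?k)) * (onorm (P Unstable (n ?k)) * norm (e ?k))"
        by (intro mult_left_mono onorm P_bounded_linear onorm_on_nonneg sub)
      also have "\<dots> \<le> onorm_on ((*v) (matrix_inv (M (N m) (n ?k)))) (\<Gamma> Unstable (n ?k)) * (onorm (P Unstable (n ?k)) *
            (D * onorm ((*v) (M (n (?k - 1)) (n ?k)))))"
        by (intro mult_left_mono e onorm_on_nonneg sub onorm_pos_le P_bounded_linear)
      finally show ?thesis by (simp only: algebra_simps)
    qed
    have sf: "summable (\<lambda>i. D * ?f i)" by (rule summable_mult) (rule condF)
    have sn: "summable (\<lambda>i. norm (?g i))"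
      by (rule summable_comparison_test'[OF sf, of 0]) (use g in simp)
    then have sg: "summable ?g" by (rule summable_norm_cancel)
    have bl: "bounded_linear ((*v) R)" for R :: "real ^ 'd ^ 'd" by (rule matrix_vector_mul_bounded_linear)
    show sa: "summable (\<lambda>i. a (i + \<kappa> m))" unfolding ai by (rule bounded_linear.summable[OF bl sg])
    have "M 0 (N m) *v (\<Sum>i. a (i + \<kappa> m)) = (\<Sum>i. M 0 (N m) *v a (i + \<kappa> m))"
      by (rule bounded_linear.suminf[OF bl sa])
    also have "\<dots> = (\<Sum>i. ?g i)" unfolding ai using inv_right[of 0 "N m"] by simp
    finally have "norm (M 0 (N m) *v (\<Sum>i. a (i + \<kappa> m))) \<le> (\<Sum>i. norm (?g i))"
      using summable_norm[OF sn] by simp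
    also have "\<dots> \<le> (\<Sum>i. D * ?f i)" by (rule suminf_le[OF g sn sf])
    also have "\<dots> = D * (\<Sum>i. ?f i)" by (rule suminf_mult[OF condF(1)])
    also have "\<dots> \<le> D * \<bar>K\<^sub>p\<bar>" using condF(2)[of m] D by (intro mult_left_mono) linarith+
    finally show "norm (M 0 (N m) *v (\<Sum>i. a (i + \<kappa> m))) \<le> D * \<bar>K\<^sub>p\<bar>" .
  qed
  have sa: "summable a" using tail(1)[of 0] by (simp only: summable_iff_shift)
  have unst: "norm (P Unstable (N m) (\<omega> (N m)) - M 0 (N m) *v v) \<le> D * \<bar>K\<^sub>p\<bar>" for m
  proof -
    have "v = (P Unstable 0 (\<omega> 0) + (\<Sum>k<\<kappa> m. a k)) + (\<Sum>i. a (i + \<kappa> m))"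
      unfolding v using suminf_split_initial_segment[OF sa, of "\<kappa> m"] by simp
    then have "M 0 (N m) *v v = P Unstable (N m) (\<omega> (N m)) + M 0 (N m) *v (\<Sum>i. a (i + \<kappa> m))"
      unfolding part by (simp add: matrix_vector_right_distrib inv_right)
    then show ?thesis using tail(2)[of m] by (simp add: norm_minus_commute)
  qed

  obtain K where K: "K > 0" "\<And>m x w. m \<ge> 1 \<Longrightarrow> norm (P x (N m) w) \<le> K * norm w" using P_bound by blast
  obtain c1 c2 where lin: "\<And>m. real (N m) \<le> c1 * real m + c2" using linear_growth by blast
  have NS: "N m \<le> N (Suc m)" for m by (intro n_le \<kappa>_le) simp
  define E where "E m = \<omega> (N (Suc m)) - M (N m) (N (Suc m)) *v \<omega> (N m)" for m
  \<comment> \<open>The central component transported to time 0, where the errors of different times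
    simply add up. The price is the norm of the inverse cocycle on the central space, both for each
    error and through \<open>low\<close>.\<close>
  define z where "z m = matrix_inv (M 0 (N m)) *v P Central (N m) (\<omega> (N m))" for m
  have z_mem: "z m \<in> \<Gamma> Central 0" for m unfolding z_def by (rule Minv_mem[OF le0 P_mem])
  have Mz: "M 0 (N m) *v z m = P Central (N m) (\<omega> (N m))" for m unfolding z_def by (rule inv_right[OF le0])
  have z_Suc: "z (Suc m) = z m + matrix_inv (M 0 (N (Suc m))) *v P Central (N (Suc m)) (E m)" for m
  proof -
    have "\<omega> (N (Suc m)) = M (N m) (N (Suc m)) *v \<omega> (N m) + E m" unfolding E_def by simp
    then have "P Central (N (Suc m)) (\<omega> (N (Suc m))) =
        M (N m) (N (Suc m)) *v P Central (N m) (\<omega> (N m)) + P Central (N (Suc m)) (E m)"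
      by (simp only: P_add P_M[OF NS])
    moreover have "matrix_inv (M 0 (N (Suc m))) *v (M (N m) (N (Suc m)) *v w) = matrix_inv (M 0 (N m)) *v w" for w
      using Minv_compose[OF le0 NS[of m], of "M (N m) (N (Suc m)) *v w"] inv_left[OF NS] by simp
    ultimately show ?thesis unfolding z_def by (simp add: matrix_vector_right_distrib)
  qed
  have R: "subexp (\<lambda>m. onorm ((*v) (M (N m) (N (Suc m)))))"
  proof (rule subexp_of_log_limit(1)[OF condS])
    show "0 < onorm ((*v) (M (N m) (N (Suc m))))" for m using onorm_ge[OF NS, of m] by linarith
  qed
  \<comment> \<open>The best constant at time i in \<open>central_lower\<close>. That lemma yields a
    different constant for every \<epsilon>, whereas \<open>subexp\<close> speaks of one function
    for all of them.\<close>
  define low where "low i = (SUP w\<in>{w \<in> \<Gamma> Central 0. norm (M 0 i *v w) \<le> 1}. norm w)" for i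
  have low: "norm w \<le> low i * norm (M 0 i *v w)" "0 \<le> low i" if w: "w \<in> \<Gamma> Central 0" for w i
  proof -
    obtain C where C: "C > 0" "\<forall>i. \<forall>w\<in>\<Gamma> Central 0. norm w \<le> C * exp (1 * real i) * norm (M 0 i *v w)"
      using central_lower[of 1] by auto
    have bdd: "bdd_above (norm ` {w \<in> \<Gamma> Central 0. norm (M 0 i *v w) \<le> 1})"
    proof (rule bdd_aboveI2)
      fix w assume w: "w \<in> {w \<in> \<Gamma> Central 0. norm (M 0 i *v w) \<le> 1}"
      have "norm w \<le> C * exp (1 * real i) * norm (M 0 i *v w)" using C(2) w by blast
      also have "\<dots> \<le> C * exp (1 * real i) * 1" using w C(1) by (intro mult_left_mono) auto
      finally show "norm w \<le> C * exp (1 * real i) * 1" .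
    qed
    show "0 \<le> low i" unfolding low_def
      by (rule cSUP_upper2[OF bdd, of 0]) (use subspace_0[OF sub] in auto)
    show "norm w \<le> low i * norm (M 0 i *v w)"
    proof (cases "w = 0")
      case False
      then have nz: "norm (M 0 i *v w) > 0" using M_nz by simp
      let ?u = "(1 / norm (M 0 i *v w)) *\<^sub>R w"
      have "?u \<in> {w \<in> \<Gamma> Central 0. norm (M 0 i *v w) \<le> 1}"
        using subspace_scale[OF sub w] nz by (simp add: matrix_vector_mult_scaleR)
      then have "norm ?u \<le> low i" unfolding low_def by (rule cSUP_upper[OF _ bdd])
      then show ?thesis using nz by (simp add: divide_le_eq)
    qed simp
  qed
  have slow: "subexp low"
    unfolding subexp_def
  proof (intro allI impI)
    fix \<epsilon> :: real assume "\<epsilon> > 0"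
    then obtain C where C: "C > 0" "\<forall>i. \<forall>w\<in>\<Gamma> Central 0. norm w \<le> C * exp (\<epsilon> * real i) * norm (M 0 i *v w)"
      using central_lower by blast
    have "\<bar>low i\<bar> \<le> C * exp (\<epsilon> * real i)" for i
    proof -
      have "low i \<le> C * exp (\<epsilon> * real i)" unfolding low_def
      proof (rule cSUP_least)
        have "0 \<in> {w \<in> \<Gamma> Central 0. norm (M 0 i *v w) \<le> 1}" using subspace_0[OF sub] by simp
        then show "{w \<in> \<Gamma> Central 0. norm (M 0 i *v w) \<le> 1} \<noteq> {}" by blast
        fix w assume w: "w \<in> {w \<in> \<Gamma> Central 0. norm (M 0 i *v w) \<le> 1}"
        have "norm w \<le> C * exp (\<epsilon> * real i) * norm (M 0 i *v w)" using C(2) w by blast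
        also have "\<dots> \<le> C * exp (\<epsilon> * real i) * 1" using w C(1) by (intro mult_left_mono) auto
        finally show "norm w \<le> C * exp (\<epsilon> * real i)" by simp
      qed
      then show ?thesis using low(2)[OF subspace_0[OF sub], of i] by simp
    qed
    then show "\<exists>C>0. \<forall>i. \<bar>low i\<bar> \<le> C * exp (\<epsilon> * real i)" using C(1) by blast
  qed
  have upp: "norm (M 0 i *v w) \<le> onorm_on ((*v) (M 0 i)) (\<Gamma> Central 0) * norm w" if "w \<in> \<Gamma> Central 0" for w i
    by (rule onorm_on_bound[OF sub that])
  have supp: "subexp (\<lambda>i. onorm_on ((*v) (M 0 i)) (\<Gamma> Central 0))"
    unfolding subexp_def
  proof (intro allI impI)
    fix \<epsilon> :: real assume "\<epsilon> > 0"
    then obtain C where C: "C > 0" "\<forall>i. \<forall>w\<in>\<Gamma> Central 0. norm (M 0 i *v w) \<le> C * exp (\<epsilon> * real i) * norm w"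
      using central_upper by blast
    have "\<bar>onorm_on ((*v) (M 0 i)) (\<Gamma> Central 0)\<bar> \<le> C * exp (\<epsilon> * real i)" for i
    proof -
      have "onorm_on ((*v) (M 0 i)) (\<Gamma> Central 0) \<le> C * exp (\<epsilon> * real i)" unfolding onorm_on_def
      proof (rule cSUP_least)
        have "0 \<in> {w \<in> \<Gamma> Central 0. norm w \<le> 1}" using subspace_0[OF sub] by simp
        then show "{w \<in> \<Gamma> Central 0. norm w \<le> 1} \<noteq> {}" by blast
        fix w assume w: "w \<in> {w \<in> \<Gamma> Central 0. norm w \<le> 1}"
        have "norm (M 0 i *v w) \<le> C * exp (\<epsilon> * real i) * norm w" using C(2) w by blast
        also have "\<dots> \<le> C * exp (\<epsilon> * real i) * 1" using w C(1) by (intro mult_left_mono) auto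
        finally show "norm (M 0 i *v w) \<le> C * exp (\<epsilon> * real i)" by simp
      qed
      then show ?thesis using onorm_on_nonneg[OF sub, of "M 0 i"] by simp
    qed
    then show "\<exists>C>0. \<forall>i. \<bar>onorm_on ((*v) (M 0 i)) (\<Gamma> Central 0)\<bar> \<le> C * exp (\<epsilon> * real i)" using C(1) by blast
  qed
  let ?s = "\<lambda>m. low (N (Suc m)) * (K * (D * onorm ((*v) (M (N m) (N (Suc m))))))"
  have ss: "subexp ?s"
    by (intro subexp_mult subexp_const R subexp_Suc[OF subexp_reindex[OF slow lin]])
  have step: "norm (matrix_inv (M 0 (N (Suc m))) *v P Central (N (Suc m)) (E m)) \<le> ?s m" for m
  proof -
    let ?w = "matrix_inv (M 0 (N (Suc m))) *v P Central (N (Suc m)) (E m)"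
    have "norm ?w \<le> low (N (Suc m)) * norm (M 0 (N (Suc m)) *v ?w)" by (rule low(1)[OF Minv_mem[OF le0 P_mem]])
    also have "M 0 (N (Suc m)) *v ?w = P Central (N (Suc m)) (E m)" by (rule inv_right[OF le0])
    also have "low (N (Suc m)) * norm (P Central (N (Suc m)) (E m)) \<le> low (N (Suc m)) * (K * norm (E m))"
      by (intro mult_left_mono K(2) low(2)[OF subspace_0[OF sub]]) simp
    also have "\<dots> \<le> ?s m"
      using K(1) unfolding E_def by (intro mult_left_mono err NS low(2)[OF subspace_0[OF sub]]) simp
    finally show ?thesis .
  qed
  have z_le: "norm (z m) \<le> norm (z 0) + (\<Sum>k<m. ?s k)" for m
  proof (induction m)
    case (Suc m)
    have "norm (z (Suc m)) \<le> norm (z m) + ?s m"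
      unfolding z_Suc by (rule order_trans[OF norm_triangle_ineq add_left_mono[OF step]])
    then show ?case using Suc by simp
  qed simp
  let ?u = "\<lambda>m. onorm_on ((*v) (M 0 (N m))) (\<Gamma> Central 0) * (norm (z 0) + (\<Sum>k<m. ?s k))"
  have cent: "norm (P Central (N m) (\<omega> (N m))) \<le> ?u m" for m
    unfolding Mz[symmetric]
    by (rule order_trans[OF upp[OF z_mem] mult_left_mono[OF z_le onorm_on_nonneg[OF sub]]])
  have su: "subexp ?u"
    by (intro subexp_mult subexp_add subexp_const subexp_sum[OF ss] subexp_reindex[OF supp lin])
  obtain Cs where Cs: "\<And>m. norm (P Stable (N m) (\<omega> (N m))) \<le> Cs" using stab by blast
  have "subexp (\<lambda>m. (Cs + D * \<bar>K\<^sub>p\<bar>) + ?u m)" by (intro subexp_add subexp_const su)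
  then show ?thesis
  proof (rule subexp_mono)
    fix m
    have "\<omega> (N m) - M 0 (N m) *v v = P Stable (N m) (\<omega> (N m)) + (P Unstable (N m) (\<omega> (N m)) - M 0 (N m) *v v) + P Central (N m) (\<omega> (N m))"
      using P_sum[of "\<omega> (N m)" "N m"] by (simp add: algebra_simps)
    then have "norm (\<omega> (N m) - M 0 (N m) *v v) \<le> norm (P Stable (N m) (\<omega> (N m))) +
        norm (P Unstable (N m) (\<omega> (N m)) - M 0 (N m) *v v) + norm (P Central (N m) (\<omega> (N m)))"
      by (metis (no_types, lifting) norm_triangle_mono norm_triangle_ineq order_refl)
    then show "\<bar>norm (\<omega> (N m) - M 0 (N m) *v v)\<bar> \<le> (Cs + D * \<bar>K\<^sub>p\<bar>) + ?u m"
      unfolding abs_norm_cancel by (rule order_trans[OF _ add_mono[OF add_mono[OF Cs unst] cent]])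
  qed
qed

end

subsection \<open>Comparison of the towers\<close>

text \<open>The growth over the first s floors for an affine map with log-slope v, by
  \<open>affine_growth\<close>, but defined from \<gamma> and v without the map. The deviation below
  measures how far T is from it.\<close>

definition codesum :: "'d::finite rotation_number \<Rightarrow> real ^ 'd \<Rightarrow> nat \<Rightarrow> 'd \<Rightarrow> nat \<Rightarrow> real" where
  "codesum \<gamma> v n j s = sum_list (map (($) v) (take s (cword \<gamma> n j)))"

definition deviation :: "'d::finite giet \<Rightarrow> 'd rotation_number \<Rightarrow> real ^ 'd \<Rightarrow> real set \<Rightarrow> nat \<Rightarrow> 'd \<Rightarrow> nat \<Rightarrow> real" where
  "deviation T \<gamma> v J n j s = growth (gmap T) J s - codesum \<gamma> v n j s"

lemma codesum_full: "length (cword \<gamma> n j) \<le> s \<Longrightarrow> codesum \<gamma> v n j s = (Qw \<gamma> 0 n *v v) $ j"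
  unfolding codesum_def Qw_mult by (simp add: shift_def)

lemma codesum_sum: "s \<le> length (cword \<gamma> n j) \<Longrightarrow> codesum \<gamma> v n j s = (\<Sum>k<s. v $ (cword \<gamma> n j ! k))"
  unfolding codesum_def sum_list_map_nth by (simp add: min_absorb2)

lemma take_concat_blocks:
  assumes "i < length w" "s \<le> length (g (w ! i))"
  shows "take (length (concat (map g (take i w))) + s) (concat (map g w)) =
     concat (map g (take i w)) @ take s (g (w ! i))"
proof -
  have "concat (map g w) = concat (map g (take i w)) @ g (w ! i) @ concat (map g (drop (Suc i) w))"
    using id_take_nth_drop[OF assms(1)] by (metis concat.simps(2) concat_append list.simps(9) map_append)
  then show ?thesis using assms(2) by simp
qed

lemma block_position:
  assumes "s < length (concat (map g w))"
  obtains i r where "i < length w" "r < length (g (w ! i))" "s = length (concat (map g (take i w))) + r"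
proof -
  have "\<exists>i r. i < length w \<and> r < length (g (w ! i)) \<and> s = length (concat (map g (take i w))) + r"
    using assms
  proof (induction w arbitrary: s)
    case (Cons a w)
    show ?case
    proof (cases "s < length (g a)")
      case True
      then show ?thesis by (intro exI[of _ 0] exI[of _ s]) simp
    next
      case False
      then have "s - length (g a) < length (concat (map g w))" using Cons.prems by simp
      from Cons.IH[OF this] obtain i r where ir: "i < length w" "r < length (g (w ! i))"
        "s - length (g a) = length (concat (map g (take i w))) + r" by blast
      then show ?thesis using False by (intro exI[of _ "Suc i"] exI[of _ r]) simp
    qed
  qed simp
  then show ?thesis using that by blast
qed

lemma length_cword_mono:
  assumes "k \<le> k'"
  shows "length (cword \<gamma> k j) \<le> length (cword \<gamma> k' j)"
proof -
  have "length (cword \<gamma> k j) \<le> length (cword \<gamma> (Suc k) j)" for k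
    by (cases "snd (\<gamma> k)") (auto simp: losing_def)
  then show ?thesis using assms by (rule lift_Suc_mono_le)
qed

locale tower_comparison =
  fixes T :: "'d::finite giet" and \<gamma> :: "'d rotation_number" and v :: "real ^ 'd" and L :: real
  assumes fol: "follows T \<gamma>" and dist: "distortion_le T L"
begin

abbreviation "Dev \<equiv> deviation T \<gamma> v"

definition dev_le :: "nat \<Rightarrow> real \<Rightarrow> bool" where
  "dev_le a G \<longleftrightarrow> (\<forall>J j s. Ico J \<and> J \<subseteq> rpiece T a j \<and> s \<le> length (cword \<gamma> a j) \<longrightarrow> \<bar>Dev J a j s\<bar> \<le> G)"

lemma dev_leD: "dev_le a G \<Longrightarrow> Ico J \<Longrightarrow> J \<subseteq> rpiece T a j \<Longrightarrow> s \<le> length (cword \<gamma> a j) \<Longrightarrow> \<bar>Dev J a j s\<bar> \<le> G"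
  unfolding dev_le_def by blast

lemma dev_block:
  fixes a b :: nat
  assumes "a \<le> b" "J \<subseteq> rpiece T b j"
  defines "w \<equiv> cword (shift \<gamma> a) (b - a) j"
  assumes "i < length w" "s \<le> length (cword \<gamma> a (w ! i))"
  shows "Dev J b j (offs \<gamma> w a i + s) - Dev J b j (offs \<gamma> w a i) = Dev ((gmap T ^^ offs \<gamma> w a i) ` J) a (w ! i) s"
    "(gmap T ^^ offs \<gamma> w a i) ` J \<subseteq> rpiece T a (w ! i)"
    "offs \<gamma> w a i + s \<le> length (cword \<gamma> b j)"
proof -
  have b: "b = a + (b - a)" using assms(1) by simp
  have W: "cword \<gamma> b j = concat (map (cword \<gamma> a) w)"
    using cword_add[of \<gamma> a "b - a" j] assms(1) unfolding w_def by simp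
  show "(gmap T ^^ offs \<gamma> w a i) ` J \<subseteq> rpiece T a (w ! i)"
    using block_start[OF fol, of J a "b - a" j i] assms unfolding w_def by simp
  have t: "take (offs \<gamma> w a i + s) (cword \<gamma> b j) = concat (map (cword \<gamma> a) (take i w)) @ take s (cword \<gamma> a (w ! i))"
    unfolding W by (rule take_concat_blocks[where g = "cword \<gamma> a", OF assms(4,5)])
  have t0: "take (offs \<gamma> w a i) (cword \<gamma> b j) = concat (map (cword \<gamma> a) (take i w))"
    unfolding W using take_concat_blocks[OF assms(4), of 0 "cword \<gamma> a"] by simp
  show "Dev J b j (offs \<gamma> w a i + s) - Dev J b j (offs \<gamma> w a i) = Dev ((gmap T ^^ offs \<gamma> w a i) ` J) a (w ! i) s"
    unfolding deviation_def codesum_def t t0 growth_add by simp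
  have "offs \<gamma> w a i + s \<le> offs \<gamma> w a (Suc i)" unfolding offs_Suc[OF assms(4)] using assms(5) by simp
  also have "\<dots> \<le> length (cword \<gamma> b j)" unfolding W by (rule offs_le)
  finally show "offs \<gamma> w a i + s \<le> length (cword \<gamma> b j)" .
qed

lemma dev_0: "Dev J n j 0 = 0"
  unfolding deviation_def codesum_def by (simp add: growth_0)

lemma dev_full:
  assumes "Ico J" "J \<subseteq> rpiece T a j"
  shows "\<bar>Dev J a j (length (cword \<gamma> a j))\<bar> \<le> norm (log_slope ((rauzy ^^ a) T) - Qw \<gamma> 0 a *v v) + L"
proof -
  have "\<bar>growth (gmap T) J (length (cword \<gamma> a j)) - log_slope ((rauzy ^^ a) T) $ j\<bar> \<le> L"
    by (rule growth_full[OF fol dist assms])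
  moreover have "\<bar>(log_slope ((rauzy ^^ a) T) - Qw \<gamma> 0 a *v v) $ j\<bar> \<le> norm (log_slope ((rauzy ^^ a) T) - Qw \<gamma> 0 a *v v)"
    by (rule component_le_norm_cart)
  ultimately show ?thesis unfolding deviation_def codesum_full[OF order_refl] by (simp add: vector_minus_component)
qed

text \<open>A partial climb at level b consists of at most R complete blocks of level a, each
  costing the error of a full climb, and one incomplete block, costing G. The old bound is added and
  not multiplied, so iterating the lemma produces a sum.\<close>

lemma dev_step:
  assumes G: "dev_le a G" and ab: "a \<le> b" and R: "\<And>j. real (length (cword (shift \<gamma> a) (b - a) j)) \<le> R"
  shows "dev_le b (R * (norm (log_slope ((rauzy ^^ a) T) - Qw \<gamma> 0 a *v v) + L) + G)"
  unfolding dev_le_def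
proof (intro allI impI, elim conjE)
  fix J j s assume J: "Ico J" "J \<subseteq> rpiece T b j" and s: "s \<le> length (cword \<gamma> b j)"
  let ?w = "cword (shift \<gamma> a) (b - a) j"
  let ?F = "norm (log_slope ((rauzy ^^ a) T) - Qw \<gamma> 0 a *v v) + L"
  have F: "?F \<ge> 0" using dist unfolding distortion_le_def by (intro add_nonneg_nonneg) auto
  have G0: "G \<ge> 0"
    using dev_leD[OF G Ico_rpiece[OF fol] order_refl le0] by (simp add: dev_0)
  have W: "cword \<gamma> b j = concat (map (cword \<gamma> a) ?w)"
    using cword_add[of \<gamma> a "b - a" j] ab by simp
  have iJ: "Ico ((gmap T ^^ k) ` J)" if "k \<le> length (cword \<gamma> b j)" for k
    by (rule Ico_sub_rpiece[OF fol J that])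
  have pre: "i \<le> length ?w \<Longrightarrow> \<bar>Dev J b j (offs \<gamma> ?w a i)\<bar> \<le> real i * ?F" for i
  proof (induction i)
    case 0
    then show ?case by (simp add: dev_0)
  next
    case (Suc i)
    then have i: "i < length ?w" by simp
    note bl = dev_block[OF ab J(2) i order_refl]
    have "\<bar>Dev J b j (offs \<gamma> ?w a (Suc i)) - Dev J b j (offs \<gamma> ?w a i)\<bar> \<le> ?F"
      unfolding offs_Suc[OF i] bl(1)
      by (rule dev_full[OF iJ bl(2)]) (use bl(3) in simp)
    then show ?case using Suc by (simp add: distrib_right)
  qed
  have mono: "real i * ?F \<le> R * ?F" if "i \<le> length ?w" for i
    using that R[of j] F by (intro mult_right_mono) auto
  show "\<bar>Dev J b j s\<bar> \<le> R * ?F + G"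
  proof (cases "s = length (cword \<gamma> b j)")
    case True
    then have "s = offs \<gamma> ?w a (length ?w)" unfolding W by simp
    then show ?thesis using pre[OF order_refl] mono[OF order_refl] G0 by simp
  next
    case False
    then have "s < length (concat (map (cword \<gamma> a) ?w))" using s unfolding W by simp
    then obtain i r where ir: "i < length ?w" "r < length (cword \<gamma> a (?w ! i))" "s = offs \<gamma> ?w a i + r"
      by (rule block_position)
    note bl = dev_block[OF ab J(2) ir(1) less_imp_le[OF ir(2)]]
    have "\<bar>Dev J b j s - Dev J b j (offs \<gamma> ?w a i)\<bar> \<le> G"
      unfolding ir(3) bl(1)
      by (rule dev_leD[OF G iJ bl(2)]) (use bl(3) ir(2) in auto)
    then show ?thesis using pre[of i] mono[of i] ir(1) by auto
  qed
qed

lemma dev_level_0: "dev_le 0 (norm (log_slope T - v) + L)"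
  unfolding dev_le_def
proof (intro allI impI, elim conjE)
  fix J j s assume J: "Ico J" "J \<subseteq> rpiece T 0 j" and s: "s \<le> length (cword \<gamma> 0 j)"
  have L: "L \<ge> 0" using dist unfolding distortion_le_def by blast
  consider "s = 0" | "s = length (cword \<gamma> 0 j)" using s by fastforce
  then show "\<bar>Dev J 0 j s\<bar> \<le> norm (log_slope T - v) + L"
  proof cases
    case 1
    then show ?thesis using L by (simp add: dev_0)
  next
    case 2
    then show ?thesis using dev_full[OF J] by (simp add: Qw_same)
  qed
qed

text \<open>Positions that differ by at most the smallest height of level a lie in one block or in
  two adjacent ones. They are joined by at most three differences within a block from its start,
  each bounded by G.\<close>

lemma dev_close:
  assumes G: "dev_le a G" and ab: "a \<le> b" and J: "Ico J" "J \<subseteq> rpiece T b j"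
    and st: "s \<le> t" "t \<le> length (cword \<gamma> b j)"
    and close: "\<And>l. t - s \<le> length (cword \<gamma> a l)"
  shows "\<bar>Dev J b j t - Dev J b j s\<bar> \<le> 3 * G"
proof -
  let ?w = "cword (shift \<gamma> a) (b - a) j"
  have G0: "G \<ge> 0" using dev_leD[OF G Ico_rpiece[OF fol] order_refl le0] by (simp add: dev_0)
  have W: "cword \<gamma> b j = concat (map (cword \<gamma> a) ?w)"
    using cword_add[of \<gamma> a "b - a" j] ab by simp
  have iJ: "Ico ((gmap T ^^ k) ` J)" if "k \<le> length (cword \<gamma> b j)" for k
    by (rule Ico_sub_rpiece[OF fol J that])
  have near: "\<bar>Dev J b j (offs \<gamma> ?w a i + r) - Dev J b j (offs \<gamma> ?w a i)\<bar> \<le> G"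
    if ir: "i < length ?w" "r \<le> length (cword \<gamma> a (?w ! i))" for i r
    unfolding dev_block(1)[OF ab J(2) ir]
    by (rule dev_leD[OF G iJ dev_block(2)[OF ab J(2) ir] ir(2)]) (use dev_block(3)[OF ab J(2) ir] in simp)
  show ?thesis
  proof (cases "s = length (cword \<gamma> b j)")
    case True
    then show ?thesis using st G0 by simp
  next
    case False
    then have "s < length (concat (map (cword \<gamma> a) ?w))" using st unfolding W by simp
    then obtain i r where ir: "i < length ?w" "r < length (cword \<gamma> a (?w ! i))" "s = offs \<gamma> ?w a i + r"
      by (rule block_position)
    note n1 = near[OF ir(1) less_imp_le[OF ir(2)], folded ir(3)]
    show ?thesis
    proof (cases "t \<le> offs \<gamma> ?w a (Suc i)")
      case True
      define q where "q = t - offs \<gamma> ?w a i"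
      have q: "t = offs \<gamma> ?w a i + q" "q \<le> length (cword \<gamma> a (?w ! i))"
        using True ir st(1) unfolding q_def offs_Suc[OF ir(1)] by auto
      show ?thesis using near[OF ir(1) q(2), folded q(1)] n1 by linarith
    next
      case False
      have si: "Suc i < length ?w"
      proof (rule ccontr)
        assume "\<not> ?thesis"
        then have "Suc i = length ?w" using ir(1) by simp
        then show False using False st(2) unfolding W by simp
      qed
      define q where "q = t - offs \<gamma> ?w a (Suc i)"
      have "t \<le> offs \<gamma> ?w a (Suc i) + length (cword \<gamma> a (?w ! Suc i))"
        using close[of "?w ! Suc i"] ir st(1) unfolding offs_Suc[OF ir(1)] by linarith
      then have q: "t = offs \<gamma> ?w a (Suc i) + q" "q \<le> length (cword \<gamma> a (?w ! Suc i))"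
        using False unfolding q_def by auto
      have n2: "\<bar>Dev J b j t - Dev J b j (offs \<gamma> ?w a (Suc i))\<bar> \<le> G" using near[OF si q(2), folded q(1)] .
      have n3: "\<bar>Dev J b j (offs \<gamma> ?w a (Suc i)) - Dev J b j (offs \<gamma> ?w a i)\<bar> \<le> G"
        using near[OF ir(1) order_refl] unfolding offs_Suc[OF ir(1)] .
      show ?thesis using n1 n2 n3 by linarith
    qed
  qed
qed

end

lemma Qw_one: "(Qw \<gamma> a b *v 1) $ j = real (length (cword (shift \<gamma> a) (b - a) j))"
proof -
  have "real (length xs) = sum_list (map (($) 1) xs)" for xs :: "'a::finite list" by (induction xs) auto
  then show ?thesis unfolding Qw_mult by simp
qed

lemma row_sum_le:
  fixes \<gamma> :: "'d::finite rotation_number"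
  shows "real (length (cword (shift \<gamma> a) (b - a) j)) \<le> onorm ((*v) (Qw \<gamma> a b)) * norm (1 :: real ^ 'd)"
proof -
  have "real (length (cword (shift \<gamma> a) (b - a) j)) = (Qw \<gamma> a b *v 1) $ j" unfolding Qw_one ..
  also have "\<dots> \<le> norm (Qw \<gamma> a b *v 1)" using component_le_norm_cart[of "Qw \<gamma> a b *v 1" j] by linarith
  also have "\<dots> \<le> onorm ((*v) (Qw \<gamma> a b)) * norm (1 :: real ^ 'd)"
    by (rule onorm[OF matrix_vector_mul_bounded_linear])
  finally show ?thesis .
qed

context tower_comparison
begin

text \<open>\<open>dev_step\<close> is iterated along the levels \<open>a m\<close>; the products of
  block numbers and full-climb errors are subexponential, hence so are their partial sums. Levels
  between \<open>a m\<close> and \<open>a (Suc m)\<close> have shorter words and are covered by the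
  same bound.\<close>

lemma dev_growth:
  assumes a: "mono a"
    and err: "subexp (\<lambda>m. norm (log_slope ((rauzy ^^ a m) T) - Qw \<gamma> 0 (a m) *v v))"
    and R: "subexp (\<lambda>m. onorm ((*v) (Qw \<gamma> (a m) (a (Suc m)))))"
  obtains G where "subexp G" "\<And>m b. b \<le> a m \<Longrightarrow> dev_le b (G m)"
proof -
  let ?c = "norm (1 :: real ^ 'd)"
  let ?R = "\<lambda>m. onorm ((*v) (Qw \<gamma> (a m) (a (Suc m)))) * ?c"
  let ?F = "\<lambda>m. norm (log_slope ((rauzy ^^ a m) T) - Qw \<gamma> 0 (a m) *v v) + L"
  let ?Fi = "norm (log_slope T - v) + L"
  let ?Ri = "onorm ((*v) (Qw \<gamma> 0 (a 0))) * ?c"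
  define G where "G m = (?Ri * ?Fi + ?Fi) + (\<Sum>k<m. ?R k * ?F k)" for m
  have L: "L \<ge> 0" using dist unfolding distortion_le_def by blast
  have Rn: "?R m \<ge> 0" "?Ri \<ge> 0" for m by (intro mult_nonneg_nonneg onorm_pos_le matrix_vector_mul_bounded_linear norm_ge_zero)+
  have Fn: "?F m \<ge> 0" for m using L by simp
  have mono_dev: "dev_le b G'" if "dev_le b G''" "G'' \<le> G'" for b G' G''
    using that unfolding dev_le_def by (meson order_trans)
  have GS: "G (Suc m) = ?R m * ?F m + G m" for m unfolding G_def by simp
  have "b \<le> a m \<Longrightarrow> dev_le b (G m)" for m b
  proof (induction m arbitrary: b)
    case 0
    have "dev_le b (?Ri * (norm (log_slope ((rauzy ^^ 0) T) - Qw \<gamma> 0 0 *v v) + L) + ?Fi)"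
    proof (rule dev_step[OF dev_level_0 le0])
      fix j
      have "length (cword (shift \<gamma> 0) (b - 0) j) \<le> length (cword (shift \<gamma> 0) (a 0 - 0) j)"
        using 0 by (intro length_cword_mono) simp
      then show "real (length (cword (shift \<gamma> 0) (b - 0) j)) \<le> ?Ri"
        using row_sum_le[of \<gamma> 0 "a 0" j] by linarith
    qed
    then show ?case unfolding G_def by (simp add: Qw_same)
  next
    case (Suc m)
    show ?case
    proof (cases "b \<le> a m")
      case True
      have "G m \<le> G (Suc m)" unfolding GS using mult_nonneg_nonneg[OF Rn(1) Fn, of m m] by simp
      then show ?thesis using Suc.IH[OF True] mono_dev by blast
    next
      case False
      have "dev_le b (?R m * ?F m + G m)"
      proof (rule dev_step[OF Suc.IH[OF order_refl]])
        show "a m \<le> b" using False by simp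
        fix j
        have "length (cword (shift \<gamma> (a m)) (b - a m) j) \<le> length (cword (shift \<gamma> (a m)) (a (Suc m) - a m) j)"
          using Suc.prems by (intro length_cword_mono) simp
        then show "real (length (cword (shift \<gamma> (a m)) (b - a m) j)) \<le> ?R m"
          using row_sum_le[of \<gamma> "a m" "a (Suc m)" j] by linarith
      qed
      then show ?thesis unfolding GS .
    qed
  qed
  moreover have "subexp G"
    unfolding G_def by (intro subexp_add subexp_const subexp_sum subexp_mult R err)
  ultimately show ?thesis using that by blast
qed

text \<open>A distance D is measured at a level M whose heights are at least D. As heights double
  from level to level, M is of order log D, so a bound exp(\<epsilon> M) becomes the power of D with
  exponent \<epsilon> / ln 2; this dictates the choice of \<epsilon>.\<close>

lemma dev_distance:
  assumes G: "\<And>m b. b \<le> a m \<Longrightarrow> dev_le b (G m)" "subexp G"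
    and heights: "\<And>m l. 1 \<le> m \<Longrightarrow> 2 ^ (m - 1) \<le> length (cword \<gamma> (a m) l)"
    and g: "g > 0"
  obtains B where "B > 0" "\<And>b J j s t. Ico J \<Longrightarrow> J \<subseteq> rpiece T b j \<Longrightarrow> s \<le> t \<Longrightarrow> t \<le> length (cword \<gamma> b j) \<Longrightarrow>
      \<bar>Dev J b j t - Dev J b j s\<bar> \<le> B * (max 1 (real (t - s))) powr g"
proof -
  define \<epsilon> where "\<epsilon> = g * ln 2"
  have \<epsilon>: "\<epsilon> > 0" unfolding \<epsilon>_def using g by simp
  obtain C where C: "C > 0" "\<And>m. \<bar>G m\<bar> \<le> C * exp (\<epsilon> * real m)" using subexpD[OF G(2) \<epsilon>] by blast
  have "\<bar>Dev J b j t - Dev J b j s\<bar> \<le> (3 * C * 4 powr g) * (max 1 (real (t - s))) powr g"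
    if J: "Ico J" "J \<subseteq> rpiece T b j" and st: "s \<le> t" "t \<le> length (cword \<gamma> b j)" for b J j s t
  proof -
    \<comment> \<open>The exponent m - 1 is that of the height bound, which starts at m = 1.
      Minimality of M gives the converse \<open>big\<close>, where the factor 4 covers the two lost
      powers of 2.\<close>
    define M where "M = (LEAST m. 1 \<le> m \<and> t - s \<le> 2 ^ (m - 1))"
    have ex: "1 \<le> Suc (t - s) \<and> t - s \<le> 2 ^ (Suc (t - s) - 1)"
      using less_exp[of "t - s"] by simp
    have M: "1 \<le> M" "t - s \<le> 2 ^ (M - 1)" using LeastI[of "\<lambda>m. 1 \<le> m \<and> t - s \<le> 2 ^ (m - 1)", OF ex] unfolding M_def by auto
    have big: "2 ^ M \<le> 4 * max 1 (real (t - s))"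
    proof (cases "M = 1")
      case False
      then have "\<not> (1 \<le> M - 1 \<and> t - s \<le> 2 ^ (M - 1 - 1))"
        using not_less_Least[of "M - 1" "\<lambda>m. 1 \<le> m \<and> t - s \<le> 2 ^ (m - 1)"] M(1) unfolding M_def[symmetric] by simp
      then have "2 ^ (M - 2) < t - s" using False M(1) by (auto simp: numeral_2_eq_2)
      then have "(2::real) ^ (M - 2) < real (t - s)" by (metis of_nat_less_iff of_nat_numeral of_nat_power)
      moreover have "(2::real) ^ M = 4 * 2 ^ (M - 2)"
      proof -
        have "M = 2 + (M - 2)" using False M(1) by simp
        then have "(2::real) ^ M = 2 ^ 2 * 2 ^ (M - 2)" by (metis power_add)
        then show ?thesis by simp
      qed
      ultimately show ?thesis by linarith
    qed auto
    have Gn: "G M \<ge> 0"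
      using dev_leD[OF G(1)[OF order_refl, of M] Ico_rpiece[OF fol] order_refl le0] by (simp add: dev_0)
    have "\<bar>Dev J b j t - Dev J b j s\<bar> \<le> 3 * G M"
    proof (cases "a M \<le> b")
      case True
      show ?thesis
        by (rule dev_close[OF G(1)[OF order_refl] True J st]) (use M heights[OF M(1)] in \<open>meson order_trans\<close>)
    next
      case False
      then have d: "dev_le b (G M)" by (intro G(1)) simp
      have "\<bar>Dev J b j t\<bar> \<le> G M" "\<bar>Dev J b j s\<bar> \<le> G M"
        using dev_leD[OF d J] st by auto
      then show ?thesis using Gn by linarith
    qed
    also have "3 * G M \<le> 3 * (C * exp (\<epsilon> * real M))" using C(2)[of M] by simp
    also have "exp (\<epsilon> * real M) = (2 ^ M) powr g"
      unfolding \<epsilon>_def by (simp add: powr_def ln_realpow algebra_simps)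
    also have "3 * (C * (2 ^ M) powr g) \<le> 3 * (C * (4 * max 1 (real (t - s))) powr g)"
      using big C(1) g by (intro mult_left_mono powr_mono2) auto
    also have "\<dots> = (3 * C * 4 powr g) * (max 1 (real (t - s))) powr g"
      by (simp add: powr_mult)
    finally show ?thesis .
  qed
  moreover have "3 * C * 4 powr g > 0" using C(1) by simp
  ultimately show ?thesis using that by blast
qed

end

section \<open>Transfer of distorted towers between maps with the same code\<close>

lemma iter_floor:
  assumes "pgiet T" "x \<in> {0..<1}" "0 \<le> int k + i"
  shows "iter T i ((gmap T ^^ k) x) = (gmap T ^^ nat (int k + i)) x"
proof (cases "0 \<le> i")
  case True
  then have "nat (int k + i) = nat i + k" by simp
  then show ?thesis using True unfolding iter_def by (simp add: funpow_add)
next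
  case False
  define m where "m = nat (- i)"
  have k: "k = m + nat (int k + i)" using False assms(3) unfolding m_def by simp
  have bij: "bij_betw (gmap T) {0..<1} {0..<1}" by (rule pgiet_bij[OF assms(1)])
  have mem: "(gmap T ^^ r) x \<in> {0..<1}" for r
    by (induction r) (use assms(2) bij in \<open>auto dest: bij_betwE\<close>)
  have "(inv_into {0..<1} (gmap T) ^^ m) ((gmap T ^^ (m + r)) x) = (gmap T ^^ r) x" for m r
  proof (induction m arbitrary: r)
    case (Suc m)
    have "(inv_into {0..<1} (gmap T) ^^ m) ((gmap T ^^ (m + Suc r)) x) = (gmap T ^^ Suc r) x" by (rule Suc)
    then show ?case using bij_betw_inv_into_left[OF bij mem, of r] by simp
  qed simp
  then show ?thesis using False k unfolding iter_def m_def[symmetric] by metis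
qed

lemma iter_floor_image:
  assumes "pgiet T" "J \<subseteq> {0..<1}" "0 \<le> int k + i"
  shows "iter T i ` (gmap T ^^ k) ` J = (gmap T ^^ nat (int k + i)) ` J"
  unfolding image_image using assms by (intro image_cong) (auto intro!: iter_floor)

text \<open>The heights depend on \<gamma> only, so the levels and the distinguished floors of the
  affine map can be kept for T. The distance estimate is applied in both directions from that floor,
  with an exponent smaller than that of the decay.\<close>

lemma towers_transfer:
  fixes T A :: "'d::finite giet"
  assumes "tower_comparison T \<gamma> L" and fA: "follows A \<gamma>" "affine_iet A" "log_slope A = v"
    and G: "\<And>m b. b \<le> a m \<Longrightarrow> tower_comparison.dev_le T \<gamma> v b (G m)" "subexp G"
    and heights: "\<And>m l. 1 \<le> m \<Longrightarrow> 2 ^ (m - 1) \<le> length (cword \<gamma> (a m) l)"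
    and exp: "exp_distorted_towers A"
  shows "exp_distorted_towers T"
proof -
  interpret tower_comparison T \<gamma> v L by (rule assms(1))
  have pT: "pgiet T" using follows_pgiet[OF fol, of 0] by simp
  have pA: "pgiet A" using follows_pgiet[OF fA(1), of 0] by simp
  note hT = followsD[OF fol] and hA = followsD[OF fA(1)]
  obtain C c g where Ccg: "C > 0" "c > 0" "g > 0" and inf: "infinite {n. \<forall>j. \<exists>k\<^sub>0 < height A n j.
        let F\<^sub>0 = iter A (int k\<^sub>0) ` piece A n j in
        \<forall>i. - int k\<^sub>0 \<le> i \<and> i < int (height A n j) - int k\<^sub>0 \<longrightarrow>
          len (iter A i ` F\<^sub>0) \<le> C * exp (- c * \<bar>real_of_int i\<bar> powr g) * len F\<^sub>0}" (is "infinite ?I")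
    using exp unfolding exp_distorted_towers_def by blast
  obtain B where B: "B > 0" "\<And>b J j s t. Ico J \<Longrightarrow> J \<subseteq> rpiece T b j \<Longrightarrow> s \<le> t \<Longrightarrow> t \<le> length (cword \<gamma> b j) \<Longrightarrow>
      \<bar>Dev J b j t - Dev J b j s\<bar> \<le> B * (max 1 (real (t - s))) powr (g / 2)"
    using dev_distance[OF G heights, of "g / 2"] Ccg(3) by auto
  \<comment> \<open>The deviation is taken with exponent g/2. Completing the square, B y <= (c/2)
    y^2 + B^2/(2c) with y of order x^(g/2), so half of the decay rate c absorbs it; the remaining
    terms, and a c/2 from the maximum with 1, go into the constant.\<close>
  define C' where "C' = exp (ln C + c / 2 + B\<^sup>2 / (2 * c))"
  have "C' > 0" unfolding C'_def by simp
  have absorb: "B * (max 1 x) powr (g / 2) \<le> c / 2 * x powr g + (c / 2 + B\<^sup>2 / (2 * c))" if "x \<ge> 0" for x :: real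
  proof -
    let ?y = "(max 1 x) powr (g / 2)"
    have "0 \<le> (c * ?y - B)\<^sup>2 / (2 * c)" using Ccg(2) by simp
    then have "B * ?y \<le> c / 2 * (?y * ?y) + B\<^sup>2 / (2 * c)"
      using Ccg(2) by (simp add: power2_diff field_simps power2_eq_square)
    moreover have "?y * ?y = (max 1 x) powr g" by (simp add: powr_add[symmetric])
    moreover have "(max 1 x) powr g \<le> 1 + x powr g" by (cases "x \<le> 1") (auto simp: max_def)
    ultimately show ?thesis using Ccg(2) mult_left_mono[of "(max 1 x) powr g" "1 + x powr g" "c / 2"]
      by (simp add: distrib_left)
  qed
  have "?I \<subseteq> {n. \<forall>j. \<exists>k\<^sub>0 < height T n j.
        let F\<^sub>0 = iter T (int k\<^sub>0) ` piece T n j in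
        \<forall>i. - int k\<^sub>0 \<le> i \<and> i < int (height T n j) - int k\<^sub>0 \<longrightarrow>
          len (iter T i ` F\<^sub>0) \<le> C' * exp (- (c / 2) * \<bar>real_of_int i\<bar> powr g) * len F\<^sub>0}"
  proof (intro subsetI CollectI allI)
    fix n j assume n: "n \<in> ?I"
    let ?b = "ztime \<gamma> n"
    let ?W = "cword \<gamma> ?b j" and ?P = "rpiece T ?b j" and ?PA = "rpiece A ?b j"
    have hgt: "height A n j = length ?W" "height T n j = length ?W" by (rule height_eq, rule fA fol)+
    have P01: "?P \<subseteq> {0..<1}" "?PA \<subseteq> {0..<1}"
      using rpiece_bounds[OF fol, of ?b j] rlen_bounds(2)[OF fol, of ?b]
        rpiece_bounds[OF fA(1), of ?b j] rlen_bounds(2)[OF fA(1), of ?b] by auto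
    obtain k where k: "k < length ?W" and kA: "\<And>i. - int k \<le> i \<Longrightarrow> i < int (length ?W) - int k \<Longrightarrow>
        len (iter A i ` iter A (int k) ` ?PA) \<le> C * exp (- c * \<bar>real_of_int i\<bar> powr g) * len (iter A (int k) ` ?PA)"
      using spec[OF CollectD[OF n], of j] unfolding Let_def hgt(1) piece_eq_rpiece[OF hA] by blast
    have iA: "iter A (int r) ` X = (gmap A ^^ r) ` X" for r X unfolding iter_def by simp
    have iT: "iter T (int r) ` X = (gmap T ^^ r) ` X" for r X unfolding iter_def by simp
    have main: "len (iter T i ` iter T (int k) ` ?P) \<le> C' * exp (- (c / 2) * \<bar>real_of_int i\<bar> powr g) * len (iter T (int k) ` ?P)"
      if i: "- int k \<le> i" "i < int (length ?W) - int k" for i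
    proof -
      define t where "t = nat (int k + i)"
      have t: "t < length ?W" "int t = int k + i" using i unfolding t_def by auto
      have tT: "iter T i ` iter T (int k) ` ?P = (gmap T ^^ t) ` ?P"
        unfolding iT t_def using iter_floor_image[OF pT P01(1), of k i] i(1) by simp
      have tA: "iter A i ` iter A (int k) ` ?PA = (gmap A ^^ t) ` ?PA"
        unfolding iA t_def using iter_floor_image[OF pA P01(2), of k i] i(1) by simp
      have lT: "len ((gmap T ^^ s) ` ?P) > 0" if "s \<le> length ?W" for s
        using Ico_len[OF Ico_sub_rpiece[OF fol Ico_rpiece[OF fol] order_refl that]] .
      have lA: "len ((gmap A ^^ s) ` ?PA) > 0" if "s \<le> length ?W" for s
        using Ico_len[OF Ico_sub_rpiece[OF fA(1) Ico_rpiece[OF fA(1)] order_refl that]] .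
      have gA: "growth (gmap A) ?PA s = codesum \<gamma> v ?b j s" if "s \<le> length ?W" for s
        unfolding codesum_sum[OF that]
        using affine_growth[OF fA(1,2) Ico_rpiece[OF fA(1)] order_refl that] fA(3) by simp
      let ?x = "\<bar>real_of_int i\<bar>"
      have "len ((gmap A ^^ t) ` ?PA) \<le> C * exp (- c * ?x powr g) * len ((gmap A ^^ k) ` ?PA)"
        using kA[OF i] unfolding tA unfolding iA .
      then have "ln (len ((gmap A ^^ t) ` ?PA)) \<le> ln (C * exp (- c * ?x powr g) * len ((gmap A ^^ k) ` ?PA))"
        using lA[of t] t(1) by (intro ln_mono) auto
      also have "\<dots> = ln C - c * ?x powr g + ln (len ((gmap A ^^ k) ` ?PA))"
        using lA[of k] k Ccg(1) by (simp add: ln_mult)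
      finally have cA: "codesum \<gamma> v ?b j t - codesum \<gamma> v ?b j k \<le> ln C - c * ?x powr g"
        using gA[of t] gA[of k] t(1) k unfolding growth_def by simp
      have "\<bar>Dev ?P ?b j t - Dev ?P ?b j k\<bar> \<le> B * (max 1 ?x) powr (g / 2)"
      proof (cases "k \<le> t")
        case True
        then have "real (t - k) = ?x" using t(2) by linarith
        then show ?thesis using B(2)[OF Ico_rpiece[OF fol] order_refl True less_imp_le[OF t(1)]] by simp
      next
        case False
        then have "t \<le> k" "real (k - t) = ?x" using t(2) by linarith+
        then show ?thesis using B(2)[OF Ico_rpiece[OF fol, of ?b j] order_refl \<open>t \<le> k\<close> less_imp_le[OF k]]
          by (simp add: abs_minus_commute)
      qed
      then have "growth (gmap T) ?P t - growth (gmap T) ?P k \<le> ln C - c * ?x powr g + B * (max 1 ?x) powr (g / 2)"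
        using cA unfolding deviation_def by linarith
      also have "\<dots> \<le> ln C - c / 2 * ?x powr g + (c / 2 + B\<^sup>2 / (2 * c))"
        using absorb[of ?x] by simp
      finally have "ln (len ((gmap T ^^ t) ` ?P)) \<le>
          (ln C + c / 2 + B\<^sup>2 / (2 * c)) + (- (c / 2) * ?x powr g) + ln (len ((gmap T ^^ k) ` ?P))"
        unfolding growth_def by simp
      then have "exp (ln (len ((gmap T ^^ t) ` ?P))) \<le>
          exp ((ln C + c / 2 + B\<^sup>2 / (2 * c)) + (- (c / 2) * ?x powr g) + ln (len ((gmap T ^^ k) ` ?P)))"
        by (simp only: exp_le_cancel_iff)
      also have "\<dots> = C' * exp (- (c / 2) * ?x powr g) * exp (ln (len ((gmap T ^^ k) ` ?P)))"
        unfolding exp_add C'_def ..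
      finally show ?thesis unfolding tT unfolding iT using lT[of t] lT[of k] t(1) k by simp
    qed
    then show "\<exists>k\<^sub>0 < height T n j. let F\<^sub>0 = iter T (int k\<^sub>0) ` piece T n j in
        \<forall>i. - int k\<^sub>0 \<le> i \<and> i < int (height T n j) - int k\<^sub>0 \<longrightarrow>
          len (iter T i ` F\<^sub>0) \<le> C' * exp (- (c / 2) * \<bar>real_of_int i\<bar> powr g) * len F\<^sub>0"
      unfolding Let_def hgt(2) piece_eq_rpiece[OF hT] using k by blast
  qed
  then have "infinite {n. \<forall>j. \<exists>k\<^sub>0 < height T n j.
        let F\<^sub>0 = iter T (int k\<^sub>0) ` piece T n j in
        \<forall>i. - int k\<^sub>0 \<le> i \<and> i < int (height T n j) - int k\<^sub>0 \<longrightarrow>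
          len (iter T i ` F\<^sub>0) \<le> C' * exp (- (c / 2) * \<bar>real_of_int i\<bar> powr g) * len F\<^sub>0}"
    using inf by (rule infinite_super)
  moreover have "infinitely_renormalizable T" using hT unfolding has_rotation_number_def by blast
  moreover have "c / 2 > 0" using Ccg(2) by simp
  ultimately show ?thesis unfolding exp_distorted_towers_def using \<open>C' > 0\<close> Ccg(3) by blast
qed

subsection \<open>Wandering intervals\<close>

text \<open>Wandering up to time R. The interval condition is required for all subintervals because
  the limit argument replaces J by a grid cell inside it; for disjointness this passage is
  automatic.\<close>

definition wanders_for :: "'d giet \<Rightarrow> nat \<Rightarrow> real set \<Rightarrow> bool" where
  "wanders_for T R J \<longleftrightarrow> Ico J \<and> J \<subseteq> {0..<1} \<and>
     (\<forall>J' i. J' \<subseteq> J \<and> Ico J' \<and> \<bar>i\<bar> \<le> int R \<longrightarrow> is_interval (iter T i ` J')) \<and>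
     (\<forall>i k. \<bar>i\<bar> \<le> int R \<and> \<bar>k\<bar> \<le> int R \<and> i \<noteq> k \<longrightarrow> iter T i ` J \<inter> iter T k ` J = {})"

lemma Ico_is_interval: "Ico J \<Longrightarrow> is_interval J"
  unfolding Ico_def by (auto simp: is_interval_1)

lemma Ico_contains_cell:
  assumes "Ico J" "len J \<ge> 2 * h" "J \<subseteq> {0..<1}" "h > 0"
  obtains a :: nat where "{real a * h..<real (Suc a) * h} \<subseteq> J" "a \<le> nat \<lceil>1 / h\<rceil>"
proof -
  obtain u v where uv: "u < v" "J = {u..<v}" using assms(1) unfolding Ico_def by blast
  have l: "v - u \<ge> 2 * h" using assms(2) uv by (simp add: len_Ico)
  have u: "0 \<le> u" "v \<le> 1" using assms(3) uv by (simp_all add: atLeastLessThan_subset_iff)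
  define a where "a = nat \<lceil>u / h\<rceil>"
  have a: "real a = of_int \<lceil>u / h\<rceil>" unfolding a_def using u assms(4) by simp
  have "u / h \<le> real a" "real a < u / h + 1" unfolding a by linarith+
  then have "u \<le> real a * h" "real a * h < u + h" using assms(4) by (auto simp: field_simps)
  then have "{real a * h..<real (Suc a) * h} \<subseteq> J" unfolding uv(2) using l by (auto simp: algebra_simps)
  moreover have "u / h \<le> 1 / h" using u uv(1) assms(4) by (intro divide_right_mono) auto
  then have "a \<le> nat \<lceil>1 / h\<rceil>" unfolding a_def by (intro nat_mono ceiling_mono)
  ultimately show ?thesis using that by blast
qed

text \<open>
  Long intervals without returns exist at every time scale; by the pigeonhole principle, they
  contain infinitely often the same cell of a fixed grid.
\<close>

lemma wandering_interval_limit: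
  assumes "\<eta> > 0" and J: "\<And>R. \<exists>J. wanders_for T R J \<and> len J \<ge> \<eta>"
  shows "\<exists>J. wandering_interval T J"
proof -
  \<comment> \<open>With mesh \<eta>/2, every interval of length at least \<eta> contains a whole
    cell.\<close>
  define h where "h = \<eta> / 2"
  have h: "h > 0" "2 * h = \<eta>" unfolding h_def using assms(1) by auto
  let ?c = "\<lambda>a::nat. {real a * h..<real (Suc a) * h}"
  have "\<exists>a. a \<le> nat \<lceil>1 / h\<rceil> \<and> (\<exists>J. wanders_for T R J \<and> ?c a \<subseteq> J)" for R
  proof -
    obtain J where w: "wanders_for T R J" "len J \<ge> \<eta>" using J by blast
    then show ?thesis
      using Ico_contains_cell[of J h] h unfolding wanders_for_def by metis
  qed
  then obtain f where f: "\<And>R. f R \<le> nat \<lceil>1 / h\<rceil>" "\<And>R. \<exists>J. wanders_for T R J \<and> ?c (f R) \<subseteq> J" by metis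
  have "finite (range f)" by (rule finite_subset[of _ "{..nat \<lceil>1 / h\<rceil>}"]) (use f(1) in auto)
  then obtain a where a: "infinite {R. f R = a}"
    using inf_img_fin_dom[of f UNIV] by (auto simp: vimage_def)
  have big: "\<exists>R'\<ge>R. \<exists>J. wanders_for T R' J \<and> ?c a \<subseteq> J" for R
  proof -
    obtain R' where "R' \<ge> R" "f R' = a" using a unfolding infinite_nat_iff_unbounded_le by blast
    then show ?thesis using f(2)[of R'] by blast
  qed
  have ic: "Ico (?c a)" unfolding Ico_def
    by (rule exI[of _ "real a * h"], rule exI[of _ "real (Suc a) * h"]) (use h(1) in \<open>simp add: algebra_simps\<close>)
  have "wandering_interval T (?c a)"
    unfolding wandering_interval_def
  proof (intro conjI allI)
    obtain R' J where "wanders_for T R' J" "?c a \<subseteq> J" using big[of 0] by blast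
    then show "?c a \<subseteq> {0..<1}" unfolding wanders_for_def by (elim conjE) (rule subset_trans)
    show "is_interval (?c a)" by (rule Ico_is_interval[OF ic])
    show "\<exists>x\<in>?c a. \<exists>y\<in>?c a. x < y"
      by (rule bexI[of _ "real a * h"], rule bexI[of _ "real a * h + h / 2"]) (use h(1) in \<open>auto simp: algebra_simps\<close>)
    show "is_interval (iter T i ` ?c a)" for i
    proof -
      obtain R' J where R: "R' \<ge> nat \<bar>i\<bar>" "wanders_for T R' J" "?c a \<subseteq> J" using big[of "nat \<bar>i\<bar>"] by blast
      then have "\<bar>i\<bar> \<le> int R'" by simp
      then show ?thesis using R(2,3) ic unfolding wanders_for_def by blast
    qed
    show "disjoint_family (\<lambda>i. iter T i ` ?c a)"
      unfolding disjoint_family_on_def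
    proof (intro ballI impI)
      fix i k :: int assume ik: "i \<noteq> k"
      obtain R' J where R: "R' \<ge> nat (\<bar>i\<bar> + \<bar>k\<bar>)" "wanders_for T R' J" "?c a \<subseteq> J" using big[of "nat (\<bar>i\<bar> + \<bar>k\<bar>)"] by blast
      then have "\<bar>i\<bar> \<le> int R'" "\<bar>k\<bar> \<le> int R'" by linarith+
      then have "iter T i ` J \<inter> iter T k ` J = {}" using R(2) ik unfolding wanders_for_def by blast
      then show "iter T i ` ?c a \<inter> iter T k ` ?c a = {}" using R(3) by blast
    qed
  qed
  then show ?thesis by blast
qed

lemma orbit_strict_mono:
  assumes "pgiet T" "\<And>k. k < N \<Longrightarrow> (gmap T ^^ k) ` J \<subseteq> topI T (c k)"
  shows "k \<le> N \<Longrightarrow> strict_mono_on J (gmap T ^^ k)"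
proof (induction k)
  case (Suc k)
  show ?case
  proof (rule strict_mono_onI)
    fix x y assume xy: "x \<in> J" "y \<in> J" "x < y"
    have m: "strict_mono_on (topI T (c k)) (gmap T)" using assms(1) unfolding pgiet_def by blast
    have "(gmap T ^^ k) x < (gmap T ^^ k) y" using Suc xy by (auto dest: strict_mono_onD)
    moreover have "(gmap T ^^ k) x \<in> topI T (c k)" "(gmap T ^^ k) y \<in> topI T (c k)"
      using assms(2)[of k] Suc.prems xy by auto
    ultimately show "(gmap T ^^ Suc k) x < (gmap T ^^ Suc k) y" using strict_mono_onD[OF m] by simp
  qed
qed (simp add: strict_mono_on_def)

lemma is_interval_preimage:
  fixes f :: "real \<Rightarrow> real"
  assumes "is_interval X" "is_interval Y" "strict_mono_on X f"
  shows "is_interval {x \<in> X. f x \<in> Y}"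
  unfolding is_interval_1
proof (intro ballI allI impI, elim conjE)
  fix x y z assume x: "x \<in> {x \<in> X. f x \<in> Y}" and y: "y \<in> {x \<in> X. f x \<in> Y}" and z: "x \<le> z" "z \<le> y"
  then have zX: "z \<in> X" using assms(1) unfolding is_interval_1 by blast
  have le: "f u \<le> f w" if "u \<in> X" "w \<in> X" "u \<le> w" for u w
    using that strict_mono_onD[OF assms(3), of u w] by (cases "u = w") auto
  have "f x \<le> f z" "f z \<le> f y" using le x y z zX by auto
  then show "z \<in> {x \<in> X. f x \<in> Y}" using assms(2) x y zX unfolding is_interval_1 by blast
qed

text \<open>Forward images are intervals since they run through top intervals. A backward image is
  the preimage of an interval under the increasing climb from a lower floor of the same tower, which
  exists as k is at least R. Two times in [-R, R] differ by at most 2R, so excluding returns up to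
  2R gives disjointness.\<close>

lemma wanders_for_floor:
  assumes fol: "follows T \<gamma>" and J: "Ico J" "J \<subseteq> (gmap T ^^ k) ` rpiece T n j" and k: "R \<le> k" "k \<le> length (cword \<gamma> n j)"
    and fwd: "\<And>i. i < R \<Longrightarrow> (gmap T ^^ i) ` J \<subseteq> topI T (c i)"
    and no: "\<And>x y m. x \<in> J \<Longrightarrow> y \<in> J \<Longrightarrow> 0 < m \<Longrightarrow> m \<le> 2 * R \<Longrightarrow> (gmap T ^^ m) x \<noteq> y"
  shows "wanders_for T R J"
proof -
  let ?P = "rpiece T n j" and ?f = "gmap T"
  have pg: "pgiet T" using follows_pgiet[OF fol, of 0] by simp
  have P01: "?P \<subseteq> {0..<1}" using rpiece_bounds[OF fol, of n j] rlen_bounds(2)[OF fol, of n] by auto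
  have range: "(?f ^^ i) x \<in> {0..<1}" if "x \<in> {0..<1}" for i x
    using gmap_range(2)[OF fol that, of i 0] by simp
  have J01: "J \<subseteq> {0..<1}" using J(2) P01 range by blast
  have itJ: "\<exists>z\<in>{0..<1}. x = (?f ^^ k) z \<and> (\<forall>i. 0 \<le> int k + i \<longrightarrow> iter T i x = (?f ^^ nat (int k + i)) z)"
    if x: "x \<in> J" for x
  proof -
    obtain z where z: "z \<in> ?P" "x = (?f ^^ k) z" using J(2) x by blast
    then have "z \<in> {0..<1}" using P01 by blast
    then show ?thesis using iter_floor[OF pg, of z k] z by blast
  qed
  have int: "is_interval (iter T i ` J')" if J': "J' \<subseteq> J" "Ico J'" and i: "\<bar>i\<bar> \<le> int R" for J' i
  proof (cases "0 \<le> i")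
    case True
    then have "iter T i ` J' = (?f ^^ nat i) ` J'" unfolding iter_def by simp
    moreover have "Ico ((?f ^^ nat i) ` J')"
      by (rule Ico_orbit[OF pg J'(2), of R c]) (use fwd J'(1) True i in \<open>blast, simp\<close>)
    ultimately show ?thesis using Ico_is_interval by simp
  next
    case False
    define r where "r = nat (- i)"
    have r: "r \<le> k" "i = - int r" using False i k(1) unfolding r_def by auto
    let ?X = "(?f ^^ (k - r)) ` ?P"
    have pow: "(?f ^^ r) ((?f ^^ (k - r)) z) = (?f ^^ k) z" for z
      using r(1) by (metis comp_apply funpow_add le_add_diff_inverse)
    have IX: "Ico ?X" by (rule Ico_sub_rpiece[OF fol Ico_rpiece[OF fol] order_refl]) (use k(2) in simp)
    have mX: "strict_mono_on ?X (?f ^^ r)"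
    proof (rule orbit_strict_mono[OF pg, of r _ "\<lambda>i. cword \<gamma> n j ! (k - r + i)"])
      fix i assume "i < r"
      then have "k - r + i < length (cword \<gamma> n j)" using r(1) k(2) by simp
      then have "(?f ^^ (k - r + i)) ` ?P \<subseteq> topI T (cword \<gamma> n j ! (k - r + i))" using rpiece_orbit(1)[OF fol] by blast
      then show "(?f ^^ i) ` ?X \<subseteq> topI T (cword \<gamma> n j ! (k - r + i))"
        by (simp add: image_image funpow_add[symmetric, THEN fun_cong, unfolded comp_apply] add.commute)
    qed simp
    have itX: "iter T i x \<in> ?X \<and> (?f ^^ r) (iter T i x) = x" if x: "x \<in> J" for x
    proof -
      obtain z where z: "z \<in> ?P" "x = (?f ^^ k) z" using J(2) x by blast
      have "iter T i x = (?f ^^ (k - r)) z"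
      proof -
        have e: "int k + i = int (k - r)" using r by simp
        have "z \<in> {0..<1}" using P01 z(1) by blast
        from iter_floor[OF pg this, of k i] show ?thesis unfolding z(2) e by simp
      qed
      then show ?thesis using z pow by auto
    qed
    have "iter T i ` J' = {x \<in> ?X. (?f ^^ r) x \<in> J'}"
    proof (intro equalityI subsetI)
      fix y assume "y \<in> iter T i ` J'"
      then show "y \<in> {x \<in> ?X. (?f ^^ r) x \<in> J'}" using itX J'(1) by auto
    next
      fix y assume y: "y \<in> {x \<in> ?X. (?f ^^ r) x \<in> J'}"
      let ?x = "(?f ^^ r) y"
      have x: "?x \<in> J" using y J'(1) by blast
      have X01: "?X \<subseteq> {0..<1}" using range P01 by blast
      have "y = iter T i ?x"
        by (rule gmap_pow_inj[OF pg, of _ _ r]) (use y X01 itX[OF x] in auto)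
      then show "y \<in> iter T i ` J'" using y by blast
    qed
    then show ?thesis
      using is_interval_preimage[OF Ico_is_interval[OF IX] Ico_is_interval[OF J'(2)] mX] by simp
  qed
  have dis: "iter T i ` J \<inter> iter T l ` J = {}" if il: "\<bar>i\<bar> \<le> int R" "\<bar>l\<bar> \<le> int R" "i < l" for i l
  proof (rule ccontr)
    assume "\<not> ?thesis"
    then obtain x y where xy: "x \<in> J" "y \<in> J" "iter T i x = iter T l y" by blast
    obtain x' where x': "x' \<in> {0..<1}" "x = (?f ^^ k) x'" "\<forall>i. 0 \<le> int k + i \<longrightarrow> iter T i x = (?f ^^ nat (int k + i)) x'"
      using itJ[OF xy(1)] by blast
    obtain y' where y': "y' \<in> {0..<1}" "y = (?f ^^ k) y'" "\<forall>i. 0 \<le> int k + i \<longrightarrow> iter T i y = (?f ^^ nat (int k + i)) y'"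
      using itJ[OF xy(2)] by blast
    define m where "m = nat (l - i)"
    have m: "0 < m" "m \<le> 2 * R" "l = i + int m" using il unfolding m_def by auto
    define p where "p = nat (int k + i)"
    have p: "0 \<le> int k + i" "int p = int k + i" "nat (int k + l) = p + m" "0 \<le> int k + l"
      using il k(1) m unfolding p_def by auto
    have "iter T i x = (?f ^^ p) x'" using x'(3) p(1) unfolding p_def by blast
    moreover have "iter T l y = (?f ^^ (p + m)) y'" using y'(3) p(3,4) by metis
    ultimately have e: "(?f ^^ p) x' = (?f ^^ (p + m)) y'" using xy(3) by simp
    have "(?f ^^ p) x' = (?f ^^ p) ((?f ^^ m) y')" using e by (simp add: funpow_add)
    then have "x' = (?f ^^ m) y'" by (rule gmap_pow_inj[OF pg x'(1) range[OF y'(1)]])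
    then have "x = (?f ^^ m) y" unfolding x'(2) y'(2) by (metis add.commute comp_apply funpow_add)
    then show False using no[OF xy(2,1) m(1,2)] by simp
  qed
  have "iter T i ` J \<inter> iter T l ` J = {}" if "\<bar>i\<bar> \<le> int R" "\<bar>l\<bar> \<le> int R" "i \<noteq> l" for i l
    using dis[of i l] dis[of l i] that by (cases "i < l") auto
  then show ?thesis unfolding wanders_for_def using J(1) J01 int by blast
qed

section \<open>Masses of floors and the existence of long intervals without returns\<close>

lemma bot_lengths:
  fixes T :: "'d::finite giet"
  assumes "follows T \<gamma>"
  shows "(\<Sum>j\<in>UNIV. len ((\<lambda>y. rlen T n * y) ` botI ((rauzy ^^ n) T) j)) = rlen T n"
proof -
  have pg: "pgiet ((rauzy ^^ n) T)" by (rule follows_pgiet[OF assms])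
  have r: "0 < rlen T n" using rlen_bounds[OF assms] by blast
  let ?I = "botI ((rauzy ^^ n) T)"
  have I: "interval_partition ?I" using pg unfolding pgiet_def by blast
  have ic: "Ico (?I j)" "?I j \<subseteq> {0..<1}" for j
    using Ico_bot[OF pg] I unfolding interval_partition_def by blast+
  have "disjoint_family_on ?I UNIV" using I unfolding interval_partition_def by blast
  then have "(\<Sum>j\<in>UNIV. len (?I j)) = len (\<Union>j\<in>UNIV. ?I j)" using ic by (intro sum_len_disjoint(1)) auto
  also have "\<dots> = 1" using I unfolding interval_partition_def by (simp add: len_Ico)
  finally have "(\<Sum>j\<in>UNIV. len (?I j)) = 1" .
  moreover have "len ((\<lambda>y. rlen T n * y) ` ?I j) = rlen T n * len (?I j)" for j
    using Ico_scale[OF r ic(1)] by blast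
  ultimately show ?thesis by (simp add: sum_distrib_left[symmetric])
qed

lemma sum_ge_average:
  fixes f :: "'d::finite \<Rightarrow> real"
  assumes "(\<Sum>j\<in>UNIV. f j) = s"
  obtains j where "f j \<ge> s / real CARD('d)"
proof -
  have "\<exists>j. f j \<ge> s / real CARD('d)"
  proof (rule ccontr)
    assume "\<not> ?thesis"
    then have "f j < s / real CARD('d)" for j by (simp add: not_le)
    then have "(\<Sum>j\<in>UNIV. f j) < (\<Sum>j\<in>(UNIV::'d set). s / real CARD('d))" by (intro sum_strict_mono) auto
    also have "\<dots> = s" by simp
    finally show False using assms by simp
  qed
  then show ?thesis using that by blast
qed

text \<open>In the induction, a floor over a point z of the old base beyond the cut l belongs to the
  tower of the preimage of z, which lies below l by \<open>long_return\<close>. The loser's new word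
  is the concatenation that contains this floor.\<close>

lemma floors_cover:
  assumes "follows T \<gamma>" "y \<in> {0..<1}"
  shows "\<exists>j x k. x \<in> rpiece T n j \<and> k < length (cword \<gamma> n j) \<and> y = (gmap T ^^ k) x"
proof (induction n)
  case 0
  have "pgiet T" using follows_pgiet[OF assms(1), of 0] by simp
  then obtain j where "y \<in> topI T j" using pgiet_maps(2) assms(2) by blast
  then show ?case by (intro exI[of _ j] exI[of _ y] exI[of _ 0]) (simp add: rpiece_def rlen_0)
next
  case (Suc n)
  let ?R = "(rauzy ^^ n) T"
  interpret rauzy_step ?R using follows_step[OF assms(1)] .
  note d = follows_data[OF assms(1), of n]
  obtain j x k where x: "x \<in> rpiece T n j" "k < length (cword \<gamma> n j)" "y = (gmap T ^^ k) x" using Suc by blast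
  obtain z where z: "z \<in> topI ?R j" "x = rlen T n * z" using x(1) unfolding rpiece_def by blast
  have z01: "z \<in> {0..<1}" using maps(3)[OF z(1)] .
  have sc: "rlen T n * u = rlen T (Suc n) * (u / l)" for u unfolding rlen_Suc using l_bounds by simp
  have ex: "\<exists>i. u / l \<in> topI (rauzy ?R) i" if "0 \<le> u" "u < l" for u
    using pgiet_maps(2)[OF pgiet_rauzy, of "u / l"] that l_bounds by simp
  have mem: "rlen T n * u \<in> rpiece T (Suc n) i" if "u / l \<in> topI (rauzy ?R) i" for u i
    unfolding rpiece_def sc by (rule image_eqI[OF refl]) (use that in simp)
  show ?case
  proof (cases "z < l")
    case True
    then obtain i where i: "z / l \<in> topI (rauzy ?R) i" using ex z01 by auto
    note o = rauzy_orbit[OF i]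
    have lz: "l * (z / l) = z" using l_bounds by simp
    have "k < length (cword \<gamma> (Suc n) i)"
    proof (cases "i = loser ?R")
      case False
      then have "j = i" using o(3) z(1) maps(6) unfolding lz by blast
      then show ?thesis using x(2) False d by simp
    next
      case True
      then have "j = \<beta>" using o(4) z(1) maps(6) unfolding lz by blast
      then show ?thesis using x(2) True d by simp
    qed
    then show ?thesis using mem[OF i] x(3) z(2) by blast
  next
    case False
    obtain u where u: "u \<in> {0..<1}" "z = f u" using pgiet_bij[OF pg] z01 unfolding bij_betw_def by blast
    have lu: "l \<le> f u" using False u by simp
    note lr = long_return[OF u(1) lu]
    obtain i where i: "u / l \<in> topI (rauzy ?R) i" using ex lr(3) u(1) by auto
    note o = rauzy_orbit[OF i]
    have lz: "l * (u / l) = u" using l_bounds by simp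
    have il: "i = loser ?R"
    proof (rule ccontr)
      assume "i \<noteq> loser ?R"
      then have "l * gmap (rauzy ?R) (u / l) = f u" using o(3) unfolding lz by blast
      moreover have "gmap (rauzy ?R) (u / l) < 1"
        using pgiet_maps(1,5)[OF pgiet_rauzy] i by (meson atLeastLessThan_iff)
      ultimately show False using lu l_bounds mult_less_cancel_left_pos[of l "gmap (rauzy ?R) (u / l)" 1] by simp
    qed
    have j\<alpha>: "j = \<alpha>" using maps(6)[OF z(1)] lr(2) u(2) by blast
    have "(gmap T ^^ length (cword \<gamma> n \<beta>)) (rlen T n * u) = rlen T n * f u"
      using orbit_coding[OF assms(1) lr(1)] by blast
    then have "y = (gmap T ^^ (length (cword \<gamma> n \<beta>) + k)) (rlen T n * u)"
      unfolding x(3) z(2) u(2) by (simp add: funpow_add add.commute[of "length (cword \<gamma> n \<beta>)"])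
    moreover have "length (cword \<gamma> n \<beta>) + k < length (cword \<gamma> (Suc n) i)"
      using x(2) il j\<alpha> d by simp
    ultimately show ?thesis using mem[OF i] by blast
  qed
qed

lemma growth_one_bounded:
  fixes T :: "'d::finite giet"
  assumes "pgiet T" "distortion_le T L"
  obtains B where "B \<ge> 0" "\<And>J j. Ico J \<Longrightarrow> J \<subseteq> topI T j \<Longrightarrow> \<bar>growth (gmap T) J 1\<bar> \<le> B"
proof -
  have L: "L \<ge> 0" using assms(2) unfolding distortion_le_def by blast
  define B where "B = L + (\<Sum>j\<in>UNIV. \<bar>growth (gmap T) (topI T j) 1\<bar>)"
  have "\<bar>growth (gmap T) J 1\<bar> \<le> B" if J: "Ico J" "J \<subseteq> topI T j" for J j
  proof -
    have "\<bar>growth (gmap T) J 1 - growth (gmap T) (topI T j) 1\<bar> \<le> L * len (topI T j)"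
      using assms(2) J Ico_top[OF assms(1)] unfolding distortion_le_def by blast
    also have "len (topI T j) \<le> 1"
    proof -
      have "topI T j \<subseteq> {0..<1}" using pgiet_maps(3)[OF assms(1)] by blast
      then show ?thesis using sum_len_disjoint(2)[of "{j}" "topI T"] Ico_top[OF assms(1)]
        by (simp add: disjoint_family_on_def)
    qed
    then have "L * len (topI T j) \<le> L" using L by (simp add: mult_left_le)
    moreover have "\<bar>growth (gmap T) (topI T j) 1\<bar> \<le> (\<Sum>j\<in>UNIV. \<bar>growth (gmap T) (topI T j) 1\<bar>)"
      by (intro member_le_sum) auto
    ultimately show ?thesis unfolding B_def by linarith
  qed
  moreover have "B \<ge> 0" unfolding B_def using L by (simp add: sum_nonneg)
  ultimately show ?thesis using that by blast
qed

text \<open>Comparison with 1/n^2: exp y is at least y^k / k!, and k is chosen with k g >=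
  2.\<close>

lemma summable_stretched_exp:
  assumes "c > 0" "g > 0"
  shows "summable (\<lambda>n. exp (- c * real n powr g))"
proof -
  obtain k :: nat where k: "real k * g \<ge> 2" using reals_Archimedean3[OF assms(2)] by (metis less_imp_le)
  let ?K = "fact k / c ^ k"
  have "exp (- c * real n powr g) \<le> ?K * (1 / real n ^ 2)" if n: "n \<ge> 1" for n
  proof -
    let ?y = "c * real n powr g"
    have y: "?y > 0" using assms n by simp
    have "?y ^ k / fact k \<le> exp ?y"
    proof -
      have "(\<lambda>i. inverse (fact i) * ?y ^ i) sums exp ?y" using exp_converges[of ?y] by (simp add: scaleR_conv_of_real)
      then have "(\<Sum>i\<in>{k}. inverse (fact i) * ?y ^ i) \<le> exp ?y"
        using y by (intro order_trans[OF sum_le_suminf eq_refl]) (auto simp: sums_iff)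
      then show ?thesis by (simp add: divide_inverse mult.commute)
    qed
    then have "?y ^ k \<le> fact k * exp ?y" by (simp add: field_simps)
    then have "exp (- ?y) * ?y ^ k \<le> exp (- ?y) * (fact k * exp ?y)" by (rule mult_left_mono) simp
    also have "\<dots> = fact k" by (simp add: exp_minus)
    finally have "exp (- ?y) \<le> fact k / ?y ^ k" using y by (simp only: pos_le_divide_eq zero_less_power)
    also have "?y ^ k = c ^ k * real n powr (g * real k)"
      using n by (simp add: power_mult_distrib powr_powr[symmetric] powr_realpow)
    also have "fact k / (c ^ k * real n powr (g * real k)) \<le> fact k / (c ^ k * real n powr 2)"
      using n k assms by (intro divide_left_mono mult_left_mono powr_mono mult_pos_pos) (auto simp: mult.commute)
    also have "\<dots> = ?K * (1 / real n ^ 2)" using n by (simp add: powr_numeral)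
    finally show ?thesis by simp
  qed
  then have le: "norm (exp (- c * real n powr g)) \<le> ?K * (1 / real n ^ 2)" if "n \<ge> 1" for n
    using that by (simp only: real_norm_def abs_exp_cancel)
  have "summable (\<lambda>n. ?K * (1 / real n ^ 2))"
    using inverse_power_summable[of 2, where 'a = real] by (intro summable_mult) (simp add: inverse_eq_divide)
  then show ?thesis by (rule summable_comparison_test'[of _ 1]) (rule le)
qed

lemma sum_two_sided_le:
  fixes h :: "nat \<Rightarrow> real"
  assumes "summable h" "\<And>n. h n \<ge> 0" "k \<le> q"
  shows "(\<Sum>t<q. h (nat \<bar>int t - int k\<bar>)) \<le> 2 * (\<Sum>n. h n)"
proof -
  have fin: "(\<Sum>n\<in>A. h n) \<le> (\<Sum>n. h n)" if "finite A" for A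
    using assms(1,2) that by (intro sum_le_suminf) auto
  have "(\<Sum>t<q. h (nat \<bar>int t - int k\<bar>)) = (\<Sum>t\<in>{..<k}. h (nat \<bar>int t - int k\<bar>)) + (\<Sum>t\<in>{k..<q}. h (nat \<bar>int t - int k\<bar>))"
    using assms(3) by (subst sum.union_disjoint[symmetric]) (auto intro: sum.cong)
  also have "(\<Sum>t\<in>{..<k}. h (nat \<bar>int t - int k\<bar>)) = (\<Sum>n\<in>{1..k}. h n)"
    by (rule sum.reindex_bij_witness[of _ "\<lambda>n. k - n" "\<lambda>t. k - t"]) (auto simp: nat_diff_distrib intro!: arg_cong[of _ _ h])
  also have "(\<Sum>t\<in>{k..<q}. h (nat \<bar>int t - int k\<bar>)) = (\<Sum>n\<in>{..<q - k}. h n)"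
    by (rule sum.reindex_bij_witness[of _ "\<lambda>n. k + n" "\<lambda>t. t - k"]) (auto intro!: arg_cong[of _ _ h])
  finally show ?thesis using fin[of "{1..k}"] fin[of "{..<q - k}"] by simp
qed

lemma Ico_Int:
  assumes "Ico X" "Ico Y" "len (X \<inter> Y) > 0"
  shows "Ico (X \<inter> Y)"
proof -
  obtain u v u' v' where "X = {u..<v}" "Y = {u'..<v'}" using assms(1,2) unfolding Ico_def by blast
  then have XY: "X \<inter> Y = {max u u'..<min v v'}" by auto
  then have "max u u' < min v v'" using assms(3) by (simp add: len_Ico split: if_splits)
  then show ?thesis unfolding Ico_def using XY by blast
qed

lemma growth_bounded:
  assumes "pgiet T" "\<And>J j. Ico J \<Longrightarrow> J \<subseteq> topI T j \<Longrightarrow> \<bar>growth (gmap T) J 1\<bar> \<le> B"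
    "Ico J" "\<And>k. k < N \<Longrightarrow> (gmap T ^^ k) ` J \<subseteq> topI T (c k)"
  shows "\<bar>growth (gmap T) J N\<bar> \<le> real N * B"
proof -
  have "\<bar>growth (gmap T) J N\<bar> \<le> (\<Sum>k<N. \<bar>growth (gmap T) ((gmap T ^^ k) ` J) 1\<bar>)"
    unfolding growth_sum[of _ _ N] by (rule sum_abs)
  also have "\<dots> \<le> (\<Sum>k<N. B)"
    by (rule sum_mono, rule assms(2)[OF Ico_orbit[OF assms(1,3,4)]]) (use assms(4) in auto)
  finally show ?thesis by simp
qed

lemma Ico_len_mono:
  assumes "Ico X" "X \<subseteq> {a..<b}"
  shows "len X \<le> b - a"
proof -
  obtain u v where uv: "u < v" "X = {u..<v}" using assms(1) unfolding Ico_def by blast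
  then have "a \<le> u" "v \<le> b" using assms(2) by (simp_all add: atLeastLessThan_subset_iff)
  then show ?thesis using uv by (simp add: len_Ico)
qed

text \<open>An orbit leaving the base stays outside it for the height of its tower. To follow images
  forwards J must lie in one top piece, and to follow them backwards in one bottom piece; averaging
  over the labels for each of the two gives the length lam/d/d.\<close>

lemma wandering_if_base_large:
  fixes T :: "'d::finite giet"
  assumes fol: "follows T \<gamma>"
    and lam: "lam > 0" "\<And>n. lam \<le> rlen T (a n)"
    and heights: "\<And>R. \<exists>n. \<forall>j. R < length (cword \<gamma> (a n) j)"
  shows "\<exists>J. wandering_interval T J"
proof (rule wandering_interval_limit)
  let ?d = "real CARD('d)"
  show "lam / ?d / ?d > 0" using lam(1) by simp
  fix R
  obtain m where m: "\<And>j. 2 * R < length (cword \<gamma> (a m) j)" using heights by blast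
  define n where "n = a m"
  let ?B = "\<lambda>j. (\<lambda>y. rlen T n * y) ` botI ((rauzy ^^ n) T) j"
  have pg: "pgiet ((rauzy ^^ n) T)" by (rule follows_pgiet[OF fol])
  have r: "0 < rlen T n" "rlen T n \<le> 1" using rlen_bounds[OF fol] by blast+
  obtain j where j: "len (?B j) \<ge> rlen T n / ?d" using sum_ge_average[OF bot_lengths[OF fol]] by blast
  have iB: "Ico (?B j)" using Ico_scale[OF r(1) Ico_bot[OF pg]] by blast
  have Bsub: "?B j \<subseteq> (\<Union>i. rpiece T n i)"
  proof
    fix x assume "x \<in> ?B j"
    then obtain y where y: "y \<in> botI ((rauzy ^^ n) T) j" "x = rlen T n * y" by blast
    then obtain i where "y \<in> topI ((rauzy ^^ n) T) i" using pgiet_maps(2,5)[OF pg] by blast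
    then show "x \<in> (\<Union>i. rpiece T n i)" unfolding rpiece_def y(2) by blast
  qed
  have meas: "X \<in> sets lborel \<and> emeasure lborel X \<noteq> \<infinity>" if "Ico X" for X using that unfolding Ico_def by auto
  have "disjoint_family_on (\<lambda>i. ?B j \<inter> rpiece T n i) UNIV"
    unfolding disjoint_family_on_def
  proof (intro ballI impI)
    fix i k :: 'd assume "i \<noteq> k"
    then have "rpiece T n i \<inter> rpiece T n k = {}"
      using floors_disjoint(2)[OF fol, of _ n i _ k 0 0] cword_ne[of \<gamma> n] by fastforce
    then show "(?B j \<inter> rpiece T n i) \<inter> (?B j \<inter> rpiece T n k) = {}" by blast
  qed
  then have "measure lborel (\<Union>i. ?B j \<inter> rpiece T n i) = (\<Sum>i\<in>UNIV. measure lborel (?B j \<inter> rpiece T n i))"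
  proof (intro measure_finite_Union)
    show "emeasure lborel (?B j \<inter> rpiece T n i) \<noteq> \<infinity>" for i
      using meas[OF iB] meas[OF Ico_rpiece[OF fol, of n i]] emeasure_mono[of "?B j \<inter> rpiece T n i" "?B j" lborel]
      by (metis Int_lower1 infinity_ennreal_def neq_top_trans)
  qed (use meas[OF iB] meas[OF Ico_rpiece[OF fol]] in auto)
  also have "(\<Union>i. ?B j \<inter> rpiece T n i) = ?B j" using Bsub by blast
  finally have "(\<Sum>i\<in>UNIV. len (?B j \<inter> rpiece T n i)) = len (?B j)" unfolding len_def ..
  then obtain i where i: "len (?B j \<inter> rpiece T n i) \<ge> len (?B j) / ?d" by (rule sum_ge_average)
  let ?J = "?B j \<inter> rpiece T n i"
  have "lam / ?d \<le> len (?B j)" using j lam(2)[of m] unfolding n_def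
    by (meson divide_right_mono of_nat_0_le_iff order_trans)
  then have lJ: "lam / ?d / ?d \<le> len ?J" using i by (meson divide_right_mono of_nat_0_le_iff order_trans)
  then have "len ?J > 0" using lam(1) \<open>lam / ?d / ?d > 0\<close> by linarith
  then have iJ: "Ico ?J" by (rule Ico_Int[OF iB Ico_rpiece[OF fol]])
  have "wanders_for T R ?J"
  proof (rule wanders_for_floor[OF fol iJ, of "length (cword \<gamma> n j)" n j R "\<lambda>k. cword \<gamma> n i ! k"])
    show "?J \<subseteq> (gmap T ^^ length (cword \<gamma> n j)) ` rpiece T n j" unfolding rpiece_return[OF fol] by blast
    show "R \<le> length (cword \<gamma> n j)" using m[of j] unfolding n_def by simp
    show "(gmap T ^^ k) ` ?J \<subseteq> topI T (cword \<gamma> n i ! k)" if "k < R" for k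
      using rpiece_orbit(1)[OF fol] that m[of i] unfolding n_def[symmetric] by auto
    show "(gmap T ^^ k) x \<noteq> y" if "x \<in> ?J" "y \<in> ?J" "0 < k" "k \<le> 2 * R" for x y k
    proof -
      have "rlen T n \<le> (gmap T ^^ k) x"
        using rpiece_orbit(2)[OF fol, of x n i k] that m[of i] unfolding n_def[symmetric] by auto
      moreover have "y < rlen T n" using rpiece_bounds[OF fol, of n i] that(2) by auto
      ultimately show ?thesis by auto
    qed
  qed simp
  then show "\<exists>J. wanders_for T R J \<and> len J \<ge> lam / ?d / ?d" using lJ by blast
qed

text \<open>If the bases have lengths bounded below, they provide the intervals. Otherwise the
  distinguished floor of some tower has length bounded below while both the bottom of the tower and
  its return image are tiny. As one iterate changes lengths by a bounded factor, that floor is far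
  from both ends.\<close>

lemma towers_wandering:
  fixes T :: "'d::finite giet"
  assumes fol: "follows T \<gamma>" and dist: "distortion_le T L" and ex: "exp_distorted_towers T"
    and zt: "mono (ztime \<gamma>)"
    and heights: "\<And>R. \<exists>n. \<forall>j. R < length (cword \<gamma> (ztime \<gamma> n) j)"
  shows "\<exists>J. wandering_interval T J"
proof (cases "\<exists>lam>0. \<forall>n. lam \<le> rlen T (ztime \<gamma> n)")
  case True
  then show ?thesis using wandering_if_base_large[OF fol _ _ heights] by blast
next
  case False
  let ?d = "real CARD('d)" and ?f = "gmap T"
  have pg: "pgiet T" using follows_pgiet[OF fol, of 0] by simp
  obtain C c g where Ccg: "C > 0" "c > 0" "g > 0" and inf: "infinite {n. \<forall>j. \<exists>k\<^sub>0 < height T n j.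
        let F\<^sub>0 = iter T (int k\<^sub>0) ` piece T n j in
        \<forall>i. - int k\<^sub>0 \<le> i \<and> i < int (height T n j) - int k\<^sub>0 \<longrightarrow>
          len (iter T i ` F\<^sub>0) \<le> C * exp (- c * \<bar>real_of_int i\<bar> powr g) * len F\<^sub>0}" (is "infinite ?I")
    using ex unfolding exp_distorted_towers_def by blast
  let ?h = "\<lambda>n::nat. exp (- c * real n powr g)"
  have sh: "summable ?h" by (rule summable_stretched_exp[OF Ccg(2,3)])
  define S where "S = (\<Sum>n. ?h n)"
  have "S > 0" unfolding S_def by (rule suminf_pos[OF sh]) simp
  \<comment> \<open>The decay bounds the mass of a tower by 2 C S times its distinguished floor, the
    factor 2 accounting for the two directions. The d towers cover [0, 1), so some distinguished
    floor has at least this length.\<close>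
  define \<eta> where "\<eta> = 1 / (2 * C * S) / ?d"
  have \<eta>: "\<eta> > 0" unfolding \<eta>_def using Ccg(1) \<open>S > 0\<close> by simp
  have floor_pos: "Ico ((?f ^^ t) ` rpiece T n j)" if "t \<le> length (cword \<gamma> n j)" for t n j
    by (rule Ico_sub_rpiece[OF fol Ico_rpiece[OF fol] order_refl that])
  have big: "\<exists>j k. k < length (cword \<gamma> (ztime \<gamma> n) j) \<and> len ((?f ^^ k) ` rpiece T (ztime \<gamma> n) j) \<ge> \<eta>" if n: "n \<in> ?I" for n
  proof -
    let ?b = "ztime \<gamma> n"
    let ?q = "\<lambda>j. length (cword \<gamma> ?b j)"
    have P01: "rpiece T ?b j \<subseteq> {0..<1}" for j
      using rpiece_bounds[OF fol, of ?b j] rlen_bounds(2)[OF fol, of ?b] by auto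
    have hgt: "height T n j = ?q j" for j by (rule height_eq[OF fol])
    have "\<exists>k. k < ?q j \<and> (\<forall>t<?q j. len ((?f ^^ t) ` rpiece T ?b j) \<le> C * ?h (nat \<bar>int t - int k\<bar>) * len ((?f ^^ k) ` rpiece T ?b j))" for j
    proof -
      obtain k where k: "k < ?q j" and kT: "\<And>i. - int k \<le> i \<Longrightarrow> i < int (?q j) - int k \<Longrightarrow>
          len (iter T i ` iter T (int k) ` rpiece T ?b j) \<le> C * exp (- c * \<bar>real_of_int i\<bar> powr g) * len (iter T (int k) ` rpiece T ?b j)"
        using spec[OF CollectD[OF n], of j] unfolding Let_def hgt piece_eq_rpiece[OF followsD[OF fol]] by blast
      have "len ((?f ^^ t) ` rpiece T ?b j) \<le> C * ?h (nat \<bar>int t - int k\<bar>) * len ((?f ^^ k) ` rpiece T ?b j)" if t: "t < ?q j" for t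
      proof -
        define i where "i = int t - int k"
        have i: "- int k \<le> i" "i < int (?q j) - int k" "0 \<le> int k + i" "nat (int k + i) = t" using t unfolding i_def by auto
        have a: "iter T (int k) ` X = (?f ^^ k) ` X" for X unfolding iter_def by simp
        have "iter T i ` (?f ^^ k) ` rpiece T ?b j = (?f ^^ t) ` rpiece T ?b j"
          using iter_floor_image[OF pg P01 i(3)] unfolding i(4) .
        moreover have "\<bar>real_of_int i\<bar> = real (nat \<bar>i\<bar>)" by simp
        ultimately show ?thesis using kT[OF i(1,2)] unfolding a i_def[symmetric] by simp
      qed
      then show ?thesis using k by blast
    qed
    then obtain k where k: "\<And>j. k j < ?q j" and kl: "\<And>j t. t < ?q j \<Longrightarrow>
       len ((?f ^^ t) ` rpiece T ?b j) \<le> C * ?h (nat \<bar>int t - int (k j)\<bar>) * len ((?f ^^ k j) ` rpiece T ?b j)" by metis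
    let ?F = "\<lambda>j. len ((?f ^^ k j) ` rpiece T ?b j)"
    have F0: "?F j \<ge> 0" for j unfolding len_def by simp
    have tower: "(\<Sum>t<?q j. len ((?f ^^ t) ` rpiece T ?b j)) \<le> (2 * C * S) * ?F j" for j
    proof -
      have "(\<Sum>t<?q j. len ((?f ^^ t) ` rpiece T ?b j)) \<le> (\<Sum>t<?q j. C * ?h (nat \<bar>int t - int (k j)\<bar>) * ?F j)"
        by (rule sum_mono) (use kl in blast)
      also have "\<dots> = (C * ?F j) * (\<Sum>t<?q j. ?h (nat \<bar>int t - int (k j)\<bar>))"
        by (simp only: sum_distrib_left) (simp only: mult_ac)
      also have "\<dots> \<le> (C * ?F j) * (2 * S)"
        unfolding S_def by (intro mult_left_mono sum_two_sided_le[OF sh]) (use k[of j] Ccg(1) F0 in \<open>auto intro: less_imp_le\<close>)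
      finally show ?thesis by (simp add: mult_ac)
    qed
    let ?X = "\<lambda>(j, t). (?f ^^ t) ` rpiece T ?b j"
    let ?A = "Sigma UNIV (\<lambda>j. {..<?q j})"
    have XI: "Ico (?X p)" if "p \<in> ?A" for p using that floor_pos by auto
    have "{0..<1} \<subseteq> (\<Union>p\<in>?A. ?X p)"
    proof
      fix y :: real assume "y \<in> {0..<1}"
      then obtain j x t where "x \<in> rpiece T ?b j" "t < ?q j" "y = (?f ^^ t) x" using floors_cover[OF fol, of y ?b] by blast
      then show "y \<in> (\<Union>p\<in>?A. ?X p)" by (intro UN_I[of "(j, t)"]) auto
    qed
    moreover have mX: "?X p \<in> sets lborel \<and> emeasure lborel (?X p) \<noteq> \<infinity>" if "p \<in> ?A" for p
      using XI[OF that] unfolding Ico_def by auto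
    ultimately have "measure lborel {0..<1::real} \<le> measure lborel (\<Union>p\<in>?A. ?X p)"
    proof (intro measure_mono_fmeasurable)
      show "(\<Union>p\<in>?A. ?X p) \<in> fmeasurable lborel"
        by (intro fmeasurable.finite_UN) (use mX in \<open>auto simp: fmeasurable_def less_top\<close>)
    qed auto
    also have "\<dots> \<le> (\<Sum>p\<in>?A. measure lborel (?X p))"
      by (intro measure_UNION_le) (use mX in auto)
    also have "\<dots> = (\<Sum>j\<in>UNIV. \<Sum>t<?q j. len ((?f ^^ t) ` rpiece T ?b j))"
      unfolding len_def by (subst sum.Sigma) (auto intro!: sum.cong)
    also have "\<dots> \<le> (\<Sum>j\<in>UNIV. (2 * C * S) * ?F j)" by (intro sum_mono tower)
    also have "\<dots> = (2 * C * S) * (\<Sum>j\<in>UNIV. ?F j)" by (simp only: sum_distrib_left)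
    finally have "1 \<le> (2 * C * S) * (\<Sum>j\<in>UNIV. ?F j)" by simp
    then have tot: "1 / (2 * C * S) \<le> (\<Sum>j\<in>UNIV. ?F j)" using Ccg(1) \<open>S > 0\<close> by (simp add: divide_le_eq mult.commute)
    obtain j where "?F j \<ge> (\<Sum>j\<in>UNIV. ?F j) / ?d" using sum_ge_average[OF refl, of ?F] by blast
    then have "?F j \<ge> \<eta>" unfolding \<eta>_def using divide_right_mono[OF tot, of ?d] by simp
    then show ?thesis using k[of j] by blast
  qed
  obtain B where B: "B \<ge> 0" "\<And>J j. Ico J \<Longrightarrow> J \<subseteq> topI T j \<Longrightarrow> \<bar>growth (gmap T) J 1\<bar> \<le> B"
    using growth_one_bounded[OF pg dist] by blast
  show ?thesis
  proof (rule wandering_interval_limit[OF \<eta>])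
    fix R
    \<comment> \<open>B bounds the change of the logarithm of a length under one iterate. A floor of
      length \<eta> within 2R iterates of the base would contain the base's smallness only up to
      exp(-R'), contradicting the choice of the level.\<close>
    define R' where "R' = real (2 * R + 1) * B"
    have "\<eta> * exp (- R') > 0" using \<eta> by simp
    then obtain n1 where n1: "rlen T (ztime \<gamma> n1) < \<eta> * exp (- R')" using False by (meson not_le)
    obtain n where n: "n \<ge> n1" "n \<in> ?I" using inf unfolding infinite_nat_iff_unbounded_le by blast
    define b where "b = ztime \<gamma> n"
    have "rlen T b \<le> rlen T (ztime \<gamma> n1)" unfolding b_def by (rule rlen_antimono[OF fol monoD[OF zt n(1)]])
    then have rb: "rlen T b < \<eta> * exp (- R')" using n1 by linarith
    obtain j k where k: "k < length (cword \<gamma> b j)" "len ((?f ^^ k) ` rpiece T b j) \<ge> \<eta>" using big[OF n(2)] unfolding b_def by blast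
    let ?q = "length (cword \<gamma> b j)" and ?P = "rpiece T b j" and ?F = "(?f ^^ k) ` rpiece T b j"
    have floor: "(?f ^^ t) ` ?P \<subseteq> topI T (cword \<gamma> b j ! t)" if "t < ?q" for t using rpiece_orbit(1)[OF fol] that by blast
    have iF: "Ico ?F" using floor_pos k(1) by simp
    have Ft: "(?f ^^ t) ` ?F = (?f ^^ (k + t)) ` ?P" for t by (simp add: image_image funpow_add add.commute[of k])
    have small: "len X < \<eta> * exp (- R')" if "Ico X" "X \<subseteq> {0..<rlen T b}" for X
      using Ico_len_mono[OF that] rb by simp
    have absurd: "ln (len ?F) - ln (len X) > R'" if "Ico X" "X \<subseteq> {0..<rlen T b}" for X
    proof -
      have "ln (len X) < ln (\<eta> * exp (- R'))" using small[OF that] Ico_len[OF that(1)] by (intro ln_less_cancel_iff[THEN iffD2]) auto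
      also have "\<dots> = ln \<eta> - R'" using \<eta> by (simp add: ln_mult)
      finally show ?thesis using ln_mono[OF k(2)] \<eta> by simp
    qed
    have Rk: "R \<le> k"
    proof (rule ccontr)
      assume "\<not> R \<le> k"
      have "\<bar>growth ?f ?P k\<bar> \<le> real k * B"
        by (rule growth_bounded[OF pg B(2) Ico_rpiece[OF fol], where c = "\<lambda>t. cword \<gamma> b j ! t"]) (use floor k(1) in auto)
      also have "\<dots> \<le> R'" unfolding R'_def using \<open>\<not> R \<le> k\<close> B(1) by (intro mult_right_mono) auto
      finally show False using absurd[OF Ico_rpiece[OF fol, of b j] rpiece_bounds[OF fol]] unfolding growth_def by linarith
    qed
    \<comment> \<open>The end of the tower is treated like its bottom: after the full height the
      piece is back in the base, hence shorter than the bound for \<open>rlen T b\<close>.\<close>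
    have Rq: "k + 2 * R < ?q"
    proof (rule ccontr)
      assume c: "\<not> k + 2 * R < ?q"
      let ?Y = "(?f ^^ ?q) ` ?P"
      have Y: "(?f ^^ (?q - k)) ` ?F = ?Y" unfolding Ft using k(1) by simp
      have iY: "Ico ?Y" by (rule floor_pos) simp
      have "?Y \<subseteq> {0..<rlen T b}"
        unfolding rpiece_return[OF fol] using pgiet_maps(5)[OF follows_pgiet[OF fol]] rlen_bounds(1)[OF fol, of b] by force
      note ab = absurd[OF iY this]
      have "\<bar>growth ?f ?F (?q - k)\<bar> \<le> real (?q - k) * B"
        by (rule growth_bounded[OF pg B(2) iF, where c = "\<lambda>t. cword \<gamma> b j ! (k + t)"]) (use floor in \<open>auto simp only: Ft less_diff_conv add.commute\<close>)
      also have "\<dots> \<le> R'" unfolding R'_def using c B(1) by (intro mult_right_mono) auto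
      finally show False using ab unfolding growth_def Y by simp
    qed
    have "wanders_for T R ?F"
    proof (rule wanders_for_floor[OF fol iF order_refl Rk, where c = "\<lambda>t. cword \<gamma> b j ! (k + t)"])
      show "k \<le> ?q" using k(1) by simp
      show "(?f ^^ t) ` ?F \<subseteq> topI T (cword \<gamma> b j ! (k + t))" if "t < R" for t
        unfolding Ft by (rule floor) (use that Rq in simp)
      show "(?f ^^ m) x \<noteq> y" if xy: "x \<in> ?F" "y \<in> ?F" and m: "0 < m" "m \<le> 2 * R" for x y m
      proof
        assume e: "(?f ^^ m) x = y"
        obtain x' y' where x': "x' \<in> ?P" "x = (?f ^^ k) x'" and y': "y' \<in> ?P" "y = (?f ^^ k) y'" using xy by blast
        have "(?f ^^ (m + k)) x' = (?f ^^ k) y'" using e unfolding x'(2) y'(2) by (simp add: funpow_add)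
        then have "m + k = k" by (rule floors_disjoint(1)[OF fol x'(1) y'(1), rotated 2]) (use Rq m k(1) in auto)
        then show False using m by simp
      qed
    qed
    then show "\<exists>J. wanders_for T R J \<and> len J \<ge> \<eta>" using k(2) by blast
  qed
qed

subsection \<open>Consequences of the Regular Diophantine Condition\<close>

lemma length_concat_ge:
  fixes f :: "'d::finite \<Rightarrow> 'b list"
  assumes "set w = UNIV"
  shows "(\<Sum>l\<in>UNIV. length (f l)) \<le> length (concat (map f w))"
proof -
  have "(\<Sum>l\<in>UNIV. length (f l)) \<le> (\<Sum>l\<in>UNIV. count_list w l * length (f l))"
  proof (rule sum_mono)
    fix l :: 'd
    have "count_list w l \<ge> 1" using assms by (simp add: count_list_0_iff Suc_le_eq neq0_conv[symmetric] del: neq0_conv)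
    then have "1 * length (f l) \<le> count_list w l * length (f l)" by (rule mult_le_mono1)
    then show "length (f l) \<le> count_list w l * length (f l)" by simp
  qed
  also have "\<dots> = length (concat (map f w))"
    using sum_list_map_eq_sum_count[of "\<lambda>l. length (f l)" w] assms by (simp add: length_concat o_def)
  finally show ?thesis .
qed

text \<open>The matrix A A has positive entries, so a return word between two good times contains
  every letter. Each new height is therefore at least the sum of all d old ones, hence at least
  twice the smallest of them.\<close>

lemma heights_grow:
  fixes S :: "'d::finite giet"
  assumes fol: "follows S \<gamma>" "irrational \<gamma>" and d: "2 \<le> CARD('d)" and good: "good_return_times S n"
  shows "1 \<le> k \<Longrightarrow> 2 ^ (k - 1) \<le> length (cword \<gamma> (ztime \<gamma> (n k)) l)"
proof -
  obtain p A where A: "\<forall>i j. (A :: real ^ 'd ^ 'd) $ i $ j > 0"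
    and n: "\<forall>k\<ge>1. Q S (n k) (n k + 2 * p) = A ** A \<and> n k + 2 * p \<le> n (Suc k)"
    using good unfolding good_return_times_def by blast
  note zm = ztime_strict_mono[OF fol]
  show "1 \<le> k \<Longrightarrow> 2 ^ (k - 1) \<le> length (cword \<gamma> (ztime \<gamma> (n k)) l)"
  proof (induction k arbitrary: l rule: dec_induct)
    case base
    show ?case using cword_ne[of \<gamma> _ l] by (simp add: Suc_le_eq)
  next
    case (step k)
    let ?a = "ztime \<gamma> (n k)" and ?b = "ztime \<gamma> (n k + 2 * p)"
    let ?w = "cword (shift \<gamma> ?a) (?b - ?a) l"
    have ab: "?a \<le> ?b" using zm by (simp add: strict_mono_less_eq)
    have "Qw \<gamma> ?a ?b = A ** A" using n step(1) Q_eq_Qw[OF fol, of "n k" "n k + 2 * p"] by simp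
    moreover have "(A ** A) $ l $ j > 0" for j
      unfolding matrix_matrix_mult_def using A by (auto intro!: sum_pos)
    moreover have "Qw \<gamma> ?a ?b $ l $ j = real (count_list ?w j)" for j unfolding Qw_def by simp
    ultimately have "real (count_list ?w j) > 0" for j by metis
    then have "count_list ?w j > 0" for j by simp
    then have "set ?w = UNIV" by (metis UNIV_eq_I count_notin less_irrefl)
    then have "(\<Sum>j\<in>UNIV. length (cword \<gamma> ?a j)) \<le> length (concat (map (cword \<gamma> ?a) ?w))" by (rule length_concat_ge)
    also have "concat (map (cword \<gamma> ?a) ?w) = cword \<gamma> ?b l"
      using cword_add[of \<gamma> ?a "?b - ?a" l] ab by simp
    also have "length (cword \<gamma> ?b l) \<le> length (cword \<gamma> (ztime \<gamma> (n (Suc k))) l)"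
      using n step(1) zm by (intro length_cword_mono) (simp add: strict_mono_less_eq)
    finally have le: "(\<Sum>j\<in>UNIV. length (cword \<gamma> ?a j)) \<le> length (cword \<gamma> (ztime \<gamma> (n (Suc k))) l)" .
    have "2 * 2 ^ (k - 1) \<le> CARD('d) * 2 ^ (k - 1)" using d by simp
    also have "\<dots> = (\<Sum>j\<in>(UNIV :: 'd set). 2 ^ (k - 1))" by simp
    also have "\<dots> \<le> (\<Sum>j\<in>UNIV. length (cword \<gamma> ?a j))" by (intro sum_mono step.IH)
    finally have "2 * 2 ^ (k - 1) \<le> length (cword \<gamma> (ztime \<gamma> (n (Suc k))) l)" using le by linarith
    moreover have "(2::nat) ^ (Suc k - 1) = 2 * 2 ^ (k - 1)" using step(1) by (simp add: power_eq_if)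
    ultimately show ?case by simp
  qed
qed

lemma bvec_nth: "bvec S E h $ j = h (S j) - h (E j)"
  unfolding bvec_def by simp

lemma subspace_bvec: "subspace (range (bvec S E))"
  unfolding subspace_def
proof (intro conjI allI ballI)
  show "0 \<in> range (bvec S E)" by (rule range_eqI[of _ _ "\<lambda>_. 0"]) (simp add: bvec_def vec_eq_iff)
  fix x y assume "x \<in> range (bvec S E)" "y \<in> range (bvec S E)"
  then obtain h k where "x = bvec S E h" "y = bvec S E k" by blast
  then show "x + y \<in> range (bvec S E)"
    by (intro range_eqI[of _ _ "\<lambda>u. h u + k u"]) (simp add: bvec_def vec_eq_iff)
next
  fix c x assume "x \<in> range (bvec S E)"
  then obtain h where "x = bvec S E h" by blast
  then show "c *\<^sub>R x \<in> range (bvec S E)"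
    by (intro range_eqI[of _ _ "\<lambda>u. c * h u"]) (simp add: bvec_def vec_eq_iff right_diff_distrib[symmetric])
qed

lemma vend_range: "vend \<gamma> S E i j \<in> range S \<union> range E"
  by (induction i arbitrary: j) auto

text \<open>The right vertices always remain among the original ones. The coefficients are then
  differences of finitely many values of h, so they are bounded, and the nonzero ones are bounded
  away from 0.\<close>

lemma bvec_bounded:
  fixes S E :: "'d::finite \<Rightarrow> 'v"
  shows "\<exists>C. \<forall>i. norm (bvec S (vend \<gamma> S E i) h) \<le> C"
    "\<exists>c>0. \<forall>i. bvec S (vend \<gamma> S E i) h \<noteq> 0 \<longrightarrow> c \<le> norm (bvec S (vend \<gamma> S E i) h)"
proof -
  let ?X = "range S \<union> range E"
  define D where "D = (\<lambda>(x, y). \<bar>h x - h y\<bar>) ` (?X \<times> ?X)"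
  have fD: "finite D" unfolding D_def by simp
  have mem: "\<bar>bvec S (vend \<gamma> S E i) h $ j\<bar> \<in> D" for i j
    unfolding bvec_nth D_def using vend_range[of \<gamma> S E i j] by (intro image_eqI[of _ _ "(S j, vend \<gamma> S E i j)"]) auto
  have "norm (bvec S (vend \<gamma> S E i) h) \<le> (\<Sum>j\<in>(UNIV :: 'd set). Max D)" for i
    by (rule order_trans[OF norm_le_l1_cart sum_mono]) (use Max_ge[OF fD mem] in simp)
  then show "\<exists>C. \<forall>i. norm (bvec S (vend \<gamma> S E i) h) \<le> C" by blast
  define c where "c = Min (insert 1 (D - {0}))"
  have "c > 0" unfolding c_def using fD by (auto simp: D_def)
  moreover have "c \<le> norm (bvec S (vend \<gamma> S E i) h)" if nz: "bvec S (vend \<gamma> S E i) h \<noteq> 0" for i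
  proof -
    obtain j where j: "bvec S (vend \<gamma> S E i) h $ j \<noteq> 0" using nz by (auto simp: vec_eq_iff)
    then have "\<bar>bvec S (vend \<gamma> S E i) h $ j\<bar> \<in> D - {0}" using mem by auto
    then have "c \<le> \<bar>bvec S (vend \<gamma> S E i) h $ j\<bar>" unfolding c_def using fD by (intro Min_le) auto
    also have "\<dots> \<le> norm (bvec S (vend \<gamma> S E i) h)" by (rule component_le_norm_cart)
    finally show ?thesis .
  qed
  ultimately show "\<exists>c>0. \<forall>i. bvec S (vend \<gamma> S E i) h \<noteq> 0 \<longrightarrow> c \<le> norm (bvec S (vend \<gamma> S E i) h)" by blast
qed

lemma onorm_Qw_ge: "1 \<le> onorm ((*v) (Qw \<gamma> a b :: real ^ 'd::finite ^ 'd))"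
proof -
  have "1 \<le> (Qw \<gamma> a b *v 1) $ j" for j
    using cword_ne[of "shift \<gamma> a" "b - a" j] unfolding Qw_one by (simp add: Suc_le_eq)
  then have "norm (1 :: real ^ 'd) \<le> norm (Qw \<gamma> a b *v 1)"
    by (intro norm_le_componentwise_cart) (simp add: abs_le_iff, smt (verit, best))
  also have "\<dots> \<le> onorm ((*v) (Qw \<gamma> a b)) * norm (1 :: real ^ 'd)" by (rule onorm[OF matrix_vector_mul_bounded_linear])
  finally have "1 * norm (1 :: real ^ 'd) \<le> onorm ((*v) (Qw \<gamma> a b)) * norm (1 :: real ^ 'd)" by simp
  moreover have "norm (1 :: real ^ 'd) > 0" by simp
  ultimately show ?thesis by (rule mult_right_le_imp_le)
qed

lemma splitting_dim:
  fixes \<Gamma> :: "'d::finite splitting"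
  assumes sub: "\<And>x. subspace (\<Gamma> x i)" and dec: "\<And>w. \<exists>!f. decomposes \<Gamma> i w f"
  shows "dim (\<Gamma> Stable i) + dim (\<Gamma> Central i) + dim (\<Gamma> Unstable i) \<le> CARD('d)"
proof -
  have s0: "0 \<in> \<Gamma> x i" for x using subspace_0[OF sub] .
  let ?SC = "{x + y |x y. x \<in> \<Gamma> Stable i \<and> y \<in> \<Gamma> Central i}"
  have eq: "f = f'" if "decomposes \<Gamma> i w f" "decomposes \<Gamma> i w f'" for w f f' using dec[of w] that by blast
  have "\<Gamma> Stable i \<inter> \<Gamma> Central i \<subseteq> {0}"
  proof
    fix w assume w: "w \<in> \<Gamma> Stable i \<inter> \<Gamma> Central i"
    have "decomposes \<Gamma> i w (\<lambda>x. if x = Stable then w else 0)" "decomposes \<Gamma> i w (\<lambda>x. if x = Central then w else 0)"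
      using w s0 unfolding decomposes_def by auto
    from fun_cong[OF eq[OF this], of Stable] show "w \<in> {0}" by simp
  qed
  then have d1: "dim ?SC = dim (\<Gamma> Stable i) + dim (\<Gamma> Central i)"
    using dim_sums_Int[OF sub[of Stable] sub[of Central]] unfolding dim_eq_0[symmetric] by linarith
  have sSC: "subspace ?SC" by (rule subspace_sums[OF sub sub])
  have "?SC \<inter> \<Gamma> Unstable i \<subseteq> {0}"
  proof
    fix w assume w: "w \<in> ?SC \<inter> \<Gamma> Unstable i"
    then obtain x y where xy: "w = x + y" "x \<in> \<Gamma> Stable i" "y \<in> \<Gamma> Central i" by blast
    have "decomposes \<Gamma> i w (\<lambda>d. if d = Stable then x else if d = Central then y else 0)"
      "decomposes \<Gamma> i w (\<lambda>d. if d = Unstable then w else 0)"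
      using w xy s0 unfolding decomposes_def by auto
    from fun_cong[OF eq[OF this], of Unstable] show "w \<in> {0}" by simp
  qed
  then have "dim {x + y |x y. x \<in> ?SC \<and> y \<in> \<Gamma> Unstable i} = dim ?SC + dim (\<Gamma> Unstable i)"
    using dim_sums_Int[OF sSC sub[of Unstable]] unfolding dim_eq_0[symmetric] by linarith
  moreover have "dim {x + y |x y. x \<in> ?SC \<and> y \<in> \<Gamma> Unstable i} \<le> CARD('d)"
    using dim_subset_UNIV_cart by blast
  ultimately show ?thesis using d1 by simp
qed

lemma good_times_grow:
  assumes "good_return_times S n"
  shows "mono n" "n 0 = 0" "k \<le> n (Suc k)"
proof -
  obtain p where p: "p \<ge> 1" "\<forall>k\<ge>1. n k + 2 * p \<le> n (Suc k)" "n 0 = 0"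
    using assms unfolding good_return_times_def by blast
  have S: "n k \<le> n (Suc k)" for k using p by (cases "k = 0") (auto dest!: spec[of _ k])
  show "mono n" using S by (simp add: mono_iff_le_Suc)
  show "n 0 = 0" by (rule p(3))
  show "k \<le> n (Suc k)"
  proof (induction k)
    case (Suc k)
    have "n (Suc k) + 2 * p \<le> n (Suc (Suc k))" using p(2) by simp
    then show ?case using Suc p(1) by linarith
  qed simp
qed

text \<open>Composes the two rates of the RDC: \<open>n k\<close> is at most linear in k, and
  \<open>\<kappa> m\<close> at most linear in m up to finitely many terms, which the additive
  constant covers.\<close>

lemma linear_growth_of_limits:
  fixes n \<kappa> :: "nat \<Rightarrow> nat"
  assumes "n 0 = 0" and c: "convergent (\<lambda>k. real (n k) / real k)"
    and l: "limsup (\<lambda>m. ereal (real (\<kappa> m) / real m)) < \<infinity>"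
  shows "\<exists>c e. \<forall>m. real (n (\<kappa> m)) \<le> c * real m + e"
proof -
  obtain B where B: "B > 0" "\<And>k. \<bar>real (n k) / real k\<bar> \<le> B"
    using convergent_imp_Bseq[OF c] unfolding Bseq_def by auto
  have nB: "real (n k) \<le> B * real k" for k
    using B(2)[of k] assms(1) by (cases "k = 0") (auto simp: divide_le_eq)
  obtain y :: real where y: "limsup (\<lambda>m. ereal (real (\<kappa> m) / real m)) < ereal y"
    using l ereal_dense2 by (metis less_ereal.simps(4) less_PInf_Ex_of_nat)
  then have "\<forall>\<^sub>F m in sequentially. ereal (real (\<kappa> m) / real m) < ereal y" by (rule Limsup_lessD)
  then obtain M where M: "\<And>m. m \<ge> M \<Longrightarrow> real (\<kappa> m) / real m < y" unfolding eventually_sequentially by auto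
  have "real (\<kappa> m) \<le> \<bar>y\<bar> * real m + (\<Sum>k\<le>M. real (\<kappa> k))" for m
  proof (cases "m \<le> M")
    case True
    then have "real (\<kappa> m) \<le> (\<Sum>k\<le>M. real (\<kappa> k))" by (intro member_le_sum) auto
    moreover have "0 \<le> \<bar>y\<bar> * real m" by simp
    ultimately show ?thesis by linarith
  next
    case False
    then have "real (\<kappa> m) < y * real m" using M[of m] by (simp add: divide_less_eq)
    also have "\<dots> \<le> \<bar>y\<bar> * real m" by (intro mult_right_mono) auto
    finally have "real (\<kappa> m) < \<bar>y\<bar> * real m" .
    moreover have "0 \<le> (\<Sum>k\<le>M. real (\<kappa> k))" by (intro sum_nonneg) auto
    ultimately show ?thesis by linarith
  qed
  then have "real (n (\<kappa> m)) \<le> (B * \<bar>y\<bar>) * real m + B * (\<Sum>k\<le>M. real (\<kappa> k))" for m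
    using nB[of "\<kappa> m"] mult_left_mono[of "real (\<kappa> m)" "\<bar>y\<bar> * real m + (\<Sum>k\<le>M. real (\<kappa> k))" B] B(1)
    by (simp add: algebra_simps)
  then show ?thesis by blast
qed

lemma Q_algebra:
  assumes "follows S \<gamma>" "irrational \<gamma>"
  shows "i \<le> j \<Longrightarrow> j \<le> k \<Longrightarrow> Q S j k *v (Q S i j *v w) = Q S i k *v w" "Q S i i *v w = w"
    "i \<le> j \<Longrightarrow> matrix_inv (Q S i j) *v (Q S i j *v w) = w"
    "i \<le> j \<Longrightarrow> Q S i j *v (matrix_inv (Q S i j) *v w) = w"
    "i \<le> j \<Longrightarrow> 1 \<le> onorm ((*v) (Q S i j))"
proof -
  note q = Q_eq_Qw[OF assms]
  note zm = strict_mono_less_eq[OF ztime_strict_mono[OF assms]]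
  note ne = follows_data(6)[OF assms(1)]
  show "i \<le> j \<Longrightarrow> j \<le> k \<Longrightarrow> Q S j k *v (Q S i j *v w) = Q S i k *v w" "Q S i i *v w = w"
    by (simp_all add: q Qw_compose zm Qw_same)
  show "i \<le> j \<Longrightarrow> matrix_inv (Q S i j) *v (Q S i j *v w) = w"
    "i \<le> j \<Longrightarrow> Q S i j *v (matrix_inv (Q S i j) *v w) = w"
    using Qw_inverse[OF ne] by (simp_all add: q zm)
  show "i \<le> j \<Longrightarrow> 1 \<le> onorm ((*v) (Q S i j))"
    by (simp add: q onorm_Qw_ge)
qed

lemma omega_error:
  fixes T :: "'d::finite giet"
  assumes "follows T \<gamma>" "irrational \<gamma>" "distortion_le T L" "i \<le> j"
  shows "norm (omega T j - Q T i j *v omega T i) \<le> 2 * L * norm (1 :: real ^ 'd) * onorm ((*v) (Q T i j))"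
proof -
  let ?a = "ztime \<gamma> i" and ?b = "ztime \<gamma> j"
  have ab: "?a \<le> ?b" using assms(4) ztime_strict_mono[OF assms(1,2)] by (simp add: strict_mono_less_eq)
  have L: "L \<ge> 0" using assms(3) unfolding distortion_le_def by blast
  have om: "omega T k = log_slope ((rauzy ^^ ztime \<gamma> k) T)" for k
    unfolding omega_def zorich_def zorich_time_eq[OF followsD[OF assms(1)]] ..
  let ?e = "log_slope ((rauzy ^^ ?b) T) - Qw \<gamma> ?a ?b *v log_slope ((rauzy ^^ ?a) T)"
  let ?r = "(2 * L) *\<^sub>R (Qw \<gamma> ?a ?b *v 1)"
  have "\<bar>?e $ l\<bar> \<le> \<bar>?r $ l\<bar>" for l
  proof -
    show ?thesis using log_slope_cocycle[OF assms(1,3) ab, of l] L by (simp add: Qw_one)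
  qed
  then have "norm ?e \<le> norm ?r" by (intro norm_le_componentwise_cart) simp
  also have "\<dots> = 2 * L * norm (Qw \<gamma> ?a ?b *v 1)" using L by simp
  also have "\<dots> \<le> 2 * L * (onorm ((*v) (Qw \<gamma> ?a ?b)) * norm (1 :: real ^ 'd))"
    using L by (intro mult_left_mono onorm matrix_vector_mul_bounded_linear) auto
  finally show ?thesis unfolding om Q_eq_Qw[OF assms(1,2,4)] by (simp add: algebra_simps)
qed

text \<open>Besides T and A there is the standard map S that carries the RDC. The three are related
  through \<gamma> alone: the cocycles of T and S both equal \<open>Qw \<gamma>\<close>, so the
  Diophantine bounds for S apply to the vectors \<open>omega T\<close>, and the towers of A and T
  have the same codes.\<close>

theorem proposition5p2p1:
  fixes T A :: "'d::finite giet"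
    and \<gamma> :: "'d rotation_number"
    and \<Gamma> :: "'d splitting"
    and n :: "nat \<Rightarrow> nat"
    and v :: "real ^ 'd"
  assumes "T \<in> giet_space 3"
    and "has_rotation_number T \<gamma>"
    and "irrational \<gamma>"
    and "rotation_RDC \<gamma> \<Gamma> n"
    and "affine_shadowing_case T \<Gamma> n"
    and "v = affine_shadow T \<Gamma> n"
    and "affine_iet A"
    and "has_rotation_number A \<gamma>"
    and "log_slope A = v"
    and "exp_distorted_towers A"
  shows "exp_distorted_towers T \<and> (\<exists>J. wandering_interval T J)"
proof -
  have gT: "giet 3 T" and irr: "irreducible_datum (datum T)" using assms(1) unfolding giet_space_def by auto
  have d: "2 \<le> CARD('d)" using gT unfolding giet_def by blast
  have fT: "follows T \<gamma>" by (rule follows_of_irreducible[OF giet_imp_pgiet[OF gT] d irr assms(2)])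
  have fol: "follows X \<gamma>" if "giet r X" "has_rotation_number X \<gamma>" for X r
    using giet_imp_pgiet[OF that(1)] that(2) fT unfolding follows_def by blast
  have fA: "follows A \<gamma>" using fol assms(7,8) unfolding affine_iet_def by blast
  obtain S where S: "standard_iet S" "has_rotation_number S \<gamma>" "RDC_with S \<Gamma> n"
    using assms(4) unfolding rotation_RDC_def by blast
  have fS: "follows S \<gamma>" using fol S(1,2) unfolding standard_iet_def by blast
  have QTS: "Q T i j = Q S i j" if "i \<le> j" for i j
    using Q_eq_Qw[OF fT assms(3) that] Q_eq_Qw[OF fS assms(3) that] by simp
  have zm: "strict_mono (ztime \<gamma>)" by (rule ztime_strict_mono[OF fT assms(3)])
  obtain L where L: "distortion_le T L" using giet_distortion[OF gT] by blast
  have L0: "L \<ge> 0" using L unfolding distortion_le_def by blast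

  have os: "oseledets_extension S \<Gamma>" and good: "good_return_times S n"
    and conv: "convergent (\<lambda>k. real (n k) / real k)"
    using S(3) unfolding RDC_with_def by blast+
  obtain K\<^sub>m K\<^sub>p \<delta> \<kappa> where K: "strict_mono \<kappa>" "limsup (\<lambda>m. ereal (real (\<kappa> m) / real m)) < \<infinity>"
    and \<delta>: "\<delta> > 0"
    and condB: "\<forall>m. (\<Sum>k = 1..\<kappa> m.
            onorm_on ((*v) (Q S (n k) (n (\<kappa> m)))) (\<Gamma> Stable (n k)) *
            onorm (splitting_proj \<Gamma> Stable (n k)) * onorm ((*v) (Q S (n (k - 1)) (n k)))) \<le> K\<^sub>m"
    and condF: "\<forall>m. let f = (\<lambda>k.
            onorm_on ((*v) (matrix_inv (Q S (n (\<kappa> m)) (n k)))) (\<Gamma> Unstable (n k)) *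
            onorm (splitting_proj \<Gamma> Unstable (n k)) * onorm ((*v) (Q S (n (k - 1)) (n k))))
          in summable (\<lambda>i. f (\<kappa> m + 1 + i)) \<and> (\<Sum>i. f (\<kappa> m + 1 + i)) \<le> K\<^sub>p"
    and condS: "(\<lambda>m. 1 / real m * ln (onorm ((*v) (Q S (n (\<kappa> m)) (n (\<kappa> (Suc m))))))) \<longlonglongrightarrow> 0"
    and condA: "\<forall>m x y. x \<noteq> y \<longrightarrow> min_angle (\<Gamma> x (n (\<kappa> m))) (\<Gamma> y (n (\<kappa> m))) > \<delta>"
    using S(3) unfolding RDC_with_def by blast
  note gt = good_times_grow[OF good]
  have \<kappa>m: "m \<le> \<kappa> m" for m by (rule strict_mono_imp_increasing[OF K(1)])

  note ext = os[unfolded oseledets_extension_def]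
  have sub: "\<forall>x i. subspace (\<Gamma> x i)" by (rule ext[THEN conjunct1])
  note ext = ext[THEN conjunct2]
  have dec: "\<forall>i w. \<exists>!f. decomposes \<Gamma> i w f" by (rule ext[THEN conjunct1])
  note ext = ext[THEN conjunct2]
  have inv: "\<forall>x i j. i \<le> j \<longrightarrow> (\<lambda>w. Q S i j *v w) ` \<Gamma> x i = \<Gamma> x j" by (rule ext[THEN conjunct1])
  note ext = ext[THEN conjunct2]
  have dims: "\<forall>i. dim (\<Gamma> Stable i) = genus (datum S) \<and> dim (\<Gamma> Unstable i) = genus (datum S)"
    by (rule ext[THEN conjunct1])
  note ext = ext[THEN conjunct2]
  obtain \<theta> C\<^sub>0 where \<theta>: "\<theta> > 0" "C\<^sub>0 > 0" and su: "\<forall>i.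
        (\<forall>w\<in>\<Gamma> Stable 0. norm (Q S 0 i *v w) \<le> C\<^sub>0 * exp (- \<theta> * real i) * norm w) \<and>
        (\<forall>w\<in>\<Gamma> Unstable i. norm (matrix_inv (Q S 0 i) *v w) \<le> C\<^sub>0 * exp (- \<theta> * real i) * norm w)"
    using ext[THEN conjunct1] by (elim exE conjE) (rule that)
  note ext = ext[THEN conjunct2]
  have cen: "\<forall>w\<in>\<Gamma> Central 0. w \<noteq> 0 \<longrightarrow> (\<lambda>i. 1 / real i * ln (norm (Q S 0 i *v w))) \<longlonglongrightarrow> 0"
    by (rule ext[THEN conjunct1])

  \<comment> \<open>The vertices are computed from the datum of T, which is also that of S. Their
    functionals are invariant under \<open>Qw \<gamma>\<close> and hence under the cocycle of
    S.\<close>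
  define V where "V j = vertex (datum T) (Top, pos (fst (datum T)) j)" for j
  define E where "E j = vertex (datum T) (Top, Suc (pos (fst (datum T)) j))" for j
  have pT: "pgiet T" by (rule giet_imp_pgiet[OF gT])
  have vl: "vlab (tl0 T) (tr0 T) (bl0 T) (br0 T) V E"
    using vertices_of_datum(1)[OF pT] unfolding V_def[abs_def] E_def[abs_def] .
  have vc: "vertex_count (datum T) \<le> dim (range (bvec V E)) + 1"
    using vertex_count_le[OF pT] unfolding V_def[abs_def] E_def[abs_def] .
  define b where "b i = bvec V (vend \<gamma> V E (ztime \<gamma> i))" for i
  have b0: "b 0 = bvec V E" unfolding b_def by simp
  have dS: "datum S = datum T"
    using assms(2) S(2) unfolding has_rotation_number_def by (metis fst_conv funpow_0)

  interpret rdc_setting "Q S" \<Gamma> n \<kappa> b \<theta> C\<^sub>0 K\<^sub>m K\<^sub>p \<delta>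
  proof
    show "Q S j k *v (Q S i j *v w) = Q S i k *v w" if "i \<le> j" "j \<le> k" for i j k w
      by (rule Q_algebra(1)[OF fS assms(3) that])
    show "Q S i i *v w = w" for i w by (rule Q_algebra(2)[OF fS assms(3)])
    show "matrix_inv (Q S i j) *v (Q S i j *v w) = w" if "i \<le> j" for i j w
      by (rule Q_algebra(3)[OF fS assms(3) that])
    show "Q S i j *v (matrix_inv (Q S i j) *v w) = w" if "i \<le> j" for i j w
      by (rule Q_algebra(4)[OF fS assms(3) that])
    show "1 \<le> onorm ((*v) (Q S i j))" if "i \<le> j" for i j
      by (rule Q_algebra(5)[OF fS assms(3) that])
    show "subspace (\<Gamma> x i)" for x i using sub by blast
    show "\<exists>!f. decomposes \<Gamma> i w f" for i w using dec by blast
    show "(*v) (Q S i j) ` \<Gamma> x i = \<Gamma> x j" if "i \<le> j" for x i j using inv that by blast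
    show "\<theta> > 0" "C\<^sub>0 > 0" by (rule \<theta>)+
    show "norm (Q S 0 i *v w) \<le> C\<^sub>0 * exp (- \<theta> * real i) * norm w" if "w \<in> \<Gamma> Stable 0" for i w using su that by blast
    show "norm (matrix_inv (Q S 0 i) *v w) \<le> C\<^sub>0 * exp (- \<theta> * real i) * norm w" if "w \<in> \<Gamma> Unstable i" for i w
      using su that by blast
    show "(\<lambda>i. 1 / real i * ln (norm (Q S 0 i *v w))) \<longlonglongrightarrow> 0" if "w \<in> \<Gamma> Central 0" "w \<noteq> 0" for w
      using cen that by blast
    show "n 0 = 0" "mono n" "strict_mono \<kappa>" by (rule gt K)+
    show "\<exists>c e. \<forall>m. real (n (\<kappa> m)) \<le> c * real m + e" by (rule linear_growth_of_limits[OF gt(2) conv K(2)])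
    show "filterlim (\<lambda>m. n (\<kappa> m)) at_top sequentially"
      unfolding filterlim_at_top eventually_sequentially
    proof (intro allI exI impI)
      fix Z m assume "Suc Z \<le> m"
      then have "n (Suc Z) \<le> n (\<kappa> m)" using \<kappa>m[of m] by (intro monoD[OF gt(1)]) simp
      then show "Z \<le> n (\<kappa> m)" using gt(3)[of Z] by linarith
    qed
    show "(\<Sum>k = 1..\<kappa> m. onorm_on ((*v) (Q S (n k) (n (\<kappa> m)))) (\<Gamma> Stable (n k)) *
            onorm (splitting_proj \<Gamma> Stable (n k)) * onorm ((*v) (Q S (n (k - 1)) (n k)))) \<le> K\<^sub>m" for m
      using condB by blast
    show "summable (\<lambda>i. onorm_on ((*v) (matrix_inv (Q S (n (\<kappa> m)) (n (\<kappa> m + 1 + i))))) (\<Gamma> Unstable (n (\<kappa> m + 1 + i))) *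
            onorm (splitting_proj \<Gamma> Unstable (n (\<kappa> m + 1 + i))) * onorm ((*v) (Q S (n (\<kappa> m + 1 + i - 1)) (n (\<kappa> m + 1 + i)))))" for m
      using spec[OF condF, of m] unfolding Let_def by (rule conjunct1)
    show "(\<Sum>i. onorm_on ((*v) (matrix_inv (Q S (n (\<kappa> m)) (n (\<kappa> m + 1 + i))))) (\<Gamma> Unstable (n (\<kappa> m + 1 + i))) *
            onorm (splitting_proj \<Gamma> Unstable (n (\<kappa> m + 1 + i))) * onorm ((*v) (Q S (n (\<kappa> m + 1 + i - 1)) (n (\<kappa> m + 1 + i))))) \<le> K\<^sub>p" for m
      using spec[OF condF, of m] unfolding Let_def by (rule conjunct2)
    show "(\<lambda>m. 1 / real m * ln (onorm ((*v) (Q S (n (\<kappa> m)) (n (\<kappa> (Suc m))))))) \<longlonglongrightarrow> 0" by (rule condS)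
    show "\<delta> > 0" by (rule \<delta>)
    show "min_angle (\<Gamma> x (n (\<kappa> m))) (\<Gamma> y (n (\<kappa> m))) > \<delta>" if "x \<noteq> y" for m x y using condA that by blast
    show "b i h \<bullet> (Q S 0 i *v w) = b 0 h \<bullet> w" for i h w
      unfolding b0 Q_eq_Qw[OF fS assms(3) le0] ztime.simps(1) unfolding b_def by (rule bvec_invariant[OF fT vl])
    show "\<exists>C. \<forall>i. norm (b i h) \<le> C" for h
      using bvec_bounded(1)[where S = V and \<gamma> = \<gamma> and E = E and h = h] unfolding b_def by blast
    show "\<exists>c>0. \<forall>i. b i h \<noteq> 0 \<longrightarrow> c \<le> norm (b i h)" for h
      using bvec_bounded(2)[where S = V and \<gamma> = \<gamma> and E = E and h = h] unfolding b_def by blast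
    show "subspace (range (b 0))" unfolding b0 by (rule subspace_bvec)
    \<comment> \<open>The halving in \<open>genus\<close> guarantees 2 g >= d - V, where V is the
      number of vertices. Hence the central dimension is at most V, and by \<open>vc\<close> at most
      one more than the rank of the functionals. If d + 1 - V is even, the rounding loses nothing
      and the excess is 0.\<close>
    have "dim (\<Gamma> Stable 0) + dim (\<Gamma> Central 0) + dim (\<Gamma> Unstable 0) \<le> CARD('d)"
      by (rule splitting_dim) (use sub dec in blast)+
    moreover have "dim (\<Gamma> Stable 0) = genus (datum T)" "dim (\<Gamma> Unstable 0) = genus (datum T)" using dims dS by auto
    ultimately show "dim (\<Gamma> Central 0) \<le> dim (range (b 0)) + 1"
      using vc unfolding b0 genus_def by linarith
  qed

  have shadow: "affine_shadow T \<Gamma> n = P Unstable 0 (omega T 0) + (\<Sum>k. matrix_inv (Q S 0 (n (Suc k))) *v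
        P Unstable (n (Suc k)) (omega T (n (Suc k)) - Q S (n k) (n (Suc k)) *v omega T (n k)))"
  proof -
    have "n k \<le> n (Suc k)" for k by (rule monoD[OF gt(1)]) simp
    then show ?thesis unfolding affine_shadow_def using QTS by simp
  qed
  have se: "subexp (\<lambda>m. norm (omega T (n (\<kappa> m)) - Q S 0 (n (\<kappa> m)) *v v))"
    unfolding assms(6) shadow
  proof (rule shadow_error)
    show "0 \<le> 2 * L * norm (1 :: real ^ 'd)" using L0 by simp
    show "norm (omega T j - Q S i j *v omega T i) \<le> 2 * L * norm (1 :: real ^ 'd) * onorm ((*v) (Q S i j))" if "i \<le> j" for i j
      using omega_error[OF fT assms(3) L that] QTS[OF that] by simp
  qed
  have om: "omega T k = log_slope ((rauzy ^^ ztime \<gamma> k) T)" for k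
    unfolding omega_def zorich_def zorich_time_eq[OF assms(2)] ..
  have err: "subexp (\<lambda>m. norm (log_slope ((rauzy ^^ ztime \<gamma> (n (\<kappa> m))) T) - Qw \<gamma> 0 (ztime \<gamma> (n (\<kappa> m))) *v v))"
    using se unfolding om Q_eq_Qw[OF fS assms(3) le0] ztime.simps(1) .
  have \<kappa>S: "n (\<kappa> m) \<le> n (\<kappa> (Suc m))" for m
    by (rule monoD[OF gt(1)]) (use K(1) in \<open>simp add: strict_mono_less_eq\<close>)
  have "subexp (\<lambda>m. onorm ((*v) (Q S (n (\<kappa> m)) (n (\<kappa> (Suc m))))))"
  proof (rule subexp_of_log_limit(1)[OF condS])
    show "0 < onorm ((*v) (Q S (n (\<kappa> m)) (n (\<kappa> (Suc m)))))" for m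
      using Q_algebra(5)[OF fS assms(3) \<kappa>S, of m] by linarith
  qed
  then have R: "subexp (\<lambda>m. onorm ((*v) (Qw \<gamma> (ztime \<gamma> (n (\<kappa> m))) (ztime \<gamma> (n (\<kappa> (Suc m)))))))"
    unfolding Q_eq_Qw[OF fS assms(3) \<kappa>S] .

  have tc: "tower_comparison T \<gamma> L" by unfold_locales (rule fT, rule L)
  define a where "a m = ztime \<gamma> (n (\<kappa> m))" for m
  have "mono a" unfolding a_def mono_iff_le_Suc using \<kappa>S zm by (simp add: strict_mono_less_eq)
  then obtain G where G: "subexp G" "\<And>m b. b \<le> a m \<Longrightarrow> tower_comparison.dev_le T \<gamma> v b (G m)"
    using tower_comparison.dev_growth[OF tc, of a v] err R unfolding a_def by blast
  have heights: "2 ^ (m - 1) \<le> length (cword \<gamma> (a m) l)" if "1 \<le> m" for m l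
  proof -
    have "(2::nat) ^ (m - 1) \<le> 2 ^ (\<kappa> m - 1)" using \<kappa>m[of m] by (intro power_increasing) auto
    also have "\<dots> \<le> length (cword \<gamma> (a m) l)" unfolding a_def
      by (rule heights_grow[OF fS assms(3) d good]) (use \<kappa>m[of m] that in simp)
    finally show ?thesis .
  qed
  have towers: "exp_distorted_towers T"
    by (rule towers_transfer[OF tc fA assms(7,9) G(2,1) heights assms(10)])
  moreover have "\<exists>J. wandering_interval T J"
  proof (rule towers_wandering[OF fT L towers])
    show "mono (ztime \<gamma>)" using zm by (rule strict_mono_mono)
    fix R
    have "R < length (cword \<gamma> (ztime \<gamma> (n (\<kappa> (Suc R)))) j)" for j
      using less_le_trans[OF less_exp] heights[of "Suc R" j] unfolding a_def by simp
    then show "\<exists>m. \<forall>j. R < length (cword \<gamma> (ztime \<gamma> m) j)" by blast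
  qed
  ultimately show ?thesis by blast
qed

end
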